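(* Let $\mathcal{O}_{3,3,3,3}$ be the closed 2-dimensional orbifold with underlying space $S^2$ and exactly four cone points, each of order $3$. For every surface $S$ finitely covering $\mathcal{O}_{3,3,3,3}$ and every odd integer $n>1$ there exists a path $(\rho_t)_{t\ge 0}$ of (surface) Hitchin representations $\rho_t\colon\pi_1(S)\to SL(n,\mathbb{R})$ such that (1) $\rho_0(\pi_1(S))\subset SL(n,\mathbb{Z})$; (2) $\rho_t$ is Zariski dense for every $t>0$; (3) $\rho_t(\pi_1(S))\subset SL(n,\mathbb{Q})$ for every $t\in\mathbb{Q}$ (with $t\ge 0$).
   Context: A surface $S$ finitely covers an orbifold $\mathcal{O}$ if there is a finite-degree orbifold covering $S\to\mathcal{O}$, where $S$ is a connected closed surface (no cone points); then $\pi_1(S)$ is a finite-index subgroup of the orbifold fundamental group $\pi_1(\mathcal{O})$. One has $\pi_1(\mathcal{O}_{3,3,3,3})=\langle \gamma_1,\gamma_2,\gamma_3,\gamma_4 \mid \gamma_1^3=\gamma_2^3=\gamma_3^3=\gamma_4^3=\gamma_1\gamma_2\gamma_3\gamma_4=1\rangle$. For a finitely presented group $\Gamma$ with $k$ generators and a Lie group $G$, $\mathrm{Hom}(\Gamma,G)$ is identified with a subset of $G^k$ and given the subspace topology; a path of representations is a continuous map $t\mapsto\rho_t$ into it. $\mathrm{Hom}^+(\Gamma,G)$ is the subset of representations that are direct sums of irreducible representations, and $\mathrm{Rep}^+(\Gamma,G)=\mathrm{Hom}^+(\Gamma,G)/G$ is the quotient by conjugation, with the quotient topology. Let $\omega_n\colon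 PSL(2,\mathbb{R})\to PSL(n,\mathbb{R})$ be the irreducible representation induced by the action of $SL(2,\mathbb{R})$ on homogeneous polynomials of degree $n-1$ in two variables. For $n$ odd, $PSL(n,\mathbb{R})=SL(n,\mathbb{R})$. For a closed surface $S$ of genus greater than one, a Fuchsian representation into $PSL(n,\mathbb{R})$ is one of the form $\omega_n\circ r_0$ with $r_0\colon\pi_1(S)\to PSL(2,\mathbb{R})$ discrete and faithful. For $n>2$ odd, all $PSL(n,\mathbb{R})$-conjugacy classes of Fuchsian representations lie in one connected component of $\mathrm{Rep}^+(\pi_1(S),PSL(n,\mathbb{R}))$, called the Hitchin component; a surface Hitchin representation is one whose conjugacy class lies in the Hitchin component. A representation $r\colon\Gamma\to G$ into an algebraic matrix Lie group is Zariski dense if the Zariski closure of $r(\Gamma)$ in $G$ is all of $G$. *)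

theory Defs
  imports "HOL-Analysis.Analysis" "HOL-Algebra.Coset" "HOL-Algebra.Generated_Groups"
begin

section \<open>Quotient topologies\<close>

definition quotient_topology :: "'a topology \<Rightarrow> ('a \<Rightarrow> 'b) \<Rightarrow> 'b topology" where
  "quotient_topology X q =
     topology (\<lambda>U. U \<subseteq> q ` topspace X \<and> openin X {x \<in> topspace X. q x \<in> U})"

lemma openin_quotient_topology:
  "openin (quotient_topology X q) U \<longleftrightarrow>
     U \<subseteq> q ` topspace X \<and> openin X {x \<in> topspace X. q x \<in> U}"
proof -
  let ?P = "\<lambda>U. U \<subseteq> q ` topspace X \<and> openin X {x \<in> topspace X. q x \<in> U}"
  have "istopology ?P"
    unfolding istopology_def
  proof (intro conjI allI impI)
    fix A B assume AB: "?P A" "?P B"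
    have "{x \<in> topspace X. q x \<in> A \<inter> B}
        = {x \<in> topspace X. q x \<in> A} \<inter> {x \<in> topspace X. q x \<in> B}" by auto
    then show "openin X {x \<in> topspace X. q x \<in> A \<inter> B}" using AB by auto
    show "A \<inter> B \<subseteq> q ` topspace X" using AB by auto
  next
    fix K assume K: "\<forall>U\<in>K. ?P U"
    have "{x \<in> topspace X. q x \<in> \<Union>K} = (\<Union>U\<in>K. {x \<in> topspace X. q x \<in> U})" by auto
    then show "openin X {x \<in> topspace X. q x \<in> \<Union>K}" using K by auto
    show "\<Union>K \<subseteq> q ` topspace X" using K by auto
  qed
  then show ?thesis
    unfolding quotient_topology_def by (simp add: topology_inverse')
qed


section \<open>Surfaces and two-dimensional orbifolds with cone points\<close>

definition closed_surface :: "'a::t2_space set \<Rightarrow> bool" where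
  "closed_surface S \<longleftrightarrow> S \<noteq> {} \<and> compact S \<and> connected S \<and>
     (\<forall>x\<in>S. \<exists>U. openin (top_of_set S) U \<and> x \<in> U \<and> U homeomorphic ball (0::complex) 1)"

text \<open>A two-dimensional orbifold all of whose singular points are cone points is given by its
  underlying surface \<open>X\<close> together with the function \<open>c\<close> that assigns to every point the order
  of its (cyclic) local group; cone points are the points of order greater than one.
  The local model at a point of order \<open>m\<close> is the quotient of the open unit disc by the rotations
  of order \<open>m\<close>, identified with the open unit disc by means of \<open>z \<mapsto> z ^ m\<close>.\<close>

definition cone_chart ::
    "'a::t2_space set \<Rightarrow> ('a \<Rightarrow> nat) \<Rightarrow> 'a \<Rightarrow> 'a set \<Rightarrow> ('a \<Rightarrow> complex) \<Rightarrow> bool" where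
  "cone_chart X c x U \<phi> \<longleftrightarrow> openin (top_of_set X) U \<and> x \<in> U \<and>
     (\<exists>\<phi>'. homeomorphism U (ball 0 1) \<phi> \<phi>') \<and> \<phi> x = 0 \<and>
     c x \<ge> 1 \<and> (\<forall>z\<in>U - {x}. c z = 1)"

text \<open>Every point \<open>y\<close> of the base has a disc neighbourhood \<open>U = D / G\<close>, with \<open>G\<close> the group of
  rotations of order \<open>d y\<close>, such that each component of the preimage of \<open>U\<close> is \<open>D / H\<close> for a
  subgroup \<open>H\<close> of \<open>G\<close> and the covering is the projection \<open>D / H \<rightarrow> D / G\<close>.  If \<open>H\<close> has order \<open>k\<close>
  and both quotients are identified with \<open>D\<close> by \<open>z \<mapsto> z ^ k\<close> and \<open>z \<mapsto> z ^ d y\<close>, the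
  projection becomes \<open>w \<mapsto> w ^ (d y div k)\<close>.\<close>

definition orbifold_covering ::
    "'a::t2_space set \<Rightarrow> ('a \<Rightarrow> nat) \<Rightarrow> 'b::t2_space set \<Rightarrow> ('b \<Rightarrow> nat) \<Rightarrow> ('a \<Rightarrow> 'b) \<Rightarrow> bool" where
  "orbifold_covering X c Y d f \<longleftrightarrow> continuous_on X f \<and> f ` X = Y \<and>
     (\<forall>y\<in>Y. \<exists>U \<psi>. cone_chart Y d y U \<psi> \<and>
        (\<exists>\<V>. \<Union>\<V> = X \<inter> f -` U \<and> pairwise disjnt \<V> \<and>
           (\<forall>V\<in>\<V>. \<exists>x \<phi>. cone_chart X c x V \<phi> \<and> c x dvd d y \<and>
              (\<forall>v\<in>V. \<psi> (f v) = \<phi> v ^ (d y div c x)))))"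

text \<open>A surface is an orbifold without cone points, that is, all orders are one.\<close>

definition surface_finitely_covers ::
    "'a::t2_space set \<Rightarrow> ('a \<Rightarrow> 'b) \<Rightarrow> 'b::t2_space set \<Rightarrow> ('b \<Rightarrow> nat) \<Rightarrow> bool" where
  "surface_finitely_covers S f Y d \<longleftrightarrow> closed_surface S \<and>
     orbifold_covering S (\<lambda>_. 1) Y d f \<and> (\<forall>y\<in>Y. finite {x \<in> S. f x = y})"

definition is_orbifold_3333 :: "'b::t2_space set \<Rightarrow> ('b \<Rightarrow> nat) \<Rightarrow> bool" where
  "is_orbifold_3333 Y d \<longleftrightarrow> Y homeomorphic sphere (0 :: real ^ 3) 1 \<and>
     (\<exists>C\<subseteq>Y. card C = 4 \<and> (\<forall>y\<in>C. d y = 3) \<and> (\<forall>y\<in>Y - C. d y = 1))"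


section \<open>The fundamental group\<close>

definition loop_class :: "'a::topological_space set \<Rightarrow> (real \<Rightarrow> 'a) \<Rightarrow> (real \<Rightarrow> 'a) set" where
  "loop_class S p = {q. homotopic_paths S p q}"

definition fundamental_group :: "'a::topological_space set \<Rightarrow> 'a \<Rightarrow> (real \<Rightarrow> 'a) set monoid" where
  "fundamental_group S x0 =
     \<lparr>carrier = {loop_class S p | p.
        path p \<and> path_image p \<subseteq> S \<and> pathstart p = x0 \<and> pathfinish p = x0},
      mult = (\<lambda>P Q. \<Union>p\<in>P. \<Union>q\<in>Q. loop_class S (p +++ q)),
      one = loop_class S (\<lambda>_. x0)\<rparr>"


section \<open>Special linear groups and the irreducible representation\<close>

definition SL :: "(real ^ 'n ^ 'n) monoid" where
  "SL = \<lparr>carrier = {M. det M = 1}, mult = (**), one = mat 1\<rparr>"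

definition PSL2 :: "(real ^ 2 ^ 2) set monoid" where
  "PSL2 = SL Mod {mat 1, - mat 1}"

definition PSL2_topology :: "(real ^ 2 ^ 2) set topology" where
  "PSL2_topology =
     quotient_topology (top_of_set (carrier SL)) (\<lambda>g. {mat 1, - mat 1} #>\<^bsub>SL\<^esub> g)"

text \<open>The monomials of degree \<open>n - 1\<close> in two variables, where \<open>n = CARD('n)\<close>, as functions on the
  plane.  They are indexed by \<open>'n\<close> through the enumeration \<open>to_nat_on UNIV\<close> of \<open>'n\<close> by
  \<open>0, \<dots>, n - 1\<close>; another enumeration changes the representation by a permutation of the basis only,
  hence, for odd \<open>n\<close>, within its conjugacy class under the special linear group.\<close>

definition basis_monomial :: "'n::finite \<Rightarrow> real ^ 2 \<Rightarrow> real" where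
  "basis_monomial j v =
     v $ 1 ^ (CARD('n) - 1 - to_nat_on (UNIV :: 'n set) j) * v $ 2 ^ to_nat_on (UNIV :: 'n set) j"

text \<open>The matrix, in the monomial basis, of the action of \<open>g\<close> that sends a homogeneous polynomial
  \<open>P\<close> to \<open>P \<circ> g\<inverse>\<close>.\<close>

definition sym_matrix :: "real ^ 2 ^ 2 \<Rightarrow> real ^ 'n ^ 'n" where
  "sym_matrix g = (THE M. \<forall>j v. basis_monomial j (matrix_inv g *v v)
                     = (\<Sum>i\<in>UNIV. M $ i $ j * basis_monomial i v))"

text \<open>For odd \<open>n\<close> the matrices of \<open>g\<close> and \<open>- g\<close> agree, so \<open>sym_matrix\<close> is constant on the elements
  of \<open>PSL2\<close>, and the projective special linear group in dimension \<open>n\<close> is \<open>SL\<close> itself.\<close>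

definition omega :: "(real ^ 2 ^ 2) set \<Rightarrow> real ^ 'n ^ 'n" where
  "omega c = the_elem (sym_matrix ` c)"


section \<open>Spaces of representations\<close>

text \<open>Representations of \<open>\<Gamma>\<close> are extensional functions, so that they are determined by their values
  on the carrier of \<open>\<Gamma>\<close>.\<close>

definition Hom_SL :: "'g monoid \<Rightarrow> ('g \<Rightarrow> real ^ 'n ^ 'n) set" where
  "Hom_SL \<Gamma> = hom \<Gamma> SL \<inter> extensional (carrier \<Gamma>)"

text \<open>\<open>A\<close> is a finite generating set of \<open>\<Gamma>\<close>; a representation is identified with the tuple of its
  values on \<open>A\<close>.\<close>

definition Hom_topology :: "'g set \<Rightarrow> 'g monoid \<Rightarrow> ('g \<Rightarrow> real ^ 'n ^ 'n) topology" where
  "Hom_topology A \<Gamma> = pullback_topology (Hom_SL \<Gamma>) (\<lambda>\<rho>. restrict \<rho> A)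
     (product_topology (\<lambda>_. top_of_set (carrier SL)) A)"

definition invariant_subspace ::
    "'g monoid \<Rightarrow> ('g \<Rightarrow> real ^ 'n ^ 'n) \<Rightarrow> (real ^ 'n) set \<Rightarrow> bool" where
  "invariant_subspace \<Gamma> \<rho> V \<longleftrightarrow>
     subspace V \<and> (\<forall>\<gamma>\<in>carrier \<Gamma>. \<forall>v\<in>V. \<rho> \<gamma> *v v \<in> V)"

definition irreducible_subrep ::
    "'g monoid \<Rightarrow> ('g \<Rightarrow> real ^ 'n ^ 'n) \<Rightarrow> (real ^ 'n) set \<Rightarrow> bool" where
  "irreducible_subrep \<Gamma> \<rho> V \<longleftrightarrow> invariant_subspace \<Gamma> \<rho> V \<and> V \<noteq> {0} \<and>
     (\<forall>W\<subseteq>V. invariant_subspace \<Gamma> \<rho> W \<longrightarrow> W = {0} \<or> W = V)"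

definition Hom_plus :: "'g monoid \<Rightarrow> ('g \<Rightarrow> real ^ 'n ^ 'n) set" where
  "Hom_plus \<Gamma> = {\<rho> \<in> Hom_SL \<Gamma>. \<exists>\<V>. finite \<V> \<and> (\<forall>V\<in>\<V>. irreducible_subrep \<Gamma> \<rho> V) \<and>
     (\<forall>x. \<exists>!f. f \<in> (\<Pi>\<^sub>E V\<in>\<V>. V) \<and> x = (\<Sum>V\<in>\<V>. f V))}"

definition conjugacy_class ::
    "'g monoid \<Rightarrow> ('g \<Rightarrow> real ^ 'n ^ 'n) \<Rightarrow> ('g \<Rightarrow> real ^ 'n ^ 'n) set" where
  "conjugacy_class \<Gamma> \<rho> =
     {\<lambda>\<gamma>\<in>carrier \<Gamma>. g ** \<rho> \<gamma> ** matrix_inv g | g. g \<in> carrier SL}"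

definition Rep_plus :: "'g set \<Rightarrow> 'g monoid \<Rightarrow> ('g \<Rightarrow> real ^ 'n ^ 'n) set topology" where
  "Rep_plus A \<Gamma> =
     quotient_topology (subtopology (Hom_topology A \<Gamma>) (Hom_plus \<Gamma>)) (conjugacy_class \<Gamma>)"


section \<open>Hitchin representations and Zariski density\<close>

definition fuchsian :: "'g monoid \<Rightarrow> ('g \<Rightarrow> real ^ 'n ^ 'n) \<Rightarrow> bool" where
  "fuchsian \<Gamma> \<rho> \<longleftrightarrow> (\<exists>r. r \<in> hom \<Gamma> PSL2 \<and> inj_on r (carrier \<Gamma>) \<and>
     subtopology PSL2_topology (r ` carrier \<Gamma>) = discrete_topology (r ` carrier \<Gamma>) \<and>
     \<rho> = (\<lambda>\<gamma>\<in>carrier \<Gamma>. omega (r \<gamma>)))"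

text \<open>Intended for odd \<open>CARD('n) > 2\<close> and \<open>\<Gamma>\<close> the fundamental group of a closed surface of genus
  greater than one.  All Fuchsian classes then lie in a single connected component, so the
  component \<open>C\<close> below is the Hitchin component.\<close>

definition surface_hitchin :: "'g set \<Rightarrow> 'g monoid \<Rightarrow> ('g \<Rightarrow> real ^ 'n ^ 'n) \<Rightarrow> bool" where
  "surface_hitchin A \<Gamma> \<rho> \<longleftrightarrow> \<rho> \<in> Hom_plus \<Gamma> \<and>
     (\<exists>C\<in>connected_components_of (Rep_plus A \<Gamma>). conjugacy_class \<Gamma> \<rho> \<in> C \<and>
        (\<exists>\<phi> :: 'g \<Rightarrow> real ^ 'n ^ 'n. fuchsian \<Gamma> \<phi> \<and> conjugacy_class \<Gamma> \<phi> \<in> C))"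

definition zariski_closure_SL :: "(real ^ 'n ^ 'n) set \<Rightarrow> (real ^ 'n ^ 'n) set" where
  "zariski_closure_SL X = {g \<in> carrier SL.
     \<forall>P. real_polynomial_function P \<longrightarrow> (\<forall>x\<in>X. P x = 0) \<longrightarrow> P g = 0}"

definition zariski_dense :: "'g monoid \<Rightarrow> ('g \<Rightarrow> real ^ 'n ^ 'n) \<Rightarrow> bool" where
  "zariski_dense \<Gamma> \<rho> \<longleftrightarrow> zariski_closure_SL (\<rho> ` carrier \<Gamma>) = carrier SL"

definition SL_over :: "real set \<Rightarrow> (real ^ 'n ^ 'n) set" where
  "SL_over R = {M \<in> carrier SL. \<forall>i j. M $ i $ j \<in> R}"

end

theory Submission
  imports Defs
begin

text \<open>The orbifold is the double of a hyperbolic quadrilateral with all angles equal to a third of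
  a straight angle, so its group is the even part of the group generated by the reflections in the four
  sides. Developing along paths turns loops of \<open>S\<close> into words in these reflections, faithfully up to
  cancellation and braid moves. The reflections preserve an integral form, and the symmetric powers of
  their two-dimensional lifts preserve the lattice spanned by monomials in three integral quadratic
  forms, which gives \<open>\<rho>\<^sub>0\<close>. Conjugating one reflection by a diagonal matrix \<open>bend t\<close> that commutes with
  its two neighbours respects the relations. The matrix \<open>bend t\<close> is rational for rational \<open>t\<close> since the
  projection on which it is based is a polynomial in a matrix of the integral representation.

  Every word has a power in the image of the surface group. Hence the Zariski closure contains the tori
  through conjugates of one hyperbolic element; their derivations generate the principal
  three-dimensional Lie algebra together with its conjugate by \<open>bend t\<close>. The former acts irreducibly,
  and for \<open>t > 0\<close> the two together generate all elementary matrices, thus all transvections lie in the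
  closure.\<close>

text \<open>Bending is possible because opposite mirrors satisfy no relation: a side of the square
  is tied only to its two neighbours, and these act by antidiagonal matrices, which commute with
  every diagonal matrix symmetric under reversal of the basis. Only the first and last entries of
  \<open>bend t\<close> differ from 1. They form the eigenspace of an extreme eigenvalue of an
  integral matrix whose eigenvalues are integers, so the projection onto it is rational. Odd
  \<open>n\<close> means forms of even degree. The two-dimensional lifts of the mirrors satisfy the
  braid relations only up to sign; even degree removes the sign and lets quadratic forms, on which
  the mirrors are integral, generate everything. The obstacle is topological: \<open>S\<close> is
  given by local charts only, and nothing relates its loops to words. The link is a covering of
  \<open>S\<close> by the disc, assembled from lifts of the two faces of the sphere. Of finite index
  only this survives: each word has a positive power in the image. That suffices because the powers
  of a hyperbolic element are Zariski dense in its torus.\<close>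

section \<open>The reflection group of a regular quadrilateral with angles \<open>\<pi> / 3\<close>\<close>

text \<open>Homogeneous coordinates \<open>(s, a, b)\<close> for the Klein model: the hyperbolic plane is the cone
  \<open>a\<^sup>2 + b\<^sup>2 < 3 s\<^sup>2\<close>, \<open>s > 0\<close>. The four mirrors \<open>s \<plusminus> a = 0\<close>, \<open>s \<plusminus> b = 0\<close> are indexed by pairs
  (axis, sign); mirrors on different axes meet at the angle \<open>\<pi> / 3\<close>, opposite mirrors
  are ultraparallel.\<close>

type_synonym mirror = "bool \<times> bool"

definition sg :: "bool \<Rightarrow> real" where "sg e = (if e then 1 else - 1)"

lemma sg_simps [simp]: "sg True = 1" "sg False = - 1" "sg e * sg e = 1" "\<bar>sg e\<bar> = 1"
  "sg e * (sg e * x) = x" "sg (\<not> e) = - sg e"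
  by (cases e; simp add: sg_def)+

fun height :: "mirror \<Rightarrow> real \<times> real \<times> real \<Rightarrow> real" where
  "height (k, e) (s, a, b) = s + sg e * (if k then b else a)"

text \<open>The image is the point plus its height times a root orthogonal to the mirror for the
  form 3 s^2 - a^2 - b^2, such as (1, -3 \<open>sg e\<close>, 0). Evaluating the heights on this
  root gives the coefficients -2, 1 and 4 of the next three lemmas.\<close>

fun reflect :: "mirror \<Rightarrow> real \<times> real \<times> real \<Rightarrow> real \<times> real \<times> real" where
  "reflect (False, e) (s, a, b) = (2 * s + sg e * a, - 3 * sg e * s - 2 * a, b)"
| "reflect (True, e) (s, a, b) = (2 * s + sg e * b, a, - 3 * sg e * s - 2 * b)"

definition act :: "mirror list \<Rightarrow> real \<times> real \<times> real \<Rightarrow> real \<times> real \<times> real" where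
  "act u z = foldr reflect u z"

definition chamber :: "(real \<times> real \<times> real) set" where
  "chamber = {z. \<forall>i. height i z \<ge> 0}"

lemma act_simps [simp]: "act [] z = z" "act (i # u) z = reflect i (act u z)"
  "act (u @ v) z = act u (act v z)"
  by (auto simp: act_def)

lemma height_reflect_same: "height i (reflect i z) = - height i z"
  by (cases i; cases z; cases "fst i") (auto simp: algebra_simps)

lemma height_reflect_adjacent:
  "fst i \<noteq> fst j \<Longrightarrow> height j (reflect i z) = height j z + height i z"
  by (cases i; cases j; cases z; cases "fst i") (auto simp: algebra_simps)

lemma height_reflect_opposite:
  "fst i = fst j \<Longrightarrow> i \<noteq> j \<Longrightarrow> height j (reflect i z) = height j z + 4 * height i z"
  by (cases i; cases j; cases z; cases "fst i"; cases "snd i"; cases "snd j") (auto simp: algebra_simps)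

lemma reflect_eq_iff: "z = z' \<longleftrightarrow> (\<forall>i. height i z = height i z')"
proof
  assume h: "\<forall>i. height i z = height i z'"
  obtain s a b s' a' b' where "z = (s, a, b)" "z' = (s', a', b')" by (metis prod_cases3)
  then show "z = z'"
    using h[rule_format, of "(False, True)"] h[rule_format, of "(False, False)"]
      h[rule_format, of "(True, True)"] by auto
qed auto

lemma reflect_reflect [simp]: "reflect i (reflect i z) = z"
  by (cases i; cases z; cases "fst i") (auto simp: algebra_simps)

lemma reflect_braid:
  assumes "fst i \<noteq> fst j"
  shows "reflect i (reflect j (reflect i z)) = reflect j (reflect i (reflect j z))"
  using assms
  by (cases i; cases j; cases z; cases "fst i"; cases "snd i"; cases "snd j") (auto simp: algebra_simps)

lemma reflect_fixed: assumes "height i z = 0" shows "reflect i z = z"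
proof -
  have "height j (reflect i z) = height j z" for j
    using assms height_reflect_same[of i z] height_reflect_adjacent[of i j z]
      height_reflect_opposite[of i j z] by (cases "fst i = fst j"; cases "i = j") auto
  then show ?thesis using reflect_eq_iff by blast
qed

lemma reflect_linear:
  "reflect i (z + w) = reflect i z + reflect i w" "reflect i (r *\<^sub>R z) = r *\<^sub>R reflect i z"
  by (cases i; cases z; cases w; cases "fst i"; auto simp: algebra_simps)+

lemma act_linear: "act u (z + w) = act u z + act u w" "act u (r *\<^sub>R z) = r *\<^sub>R act u z"
  by (induction u) (auto simp: reflect_linear)

text \<open>The defining relations of the Coxeter group with \<open>m = 3\<close> for mirrors on different axes and
  \<open>m = \<infinity>\<close> for opposite ones.\<close>

inductive weq :: "mirror list \<Rightarrow> mirror list \<Rightarrow> bool" (infix "\<simeq>" 50) where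
  cancel: "u @ [i, i] @ v \<simeq> u @ v"
| braid: "fst i \<noteq> fst j \<Longrightarrow> u @ [i, j, i] @ v \<simeq> u @ [j, i, j] @ v"
| refl [intro, simp]: "u \<simeq> u"
| sym: "u \<simeq> v \<Longrightarrow> v \<simeq> u"
| trans [trans]: "u \<simeq> v \<Longrightarrow> v \<simeq> w \<Longrightarrow> u \<simeq> w"

lemma weq_context: "u \<simeq> v \<Longrightarrow> x @ u @ y \<simeq> x @ v @ y"
proof (induction rule: weq.induct)
  case (cancel u i v)
  show ?case using weq.cancel[of "x @ u" i "v @ y"] by simp
next
  case (braid i j u v)
  then show ?case using weq.braid[of i j "x @ u" "v @ y"] by simp
qed (auto intro: weq.sym weq.trans)

lemma weq_append: "u \<simeq> u' \<Longrightarrow> v \<simeq> v' \<Longrightarrow> u @ v \<simeq> u' @ v'"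
  using weq_context[of u u' "[]" v] weq_context[of v v' u' "[]"] by (auto intro: weq.trans)

lemma weq_Cons: "u \<simeq> v \<Longrightarrow> i # u \<simeq> i # v"
  using weq_context[of u v "[i]" "[]"] by simp

lemma weq_cancel_Cons: "i # i # u \<simeq> u"
  using weq.cancel[of "[]" i u] by simp

lemma weq_rev_left: "rev u @ u \<simeq> []"
proof (induction u)
  case (Cons i u)
  have "rev u @ [i, i] @ u \<simeq> rev u @ u" by (rule weq.cancel)
  then show ?case using Cons weq.trans by auto
qed auto

lemma weq_rev_right: "u @ rev u \<simeq> []"
  using weq_rev_left[of "rev u"] by simp

lemma weq_act: "u \<simeq> v \<Longrightarrow> act u = act v"
  by (induction rule: weq.induct) (auto simp: fun_eq_iff reflect_braid)

lemma weq_parity: "u \<simeq> v \<Longrightarrow> even (length u) = even (length v)"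
  by (induction rule: weq.induct) auto

lemma act_rev [simp]: "act (rev u) (act u z) = z" "act u (act (rev u) z) = z"
  using fun_cong[OF weq_act[OF weq_rev_left, of u], of z] fun_cong[OF weq_act[OF weq_rev_right, of u], of z]
  by simp_all

section \<open>Minimal words and the side of a mirror on which a tile lies\<close>

definition min_word :: "mirror list \<Rightarrow> bool" where
  "min_word u \<longleftrightarrow> (\<forall>v. u \<simeq> v \<longrightarrow> length u \<le> length v)"

lemma reduced_exists: "\<exists>v. u \<simeq> v \<and> min_word v"
proof -
  obtain v where "u \<simeq> v" "\<And>w. u \<simeq> w \<Longrightarrow> length v \<le> length w"
    using ex_has_least_nat[of "\<lambda>v. u \<simeq> v" u length] by auto
  then show ?thesis unfolding min_word_def by (meson weq.trans)
qed

lemma reduced_infix: assumes "min_word (x @ u @ y)" shows "min_word u"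
  unfolding min_word_def
proof (intro allI impI)
  fix v assume "u \<simeq> v"
  then have "x @ u @ y \<simeq> x @ v @ y" by (rule weq_context)
  then have "length (x @ u @ y) \<le> length (x @ v @ y)" using assms unfolding min_word_def by blast
  then show "length u \<le> length v" by simp
qed

lemma not_reduced_square: "\<not> min_word (x @ [i, i] @ y)"
  using weq.cancel[of x i y] unfolding min_word_def by force

lemma not_reduced_four:
  assumes "fst i \<noteq> fst j" shows "\<not> min_word (i # j # i # j # y)"
proof -
  have "[] @ [i, j, i] @ (j # y) \<simeq> [] @ [j, i, j] @ (j # y)" by (rule weq.braid[OF assms])
  also have "[] @ [j, i, j] @ (j # y) \<simeq> [j, i] @ y" using weq.cancel[of "[j, i]" j y] by simp
  finally show ?thesis unfolding min_word_def by force
qed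

text \<open>The second inequality strengthens the induction. Reflection in \<open>t\<close> turns
  heights p of \<open>i\<close> and q of \<open>t\<close> into p + 4 q and - q, and both p + 4 q and
  p + 3 q are sums of q and p + q with nonnegative coefficients.\<close>

lemma dihedral_opposite_height:
  assumes "fst i = fst t" "i \<noteq> t" "set x \<subseteq> {i, t}" "distinct_adj (i # x)"
    "height i z \<ge> 0" "height t z \<ge> 0"
  shows "height i (act x z) \<ge> 0 \<and> height i (act x z) + height t (act x z) \<ge> 0"
  using assms
proof (induction x arbitrary: i t)
  case (Cons y x)
  have y: "y = t" using Cons.prems by auto
  have IH: "height t (act x z) \<ge> 0 \<and> height t (act x z) + height i (act x z) \<ge> 0"
    using Cons.IH[of t i] Cons.prems y by (auto simp: insert_commute)
  show ?case using IH y Cons.prems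
    by (auto simp: height_reflect_same height_reflect_opposite)
qed auto

text \<open>For mirrors on different axes an alternating word of four letters is not minimal, so
  \<open>x\<close> has at most two letters and the height is computed directly. For opposite mirrors
  minimality forces \<open>i # x\<close> to alternate.\<close>

lemma dihedral_height:
  assumes i: "i \<noteq> t" and x: "set x \<subseteq> {i, t}" and red: "min_word (i # x @ v)"
    and z: "height i z \<ge> 0" "height t z \<ge> 0"
  shows "height i (act x z) \<ge> 0"
proof (cases "fst i = fst t")
  case True
  have "distinct_adj (i # x)"
  proof (rule ccontr)
    assume "\<not> distinct_adj (i # x)"
    then obtain n where n: "Suc n < length (i # x)" "(i # x) ! n = (i # x) ! Suc n"
      by (auto simp: distinct_adj_conv_nth)
    define l where "l = i # x"
    have "l = take n l @ l ! n # l ! Suc n # drop (Suc (Suc n)) l"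
      using n id_take_nth_drop[of n l] Cons_nth_drop_Suc[of "Suc n" l] unfolding l_def[symmetric] by simp
    then have "l @ v = take n l @ [l ! n, l ! n] @ (drop (Suc (Suc n)) l @ v)"
      using n(2) unfolding l_def[symmetric] by (metis append_Cons append_Nil append_assoc)
    then have "i # x @ v = take n l @ [l ! n, l ! n] @ (drop (Suc (Suc n)) l @ v)"
      by (simp add: l_def)
    then show False using red not_reduced_square by metis
  qed
  then show ?thesis using dihedral_opposite_height[OF True i x _ z] by blast
next
  case False
  have adj: "p \<noteq> q" if "i # x @ v = A @ [p, q] @ B" for A p q B
    using red not_reduced_square[of A p B] that by auto
  consider "x = []" | y where "x = [y]" | y y' where "x = [y, y']"
    | y y' y'' x' where "x = y # y' # y'' # x'"
  proof -
    have "x = [] \<or> (\<exists>y. x = [y]) \<or> (\<exists>y y'. x = [y, y']) \<or> (\<exists>y y' y'' x'. x = y # y' # y'' # x')"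
      by (cases x; cases "tl x"; cases "tl (tl x)") auto
    then show ?thesis using that by blast
  qed
  then show ?thesis
  proof cases
    case 2
    have "y \<noteq> i" using adj[of "[]" i y v] 2 by auto
    then show ?thesis using 2 x z False by (auto simp: height_reflect_adjacent)
  next
    case 3
    have "y \<noteq> i" using adj[of "[]" i y "y' # v"] 3 by auto
    moreover have "y' \<noteq> y" using adj[of "[i]" y y' v] 3 by auto
    ultimately show ?thesis using 3 x z False
      by (auto simp: height_reflect_adjacent height_reflect_same)
  next
    case 4
    have "y \<noteq> i" using adj[of "[]" i y "y' # y'' # x' @ v"] 4 by auto
    moreover have "y' \<noteq> y" using adj[of "[i]" y y' "y'' # x' @ v"] 4 by auto
    moreover have "y'' \<noteq> y'" using adj[of "[i, y]" y' y'' "x' @ v"] 4 by auto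
    ultimately have "y = t" "y' = i" "y'' = t" using x 4 by auto
    then show ?thesis using red 4 not_reduced_four[OF False] by auto
  qed (use z in auto)
qed

text \<open>Tits' lemma: if \<open>i w\<close> is longer than \<open>w\<close>, the tile \<open>w\<close> lies on the inner side of mirror \<open>i\<close>.
  Split \<open>w = x v\<close> with \<open>x\<close> in the dihedral group of \<open>i\<close> and the first letter of \<open>w\<close>, and
  \<open>v\<close> as short as possible.\<close>

lemma reduced_Cons_height:
  assumes "min_word (i # w)" "z \<in> chamber" shows "height i (act w z) \<ge> 0"
  using assms
proof (induction "length w" arbitrary: w i rule: less_induct)
  case less
  show ?case
  proof (cases w)
    case Nil
    then show ?thesis using less.prems(2) unfolding chamber_def by (metis act_simps(1) mem_Collect_eq)
  next
    case (Cons t w')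
    have w_red: "min_word w" using less.prems(1) reduced_infix[of "[i]" w "[]"] by simp
    have it: "i \<noteq> t" using less.prems(1) not_reduced_square[of "[]" i w'] Cons by auto
    define P where "P = (\<lambda>(x, v). w \<simeq> x @ v \<and> length x + length v = length w \<and> set x \<subseteq> {i, t})"
    have "P ([t], w')" unfolding P_def using Cons by auto
    then obtain xv where xv: "P xv" "\<And>p. P p \<Longrightarrow> length (snd xv) \<le> length (snd p)"
      using ex_has_least_nat[of P "([t], w')" "length \<circ> snd"] by auto
    obtain x v where [simp]: "xv = (x, v)" by force
    have wxv: "w \<simeq> x @ v" and len: "length x + length v = length w" and xs: "set x \<subseteq> {i, t}"
      using xv(1) unfolding P_def by auto
    have lv: "length v < length w" using xv(2)[of "([t], w')"] \<open>P ([t], w')\<close> Cons by auto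
    have red: "min_word (j # v)" if j: "j \<in> {i, t}" for j
    proof (rule ccontr)
      assume "\<not> min_word (j # v)"
      then obtain v2 where v2: "j # v \<simeq> v2" "length v2 < Suc (length v)"
        unfolding min_word_def by force
      \<comment> \<open>All relations preserve parity, so a word shorter than \<open>j # v\<close>
        is even shorter than \<open>v\<close>. Moving \<open>j\<close> over to the dihedral part
        then contradicts the choice of the split.\<close>
      have "even (length v2) = even (Suc (length v))" using weq_parity[OF v2(1)] by simp
      then have lv2: "length v2 < length v" using v2(2) by (cases "length v2 = length v") auto
      have "v \<simeq> j # v2" by (meson v2(1) weq_Cons weq_cancel_Cons weq.sym weq.trans)
      then have w2: "w \<simeq> (x @ [j]) @ v2"
        using wxv weq_append[of x x v "j # v2"] by (auto intro: weq.trans)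
      then have "length w \<le> length (x @ [j]) + length v2"
        using w_red unfolding min_word_def by (metis length_append)
      then have "P (x @ [j], v2)" unfolding P_def using w2 xs j len lv2 by auto
      then show False using xv(2) lv2 by fastforce
    qed
    have "min_word (i # x @ v)"
      unfolding min_word_def
    proof (intro allI impI)
      fix y assume "i # x @ v \<simeq> y"
      then have "i # w \<simeq> y" using wxv weq_Cons weq.trans by blast
      then show "length (i # x @ v) \<le> length y" using less.prems(1) len unfolding min_word_def by fastforce
    qed
    moreover have "height i (act v z) \<ge> 0" "height t (act v z) \<ge> 0"
      using less.hyps[OF lv] red less.prems(2) by auto
    ultimately have "height i (act x (act v z)) \<ge> 0" using dihedral_height[OF it xs] by blast
    then show ?thesis using weq_act[OF wxv] by simp
  qed
qed

text \<open>The chamber is a strict fundamental domain, with stabilizers generated by the mirrors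
  through the point.\<close>

lemma chamber_strict:
  assumes "z \<in> chamber" "act u z \<in> chamber"
  shows "act u z = z \<and> (\<exists>g. u \<simeq> g \<and> set g \<subseteq> {i. height i z = 0})"
proof -
  obtain w where w: "u \<simeq> w" "min_word w" using reduced_exists by blast
  have "act w z = z \<and> set w \<subseteq> {i. height i z = 0}"
    if "min_word w" "act w z \<in> chamber" for w
    using that
  proof (induction w)
    case (Cons t w)
    \<comment> \<open>The point is on the inner side of mirror \<open>t\<close> before the last
      reflection by Tits' lemma and after it by assumption, so it lies on the mirror.\<close>
    have "height t (act w z) \<ge> 0" using Cons.prems reduced_Cons_height assms(1) by blast
    moreover have "height t (act (t # w) z) \<ge> 0" using Cons.prems unfolding chamber_def by blast
    ultimately have h0: "height t (act w z) = 0" by (simp add: height_reflect_same)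
    then have e: "act (t # w) z = act w z" by (simp add: reflect_fixed)
    have "min_word w" using Cons.prems(1) reduced_infix[of "[t]" w "[]"] by simp
    then have "act w z = z \<and> set w \<subseteq> {i. height i z = 0}" using Cons.IH Cons.prems(2) e by simp
    then show ?case using e h0 by simp
  qed auto
  then show ?thesis using w assms(2) weq_act[OF w(1)] by metis
qed

text \<open>The centre of the tile lies on no mirror, so its stabilizer is trivial. Faithfulness of
  the action is always tested at this point.\<close>

lemma act_center_imp_weq: assumes "act u (1, 0, 0) = (1, 0, 0)" shows "u \<simeq> []"
proof -
  have "(1, 0, 0) \<in> chamber" by (auto simp: chamber_def)
  then obtain g where "u \<simeq> g" "set g \<subseteq> {i. height i (1, 0, 0) = 0}"
    using chamber_strict[of "(1,0,0)" u] assms by auto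
  moreover have "{i. height i (1, 0, 0) = 0} = {}" by auto
  ultimately show ?thesis by simp
qed

section \<open>The cone over the disc and the reduction of its points to the chamber\<close>

definition fcone :: "(real \<times> real \<times> real) set" where
  "fcone = {(s, a, b). s > 0 \<and> a\<^sup>2 + b\<^sup>2 < 3 * s\<^sup>2}"

lemma cone_fst_pos: assumes "z \<in> fcone" shows "fst (reflect i z) > 0"
proof -
  obtain s a b where z: "z = (s, a, b)" by (rule prod_cases3)
  obtain k e where i: "i = (k, e)" by force
  have s: "s > 0" "a\<^sup>2 + b\<^sup>2 < 3 * s\<^sup>2" using assms z by (auto simp: fcone_def)
  have "a\<^sup>2 < (2 * s)\<^sup>2" "b\<^sup>2 < (2 * s)\<^sup>2"
  proof -
    have "(2 * s)\<^sup>2 = 4 * s\<^sup>2" by (simp add: power_mult_distrib)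
    then show "a\<^sup>2 < (2 * s)\<^sup>2" "b\<^sup>2 < (2 * s)\<^sup>2"
      using s(2) zero_le_power2[of a] zero_le_power2[of b] zero_le_power2[of s] by linarith+
  qed
  then have "\<bar>a\<bar> < 2 * s" "\<bar>b\<bar> < 2 * s"
    using s(1) power2_less_imp_less[of "\<bar>a\<bar>" "2 * s"] power2_less_imp_less[of "\<bar>b\<bar>" "2 * s"]
    by simp_all
  then show ?thesis using z i by (cases k; cases e) auto
qed

lemma reflect_cone: assumes "z \<in> fcone" shows "reflect i z \<in> fcone"
proof -
  obtain s a b where z: "z = (s, a, b)" by (rule prod_cases3)
  obtain k e where i: "i = (k, e)" by force
  show ?thesis using cone_fst_pos[OF assms, of i] assms unfolding z i
    by (cases k; cases e) (auto simp: fcone_def power2_eq_square algebra_simps)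
qed

lemma act_cone: "z \<in> fcone \<Longrightarrow> act u z \<in> fcone"
  by (induction u) (auto simp: reflect_cone)

lemma three_squares_le:
  fixes p q z :: int
  assumes "3 * (p\<^sup>2 + q\<^sup>2) \<le> z"
  shows "p\<^sup>2 \<le> z \<and> q\<^sup>2 \<le> z \<and> 3 * p\<^sup>2 \<le> z \<and> 3 * q\<^sup>2 \<le> z"
proof -
  have "x \<le> z \<and> y \<le> z \<and> 3 * x \<le> z \<and> 3 * y \<le> z" if "0 \<le> x" "0 \<le> y" "3 * (x + y) \<le> z" for x y :: int
    using that by auto
  from this[OF zero_le_power2 zero_le_power2 assms] show ?thesis .
qed

text \<open>The \<open>s\<close>-coordinate of \<open>act u z\<close> is a linear form in \<open>z\<close> with integer coefficients on the dual
  hyperboloid, so it takes only finitely many values below a given bound, and its minimum over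
  \<open>u\<close> is attained at a point of the chamber.\<close>

lemma act_fst_form:
  "\<exists>(m :: int) (p :: int) (q :: int). 0 \<le> m \<and> m\<^sup>2 \<ge> 3 * (p\<^sup>2 + q\<^sup>2) \<and>
     (\<forall>s a b :: real. fst (act u (s, a, b)) = of_int m * s + of_int p * a + of_int q * b)"
proof (induction u rule: rev_induct)
  case Nil
  show ?case by (rule exI[of _ 1], rule exI[of _ 0], rule exI[of _ 0]) auto
next
  \<comment> \<open>The appended letter acts on the argument before \<open>u\<close> does, so the
    coefficients change by the transposed reflection, which again preserves the dual form.\<close>
  case (snoc i u)
  then obtain m p q :: int where m: "(m::int) \<ge> 0" "m\<^sup>2 \<ge> 3 * (p\<^sup>2 + q\<^sup>2)"
    and f: "\<And>s a b :: real. fst (act u (s, a, b)) = of_int m * s + of_int p * a + of_int q * b" by blast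
  obtain k e where i: "i = (k, e)" by force
  define \<sigma> :: int where "\<sigma> = (if e then 1 else - 1)"
  have sg: "sg e = of_int \<sigma>" and \<sigma>2: "\<sigma> * \<sigma> = 1" by (auto simp: \<sigma>_def sg_def)
  define r where "r = (if k then q else p)"
  have rb: "3 * r\<^sup>2 \<le> m\<^sup>2" using three_squares_le[OF m(2)] unfolding r_def by simp
  have "9 * x \<le> 4 * y" if "3 * x \<le> y" "0 \<le> y" for x y :: int using that by auto
  then have "9 * r\<^sup>2 \<le> 4 * m\<^sup>2" using rb zero_le_power2 by blast
  then have "(3 * (\<sigma> * r))\<^sup>2 \<le> (2 * m)\<^sup>2"
    by (simp add: power_mult_distrib \<sigma>_def split: if_splits)
  then have "\<bar>3 * (\<sigma> * r)\<bar> \<le> 2 * m" using m(1) by (metis abs_le_square_iff abs_of_nonneg mult_nonneg_nonneg zero_le_numeral)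
  then have pos: "2 * m - 3 * \<sigma> * r \<ge> 0" by auto
  show ?case
  proof (cases k)
    case False
    have "(2 * m - 3 * \<sigma> * p)\<^sup>2 - 3 * ((\<sigma> * m - 2 * p)\<^sup>2 + q\<^sup>2) = m\<^sup>2 - 3 * (p\<^sup>2 + q\<^sup>2)"
      using \<sigma>2 by (auto simp: \<sigma>_def power2_eq_square algebra_simps)
    then have "2 * m - 3 * \<sigma> * p \<ge> 0 \<and> (2 * m - 3 * \<sigma> * p)\<^sup>2 \<ge> 3 * ((\<sigma> * m - 2 * p)\<^sup>2 + q\<^sup>2) \<and>
       (\<forall>s a b. fst (act (u @ [i]) (s, a, b)) = of_int (2 * m - 3 * \<sigma> * p) * s + of_int (\<sigma> * m - 2 * p) * a + of_int q * b)"
      using pos m False i unfolding r_def by (auto simp: f sg algebra_simps)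
    then show ?thesis by blast
  next
    case True
    have "(2 * m - 3 * \<sigma> * q)\<^sup>2 - 3 * (p\<^sup>2 + (\<sigma> * m - 2 * q)\<^sup>2) = m\<^sup>2 - 3 * (p\<^sup>2 + q\<^sup>2)"
      using \<sigma>2 by (auto simp: \<sigma>_def power2_eq_square algebra_simps)
    then have "2 * m - 3 * \<sigma> * q \<ge> 0 \<and> (2 * m - 3 * \<sigma> * q)\<^sup>2 \<ge> 3 * (p\<^sup>2 + (\<sigma> * m - 2 * q)\<^sup>2) \<and>
       (\<forall>s a b. fst (act (u @ [i]) (s, a, b)) = of_int (2 * m - 3 * \<sigma> * q) * s + of_int p * a + of_int (\<sigma> * m - 2 * q) * b)"
      using pos m True i unfolding r_def by (auto simp: f sg algebra_simps)
    then show ?thesis by blast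
  qed
qed

lemma act_into_chamber: assumes "z \<in> fcone" shows "\<exists>u. act u z \<in> chamber"
proof -
  obtain s a b where z: "z = (s, a, b)" by (rule prod_cases3)
  define n where "n = sqrt (a\<^sup>2 + b\<^sup>2)"
  have s: "s > 0" "a\<^sup>2 + b\<^sup>2 < 3 * s\<^sup>2" using assms z by (auto simp: fcone_def)
  have n0: "n \<ge> 0" "n < sqrt 3 * s"
  proof -
    have "sqrt (a\<^sup>2 + b\<^sup>2) < sqrt (3 * s\<^sup>2)" using s(2) by (rule real_sqrt_less_mono)
    then show "n < sqrt 3 * s" using s(1) by (simp add: n_def real_sqrt_mult)
  qed (simp add: n_def)
  \<comment> \<open>Since the vector (p, q) has length at most m / sqrt 3, the Cauchy-Schwarz
    inequality bounds the form from below by m c. Hence only finitely many m, and with them p and q,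
    give a value of at most \<open>s\<close>.\<close>
  define c where "c = s - n / sqrt 3"
  have c: "c > 0" using n0 unfolding c_def by (simp add: field_simps)
  define T where "T = {(m, p, q). 0 \<le> m \<and> of_int m * c \<le> s \<and> (m::int)\<^sup>2 \<ge> 3 * ((p::int)\<^sup>2 + (q::int)\<^sup>2)}"
  define M where "M = \<lceil>s / c\<rceil>"
  have "T \<subseteq> {-M..M} \<times> {-M..M} \<times> {-M..M}"
  proof
    fix x assume "x \<in> T"
    then obtain m p q :: int where x: "x = (m, p, q)"
      and h: "0 \<le> m" "of_int m * c \<le> s" "3 * (p\<^sup>2 + q\<^sup>2) \<le> m\<^sup>2" unfolding T_def by blast
    have "of_int m \<le> s / c" using h(2) c by (simp add: field_simps)
    then have "m \<le> M" unfolding M_def by (simp add: le_ceiling_iff)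
    moreover have "p\<^sup>2 \<le> m\<^sup>2" "q\<^sup>2 \<le> m\<^sup>2" using three_squares_le[OF h(3)] by auto
    then have "\<bar>p\<bar> \<le> m" "\<bar>q\<bar> \<le> m" using h(1) by (auto simp: abs_le_square_iff[symmetric])
    ultimately show "x \<in> {-M..M} \<times> {-M..M} \<times> {-M..M}" using h(1) x by auto
  qed
  then have "finite T" by (rule finite_subset) auto
  define V where "V = {fst (act u z) | u. fst (act u z) \<le> s}"
  have "V \<subseteq> (\<lambda>(m, p, q). of_int m * s + of_int p * a + of_int q * b) ` T"
  proof
    fix v assume "v \<in> V"
    then obtain u where v: "v = fst (act u z)" "v \<le> s" unfolding V_def by auto
    obtain m p q :: int where m: "m \<ge> 0" "m\<^sup>2 \<ge> 3 * (p\<^sup>2 + q\<^sup>2)"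
      and f: "\<And>s a b :: real. fst (act u (s, a, b)) = of_int m * s + of_int p * a + of_int q * b" using act_fst_form[of u] by blast
    define r where "r = sqrt ((of_int p)\<^sup>2 + (of_int q :: real)\<^sup>2)"
    have "3 * ((of_int p)\<^sup>2 + (of_int q)\<^sup>2) \<le> (of_int m :: real)\<^sup>2" using m(2)
      by (metis (mono_tags) of_int_add of_int_le_iff of_int_mult of_int_numeral of_int_power)
    then have "sqrt (3 * ((of_int p)\<^sup>2 + (of_int q)\<^sup>2)) \<le> sqrt ((of_int m :: real)\<^sup>2)"
      by (rule real_sqrt_le_mono)
    then have "sqrt 3 * r \<le> of_int m" using m(1) unfolding real_sqrt_mult by (simp add: r_def)
    then have r: "r \<le> of_int m / sqrt 3" by (simp add: field_simps)
    have "(p * a + q * b)\<^sup>2 \<le> ((of_int p)\<^sup>2 + (of_int q :: real)\<^sup>2) * (a\<^sup>2 + b\<^sup>2)"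
      using zero_le_power2[of "p * b - q * a"] by (simp add: power2_eq_square algebra_simps del: zero_le_power2)
    then have "sqrt ((p * a + q * b)\<^sup>2) \<le> r * n"
      unfolding r_def n_def real_sqrt_mult[symmetric] by (rule real_sqrt_le_mono)
    then have "- (p * a + q * b) \<le> r * n" by simp
    moreover have "r * n \<le> of_int m / sqrt 3 * n" using r n0(1) by (rule mult_right_mono)
    ultimately have "of_int m * c \<le> m * s + p * a + q * b" unfolding c_def by (simp add: algebra_simps)
    then have "of_int m * c \<le> s" using v f z by auto
    then have "(m, p, q) \<in> T" using m unfolding T_def by auto
    then show "v \<in> (\<lambda>(m, p, q). of_int m * s + of_int p * a + of_int q * b) ` T"
      using v f z by force
  qed
  then have finV: "finite V" using \<open>finite T\<close> finite_surj by blast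
  have "s \<in> V" unfolding V_def using z by (auto intro!: exI[of _ "[]"])
  then have "Min V \<in> V" using finV Min_in by blast
  then obtain u where u: "Min V = fst (act u z)" unfolding V_def by auto
  have min: "fst (act u z) \<le> fst (act v z)" for v
  proof (cases "fst (act v z) \<le> s")
    case True
    then have "fst (act v z) \<in> V" unfolding V_def by auto
    then show ?thesis using Min_le[OF finV] u by auto
  next
    case False
    then show ?thesis using Min_le[OF finV \<open>s \<in> V\<close>] u by auto
  qed
  have "height i (act u z) \<ge> 0" for i
  proof -
    \<comment> \<open>A reflection changes the first coordinate by exactly the height, so at a
      minimum no height is negative.\<close>
    have "fst (act (i # u) z) = fst (act u z) + height i (act u z)"
      by (cases i; cases "act u z"; cases "fst i") auto
    then show ?thesis using min[of "i # u"] by linarith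
  qed
  then show ?thesis unfolding chamber_def by blast
qed

subsection \<open>The tiling of the Klein disc\<close>

definition disc :: "(real \<times> real) set" where "disc = ball 0 (sqrt 3)"

definition tile :: "(real \<times> real) set" where "tile = cbox (-1, -1) (1, 1)"

definition corners :: "(real \<times> real) set" where "corners = {1, -1} \<times> {1, -1}"

definition sides :: "real \<times> real \<Rightarrow> mirror set" where "sides w = {i. height i (1, w) = 0}"

definition move :: "mirror list \<Rightarrow> real \<times> real \<Rightarrow> real \<times> real" where
  "move u w = snd (act u (1, w)) /\<^sub>R fst (act u (1, w))"

lemma disc_iff: "w \<in> disc \<longleftrightarrow> (1, w) \<in> fcone"
proof -
  have "w \<in> disc \<longleftrightarrow> sqrt ((fst w)\<^sup>2 + (snd w)\<^sup>2) < sqrt 3"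
    by (simp add: disc_def norm_prod_def)
  also have "\<dots> \<longleftrightarrow> (1, w) \<in> fcone"
    by (cases w) (simp add: fcone_def)
  finally show ?thesis .
qed

lemma tile_iff: "w \<in> tile \<longleftrightarrow> (1, w) \<in> chamber"
proof -
  have "w \<in> tile \<longleftrightarrow> \<bar>fst w\<bar> \<le> 1 \<and> \<bar>snd w\<bar> \<le> 1"
    by (cases w) (auto simp: tile_def mem_box Basis_prod_def)
  also have "\<dots> \<longleftrightarrow> (1, w) \<in> chamber"
  proof
    assume "\<bar>fst w\<bar> \<le> 1 \<and> \<bar>snd w\<bar> \<le> 1"
    then show "(1, w) \<in> chamber" by (cases w) (auto simp: chamber_def sg_def)
  next
    assume "(1, w) \<in> chamber"
    then have h: "height (k, e) (1, w) \<ge> 0" for k e by (simp add: chamber_def)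
    show "\<bar>fst w\<bar> \<le> 1 \<and> \<bar>snd w\<bar> \<le> 1"
      using h[of False True] h[of False False] h[of True True] h[of True False] by (cases w) auto
  qed
  finally show ?thesis .
qed

lemma tile_abs: "w \<in> tile \<longleftrightarrow> \<bar>fst w\<bar> \<le> 1 \<and> \<bar>snd w\<bar> \<le> 1"
  by (cases w) (auto simp: tile_def mem_box Basis_prod_def)

lemma tile_subset_disc: "tile \<subseteq> disc"
proof
  fix w assume "w \<in> tile"
  then have "(fst w)\<^sup>2 \<le> 1" "(snd w)\<^sup>2 \<le> 1" by (auto simp: tile_abs abs_square_le_1)
  then show "w \<in> disc" unfolding disc_iff by (cases w) (auto simp: fcone_def)
qed

lemma compact_tile: "compact tile" and convex_tile: "convex tile"
  by (auto simp: tile_def)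

lemma open_disc: "open disc" and convex_disc: "convex disc"
  by (auto simp: disc_def)

lemma act_scale: assumes "w \<in> disc"
  shows "fst (act u (1, w)) > 0" "act u (1, w) = fst (act u (1, w)) *\<^sub>R (1, move u w)"
proof -
  show p: "fst (act u (1, w)) > 0"
    using act_cone[of "(1, w)" u] assms by (auto simp: disc_iff fcone_def)
  show "act u (1, w) = fst (act u (1, w)) *\<^sub>R (1, move u w)"
    using p by (cases "act u (1, w)") (auto simp: move_def)
qed

lemma scale_fcone: "r > 0 \<Longrightarrow> z \<in> fcone \<Longrightarrow> r *\<^sub>R z \<in> fcone"
proof (cases z)
  case (fields s a b)
  assume "r > 0" "z \<in> fcone"
  then have "s > 0" "(a\<^sup>2 + b\<^sup>2) * r\<^sup>2 < 3 * s\<^sup>2 * r\<^sup>2"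
    using fields by (auto simp: fcone_def intro!: mult_strict_right_mono)
  then show ?thesis using fields \<open>r > 0\<close> by (auto simp: fcone_def power_mult_distrib algebra_simps)
qed

lemma move_disc: assumes "w \<in> disc" shows "move u w \<in> disc"
proof -
  let ?r = "fst (act u (1, w))"
  have "act u (1, w) \<in> fcone" using act_cone assms disc_iff by blast
  then have "inverse ?r *\<^sub>R act u (1, w) \<in> fcone" using act_scale[OF assms] scale_fcone by simp
  moreover have "inverse ?r *\<^sub>R act u (1, w) = (1, move u w)"
    using act_scale[OF assms, of u] by (metis left_inverse less_irrefl scaleR_one scaleR_scaleR)
  ultimately show ?thesis by (simp add: disc_iff)
qed

lemma move_Nil [simp]: "move [] w = w"
  by (simp add: move_def)

lemma move_append: assumes "w \<in> disc" shows "move (u @ v) w = move u (move v w)"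
proof -
  define r where "r = fst (act v (1, w))"
  have r: "r > 0" "act v (1, w) = r *\<^sub>R (1, move v w)" using act_scale[OF assms] r_def by auto
  have "act (u @ v) (1, w) = r *\<^sub>R act u (1, move v w)" by (simp add: r act_linear del: scaleR_Pair)
  then show ?thesis using r(1) by (simp add: move_def)
qed

lemma weq_move: "u \<simeq> v \<Longrightarrow> move u = move v"
  using weq_act by (auto simp: move_def fun_eq_iff)

lemma move_rev [simp]: "w \<in> disc \<Longrightarrow> move (rev u) (move u w) = w" "w \<in> disc \<Longrightarrow> move u (move (rev u) w) = w"
  using weq_move[OF weq_rev_left, of u] weq_move[OF weq_rev_right, of u]
  by (simp_all flip: move_append)

lemma continuous_act: "continuous_on UNIV (act u)"
proof (induction u)
  case (Cons i u)
  have "continuous_on UNIV (reflect i)"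
  proof -
    have "reflect i = (\<lambda>z. if fst i
        then (2 * fst z + sg (snd i) * snd (snd z), fst (snd z), - 3 * sg (snd i) * fst z - 2 * snd (snd z))
        else (2 * fst z + sg (snd i) * fst (snd z), - 3 * sg (snd i) * fst z - 2 * fst (snd z), snd (snd z)))"
      by (cases i; cases "fst i") (auto simp: fun_eq_iff)
    then show ?thesis by (cases "fst i") (auto intro!: continuous_intros)
  qed
  then have "continuous_on UNIV (\<lambda>z. reflect i (act u z))" using Cons
    by (rule continuous_on_compose2) auto
  then show ?case by (simp add: act_def)
qed (simp add: act_def)

lemma continuous_move: "continuous_on disc (move u)"
proof -
  have "continuous_on disc (\<lambda>w. act u (1, w))"
    by (intro continuous_intros continuous_on_compose2[OF continuous_act]) auto
  then show ?thesis unfolding move_def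
    using act_scale(1) by (intro continuous_intros) (auto simp: less_le)
qed

lemma continuous_height: "continuous_on A (height i)"
proof -
  have "height i = (\<lambda>z. fst z + sg (snd i) * (if fst i then snd (snd z) else fst (snd z)))"
    by (cases i) (auto simp: fun_eq_iff)
  then show ?thesis by (cases "fst i") (auto intro!: continuous_intros)
qed

lemma tile_strict:
  assumes "w \<in> tile" "move u w \<in> tile"
  shows "move u w = w \<and> (\<exists>g. u \<simeq> g \<and> set g \<subseteq> sides w)"
proof -
  have w: "w \<in> disc" using assms(1) tile_subset_disc by auto
  let ?r = "fst (act u (1, w))"
  have r: "?r > 0" "act u (1, w) = ?r *\<^sub>R (1, move u w)" using act_scale[OF w] by auto
  have hs: "height i (c *\<^sub>R z) = c * height i z" for i c z
    by (cases i; cases z) (auto simp: algebra_simps)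
  have "act u (1, w) \<in> chamber" using assms(2) r(1) unfolding tile_iff chamber_def
    by (subst r(2)) (auto simp: hs simp del: scaleR_Pair)
  then have c: "act u (1, w) = (1, w)" "\<exists>g. u \<simeq> g \<and> set g \<subseteq> sides w"
    using chamber_strict[of "(1, w)" u] assms(1) unfolding tile_iff sides_def by auto
  then show ?thesis by (simp add: move_def)
qed

lemma disc_covered: assumes "w \<in> disc" shows "\<exists>u v. v \<in> tile \<and> w = move u v"
proof -
  obtain u where u: "act u (1, w) \<in> chamber" using act_into_chamber assms disc_iff by blast
  let ?r = "fst (act u (1, w))"
  have r: "?r > 0" "act u (1, w) = ?r *\<^sub>R (1, move u w)" using act_scale[OF assms] by auto
  have hs: "height i (c *\<^sub>R z) = c * height i z" for i c z
    by (cases i; cases z) (auto simp: algebra_simps)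
  have "height i (1, move u w) \<ge> 0" for i
    using u r(1) hs[of i ?r "(1, move u w)"] unfolding chamber_def
    by (metis (no_types, lifting) mem_Collect_eq r(2) zero_le_mult_iff less_le_not_le)
  then have "move u w \<in> tile" by (simp add: tile_iff chamber_def)
  moreover have "w = move (rev u) (move u w)" using assms by simp
  ultimately show ?thesis by blast
qed

lemma height_one: "height i (1, w) = 1 + sg (snd i) * (if fst i then snd w else fst w)"
  by (cases i; cases w) simp

section \<open>Stabilizers and neighbourhoods of points of the tile\<close>

lemma side_cases:
  obtains "sides w = {}" | i where "sides w = {i}"
    | i j where "fst i \<noteq> fst j" "sides w = {i, j}"
proof -
  have one: "snd i = snd j" if "i \<in> sides w" "j \<in> sides w" "fst i = fst j" for i j
    using that by (cases "snd i"; cases "snd j") (simp_all add: sides_def height_one)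
  have "(\<exists>i j. fst i \<noteq> fst j \<and> sides w = {i, j}) \<or> (\<exists>i. sides w = {i}) \<or> sides w = {}"
  proof (cases "sides w = {}")
    case False
    then obtain i where i: "i \<in> sides w" by auto
    show ?thesis
    proof (cases "\<exists>j\<in>sides w. fst j \<noteq> fst i")
      case True
      then obtain j where j: "j \<in> sides w" "fst j \<noteq> fst i" by auto
      have "l = i \<or> l = j" if "l \<in> sides w" for l
      proof (cases "fst l = fst i")
        case True
        then show ?thesis using one[OF that i] by (simp add: prod_eq_iff)
      next
        case False
        then have "fst l = fst j" using j(2) by auto
        then show ?thesis using one[OF that j(1)] by (simp add: prod_eq_iff)
      qed
      then have "sides w = {i, j}" using i j by auto
      then show ?thesis using j by metis
    next
      case False
      then have "l = i" if "l \<in> sides w" for l using one[OF that i] that by (simp add: prod_eq_iff)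
      then have "sides w = {i}" using i by blast
      then show ?thesis by blast
    qed
  qed auto
  then show ?thesis using that by blast
qed

lemma act_fixed: "set g \<subseteq> sides w \<Longrightarrow> act g (1, w) = (1, w)"
  by (induction g) (auto simp: sides_def reflect_fixed)

lemma move_fixed: "set g \<subseteq> sides w \<Longrightarrow> move g w = w"
  by (simp add: move_def act_fixed)

text \<open>Two neighbouring mirrors generate a dihedral group of order six, and these words
  represent its elements.\<close>

lemma dihedral_word_cases:
  assumes "fst i \<noteq> fst j" "set g \<subseteq> {i, j}"
  shows "\<exists>h\<in>{[], [i], [j], [i, j], [j, i], [i, j, i]}. g \<simeq> h"
  using assms(2)
proof (induction g)
  case (Cons k g)
  then obtain h where h: "h \<in> {[], [i], [j], [i, j], [j, i], [i, j, i]}" "g \<simeq> h" by auto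
  have kg: "k # g \<simeq> k # h" using h(2) by (rule weq_Cons)
  have b: "[j, i, j] \<simeq> [i, j, i]" using weq.braid[of j i "[]" "[]"] assms(1) by simp
  have c: "[i, i] @ x \<simeq> x" "[j, j] @ x \<simeq> x" for x
    using weq_cancel_Cons[of i x] weq_cancel_Cons[of j x] by auto
  have d: "[j, i, j, i] \<simeq> [i, j]"
    using weq_append[OF b weq.refl, of "[i]"] weq.cancel[of "[i, j]" i "[]"] by (auto intro: weq.trans)
  have "\<exists>h'\<in>{[], [i], [j], [i, j], [j, i], [i, j, i]}. k # h \<simeq> h'"
    using h(1) Cons.prems b c[of "[]"] c[of "[i]"] c[of "[j]"] c[of "[i, j]"] c[of "[j, i]"] d
      c[of "[j, i]"] weq.refl by (auto simp: Bex_def)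
  then show ?case using kg by (meson weq.trans)
qed auto

text \<open>Only words in the mirrors through \<open>w\<close> matter near \<open>w\<close>: the
  radius is chosen such that all other mirrors keep a positive height after any of the finitely many
  words of length at most three. Such a word then brings the point to the inner side of the mirrors
  through \<open>w\<close>.\<close>

lemma star_neighbourhood:
  assumes "w \<in> tile"
  obtains \<epsilon> where "\<epsilon> > 0" "ball w \<epsilon> \<subseteq> disc"
    "\<And>z. z \<in> ball w \<epsilon> \<Longrightarrow> \<exists>g v. set g \<subseteq> sides w \<and> length g \<le> 3 \<and> v \<in> tile \<and> sides v \<subseteq> sides w \<and> z = move g v"
proof -
  let ?I = "sides w"
  let ?W = "{g. set g \<subseteq> ?I \<and> length g \<le> 3}"
  have finW: "finite ?W" by (rule finite_lists_length_le) simp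
  define U where "U = disc \<inter> {z. \<forall>g\<in>?W. \<forall>k\<in>- ?I. height k (act g (1, z)) > 0}"
  have w: "w \<in> disc" using assms tile_subset_disc by auto
  have U: "U = disc \<inter> (\<Inter>g\<in>?W. \<Inter>k\<in>- ?I. {z. 0 < height k (act g (1, z))})"
    unfolding U_def by auto
  have "open {z. 0 < height k (act g (1, z))}" for k g
    by (intro open_Collect_less continuous_intros continuous_on_compose2[OF continuous_act]
        continuous_on_compose2[OF continuous_height[of UNIV]]) auto
  then have "open U" unfolding U
    by (intro open_Int open_disc open_INT finW ballI) (auto intro: finite_subset[of _ UNIV])
  moreover have "w \<in> U"
  proof -
    have "height k (1, w) > 0" if "k \<notin> ?I" for k
    proof -
      have "\<forall>k. height k (1, w) \<ge> 0" using assms unfolding tile_iff chamber_def by blast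
      then show ?thesis using that unfolding sides_def by (metis less_le mem_Collect_eq)
    qed
    then show ?thesis unfolding U_def using w by (auto simp: act_fixed)
  qed
  ultimately obtain \<epsilon> where \<epsilon>: "\<epsilon> > 0" "ball w \<epsilon> \<subseteq> U" by (meson open_contains_ball)
  have "\<exists>g v. set g \<subseteq> ?I \<and> length g \<le> 3 \<and> v \<in> tile \<and> sides v \<subseteq> ?I \<and> z = move g v" if z: "z \<in> U" for z
  proof -
    have zd: "z \<in> disc" using z U_def by auto
    have "\<exists>g\<in>?W. \<forall>k\<in>?I. height k (act g (1, z)) \<ge> 0"
    proof (cases rule: side_cases[of w])
      case 1
      then show ?thesis by (auto intro: exI[of _ "[]"])
    next
      case (2 i)
      show ?thesis
      proof (cases "height i (1, z) \<ge> 0")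
        case True
        then show ?thesis using 2 by (intro bexI[of _ "[]"]) auto
      next
        case False
        then show ?thesis using 2 by (intro bexI[of _ "[i]"]) (auto simp: height_reflect_same)
      qed
    next
      case (3 i j)
      \<comment> \<open>The heights of the two mirrors through a corner determine in which of the
        six sectors the point lies, and each sector is brought to the inner one by one of the six
        words.\<close>
      define p where "p = height i (1, z)"
      define q where "q = height j (1, z)"
      have ji: "fst j \<noteq> fst i" "i \<noteq> j" "j \<noteq> i" using 3 by auto
      have h: "height i (act [i] (1, z)) = - p" "height j (act [i] (1, z)) = p + q"
        "height i (act [j] (1, z)) = p + q" "height j (act [j] (1, z)) = - q"
        "height i (act [i, j] (1, z)) = - p - q" "height j (act [i, j] (1, z)) = p"
        "height i (act [j, i] (1, z)) = q" "height j (act [j, i] (1, z)) = - p - q"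
        "height i (act [i, j, i] (1, z)) = - q" "height j (act [i, j, i] (1, z)) = - p"
        using 3 ji by (auto simp: height_reflect_same height_reflect_adjacent p_def q_def)
      have *: ?thesis if "g \<in> ?W" "height i (act g (1, z)) \<ge> 0" "height j (act g (1, z)) \<ge> 0" for g
        using that 3 by (intro bexI[of _ g]) auto
      have "(p \<ge> 0 \<and> q \<ge> 0) \<or> (- p \<ge> 0 \<and> p + q \<ge> 0) \<or> (p + q \<ge> 0 \<and> - q \<ge> 0) \<or>
        (- p - q \<ge> 0 \<and> p \<ge> 0) \<or> (q \<ge> 0 \<and> - p - q \<ge> 0) \<or> (- q \<ge> 0 \<and> - p \<ge> 0)" by linarith
      then show ?thesis
        using *[of "[]"] *[of "[i]"] *[of "[j]"] *[of "[i, j]"] *[of "[j, i]"] *[of "[i, j, i]"]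
        unfolding h using 3(2) by (auto simp: p_def q_def)
    qed
    then obtain g where g: "g \<in> ?W" "\<And>k. k \<in> ?I \<Longrightarrow> height k (act g (1, z)) \<ge> 0" by auto
    have pos: "height k (act g (1, z)) > 0" if "k \<notin> ?I" for k using z g(1) that U_def by auto
    let ?r = "fst (act g (1, z))"
    have r: "?r > 0" "act g (1, z) = ?r *\<^sub>R (1, move g z)" using act_scale[OF zd] by auto
    have hs: "height k (act g (1, z)) = ?r * height k (1, move g z)" for k
    proof -
      have "height i (c *\<^sub>R z) = c * height i z" for i c z
        by (cases i; cases z) (auto simp: algebra_simps)
      then show ?thesis by (subst r(2)) blast
    qed
    have "height k (1, move g z) \<ge> 0" for k
      using pos[of k] g(2)[of k] hs[of k] r(1) by (cases "k \<in> ?I") (auto simp: zero_le_mult_iff zero_less_mult_iff)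
    then have "move g z \<in> tile" by (simp add: tile_iff chamber_def)
    moreover have "sides (move g z) \<subseteq> ?I"
    proof
      fix k assume k: "k \<in> sides (move g z)"
      show "k \<in> ?I"
        using pos[of k] hs[of k] k unfolding sides_def[of "move g z"] by (cases "k \<in> ?I") simp_all
    qed
    moreover have "z = move (rev g) (move g z)" using zd by simp
    ultimately show ?thesis using g(1) by (intro exI[of _ "rev g"] exI[of _ "move g z"]) auto
  qed
  then show thesis using that[OF \<epsilon>(1)] \<epsilon>(2) U_def by blast
qed

subsection \<open>Lifts of the tile\<close>

text \<open>For sheets above a chart: a connected set above the chart stays in one sheet.\<close>

lemma connected_subset_disjoint_open_family:
  assumes A: "connected A" "A \<subseteq> \<Union>\<V>" and op: "\<And>V. V \<in> \<V> \<Longrightarrow> openin (top_of_set S) V"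
    and dj: "pairwise disjnt \<V>" and V: "V \<in> \<V>" "A \<inter> V \<noteq> {}"
  shows "A \<subseteq> V"
proof -
  define B where "B = \<Union>(\<V> - {V})"
  have B: "openin (top_of_set S) B" unfolding B_def by (intro openin_Union) (auto intro: op)
  obtain U1 where U1: "open U1" "V = S \<inter> U1" using op[OF V(1)] by (auto simp: openin_open)
  obtain U2 where U2: "open U2" "B = S \<inter> U2" using B by (auto simp: openin_open)
  have AS: "A \<subseteq> S" using A(2) op by (force dest: openin_imp_subset)
  have VB: "V \<inter> B = {}" using dj V(1) unfolding B_def pairwise_def disjnt_def by auto
  have "U1 \<inter> A = {} \<or> U2 \<inter> A = {}"
  proof (rule connectedD[OF A(1) U1(1) U2(1)])
    show "U1 \<inter> U2 \<inter> A = {}" using VB U1 U2 AS by blast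
    show "A \<subseteq> U1 \<union> U2" using A(2) U1 U2 unfolding B_def by blast
  qed
  then have "B \<inter> A = {}" using V(2) U1 U2 AS by blast
  then show ?thesis using A(2) unfolding B_def by blast
qed

lemma sides_iff: "k \<in> sides w \<longleftrightarrow> (if fst k then snd w else fst w) = - sg (snd k)"
proof -
  have "1 + x = 0 \<longleftrightarrow> x = - 1" "1 + - x = 0 \<longleftrightarrow> x = 1" for x :: real by linarith+
  then show ?thesis
    unfolding sides_def height_one mem_Collect_eq by (cases "snd k") simp_all
qed

lemma corner_iff_sides: assumes "w \<in> tile"
  shows "w \<in> corners \<longleftrightarrow> (\<exists>i j. fst i \<noteq> fst j \<and> sides w = {i, j})"
proof
  assume "w \<in> corners"
  then have w: "fst w = 1 \<or> fst w = - 1" "snd w = 1 \<or> snd w = - 1" by (auto simp: corners_def)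
  then have "k \<in> sides w \<longleftrightarrow> snd k = ((if fst k then snd w else fst w) = - 1)" for k
    unfolding sides_iff sg_def by (cases "snd k"; cases "fst k"; auto)
  then have "sides w = {(False, fst w = - 1), (True, snd w = - 1)}"
    by (intro Set.set_eqI) (auto split: if_splits)
  then show "\<exists>i j. fst i \<noteq> fst j \<and> sides w = {i, j}"
    by (intro exI[of _ "(False, fst w = - 1)"] exI[of _ "(True, snd w = - 1)"]) simp
next
  assume "\<exists>i j. fst i \<noteq> fst j \<and> sides w = {i, j}"
  then obtain i j where ij: "fst i \<noteq> fst j" "i \<in> sides w" "j \<in> sides w" by blast
  have "\<bar>if fst k then snd w else fst w\<bar> = 1" if "k \<in> sides w" for k
    using that by (simp add: sides_iff)
  from this[OF ij(2)] this[OF ij(3)] ij(1) have "\<bar>fst w\<bar> = 1" "\<bar>snd w\<bar> = 1"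
    by (auto split: if_splits)
  then show "w \<in> corners" by (cases w) (auto simp: corners_def)
qed

lemma corners_subset_tile: "corners \<subseteq> tile"
  by (auto simp: corners_def tile_abs)

lemma finite_corners: "finite corners"
  by (simp add: corners_def)

text \<open>Each corner is cut off by an open half plane, so the tile without corners is still
  convex. It is therefore simply connected, as lifting through the punctured covering
  demands.\<close>

lemma tile_minus_corners:
  "tile - corners = tile \<inter> (\<Inter>c\<in>corners. {w. c \<bullet> w < 2})"
proof -
  have "w \<in> corners \<longleftrightarrow> (\<exists>c\<in>corners. c \<bullet> w \<ge> 2)" if "w \<in> tile" for w
    using that by (cases w) (auto simp: corners_def tile_abs inner_prod_def)
  then show ?thesis by (intro Set.set_eqI) (force simp: not_le[symmetric])
qed

lemma convex_tile_minus_corners: "convex (tile - corners)"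
  unfolding tile_minus_corners
  by (intro convex_Int convex_tile convex_INT) (auto intro: convex_halfspace_lt)

lemma closure_tile_minus_corners: "closure (tile - corners) = tile"
proof
  show "closure (tile - corners) \<subseteq> tile"
    by (meson Diff_subset closure_minimal compact_imp_closed compact_tile)
  have box_abs: "w \<in> box (- 1, - 1) (1 :: real, 1 :: real) \<longleftrightarrow> \<bar>fst w\<bar> < 1 \<and> \<bar>snd w\<bar> < 1" for w :: "real \<times> real"
    by (cases w) (auto simp: mem_box Basis_prod_def)
  have "w \<in> tile - corners" if "w \<in> box (- 1, - 1) (1 :: real, 1 :: real)" for w :: "real \<times> real"
    using that unfolding box_abs by (cases w) (auto simp: tile_abs corners_def)
  then have "box (- 1, - 1) (1 :: real, 1 :: real) \<subseteq> tile - corners" by blast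
  moreover have "closure (box (- 1, - 1) (1 :: real, 1 :: real)) = tile"
  proof -
    have "0 \<in> box (- 1, - 1) (1 :: real, 1 :: real)" unfolding box_abs by simp
    then show ?thesis unfolding tile_def by (metis closure_box empty_iff)
  qed
  ultimately show "tile \<subseteq> closure (tile - corners)" by (metis closure_mono)
qed

definition midpoint_of :: "mirror \<Rightarrow> real \<times> real" where
  "midpoint_of i = (if fst i then (0, - sg (snd i)) else (- sg (snd i), 0))"

lemma midpoint_of: "midpoint_of i \<in> tile - corners" "sides (midpoint_of i) = {i}"
proof -
  show "midpoint_of i \<in> tile - corners"
    by (auto simp: midpoint_of_def tile_abs corners_def)
  show "sides (midpoint_of i) = {i}"
  proof (rule Set.set_eqI)
    fix k :: mirror
    obtain a b where k: "k = (a, b)" by force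
    obtain a' b' where i: "i = (a', b')" by force
    show "k \<in> sides (midpoint_of i) \<longleftrightarrow> k \<in> {i}"
      unfolding k i by (cases a; cases b; cases a'; cases b') (simp_all add: midpoint_of_def sides_def height_one)
  qed
qed

lemma convex_edge: "convex {w \<in> tile. i \<in> sides w}"
proof -
  have h: "height i (1, (1 - u) *\<^sub>R x + u *\<^sub>R y) = (1 - u) * height i (1, x) + u * height i (1, y)" for u x y
    by (simp add: height_one algebra_simps)
  show ?thesis
    unfolding convex_alt
  proof (intro ballI allI impI)
    fix x y :: "real \<times> real" and u :: real
    assume "x \<in> {w \<in> tile. i \<in> sides w}" "y \<in> {w \<in> tile. i \<in> sides w}" "0 \<le> u \<and> u \<le> 1"
    then show "(1 - u) *\<^sub>R x + u *\<^sub>R y \<in> {w \<in> tile. i \<in> sides w}"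
      using convexD_alt[OF convex_tile, of x y u] h[of u x y] by (simp add: sides_def)
  qed
qed

text \<open>A corner is approached along the segment to the midpoint of the edge, which meets no
  corner in its interior. Agreement of two lifts along an open edge thus extends to its end
  points.\<close>

lemma corner_in_closure_edge:
  assumes "v \<in> tile" "i \<in> sides v"
  shows "v \<in> closure ({w \<in> tile. i \<in> sides w} - corners)"
proof (cases "v \<in> corners")
  case False
  then show ?thesis using assms closure_subset by fastforce
next
  case True
  let ?m = "midpoint_of i"
  have m: "?m \<in> {w \<in> tile. i \<in> sides w}" "?m \<notin> corners" using midpoint_of[of i] by auto
  then have ne: "v \<noteq> ?m" using True by auto
  have "open_segment v ?m \<subseteq> {w \<in> tile. i \<in> sides w} - corners"
  proof
    fix z assume z: "z \<in> open_segment v ?m"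
    have "closed_segment v ?m \<subseteq> {w \<in> tile. i \<in> sides w}"
      using convex_edge[of i] m(1) assms unfolding convex_contains_segment by blast
    then have "z \<in> {w \<in> tile. i \<in> sides w}" using z open_closed_segment by blast
    moreover have "z \<notin> corners"
    proof
      assume zc: "z \<in> corners"
      obtain u where u: "0 < u" "u < 1" "z = (1 - u) *\<^sub>R v + u *\<^sub>R ?m"
        using z by (auto simp: in_segment)
      have ab: "\<bar>fst c\<bar> = 1" "\<bar>snd c\<bar> = 1" if "c \<in> corners" for c
        using that by (auto simp: corners_def)
      show False
      proof (cases "fst i")
        case True
        then have "\<bar>fst z\<bar> = (1 - u) * \<bar>fst v\<bar>" using u by (simp add: midpoint_of_def abs_mult)
        then show False using u(1) ab[OF zc] ab[OF \<open>v \<in> corners\<close>] by simp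
      next
        case False
        then have "\<bar>snd z\<bar> = (1 - u) * \<bar>snd v\<bar>" using u by (simp add: midpoint_of_def abs_mult)
        then show False using u(1) ab[OF zc] ab[OF \<open>v \<in> corners\<close>] by simp
      qed
    qed
    ultimately show "z \<in> {w \<in> tile. i \<in> sides w} - corners" by blast
  qed
  then have "closure (open_segment v ?m) \<subseteq> closure ({w \<in> tile. i \<in> sides w} - corners)"
    by (rule closure_mono)
  then show ?thesis using ne by auto
qed

text \<open>A coordinate changes by less than 1, so it cannot pass from 1 to -1 or back: no other
  corner and no side opposite to one through \<open>v\<close> is within reach.\<close>

lemma near_corner:
  assumes "v \<in> corners" "z \<in> tile" "dist v z < 1" "z \<noteq> v"
  shows "z \<notin> corners" "sides z \<subseteq> sides v"
proof -
  have d: "\<bar>fst v - fst z\<bar> < 1" "\<bar>snd v - snd z\<bar> < 1"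
    using assms(3) dist_fst_le[of v z] dist_snd_le[of v z] by (auto simp: dist_real_def)
  show "z \<notin> corners"
  proof
    assume "z \<in> corners"
    then have "fst z = fst v" "snd z = snd v" using assms(1) d by (auto simp: corners_def)
    then show False using assms(4) by (simp add: prod_eq_iff)
  qed
  show "sides z \<subseteq> sides v"
  proof
    fix k assume "k \<in> sides z"
    then show "k \<in> sides v" using assms(1) d
      by (cases "snd k") (auto simp: corners_def sides_def height_one split: if_splits)
  qed
qed

text \<open>The base is the sphere as the double of the square: \<open>\<iota> True\<close> and
  \<open>\<iota> False\<close> are its two faces, and they coincide exactly along the boundary. The
  corners are the cone points.\<close>

locale square_orbifold =
  fixes S :: "'c::real_normed_vector set" and F :: "'d::real_normed_vector set"
    and d :: "'d \<Rightarrow> nat" and f :: "'c \<Rightarrow> 'd" and \<iota> :: "bool \<Rightarrow> real \<times> real \<Rightarrow> 'd"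
  assumes compact_S: "compact S" and connected_S: "connected S" and S_ne: "S \<noteq> {}"
    and cov: "orbifold_covering S (\<lambda>_. 1) F d f"
    and fib: "\<And>y. y \<in> F \<Longrightarrow> finite {x \<in> S. f x = y}"
    and iota_cont: "\<And>e. continuous_on tile (\<iota> e)"
    and iota_img: "\<iota> True ` tile \<union> \<iota> False ` tile = F"
    and iota_eq: "\<And>e e' w w'. w \<in> tile \<Longrightarrow> w' \<in> tile \<Longrightarrow>
        \<iota> e w = \<iota> e' w' \<longleftrightarrow> w = w' \<and> (e = e' \<or> sides w \<noteq> {})"
    and order: "\<And>e w. w \<in> tile \<Longrightarrow> d (\<iota> e w) = (if w \<in> corners then 3 else 1)"
begin

lemma iota_F: "w \<in> tile \<Longrightarrow> \<iota> e w \<in> F"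
  using iota_img by (cases e) auto

lemma F_iota: "y \<in> F \<Longrightarrow> \<exists>e w. w \<in> tile \<and> y = \<iota> e w"
  using iota_img by blast

lemma f_cont: "continuous_on S f" and f_img: "f ` S = F"
  using cov unfolding orbifold_covering_def by auto

definition punctures :: "'d set" where "punctures = \<iota> True ` corners"

lemma iota_punctures: assumes "w \<in> tile" shows "\<iota> e w \<in> punctures \<longleftrightarrow> w \<in> corners"
proof
  assume "\<iota> e w \<in> punctures"
  then obtain c where c: "c \<in> corners" "\<iota> e w = \<iota> True c" unfolding punctures_def by blast
  then show "w \<in> corners" using iota_eq[OF assms, of c e True] corners_subset_tile by auto
next
  assume w: "w \<in> corners"
  then have "sides w \<noteq> {}" using corner_iff_sides[OF assms] by auto
  then have "\<iota> e w = \<iota> True w" using iota_eq[OF assms assms] by blast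
  then show "\<iota> e w \<in> punctures" using w unfolding punctures_def by simp
qed

lemma order_F: "y \<in> F \<Longrightarrow> d y = (if y \<in> punctures then 3 else 1)"
  using F_iota[of y] order iota_punctures by auto

lemma covering_data:
  assumes "y \<in> F"
  obtains U \<psi> \<psi>' \<V> where "openin (top_of_set F) U" "y \<in> U" "homeomorphism U (ball (0::complex) 1) \<psi> \<psi>'"
    "\<psi> y = 0" "\<forall>z\<in>U - {y}. d z = 1" "\<Union>\<V> = S \<inter> f -` U" "pairwise disjnt \<V>"
    "\<And>V. V \<in> \<V> \<Longrightarrow> openin (top_of_set S) V"
    "\<And>V. V \<in> \<V> \<Longrightarrow> \<exists>x \<phi> \<phi>'. x \<in> V \<and> \<phi> x = 0 \<and> homeomorphism V (ball (0::complex) 1) \<phi> \<phi>' \<and>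
       (\<forall>v\<in>V. \<psi> (f v) = \<phi> v ^ d y)"
proof -
  obtain U \<psi> \<V> where c: "cone_chart F d y U \<psi>" and V: "\<Union>\<V> = S \<inter> f -` U" "pairwise disjnt \<V>"
    and ch: "\<forall>V\<in>\<V>. \<exists>x \<phi>. cone_chart S (\<lambda>_. 1) x V \<phi> \<and> 1 dvd d y \<and> (\<forall>v\<in>V. \<psi> (f v) = \<phi> v ^ (d y div 1))"
    using cov[unfolded orbifold_covering_def, THEN conjunct2, THEN conjunct2, rule_format, OF assms] by blast
  obtain \<psi>' where \<psi>': "homeomorphism U (ball (0::complex) 1) \<psi> \<psi>'"
    using c unfolding cone_chart_def by blast
  show thesis
  proof (rule that[of U \<psi> \<psi>' \<V>])
    fix A assume "A \<in> \<V>"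
    then obtain x \<phi> where x: "cone_chart S (\<lambda>_. 1) x A \<phi>" "\<forall>v\<in>A. \<psi> (f v) = \<phi> v ^ d y"
      using ch by fastforce
    then show "openin (top_of_set S) A" by (simp add: cone_chart_def)
    show "\<exists>x \<phi> \<phi>'. x \<in> A \<and> \<phi> x = 0 \<and> homeomorphism A (ball (0::complex) 1) \<phi> \<phi>' \<and>
       (\<forall>v\<in>A. \<psi> (f v) = \<phi> v ^ d y)"
      using x unfolding cone_chart_def by blast
  qed (use c \<psi>' V in \<open>auto simp: cone_chart_def\<close>)
qed

abbreviation "S0 \<equiv> S - f -` punctures"

text \<open>At a point of order one the local model is an ordinary homeomorphism, and a chart around
  it contains no other point of higher order. Away from the cone points the orbifold covering is
  therefore an honest covering.\<close>

lemma covering_punctured: "covering_space S0 f (F - punctures)"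
  unfolding covering_space_def
proof (intro conjI ballI)
  show "continuous_on S0 f" using f_cont continuous_on_subset by blast
  show "f ` S0 = F - punctures" using f_img by auto
  fix y assume y: "y \<in> F - punctures"
  then have dy: "d y = 1" using order_F by auto
  have "y \<in> F" using y by auto
  then obtain U \<psi> \<psi>' \<V> where U: "openin (top_of_set F) U" "y \<in> U"
    and \<psi>: "homeomorphism U (ball (0::complex) 1) \<psi> \<psi>'" and oth: "\<forall>z\<in>U - {y}. d z = 1"
    and V: "\<Union>\<V> = S \<inter> f -` U" "pairwise disjnt \<V>"
    "\<And>V. V \<in> \<V> \<Longrightarrow> openin (top_of_set S) V"
    and ch: "\<And>V. V \<in> \<V> \<Longrightarrow> \<exists>x \<phi> \<phi>'. x \<in> V \<and> \<phi> x = 0 \<and> homeomorphism V (ball (0::complex) 1) \<phi> \<phi>' \<and>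
       (\<forall>v\<in>V. \<psi> (f v) = \<phi> v ^ d y)"
    by (rule covering_data) metis
  have UF: "U \<subseteq> F" using U(1) openin_imp_subset by blast
  have Up: "U \<inter> punctures = {}"
  proof -
    have "d z = 1" if "z \<in> U" for z using that oth dy by (cases "z = y") auto
    then show ?thesis using order_F UF by fastforce
  qed
  show "\<exists>T. y \<in> T \<and> openin (top_of_set (F - punctures)) T \<and>
     (\<exists>v. \<Union>v = S0 \<inter> f -` T \<and> (\<forall>u\<in>v. openin (top_of_set S0) u) \<and> pairwise disjnt v \<and>
       (\<forall>u\<in>v. \<exists>q. homeomorphism u T f q))"
  proof (intro exI[of _ U] conjI exI[of _ \<V>] ballI)
    show "openin (top_of_set (F - punctures)) U"
      using U(1) Up UF by (intro openin_subset_trans[OF U(1)]) auto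
    show un: "\<Union>\<V> = S0 \<inter> f -` U" using V(1) Up by blast
    fix A assume A: "A \<in> \<V>"
    then show "openin (top_of_set S0) A"
      using un by (intro openin_subset_trans[OF V(3)[OF A]]) auto
    obtain \<phi> \<phi>' where \<phi>: "homeomorphism A (ball (0::complex) 1) \<phi> \<phi>'" "\<forall>v\<in>A. \<psi> (f v) = \<phi> v"
      using ch[OF A] dy by auto
    have h: "homeomorphism A U (\<psi>' \<circ> \<phi>) (\<phi>' \<circ> \<psi>)"
      by (rule homeomorphism_compose[OF \<phi>(1) homeomorphism_symD[OF \<psi>]])
    have "f v = (\<psi>' \<circ> \<phi>) v" if "v \<in> A" for v
    proof -
      have "f v \<in> U" using that A V(1) by blast
      then show ?thesis using \<phi>(2) that homeomorphism_apply1[OF \<psi>] by fastforce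
    qed
    then have "homeomorphism A U f (\<phi>' \<circ> \<psi>)" by (intro homeomorphism_cong[OF h]) auto
    then show "\<exists>q. homeomorphism A U f q" by blast
  qed (use U V in auto)
qed

text \<open>The sign tells which of the two faces of the sphere the tile is mapped to.\<close>

definition lifts :: "(bool \<times> (real \<times> real \<Rightarrow> 'c)) set" where
  "lifts = {(e, l). l \<in> extensional tile \<and> continuous_on tile l \<and> l ` tile \<subseteq> S \<and> (\<forall>w\<in>tile. f (l w) = \<iota> e w)}"

lemma liftsD:
  assumes "x \<in> lifts"
  shows "snd x \<in> extensional tile" "continuous_on tile (snd x)" "\<And>w. w \<in> tile \<Longrightarrow> snd x w \<in> S"
    "\<And>w. w \<in> tile \<Longrightarrow> f (snd x w) = \<iota> (fst x) w"
  using assms by (auto simp: lifts_def)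

text \<open>Covering theory compares lifts away from the corners only; density of that set and
  continuity do the rest.\<close>

lemma lift_eqI:
  assumes "x \<in> lifts" "y \<in> lifts" "fst x = fst y" "\<And>w. w \<in> tile - corners \<Longrightarrow> snd x w = snd y w"
  shows "x = y"
proof -
  have "snd x w = snd y w" if w: "w \<in> tile" for w
  proof -
    have "(\<lambda>w. snd x w - snd y w) w = 0"
      by (rule continuous_constant_on_closure[of "tile - corners"])
        (use assms liftsD(2)[OF assms(1)] liftsD(2)[OF assms(2)] w in
          \<open>auto simp: closure_tile_minus_corners intro!: continuous_on_diff\<close>)
    then show ?thesis by simp
  qed
  then have "snd x = snd y" using liftsD(1)[OF assms(1)] liftsD(1)[OF assms(2)]
    by (intro extensionalityI) auto
  then show ?thesis using assms(3) by (simp add: prod_eq_iff)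
qed

lemma lift_in_S0: "x \<in> lifts \<Longrightarrow> w \<in> tile - corners \<Longrightarrow> snd x w \<in> S0"
  using liftsD(3,4)[of x w] iota_punctures[of w] by auto

lemma iota_off: "w \<in> tile - corners \<Longrightarrow> \<iota> e w \<in> F - punctures"
  using iota_F iota_punctures by auto

text \<open>The mixed signs allow comparing lifts of both faces along an edge.\<close>

lemma lifts_agree_on:
  assumes x: "x \<in> lifts" "y \<in> lifts" and T: "connected T" "T \<subseteq> tile - corners"
    and e: "fst x = fst y \<or> (\<forall>w\<in>T. sides w \<noteq> {})"
    and a: "a \<in> T" "snd x a = snd y a" and w: "w \<in> T"
  shows "snd x w = snd y w"
proof (rule covering_space_lift_unique[OF covering_punctured, where f = "\<iota> (fst x)" and T = T and a = a])
  show "continuous_on T (\<iota> (fst x))" "continuous_on T (snd x)" "continuous_on T (snd y)"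
    using T(2) iota_cont liftsD(2) x by (meson Diff_subset continuous_on_subset order_trans)+
  show "\<iota> (fst x) \<in> T \<rightarrow> F - punctures" using iota_off T(2) by blast
  show "snd x \<in> T \<rightarrow> S0" "snd y \<in> T \<rightarrow> S0" using lift_in_S0 x T(2) by blast+
  show "\<iota> (fst x) z = f (snd x z)" if "z \<in> T" for z
    using liftsD(4)[OF x(1), of z] that T(2) by auto
  show "\<iota> (fst x) z = f (snd y z)" if "z \<in> T" for z
  proof -
    have "z \<in> tile" using that T(2) by auto
    then have "\<iota> (fst x) z = \<iota> (fst y) z" using iota_eq e that by blast
    then show ?thesis using liftsD(4)[OF x(2)] \<open>z \<in> tile\<close> by auto
  qed
qed (use a T w in auto)

lemma lift_unique:
  assumes x: "x \<in> lifts" "y \<in> lifts" "fst x = fst y" and w: "w \<in> tile - corners" "snd x w = snd y w"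
  shows "x = y"
  using lifts_agree_on[OF x(1,2) _ _ _ w(1) w(2)] x(3) convex_tile_minus_corners
  by (intro lift_eqI[OF x]) (auto simp: convex_connected)

lemma lift_exists_open:
  assumes "s \<in> S" "w \<in> tile - corners" "f s = \<iota> e w"
  obtains g where "continuous_on (tile - corners) g" "g ` (tile - corners) \<subseteq> S" "g w = s"
    "\<And>z. z \<in> tile - corners \<Longrightarrow> f (g z) = \<iota> e z"
proof -
  have "s \<in> S0" using assms iota_punctures by auto
  obtain g where "continuous_on (tile - corners) g" "g \<in> (tile - corners) \<rightarrow> S0" "g w = s"
    "\<And>z. z \<in> tile - corners \<Longrightarrow> f (g z) = \<iota> e z"
  proof (rule covering_space_lift_strong[OF covering_punctured \<open>s \<in> S0\<close> assms(2)])
    show "simply_connected (tile - corners)" "locally path_connected (tile - corners)"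
      using convex_tile_minus_corners convex_imp_simply_connected convex_imp_locally_path_connected by blast+
    show "continuous_on (tile - corners) (\<iota> e)"
      using iota_cont continuous_on_subset by blast
    show "\<iota> e \<in> tile - corners \<rightarrow> F - punctures" using iota_off by blast
    show "\<iota> e w = f s" using assms by simp
  qed blast
  then show thesis using that by blast
qed

text \<open>Near a corner the covering is a disjoint union of copies of \<open>z \<mapsto> z\<^sup>3\<close>.\<close>

definition corner_data :: "real \<times> real \<Rightarrow> 'd set \<Rightarrow> ('d \<Rightarrow> complex) \<Rightarrow> (complex \<Rightarrow> 'd) \<Rightarrow> 'c set set \<Rightarrow> real \<Rightarrow> bool" where
  "corner_data v U \<psi> \<psi>' \<V> \<epsilon> \<longleftrightarrow>
    openin (top_of_set F) U \<and> \<iota> True v \<in> U \<and> homeomorphism U (ball 0 1) \<psi> \<psi>' \<and> \<psi> (\<iota> True v) = 0 \<and>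
    (\<forall>V\<in>\<V>. \<exists>s \<phi> \<phi>'. s \<in> V \<and> V \<subseteq> S \<and> f s = \<iota> True v \<and> openin (top_of_set S) V \<and>
       homeomorphism V (ball (0::complex) 1) \<phi> \<phi>' \<and> \<phi> s = 0 \<and> (\<forall>x\<in>V. f x \<in> U \<and> \<psi> (f x) = \<phi> x ^ 3)) \<and>
    (\<forall>s\<in>S. f s \<in> U \<longrightarrow> (\<exists>V\<in>\<V>. s \<in> V)) \<and>
    (\<forall>B. \<forall>V\<in>\<V>. connected B \<longrightarrow> B \<subseteq> S \<longrightarrow> f ` B \<subseteq> U \<longrightarrow> B \<inter> V \<noteq> {} \<longrightarrow> B \<subseteq> V) \<and>
    0 < \<epsilon> \<and> \<epsilon> < 1 \<and> (\<forall>e. \<forall>z\<in>tile. dist v z < \<epsilon> \<longrightarrow> \<iota> e z \<in> U)"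

lemma corner_dataD:
  assumes "corner_data v U \<psi> \<psi>' \<V> \<epsilon>"
  shows "openin (top_of_set F) U" "\<iota> True v \<in> U" "homeomorphism U (ball 0 1) \<psi> \<psi>'" "\<psi> (\<iota> True v) = 0"
    "\<And>V. V \<in> \<V> \<Longrightarrow> \<exists>s \<phi> \<phi>'. s \<in> V \<and> V \<subseteq> S \<and> f s = \<iota> True v \<and> openin (top_of_set S) V \<and>
       homeomorphism V (ball (0::complex) 1) \<phi> \<phi>' \<and> \<phi> s = 0 \<and> (\<forall>x\<in>V. f x \<in> U \<and> \<psi> (f x) = \<phi> x ^ 3)"
    "\<And>s. s \<in> S \<Longrightarrow> f s \<in> U \<Longrightarrow> \<exists>V\<in>\<V>. s \<in> V"
    "\<And>B V. connected B \<Longrightarrow> B \<subseteq> S \<Longrightarrow> f ` B \<subseteq> U \<Longrightarrow> V \<in> \<V> \<Longrightarrow> B \<inter> V \<noteq> {} \<Longrightarrow> B \<subseteq> V"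
    "0 < \<epsilon>" "\<epsilon> < 1" "\<And>e z. z \<in> tile \<Longrightarrow> dist v z < \<epsilon> \<Longrightarrow> \<iota> e z \<in> U"
  using assms unfolding corner_data_def by simp_all

lemma corner_data_exists:
  assumes v: "v \<in> corners"
  obtains U \<psi> \<psi>' \<V> \<epsilon> where "corner_data v U \<psi> \<psi>' \<V> \<epsilon>"
proof -
  let ?y = "\<iota> True v"
  have vt: "v \<in> tile" using v corners_subset_tile by auto
  have yF: "?y \<in> F" using iota_F vt by auto
  have dy: "d ?y = 3" using order[OF vt] v by simp
  obtain U \<psi> \<psi>' \<V> where U: "openin (top_of_set F) U" "?y \<in> U"
    and \<psi>: "homeomorphism U (ball (0::complex) 1) \<psi> \<psi>'" "\<psi> ?y = 0"
    and V: "\<Union>\<V> = S \<inter> f -` U" "pairwise disjnt \<V>"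
    "\<And>V. V \<in> \<V> \<Longrightarrow> openin (top_of_set S) V"
    and ch: "\<And>V. V \<in> \<V> \<Longrightarrow> \<exists>x \<phi> \<phi>'. x \<in> V \<and> \<phi> x = 0 \<and> homeomorphism V (ball (0::complex) 1) \<phi> \<phi>' \<and>
       (\<forall>v\<in>V. \<psi> (f v) = \<phi> v ^ d ?y)"
    using covering_data[OF yF] by metis
  obtain O' where O': "open O'" "U = F \<inter> O'" using U(1) by (auto simp: openin_open)
  have "\<exists>\<epsilon>>0. \<forall>z\<in>tile. dist v z < \<epsilon> \<longrightarrow> \<iota> e z \<in> U" for e
  proof -
    have yv: "\<iota> e v = ?y" using iota_eq[OF vt vt] corner_iff_sides[OF vt] v by auto
    have "openin (top_of_set tile) (tile \<inter> \<iota> e -` O')"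
      by (rule continuous_openin_preimage_gen[OF iota_cont O'(1)])
    moreover have "v \<in> tile \<inter> \<iota> e -` O'" using yv U(2) O'(2) vt by auto
    ultimately obtain \<epsilon> where "\<epsilon> > 0" "\<forall>z\<in>tile. dist z v < \<epsilon> \<longrightarrow> z \<in> tile \<inter> \<iota> e -` O'"
      unfolding openin_euclidean_subtopology_iff by blast
    then show ?thesis using iota_F O'(2) by (metis IntD2 IntI dist_commute vimageD)
  qed
  then obtain \<epsilon>' where \<epsilon>': "\<And>e. \<epsilon>' e > 0" "\<And>e z. z \<in> tile \<Longrightarrow> dist v z < \<epsilon>' e \<Longrightarrow> \<iota> e z \<in> U" by metis
  \<comment> \<open>The radius works for both faces, and the bound 1 / 2 keeps it below 1 as
    required by \<open>near_corner\<close>.\<close>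
  define \<epsilon> where "\<epsilon> = min (min (\<epsilon>' True) (\<epsilon>' False)) (1/2)"
  have "\<epsilon> \<le> \<epsilon>' e" for e by (cases e) (auto simp: \<epsilon>_def)
  then have \<epsilon>3: "\<iota> e z \<in> U" if "z \<in> tile" "dist v z < \<epsilon>" for e z
    using \<epsilon>'(2)[of z e] that less_le_trans by blast
  have \<epsilon>: "\<epsilon> > 0" "\<epsilon> < 1" using \<epsilon>'(1) by (auto simp: \<epsilon>_def)
  have "\<exists>s \<phi> \<phi>'. s \<in> V \<and> V \<subseteq> S \<and> f s = \<iota> True v \<and> openin (top_of_set S) V \<and>
       homeomorphism V (ball (0::complex) 1) \<phi> \<phi>' \<and> \<phi> s = 0 \<and> (\<forall>x\<in>V. f x \<in> U \<and> \<psi> (f x) = \<phi> x ^ 3)"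
    if VV: "V \<in> \<V>" for V
  proof -
    obtain s \<phi> \<phi>' where s: "s \<in> V" "\<phi> s = 0" "homeomorphism V (ball (0::complex) 1) \<phi> \<phi>'"
      "\<And>x. x \<in> V \<Longrightarrow> \<psi> (f x) = \<phi> x ^ 3" using ch[OF VV] dy by auto
    have fU: "f x \<in> U" "x \<in> S" if "x \<in> V" for x using that VV V(1) by blast+
    have "\<psi> (f s) = \<psi> ?y" using s(4)[OF s(1)] s(2) \<psi>(2) by simp
    then have "f s = ?y" using homeomorphism_apply1[OF \<psi>(1)] fU(1)[OF s(1)] U(2) by metis
    then show ?thesis using s fU V(3)[OF VV] by blast
  qed
  moreover have "B \<subseteq> V" if "V \<in> \<V>" "connected B" "B \<subseteq> S" "f ` B \<subseteq> U" "B \<inter> V \<noteq> {}" for B V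
    using connected_subset_disjoint_open_family[OF that(2) _ V(3) V(2) that(1,5)] that V(1) by blast
  moreover have "\<exists>V\<in>\<V>. s \<in> V" if "s \<in> S" "f s \<in> U" for s using V(1) that by blast
  ultimately have "corner_data v U \<psi> \<psi>' \<V> \<epsilon>"
    unfolding corner_data_def using U \<psi> \<epsilon> \<epsilon>3 by simp
  then show thesis by (rule that)
qed

lemma convex_corner_nbhd: "convex ((tile - corners) \<inter> ball v \<epsilon>)"
  by (intro convex_Int convex_tile_minus_corners convex_ball)

lemma corner_nbhd_ne: assumes "v \<in> corners" "\<epsilon> > 0" shows "(tile - corners) \<inter> ball v \<epsilon> \<noteq> {}"
proof -
  have "v \<in> closure (tile - corners)" using assms closure_tile_minus_corners corners_subset_tile by auto
  then obtain z where "z \<in> tile - corners" "dist z v < \<epsilon>"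
    using assms(2) unfolding closure_approachable by blast
  then have "z \<in> (tile - corners) \<inter> ball v \<epsilon>" by (simp add: dist_commute)
  then show ?thesis by blast
qed

text \<open>The lift exists off the corners by covering theory. It extends to a corner because its
  image near the corner stays in one sheet, where the third power of the chart tends to zero; hence
  the lift tends to the centre of the sheet.\<close>

lemma lift_exists:
  assumes "s \<in> S" "w \<in> tile - corners" "f s = \<iota> e w"
  shows "\<exists>x\<in>lifts. fst x = e \<and> snd x w = s"
proof -
  obtain g where g: "continuous_on (tile - corners) g" "g ` (tile - corners) \<subseteq> S" "g w = s"
    "\<And>z. z \<in> tile - corners \<Longrightarrow> f (g z) = \<iota> e z" using lift_exists_open[OF assms] by blast
  have "\<exists>p. p \<in> S \<and> f p = \<iota> e v \<and> (g \<longlongrightarrow> p) (at v within (tile - corners))" if v: "v \<in> corners" for v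
  proof -
    have vt: "v \<in> tile" using v corners_subset_tile by auto
    have yv: "\<iota> e v = \<iota> True v" using iota_eq[OF vt vt] corner_iff_sides[OF vt] v by auto
    obtain U \<psi> \<psi>' \<V> \<epsilon> where cd: "corner_data v U \<psi> \<psi>' \<V> \<epsilon>" using corner_data_exists[OF v] .
    note U = corner_dataD(1,2)[OF cd] and \<psi> = corner_dataD(3,4)[OF cd] and ch = corner_dataD(5)[OF cd]
      and inV = corner_dataD(6)[OF cd] and cl = corner_dataD(7)[OF cd] and \<epsilon> = corner_dataD(8-10)[OF cd]
    let ?N = "(tile - corners) \<inter> ball v \<epsilon>"
    obtain z0 where z0: "z0 \<in> ?N" using corner_nbhd_ne[OF v \<epsilon>(1)] by blast
    have gN: "g ` ?N \<subseteq> S" using g(2) by blast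
    have "f (g z) \<in> U" if "z \<in> ?N" for z using that g(4)[of z] \<epsilon>(3)[of z e] by auto
    then have fgN: "f ` g ` ?N \<subseteq> U" by blast
    obtain V where V: "V \<in> \<V>" "g z0 \<in> V" using inV[of "g z0"] gN fgN z0 by blast
    have "continuous_on ?N g" using g(1) by (rule continuous_on_subset) auto
    then have "connected (g ` ?N)"
      by (rule connected_continuous_image[OF _ convex_connected[OF convex_corner_nbhd]])
    then have gV: "g ` ?N \<subseteq> V" using cl[OF _ gN fgN V(1)] V(2) z0 by blast
    obtain p \<phi> \<phi>' where p: "p \<in> V" "V \<subseteq> S" "f p = \<iota> True v" "homeomorphism V (ball (0::complex) 1) \<phi> \<phi>'"
      "\<phi> p = 0" "\<And>x. x \<in> V \<Longrightarrow> f x \<in> U \<and> \<psi> (f x) = \<phi> x ^ 3" using ch[OF V(1)] by blast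
    let ?F = "at v within (tile - corners)"
    have evN: "eventually (\<lambda>z. z \<in> ?N) ?F"
      unfolding eventually_at by (intro exI[of _ \<epsilon>]) (simp add: \<epsilon>(1) dist_commute)
    have "((\<lambda>z. \<psi> (\<iota> e z)) \<longlongrightarrow> \<psi> (\<iota> e v)) ?F"
    proof (rule continuous_on_tendsto_compose[of U \<psi>])
      show "continuous_on U \<psi>" by (rule homeomorphism_cont1[OF \<psi>(1)])
      show "(\<iota> e \<longlongrightarrow> \<iota> e v) ?F"
        using iota_cont[of e] vt by (meson Diff_subset continuous_on_def tendsto_within_subset)
      show "\<iota> e v \<in> U" using U(2) yv by simp
      show "\<forall>\<^sub>F x in ?F. \<iota> e x \<in> U" using evN by eventually_elim (use \<epsilon>(3) in auto)
    qed
    then have "((\<lambda>z. norm (\<psi> (\<iota> e z))) \<longlongrightarrow> 0) ?F" using \<psi>(2) yv tendsto_norm_zero by metis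
    \<comment> \<open>The norm of the chart upstairs is the cube root of the norm downstairs, so no
      branch of the complex root has to be chosen.\<close>
    then have "((\<lambda>z. root 3 (norm (\<psi> (\<iota> e z)))) \<longlongrightarrow> root 3 0) ?F" by (intro tendsto_intros)
    then have t1: "((\<lambda>z. root 3 (norm (\<psi> (\<iota> e z)))) \<longlongrightarrow> 0) ?F" by simp
    have "eventually (\<lambda>z. root 3 (norm (\<psi> (\<iota> e z))) = norm (\<phi> (g z))) ?F"
      using evN
    proof eventually_elim
      case (elim z)
      then have "g z \<in> V" "f (g z) = \<iota> e z" using gV g(4)[of z] by blast+
      then have "\<psi> (\<iota> e z) = \<phi> (g z) ^ 3" using p(6)[of "g z"] by simp
      then have "norm (\<psi> (\<iota> e z)) = norm (\<phi> (g z)) ^ 3" by (simp add: norm_power)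
      then show ?case by (simp add: real_root_power_cancel)
    qed
    from Lim_transform_eventually[OF t1 this]
    have "((\<lambda>z. norm (\<phi> (g z))) \<longlongrightarrow> 0) ?F" .
    then have \<phi>0: "((\<lambda>z. \<phi> (g z)) \<longlongrightarrow> 0) ?F" by (rule tendsto_norm_zero_cancel)
    have t2: "((\<lambda>z. \<phi>' (\<phi> (g z))) \<longlongrightarrow> \<phi>' 0) ?F"
    proof (rule continuous_on_tendsto_compose[OF _ \<phi>0])
      show "continuous_on (ball 0 1) \<phi>'" by (rule homeomorphism_cont2[OF p(4)])
      show "\<forall>\<^sub>F x in ?F. \<phi> (g x) \<in> ball 0 1"
        using evN by eventually_elim (use gV homeomorphism_image1[OF p(4)] in blast)
    qed auto
    have ev2: "eventually (\<lambda>z. \<phi>' (\<phi> (g z)) = g z) ?F"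
      using evN by eventually_elim (use gV homeomorphism_apply1[OF p(4)] in blast)
    have "\<phi>' 0 = p" using homeomorphism_apply1[OF p(4) p(1)] p(5) by simp
    then have "(g \<longlongrightarrow> p) ?F" using Lim_transform_eventually[OF t2 ev2] by simp
    moreover have "p \<in> S" "f p = \<iota> e v" using p(1,2,3) yv by auto
    ultimately show ?thesis by blast
  qed
  then obtain L where L: "\<And>v. v \<in> corners \<Longrightarrow> L v \<in> S" "\<And>v. v \<in> corners \<Longrightarrow> f (L v) = \<iota> e v"
    "\<And>v. v \<in> corners \<Longrightarrow> (g \<longlongrightarrow> L v) (at v within (tile - corners))" by metis
  define l where "l = restrict (\<lambda>z. if z \<in> corners then L z else g z) tile"
  have "continuous_on tile l"
    unfolding continuous_on_def
  proof
    \<comment> \<open>The finitely many other corners do not affect a limit at \<open>z\<close>, so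
      it may be taken within the tile without its corners.\<close>
    fix z assume z: "z \<in> tile"
    have eq: "at z within tile = at z within (tile - corners)"
    proof (rule at_within_nhd)
      show "open (- (corners - {z}))" using finite_corners by (intro open_Compl finite_imp_closed) auto
    qed auto
    have t: "(g \<longlongrightarrow> l z) (at z within (tile - corners))"
    proof (cases "z \<in> corners")
      case True
      then show ?thesis using L(3) z by (simp add: l_def)
    next
      case False
      then show ?thesis using g(1) z by (auto simp: l_def continuous_on_def)
    qed
    have "\<forall>\<^sub>F x in at z within (tile - corners). g x = l x"
      unfolding eventually_at by (intro exI[of _ 1]) (simp add: l_def)
    from Lim_transform_eventually[OF t this] show "(l \<longlongrightarrow> l z) (at z within tile)"
      unfolding eq .
  qed
  then have "(e, l) \<in> lifts"
    using L(1,2) g(2,4) unfolding lifts_def by (auto simp: l_def image_subset_iff)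
  moreover have "l w = s" using assms(2) g(3) by (simp add: l_def)
  ultimately show ?thesis by (metis fst_conv snd_conv)
qed

end

context square_orbifold
begin

section \<open>Lifts around a corner\<close>

definition corner_point :: "real \<times> real \<Rightarrow> 'c \<Rightarrow> 'd set \<Rightarrow> ('d \<Rightarrow> complex) \<Rightarrow> (complex \<Rightarrow> 'd) \<Rightarrow>
    'c set \<Rightarrow> ('c \<Rightarrow> complex) \<Rightarrow> (complex \<Rightarrow> 'c) \<Rightarrow> real \<Rightarrow> bool" where
  "corner_point v s U \<psi> \<psi>' V \<phi> \<phi>' \<epsilon> \<longleftrightarrow>
    homeomorphism U (ball 0 1) \<psi> \<psi>' \<and> \<psi> (\<iota> True v) = 0 \<and> \<iota> True v \<in> U \<and>
    s \<in> V \<and> V \<subseteq> S \<and> homeomorphism V (ball 0 1) \<phi> \<phi>' \<and> \<phi> s = 0 \<and>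
    (\<forall>x\<in>V. f x \<in> U) \<and> (\<forall>x\<in>V. \<psi> (f x) = \<phi> x ^ 3) \<and> (\<forall>x\<in>V. f x = \<iota> True v \<longrightarrow> x = s) \<and>
    (\<forall>B. connected B \<longrightarrow> B \<subseteq> S \<longrightarrow> f ` B \<subseteq> U \<longrightarrow> B \<inter> V \<noteq> {} \<longrightarrow> B \<subseteq> V) \<and>
    0 < \<epsilon> \<and> \<epsilon> < 1 \<and> (\<forall>e. \<forall>z\<in>tile. dist v z < \<epsilon> \<longrightarrow> \<iota> e z \<in> U)"

lemma corner_pointD:
  assumes "corner_point v s U \<psi> \<psi>' V \<phi> \<phi>' \<epsilon>"
  shows "homeomorphism U (ball 0 1) \<psi> \<psi>'" "\<psi> (\<iota> True v) = 0" "\<iota> True v \<in> U"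
    "s \<in> V" "V \<subseteq> S" "homeomorphism V (ball 0 1) \<phi> \<phi>'" "\<phi> s = 0"
    "\<And>x. x \<in> V \<Longrightarrow> f x \<in> U" "\<And>x. x \<in> V \<Longrightarrow> \<psi> (f x) = \<phi> x ^ 3"
    "\<And>x. x \<in> V \<Longrightarrow> f x = \<iota> True v \<Longrightarrow> x = s"
    "\<And>B. connected B \<Longrightarrow> B \<subseteq> S \<Longrightarrow> f ` B \<subseteq> U \<Longrightarrow> B \<inter> V \<noteq> {} \<Longrightarrow> B \<subseteq> V"
    "0 < \<epsilon>" "\<epsilon> < 1" "\<And>e z. z \<in> tile \<Longrightarrow> dist v z < \<epsilon> \<Longrightarrow> \<iota> e z \<in> U"
  using assms unfolding corner_point_def by simp_all

lemma corner_point_exists: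
  assumes v: "v \<in> corners" and s: "s \<in> S" "f s = \<iota> True v"
  obtains U \<psi> \<psi>' V \<phi> \<phi>' \<epsilon> where "corner_point v s U \<psi> \<psi>' V \<phi> \<phi>' \<epsilon>"
proof -
  obtain U \<psi> \<psi>' \<V> \<epsilon> where cd: "corner_data v U \<psi> \<psi>' \<V> \<epsilon>" using corner_data_exists[OF v] .
  note D = corner_dataD[OF cd]
  obtain V where V: "V \<in> \<V>" "s \<in> V" using D(6)[OF s(1)] s(2) D(2) by auto
  obtain p \<phi> \<phi>' where p: "p \<in> V" "V \<subseteq> S" "f p = \<iota> True v" "homeomorphism V (ball (0::complex) 1) \<phi> \<phi>'"
      "\<phi> p = 0" and fV: "\<forall>x\<in>V. f x \<in> U \<and> \<psi> (f x) = \<phi> x ^ 3" using D(5)[OF V(1)] by auto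
  have uniq: "x = p" if "x \<in> V" "f x = \<iota> True v" for x
  proof -
    have "\<phi> x ^ 3 = 0" using fV that D(4) by metis
    then have "\<phi> x = \<phi> p" using p(5) by simp
    then show ?thesis using homeomorphism_apply1[OF p(4)] that(1) p(1) by metis
  qed
  have "s = p" using uniq V(2) s(2) by simp
  then have "corner_point v s U \<psi> \<psi>' V \<phi> \<phi>' \<epsilon>"
    unfolding corner_point_def
  proof (intro conjI allI ballI impI)
    show "homeomorphism U (ball 0 1) \<psi> \<psi>'" "\<psi> (\<iota> True v) = 0" "\<iota> True v \<in> U" by (fact D)+
    show "s \<in> V" "V \<subseteq> S" "homeomorphism V (ball 0 1) \<phi> \<phi>'" by fact+
    show "\<phi> s = 0" unfolding \<open>s = p\<close> by fact
    show "f x \<in> U" "\<psi> (f x) = \<phi> x ^ 3" if "x \<in> V" for x using fV that by blast+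
    show "x = s" if "x \<in> V" "f x = \<iota> True v" for x using uniq[OF that] \<open>s = p\<close> by simp
    show "B \<subseteq> V" if "connected B" "B \<subseteq> S" "f ` B \<subseteq> U" "B \<inter> V \<noteq> {}" for B
      by (rule D(7)[OF that(1-3) V(1) that(4)])
    show "0 < \<epsilon>" "\<epsilon> < 1" by (fact D)+
    show "\<iota> e z \<in> U" if "z \<in> tile" "dist v z < \<epsilon>" for e z by (rule D(10)[OF that])
  qed
  then show thesis by (rule that)
qed

lemma lift_image_near:
  assumes cp: "corner_point v s U \<psi> \<psi>' V \<phi> \<phi>' \<epsilon>" and v: "v \<in> corners" and x: "x \<in> lifts"
    and w: "w \<in> tile" "dist v w < \<epsilon>" "snd x w \<in> V"
  shows "snd x ` (tile \<inter> ball v \<epsilon>) \<subseteq> V"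
proof -
  note D = corner_pointD[OF cp]
  have "connected (snd x ` (tile \<inter> ball v \<epsilon>))"
  proof (rule connected_continuous_image)
    show "continuous_on (tile \<inter> ball v \<epsilon>) (snd x)"
      by (rule continuous_on_subset[OF liftsD(2)[OF x]]) auto
    show "connected (tile \<inter> ball v \<epsilon>)"
      by (rule convex_connected[OF convex_Int[OF convex_tile convex_ball]])
  qed
  then show ?thesis
  proof (rule D(11))
    show "snd x ` (tile \<inter> ball v \<epsilon>) \<subseteq> S" using liftsD(3)[OF x] by auto
    show "f ` snd x ` (tile \<inter> ball v \<epsilon>) \<subseteq> U" using liftsD(4)[OF x] D(14) by auto
    have "snd x w \<in> snd x ` (tile \<inter> ball v \<epsilon>)" using w by (intro imageI) auto
    then show "snd x ` (tile \<inter> ball v \<epsilon>) \<inter> V \<noteq> {}" using w(3) by blast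
  qed
qed

lemma iota_corner: "v \<in> corners \<Longrightarrow> \<iota> e v = \<iota> True v"
  using iota_eq[of v v e True] corner_iff_sides[of v] corners_subset_tile by auto

text \<open>The image of the tile near \<open>v\<close> is connected and lies over the chart, so it
  is in the sheet \<open>V\<close> as soon as one of its points is, and \<open>s\<close> is the only
  point of \<open>V\<close> over the corner.\<close>

lemma lift_near_corner:
  assumes cp: "corner_point v s U \<psi> \<psi>' V \<phi> \<phi>' \<epsilon>" and v: "v \<in> corners" and x: "x \<in> lifts"
    and w: "w \<in> tile" "dist v w < \<epsilon>"
  shows "snd x w \<in> V \<longleftrightarrow> snd x v = s"
proof -
  note D = corner_pointD[OF cp]
  have vt: "v \<in> tile" using v corners_subset_tile by auto
  show ?thesis
  proof
    assume "snd x w \<in> V"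
    then have "snd x ` (tile \<inter> ball v \<epsilon>) \<subseteq> V" by (rule lift_image_near[OF cp v x w])
    then have "snd x v \<in> V" using vt D(12) by auto
    moreover have "f (snd x v) = \<iota> True v" using liftsD(4)[OF x vt] iota_corner[OF v] by simp
    ultimately show "snd x v = s" by (rule D(10))
  next
    assume "snd x v = s"
    then have "snd x ` (tile \<inter> ball v \<epsilon>) \<subseteq> V"
      by (intro lift_image_near[OF cp v x vt]) (use D(4,12) in auto)
    then show "snd x w \<in> V" using w by auto
  qed
qed

text \<open>A lift through \<open>s\<close> is determined by its value at a nearby point
  \<open>w\<close>, and the candidates in the sheet are the three cube roots of the chart value of
  that point.\<close>

lemma card_corner_lifts:
  assumes v: "v \<in> corners" and s: "s \<in> S" "f s = \<iota> True v"
  shows "card {x \<in> lifts. fst x = e \<and> snd x v = s} = 3"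
proof -
  obtain U \<psi> \<psi>' V \<phi> \<phi>' \<epsilon> where cp: "corner_point v s U \<psi> \<psi>' V \<phi> \<phi>' \<epsilon>"
    using corner_point_exists[OF v s] .
  note D = corner_pointD[OF cp]
  have vt: "v \<in> tile" using v corners_subset_tile by auto
  obtain w where "w \<in> (tile - corners) \<inter> ball v \<epsilon>" using corner_nbhd_ne[OF v D(12)] by blast
  then have w: "w \<in> tile - corners" "w \<in> tile" "dist v w < \<epsilon>" by auto
  define c where "c = \<psi> (\<iota> e w)"
  have wU: "\<iota> e w \<in> U" using D(14) w by blast
  have "\<iota> e w \<noteq> \<iota> True v" using iota_eq[OF w(2) vt] w(1) v by auto
  then have c0: "c \<noteq> 0" using homeomorphism_apply1[OF D(1) wU] homeomorphism_apply1[OF D(1) D(3)] D(2)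
    unfolding c_def by auto
  have c1: "norm c < 1" using homeomorphism_image1[OF D(1)] wU unfolding c_def by auto
  let ?L = "{x \<in> lifts. fst x = e \<and> snd x v = s}"
  have xV: "snd x w \<in> V" "f (snd x w) = \<iota> e w" if "x \<in> ?L" for x
  proof -
    have x: "x \<in> lifts" "fst x = e" "snd x v = s" using that by simp_all
    show "snd x w \<in> V" using lift_near_corner[OF cp v x(1) w(2,3)] x(3) by simp
    show "f (snd x w) = \<iota> e w" using liftsD(4)[OF x(1) w(2)] x(2) by simp
  qed
  have "bij_betw (\<lambda>x. \<phi> (snd x w)) ?L {z. z ^ 3 = c}"
    unfolding bij_betw_def
  proof
    show "inj_on (\<lambda>x. \<phi> (snd x w)) ?L"
    proof (rule inj_onI)
      fix x y assume xy: "x \<in> ?L" "y \<in> ?L" "\<phi> (snd x w) = \<phi> (snd y w)"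
      have "snd x w = \<phi>' (\<phi> (snd x w))" by (rule homeomorphism_apply1[OF D(6) xV(1)[OF xy(1)], symmetric])
      also have "\<dots> = \<phi>' (\<phi> (snd y w))" by (simp only: xy(3))
      also have "\<dots> = snd y w" by (rule homeomorphism_apply1[OF D(6) xV(1)[OF xy(2)]])
      finally have "snd x w = snd y w" .
      moreover have "x \<in> lifts" "y \<in> lifts" "fst x = fst y" using xy(1,2) by simp_all
      ultimately show "x = y" using lift_unique[OF _ _ _ w(1)] by simp
    qed
    show "(\<lambda>x. \<phi> (snd x w)) ` ?L = {z. z ^ 3 = c}"
    proof (intro Set.equalityI subsetI)
      fix z assume "z \<in> (\<lambda>x. \<phi> (snd x w)) ` ?L"
      then obtain x where x: "x \<in> ?L" "z = \<phi> (snd x w)" by blast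
      then have "z ^ 3 = \<psi> (f (snd x w))" using D(9)[OF xV(1)[OF x(1)]] by simp
      then show "z \<in> {z. z ^ 3 = c}" using xV(2)[OF x(1)] by (simp add: c_def)
    next
      fix z assume "z \<in> {z. z ^ 3 = c}"
      then have z: "z ^ 3 = c" by simp
      have "norm z < 1"
      proof (rule ccontr)
        assume "\<not> norm z < 1"
        then have "norm z ^ 3 \<ge> 1" by (intro one_le_power) simp
        then show False using c1 z norm_power[of z 3] by simp
      qed
      then have zb: "z \<in> ball 0 1" by simp
      have sV: "\<phi>' z \<in> V" using homeomorphism_image2[OF D(6)] zb by blast
      have ps: "\<phi> (\<phi>' z) = z" by (rule homeomorphism_apply2[OF D(6) zb])
      have "\<psi> (f (\<phi>' z)) = \<psi> (\<iota> e w)" using D(9)[OF sV] ps z by (simp add: c_def)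
      then have fs: "f (\<phi>' z) = \<iota> e w"
        using homeomorphism_apply1[OF D(1) wU] homeomorphism_apply1[OF D(1) D(8)[OF sV]] by simp
      have "\<phi>' z \<in> S" using sV D(5) by blast
      from lift_exists[OF this w(1) fs] obtain x where x: "x \<in> lifts" "fst x = e" "snd x w = \<phi>' z" by blast
      then have "snd x v = s" using lift_near_corner[OF cp v x(1) w(2,3)] sV by simp
      then have "x \<in> ?L" using x by simp
      then show "z \<in> (\<lambda>x. \<phi> (snd x w)) ` ?L" using ps x(3) by (intro image_eqI[of _ _ x]) simp_all
    qed
  qed
  then have "card ?L = card {z. z ^ 3 = c}" by (rule bij_betw_same_card)
  then show ?thesis using card_nth_roots[OF c0, of 3] by simp
qed

lemma lift_through:
  assumes s: "s \<in> S"
  obtains x w where "x \<in> lifts" "w \<in> tile" "snd x w = s"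
proof -
  have "f s \<in> F" using s f_img by blast
  then obtain e w where w: "w \<in> tile" "f s = \<iota> e w" using F_iota by blast
  show thesis
  proof (cases "w \<in> corners")
    case True
    then have "card {x \<in> lifts. fst x = e \<and> snd x w = s} = 3"
      using card_corner_lifts[OF True s] w(2) iota_corner[OF True] by simp
    then have "{x \<in> lifts. fst x = e \<and> snd x w = s} \<noteq> {}" by (metis card.empty zero_neq_numeral)
    then show thesis using that w(1) by blast
  next
    case False
    then show thesis using lift_exists[OF s _ w(2)] w(1) that by blast
  qed
qed

text \<open>A lift is determined by its face and its value at the centre of the tile, which lies in
  a finite fibre.\<close>

lemma finite_lifts: "finite lifts"
proof -
  have 0: "(0, 0) \<in> tile - corners" by (simp add: tile_abs corners_def)
  have "inj_on (\<lambda>x. (fst x, snd x (0, 0))) lifts"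
    using lift_unique[OF _ _ _ 0] by (intro inj_onI) simp
  moreover have "(\<lambda>x. (fst x, snd x (0, 0))) ` lifts \<subseteq> UNIV \<times> ({s \<in> S. f s = \<iota> True (0, 0)} \<union> {s \<in> S. f s = \<iota> False (0, 0)})"
  proof
    fix p assume "p \<in> (\<lambda>x. (fst x, snd x (0, 0))) ` lifts"
    then obtain x where x: "x \<in> lifts" "p = (fst x, snd x (0, 0))" by blast
    have "snd x (0, 0) \<in> S" "f (snd x (0, 0)) = \<iota> (fst x) (0, 0)" using liftsD[OF x(1)] 0 by blast+
    then show "p \<in> UNIV \<times> ({s \<in> S. f s = \<iota> True (0, 0)} \<union> {s \<in> S. f s = \<iota> False (0, 0)})"
      using x(2) by (cases "fst x") auto
  qed
  moreover have "finite (UNIV \<times> ({s \<in> S. f s = \<iota> True (0, 0)} \<union> {s \<in> S. f s = \<iota> False (0, 0)}) :: (bool \<times> 'c) set)"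
    by (intro finite_SigmaI finite_UnI fib iota_F) (use 0 in simp_all)
  ultimately show ?thesis by (meson finite_subset finite_imageD)
qed

subsection \<open>Crossing an edge\<close>

text \<open>The choice is in fact unique: two lifts of one face that agree at an inner point of the
  edge are equal. Crossing an edge always exchanges the two faces.\<close>

definition nb :: "mirror \<Rightarrow> bool \<times> (real \<times> real \<Rightarrow> 'c) \<Rightarrow> bool \<times> (real \<times> real \<Rightarrow> 'c)" where
  "nb i x = (SOME y. y \<in> lifts \<and> fst y = (\<not> fst x) \<and> (\<forall>w\<in>tile. i \<in> sides w \<longrightarrow> snd y w = snd x w))"

lemma nb_exists:
  assumes x: "x \<in> lifts"
  shows "\<exists>y. y \<in> lifts \<and> fst y = (\<not> fst x) \<and> (\<forall>w\<in>tile. i \<in> sides w \<longrightarrow> snd y w = snd x w)"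
proof -
  let ?m = "midpoint_of i" and ?E = "{w \<in> tile. i \<in> sides w}"
  have m: "?m \<in> tile - corners" "?m \<in> tile" "sides ?m = {i}" using midpoint_of[of i] by auto
  have fm: "f (snd x ?m) = \<iota> (\<not> fst x) ?m" using liftsD(4)[OF x m(2)] iota_eq[OF m(2) m(2)] m(3) by simp
  from lift_exists[OF liftsD(3)[OF x m(2)] m(1) fm]
  obtain y where y: "y \<in> lifts" "fst y = (\<not> fst x)" "snd y ?m = snd x ?m" by blast
  have on: "snd y w = snd x w" if w: "w \<in> ?E - corners" for w
  proof (rule lifts_agree_on[OF y(1) x, of "?E - corners" ?m])
    have eq: "?E - corners = ?E \<inter> (tile - corners)" by blast
    show "connected (?E - corners)"
      unfolding eq by (rule convex_connected[OF convex_Int[OF convex_edge convex_tile_minus_corners]])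
    show "fst y = fst x \<or> (\<forall>w\<in>?E - corners. sides w \<noteq> {})" by blast
  qed (use m y(3) w in auto)
  have "snd y w = snd x w" if w: "w \<in> tile" "i \<in> sides w" for w
  proof -
    have clE: "closure (?E - corners) \<subseteq> tile"
      by (rule closure_minimal) (auto simp: compact_imp_closed compact_tile)
    have "(\<lambda>w. snd y w - snd x w) w = 0"
    proof (rule continuous_constant_on_closure[of "?E - corners"])
      show "continuous_on (closure (?E - corners)) (\<lambda>w. snd y w - snd x w)"
        by (intro continuous_on_diff continuous_on_subset[OF liftsD(2)[OF y(1)] clE]
            continuous_on_subset[OF liftsD(2)[OF x] clE])
      show "w \<in> closure (?E - corners)" by (rule corner_in_closure_edge[OF w])
    qed (use on in auto)
    then show ?thesis by simp
  qed
  then show ?thesis using y by blast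
qed

lemma nb:
  assumes "x \<in> lifts"
  shows "nb i x \<in> lifts" "fst (nb i x) = (\<not> fst x)"
    "\<And>w. w \<in> tile \<Longrightarrow> i \<in> sides w \<Longrightarrow> snd (nb i x) w = snd x w"
  using someI_ex[OF nb_exists[OF assms, of i]] unfolding nb_def by blast+

lemma nb_eqI:
  assumes "x \<in> lifts" "y \<in> lifts" "fst y \<noteq> fst x" "w \<in> tile - corners" "i \<in> sides w" "snd y w = snd x w"
  shows "nb i x = y"
proof (rule lift_unique[OF nb(1)[OF assms(1)] assms(2) _ assms(4)])
  show "fst (nb i x) = fst y" using nb(2)[OF assms(1)] assms(3) by simp
  show "snd (nb i x) w = snd y w" using nb(3)[OF assms(1)] assms(4-6) by simp
qed

lemma nb_nb: assumes "x \<in> lifts" shows "nb i (nb i x) = x"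
proof (rule nb_eqI[OF nb(1)[OF assms] assms])
  show "midpoint_of i \<in> tile - corners" "i \<in> sides (midpoint_of i)" using midpoint_of[of i] by auto
  then show "snd x (midpoint_of i) = snd (nb i x) (midpoint_of i)" using nb(3)[OF assms] by simp
qed (simp add: nb(2)[OF assms])

lemma fold_nb_lifts: "x \<in> lifts \<Longrightarrow> fold nb g x \<in> lifts"
  by (induction g arbitrary: x) (simp_all add: nb(1))

lemma fold_nb_value: "x \<in> lifts \<Longrightarrow> w \<in> tile \<Longrightarrow> set g \<subseteq> sides w \<Longrightarrow> snd (fold nb g x) w = snd x w"
  by (induction g arbitrary: x) (simp_all add: nb)

lemma fold_nb_sign: "x \<in> lifts \<Longrightarrow> fst (fold nb g x) = (fst x = even (length g))"
  by (induction g arbitrary: x) (auto simp: nb)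

text \<open>The lifts around a corner form a single orbit, since a punctured disc is connected.\<close>

lemma corner_transitive:
  assumes v: "v \<in> corners" and x: "x \<in> lifts" and y: "y \<in> lifts" and xy: "snd x v = snd y v"
  shows "\<exists>g. set g \<subseteq> sides v \<and> fold nb g x = y"
proof (rule ccontr)
  assume no: "\<not> ?thesis"
  define s where "s = snd x v"
  have vt: "v \<in> tile" using v corners_subset_tile by auto
  have s: "s \<in> S" "f s = \<iota> True v" using liftsD(3,4)[OF x vt] iota_corner[OF v] s_def by auto
  obtain U \<psi> \<psi>' V \<phi> \<phi>' \<epsilon> where cp: "corner_point v s U \<psi> \<psi>' V \<phi> \<phi>' \<epsilon>"
    using corner_point_exists[OF v s] .
  note D = corner_pointD[OF cp]
  define L where "L = {z \<in> lifts. snd z v = s}"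
  \<comment> \<open>The orbit of \<open>x\<close> and the remaining lifts through \<open>s\<close>
    will cut a punctured disc around \<open>s\<close> into two nonempty disjoint closed
    pieces.\<close>
  define Orb where "Orb = {z. \<exists>g. set g \<subseteq> sides v \<and> fold nb g x = z}"
  have OL: "Orb \<subseteq> L"
  proof
    fix z assume "z \<in> Orb"
    then obtain g where "set g \<subseteq> sides v" "fold nb g x = z" unfolding Orb_def by blast
    then show "z \<in> L" using fold_nb_lifts[OF x, of g] fold_nb_value[OF x vt, of g] by (simp add: L_def s_def)
  qed
  have xO: "x \<in> Orb" unfolding Orb_def by (auto intro: exI[of _ "[]"])
  have yL: "y \<in> L - Orb" using no y xy unfolding L_def Orb_def s_def by auto
  have Ostep: "nb i z \<in> Orb" if "z \<in> Orb" "i \<in> sides v" for z i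
  proof -
    obtain g where "set g \<subseteq> sides v" "fold nb g x = z" using \<open>z \<in> Orb\<close> unfolding Orb_def by blast
    then have "set (g @ [i]) \<subseteq> sides v" "fold nb (g @ [i]) x = nb i z" using that(2) by auto
    then show ?thesis unfolding Orb_def by blast
  qed
  define \<epsilon>' where "\<epsilon>' = \<epsilon> / 2"
  have \<epsilon>': "0 < \<epsilon>'" "\<epsilon>' < \<epsilon>" using D(12) by (auto simp: \<epsilon>'_def)
  \<comment> \<open>Everything on the sphere away from the corner. Points of \<open>S\<close> over
    its complement lie on lifts of points close to \<open>v\<close>, which fixes the radius of the
    punctured disc \<open>W\<close>.\<close>
  define K where "K = \<iota> True ` (tile - ball v \<epsilon>') \<union> \<iota> False ` (tile - ball v \<epsilon>')"
  have cK: "compact (\<iota> e ` (tile - ball v \<epsilon>'))" for e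
    by (intro compact_continuous_image compact_diff compact_tile open_ball continuous_on_subset[OF iota_cont]) auto
  then have oK: "open (- K)" unfolding K_def by (intro open_Compl closed_Un compact_imp_closed)
  have yK: "\<iota> True v \<notin> K"
  proof
    assume "\<iota> True v \<in> K"
    then obtain e w where "w \<in> tile - ball v \<epsilon>'" "\<iota> True v = \<iota> e w" unfolding K_def by blast
    then show False using iota_eq[OF vt, of w True e] \<epsilon>'(1) by auto
  qed
  have \<phi>0: "\<phi>' 0 = s" using homeomorphism_apply1[OF D(6) D(4)] D(7) by simp
  have cf: "continuous_on (ball 0 1) (\<lambda>z. f (\<phi>' z))"
  proof (rule continuous_on_compose2[OF f_cont homeomorphism_cont2[OF D(6)]])
    show "\<phi>' ` ball 0 1 \<subseteq> S" using homeomorphism_image2[OF D(6)] D(5) by simp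
  qed
  have "open (ball 0 1 \<inter> (\<lambda>z. f (\<phi>' z)) -` (- K))"
    by (rule continuous_open_preimage[OF cf open_ball oK])
  moreover have "0 \<in> ball 0 1 \<inter> (\<lambda>z. f (\<phi>' z)) -` (- K)" using \<phi>0 s(2) yK by simp
  ultimately obtain \<rho> where \<rho>: "\<rho> > 0" "ball 0 \<rho> \<subseteq> ball 0 1 \<inter> (\<lambda>z. f (\<phi>' z)) -` (- K)"
    unfolding open_contains_ball by blast
  define W where "W = \<phi>' ` (ball 0 \<rho> - {0})"
  have \<phi>V: "\<phi>' z \<in> V" if "z \<in> ball 0 \<rho>" for z
    using that \<rho>(2) homeomorphism_image2[OF D(6)] by blast
  have WV: "W \<subseteq> V" using \<phi>V unfolding W_def by blast
  have W_iff: "p \<in> W \<longleftrightarrow> p \<in> V \<and> \<phi> p \<noteq> 0 \<and> norm (\<phi> p) < \<rho>" for p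
  proof
    assume "p \<in> W"
    then obtain z where z: "z \<in> ball 0 \<rho>" "z \<noteq> 0" "p = \<phi>' z" unfolding W_def by blast
    then have "\<phi> p = z" using homeomorphism_apply2[OF D(6)] \<rho>(2) by blast
    then show "p \<in> V \<and> \<phi> p \<noteq> 0 \<and> norm (\<phi> p) < \<rho>" using z \<phi>V by auto
  next
    assume p: "p \<in> V \<and> \<phi> p \<noteq> 0 \<and> norm (\<phi> p) < \<rho>"
    then have "p = \<phi>' (\<phi> p)" using homeomorphism_apply1[OF D(6)] by simp
    then show "p \<in> W" unfolding W_def using p by (intro image_eqI[of _ _ "\<phi> p"]) auto
  qed
  have connW: "connected W" unfolding W_def
  proof (rule connected_continuous_image)
    show "continuous_on (ball 0 \<rho> - {0}) \<phi>'"
      by (rule continuous_on_subset[OF homeomorphism_cont2[OF D(6)]]) (use \<rho>(2) in blast)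
    show "connected (ball (0::complex) \<rho> - {0})"
      by (rule connected_punctured_convex[OF convex_ball]) (use \<rho>(1) aff_dim_open[OF open_ball, of "0::complex" \<rho>] in simp)
  qed
  \<comment> \<open>The region swept out near \<open>s\<close> by a set of lifts. Closed balls of
    half the radius make it compact and still leave it inside the domain of the chart.\<close>
  define A where "A M = (\<Union>z\<in>M. snd z ` (tile \<inter> cball v \<epsilon>'))" for M :: "(bool \<times> (real \<times> real \<Rightarrow> 'c)) set"
  have clA: "closed (A M)" if "M \<subseteq> L" for M
    unfolding A_def
  proof (intro closed_UN ballI)
    show "finite M" by (rule finite_subset[OF _ finite_lifts]) (use that L_def in blast)
    fix z assume "z \<in> M"
    then have z: "z \<in> lifts" using that L_def by auto
    show "closed (snd z ` (tile \<inter> cball v \<epsilon>'))"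
      by (intro compact_imp_closed compact_continuous_image compact_Int_closed compact_tile closed_cball
          continuous_on_subset[OF liftsD(2)[OF z]]) auto
  qed
  have ne: "A M \<inter> W \<noteq> {}" if M: "z \<in> M" "M \<subseteq> L" for M z
  proof -
    have z: "z \<in> lifts" "snd z v = s" using M L_def by auto
    have vV: "snd z w \<in> V" if "w \<in> tile" "dist v w < \<epsilon>" for w
      using lift_near_corner[OF cp v z(1) that] z(2) by simp
    have c1: "continuous_on (tile \<inter> ball v \<epsilon>) (\<lambda>w. \<phi> (snd z w))"
      by (rule continuous_on_compose2[OF homeomorphism_cont1[OF D(6)] continuous_on_subset[OF liftsD(2)[OF z(1)]]])
        (use vV in auto)
    have "v \<in> tile \<inter> ball v \<epsilon>" using vt D(12) by simp
    from c1[unfolded continuous_on_iff, rule_format, OF this \<rho>(1)] obtain \<delta> where \<delta>: "\<delta> > 0"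
      "\<And>w. w \<in> tile \<inter> ball v \<epsilon> \<Longrightarrow> dist w v < \<delta> \<Longrightarrow> dist (\<phi> (snd z w)) (\<phi> (snd z v)) < \<rho>" by blast
    have "min \<delta> \<epsilon>' > 0" using \<delta>(1) \<epsilon>'(1) by simp
    from corner_nbhd_ne[OF v this] obtain w where w0: "w \<in> (tile - corners) \<inter> ball v (min \<delta> \<epsilon>')" by blast
    then have w: "w \<in> tile - corners" "dist v w < \<delta>" "dist v w < \<epsilon>'" by simp_all
    have "norm (\<phi> (snd z w)) < \<rho>"
      using \<delta>(2)[of w] w \<epsilon>'(2) z(2) D(7) by (simp add: dist_commute)
    moreover have "\<phi> (snd z w) \<noteq> 0"
    proof
      assume "\<phi> (snd z w) = 0"
      moreover have wV: "snd z w \<in> V" using vV w \<epsilon>'(2) by auto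
      ultimately have "snd z w = s" using homeomorphism_apply1[OF D(6)] \<phi>0 by metis
      then have "\<iota> (fst z) w = \<iota> True v" using liftsD(4)[OF z(1), of w] w(1) s(2) by simp
      then show False using iota_eq[of w v "fst z" True] w(1) v vt by auto
    qed
    ultimately have "snd z w \<in> W" using W_iff vV w \<epsilon>'(2) by auto
    moreover have "snd z w \<in> A M" unfolding A_def using M(1) w by (intro UN_I[of z]) auto
    ultimately show ?thesis by blast
  qed
  have cover: "W \<subseteq> A Orb \<union> A (L - Orb)"
  proof
    fix p assume p: "p \<in> W"
    then obtain z where z: "z \<in> ball 0 \<rho>" "z \<noteq> 0" "p = \<phi>' z" unfolding W_def by blast
    have pV: "p \<in> V" using p WV by blast
    have pS: "p \<in> S" using pV D(5) by blast
    have "f p \<notin> K" using z \<rho>(2) by blast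
    moreover obtain e w where w: "w \<in> tile" "f p = \<iota> e w" using F_iota pS f_img by blast
    ultimately have wb: "dist v w < \<epsilon>'" unfolding K_def by (cases e) (auto simp: not_le)
    have "w \<noteq> v" using D(10)[OF pV] w(2) iota_corner[OF v] p W_iff D(7) by metis
    then have wc: "w \<in> tile - corners" using near_corner(1)[OF v w(1)] wb \<epsilon>'(2) D(13) w(1) by auto
    obtain x' where x': "x' \<in> lifts" "fst x' = e" "snd x' w = p" using lift_exists[OF pS wc w(2)] by blast
    have "snd x' v = s" using lift_near_corner[OF cp v x'(1) w(1)] wb \<epsilon>'(2) x'(3) pV by auto
    then have "x' \<in> L" using x'(1) L_def by simp
    moreover have "p \<in> snd x' ` (tile \<inter> cball v \<epsilon>')" using x'(3) w(1) wb by (intro image_eqI[of _ _ w]) auto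
    ultimately show "p \<in> A Orb \<union> A (L - Orb)" unfolding A_def by blast
  qed
  have "A Orb \<inter> A (L - Orb) \<inter> W = {}"
  proof (rule ccontr)
    assume "\<not> ?thesis"
    then obtain p where p: "p \<in> A Orb" "p \<in> A (L - Orb)" "p \<in> W" by blast
    obtain a w where a: "a \<in> Orb" "w \<in> tile" "dist v w \<le> \<epsilon>'" "p = snd a w" using p(1) unfolding A_def by auto
    obtain b w' where b: "b \<in> L" "b \<notin> Orb" "w' \<in> tile" "p = snd b w'" using p(2) unfolding A_def by auto
    have al: "a \<in> lifts" and bl: "b \<in> lifts" using a b OL L_def by auto
    have "\<iota> (fst a) w = \<iota> (fst b) w'" using liftsD(4)[OF al a(2)] liftsD(4)[OF bl b(3)] a(4) b(4) by simp
    then have ww: "w = w'" "fst a = fst b \<or> sides w \<noteq> {}" using iota_eq[OF a(2) b(3)] by auto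
    have "snd a v = s" using a(1) OL L_def by auto
    then have wv: "w \<noteq> v" using a(4) p(3) W_iff D(7) by auto
    have wc: "w \<in> tile - corners" and ws: "sides w \<subseteq> sides v"
      using near_corner[OF v a(2) _ wv] a \<epsilon>'(2) D(13) by auto
    \<comment> \<open>A common point of the two regions is off the corner, so the two lifts are
      equal or neighbours across an edge through \<open>v\<close>. Either way they lie in the same
      orbit.\<close>
    show False
    proof (cases "fst a = fst b")
      case True
      then have "a = b" using lift_unique[OF al bl True wc] a(4) b(4) ww(1) by simp
      then show False using a b by simp
    next
      case False
      then obtain i where i: "i \<in> sides w" using ww(2) by blast
      have "nb i a = b" by (rule nb_eqI[OF al bl _ wc i]) (use False a(4) b(4) ww(1) in auto)
      moreover have "nb i a \<in> Orb" by (rule Ostep[OF a(1)]) (use i ws in blast)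
      ultimately show False using b(2) by simp
    qed
  qed
  then have "A Orb \<inter> W = {} \<or> A (L - Orb) \<inter> W = {}"
    by (intro connected_closedD[OF connW _ cover clA clA]) (use OL in auto)
  then show False using ne[OF xO OL] ne[OF yL] by auto
qed

text \<open>Crossing the two edges in turn rotates around the corner. The rotation has order exactly
  three, since the lifts of one sign through the corner point form a single orbit of three elements.
  Cancelling the involutions in the third power of the rotation gives the braid relation.\<close>

lemma corner_rotation:
  assumes x: "x \<in> lifts" and ij: "fst i \<noteq> fst j"
  shows "nb j (nb i x) \<noteq> x" "nb i (nb j (nb i x)) = nb j (nb i (nb j x))"
proof -
  define v :: "real \<times> real" where
    "v = (if fst i then (- sg (snd j), - sg (snd i)) else (- sg (snd i), - sg (snd j)))"
  have v: "v \<in> corners" by (auto simp: v_def corners_def sg_def)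
  have vt: "v \<in> tile" using v corners_subset_tile by auto
  have iv: "i \<in> sides v" "j \<in> sides v" using ij by (auto simp: sides_iff v_def)
  have sv: "sides v = {i, j}"
  proof -
    obtain i' j' where "sides v = {i', j'}" using corner_iff_sides[OF vt] v by blast
    then show ?thesis using iv ij by auto
  qed
  define a where "a = nb i"
  define b where "b = nb j"
  have l: "a z \<in> lifts" "b z \<in> lifts" and inv: "a (a z) = z" "b (b z) = z"
    and sgn: "fst (a z) = (\<not> fst z)" "fst (b z) = (\<not> fst z)" if "z \<in> lifts" for z
    using that nb nb_nb unfolding a_def b_def by auto
  define s where "s = snd x v"
  define Le where "Le = {z \<in> lifts. fst z = fst x \<and> snd z v = s}"
  have s: "s \<in> S" "f s = \<iota> True v" using liftsD(3,4)[OF x vt] iota_corner[OF v] s_def by auto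
  have cLe: "card Le = 3" unfolding Le_def by (rule card_corner_lifts[OF v s])
  have orbit: "Le \<subseteq> M" if M: "x \<in> M" "\<And>z. z \<in> M \<Longrightarrow> a z \<in> M" "\<And>z. z \<in> M \<Longrightarrow> b z \<in> M" for M
  proof
    fix y assume "y \<in> Le"
    then have "y \<in> lifts" "snd x v = snd y v" by (simp_all add: Le_def s_def)
    from corner_transitive[OF v x this] obtain g where g: "set g \<subseteq> {i, j}" "fold nb g x = y"
      unfolding sv by blast
    have "fold nb g z \<in> M" if "set g \<subseteq> {i, j}" "z \<in> M" for z
      using that
    proof (induction g arbitrary: z)
      case (Cons k g)
      have "nb k z \<in> M" using Cons.prems M(2)[of z] M(3)[of z] by (auto simp: a_def b_def)
      then show ?case using Cons.IH Cons.prems by simp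
    qed simp
    then show "y \<in> M" using g M(1) by blast
  qed
  have sub: "Le \<subseteq> {z \<in> M. fst z = fst x}" if "Le \<subseteq> M" for M using that Le_def by auto
  \<comment> \<open>A cycle of length one, and below a cycle of length two, would close up the orbit
    of \<open>x\<close> with fewer than three lifts of its sign.\<close>
  have c1: "b (a x) \<noteq> x"
  proof
    assume e: "b (a x) = x"
    then have ax: "b x = a x" using inv(2)[OF l(1)[OF x]] by simp
    have "Le \<subseteq> {x, a x}" by (rule orbit) (use ax inv(1)[OF x] e in auto)
    then have "Le \<subseteq> {x}" using sub[of "{x, a x}"] sgn(1)[OF x] by auto
    then have "card Le \<le> card {x}" by (intro card_mono) auto
    then show False using cLe by simp
  qed
  define y where "y = b (a x)"
  have y: "y \<in> lifts" using x l y_def by auto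
  define z where "z = b (a y)"
  have z: "z \<in> lifts" using y l z_def by auto
  have c2: "z \<noteq> x"
  proof
    assume e: "z = x"
    then have bx: "b x = a y" using inv(2)[OF l(1)[OF y]] z_def by simp
    have "Le \<subseteq> {x, a x, y, a y}"
      by (rule orbit) (use bx inv(1)[OF x] inv(1)[OF y] inv(2)[OF l(1)[OF x]] e y_def z_def in auto)
    then have "Le \<subseteq> {x, y}" using sub[of "{x, a x, y, a y}"] sgn(1)[OF x] sgn(1)[OF y] sgn(2)[OF l(1)[OF x]] y_def by auto
    then have "card Le \<le> card {x, y}" by (intro card_mono) auto
    also have "\<dots> \<le> 2" by (simp add: card_insert_if)
    finally show False using cLe by simp
  qed
  have abinj: "p = q" if "b (a p) = b (a q)" "p \<in> lifts" "q \<in> lifts" for p q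
  proof -
    have "b (b (a p)) = b (b (a q))" by (simp only: that(1))
    then have "a p = a q" unfolding inv(2)[OF l(1)[OF that(2)]] inv(2)[OF l(1)[OF that(3)]] .
    then have "a (a p) = a (a q)" by (rule arg_cong)
    then show ?thesis unfolding inv(1)[OF that(2)] inv(1)[OF that(3)] .
  qed
  have inLe: "b (a p) \<in> Le" if "p \<in> Le" for p
  proof -
    have p: "p \<in> lifts" "fst p = fst x" "snd p v = s" using that by (simp_all add: Le_def)
    have "snd (b (a p)) v = s"
      using nb(3)[OF p(1) vt iv(1)] nb(3)[OF l(1)[OF p(1)] vt iv(2)] p(3) by (simp add: a_def b_def)
    then show ?thesis using l p sgn by (simp add: Le_def)
  qed
  have xL: "x \<in> Le" using x Le_def s_def by auto
  have yL: "y \<in> Le" and zL: "z \<in> Le" using inLe xL y_def z_def by auto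
  have yz: "y \<noteq> z" using abinj[of x y] c1 x y unfolding y_def z_def by auto
  have "card {x, y, z} = 3" using c1 c2 yz y_def by auto
  moreover have "finite Le" using cLe card.infinite[of Le] by (cases "finite Le") simp_all
  ultimately have Le3: "Le = {x, y, z}"
    using card_subset_eq[of Le "{x, y, z}"] cLe xL yL zL by simp
  have "b (a z) \<in> {x, y, z}" using inLe[OF zL] Le3 by simp
  moreover have "b (a z) \<noteq> y" using abinj[of z x] c2 x z unfolding y_def by auto
  moreover have "b (a z) \<noteq> z" using abinj[of z y] yz z y unfolding z_def by auto
  ultimately have "b (a z) = x" by simp
  then have "b (a (b (a (b (a x))))) = x" by (simp add: y_def z_def)
  define t where "t = a (b (a x))"
  have t: "t \<in> lifts" using l x t_def by simp
  have "b (a (b t)) = x" unfolding t_def by fact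
  then have "a (b t) = b x" using inv(2)[OF l(1)[OF l(2)[OF t]]] by metis
  then have "b t = a (b x)" using inv(1)[OF l(2)[OF t]] by metis
  then have "t = b (a (b x))" using inv(2)[OF t] by metis
  then have "a (b (a x)) = b (a (b x))" unfolding t_def .
  then show "nb i (nb j (nb i x)) = nb j (nb i (nb j x))" by (simp add: a_def b_def)
  show "nb j (nb i x) \<noteq> x" using c1 by (simp add: a_def b_def)
qed

text \<open>The group of words acts on the lifts from the right, the first letter being crossed
  first.\<close>

lemma fold_nb_weq: "u \<simeq> v \<Longrightarrow> x \<in> lifts \<Longrightarrow> fold nb u x = fold nb v x"
proof (induction arbitrary: x rule: weq.induct)
  case (cancel u i v)
  then show ?case using nb_nb[OF fold_nb_lifts[OF cancel]] by simp
next
  case (braid i j u v)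
  then show ?case using corner_rotation(2)[OF fold_nb_lifts[OF braid(2)], of i j] by simp
qed simp_all

lemma lifts_transitive:
  assumes x: "x \<in> lifts" and y: "y \<in> lifts" and w: "w \<in> tile" and xy: "snd x w = snd y w"
  shows "\<exists>g. set g \<subseteq> sides w \<and> fold nb g x = y"
proof (cases "w \<in> corners")
  case True
  then show ?thesis using corner_transitive[OF _ x y xy] by blast
next
  case False
  then have wc: "w \<in> tile - corners" using w by blast
  have "\<iota> (fst x) w = \<iota> (fst y) w" using liftsD(4)[OF x w] liftsD(4)[OF y w] xy by simp
  then have e: "fst x = fst y \<or> sides w \<noteq> {}" using iota_eq[OF w w, of "fst x" "fst y"] by simp
  show ?thesis
  proof (cases "fst x = fst y")
    case True
    then have "x = y" by (rule lift_unique[OF x y _ wc xy])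
    then show ?thesis by (intro exI[of _ "[]"]) simp
  next
    case F: False
    then obtain i where i: "i \<in> sides w" using e by blast
    have "nb i x = y" by (rule nb_eqI[OF x y _ wc i]) (use F xy in auto)
    then show ?thesis using i by (intro exI[of _ "[i]"]) simp
  qed
qed

text \<open>This expresses that \<open>S\<close> has no cone points. A word fixing a lift has even
  length, so at an edge it is trivial and at a corner it is a rotation, and proper rotations move
  every lift.\<close>

lemma stabilizer_free:
  assumes x: "x \<in> lifts" and w: "w \<in> tile" and m: "set m \<subseteq> sides w" "fold nb m x = x"
  shows "m \<simeq> []"
proof -
  have ev: "even (length m)" using fold_nb_sign[OF x, of m] m(2) by auto
  show ?thesis
  proof (cases rule: side_cases[of w])
    case 1
    then show ?thesis using m by simp
  next
    case (2 i)
    have "m \<simeq> (if even (length m) then [] else [i])"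
      using m(1)[unfolded 2]
    proof (induction m)
      case (Cons k m)
      then have "k # m \<simeq> i # (if even (length m) then [] else [i])" using weq_Cons by auto
      then show ?case using weq_cancel_Cons[of i "[]"] by (auto split: if_splits intro: weq.trans)
    qed simp
    then show ?thesis using ev by simp
  next
    case (3 i j)
    obtain h where h: "h \<in> {[], [i], [j], [i, j], [j, i], [i, j, i]}" "m \<simeq> h"
      using dihedral_word_cases[OF 3(1)] m(1) 3(2) by metis
    have "fold nb h x = x" using fold_nb_weq[OF h(2) x] m(2) by simp
    then have "h \<noteq> [i, j]" "h \<noteq> [j, i]"
      using corner_rotation(1)[OF x 3(1)] corner_rotation(1)[OF x 3(1)[symmetric]] by auto
    moreover have "even (length h)" using weq_parity[OF h(2)] ev by simp
    ultimately have "h = []" using h(1) by auto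
    then show ?thesis using h(2) by simp
  qed
qed

end

subsection \<open>The universal covering by the Klein disc\<close>

text \<open>Two ways of writing a point of the disc differ by a word in the sides through its
  representative in the tile, by \<open>tile_strict\<close>.\<close>

lemma same_tile:
  assumes "w \<in> tile" "w' \<in> tile" "move u w = move u' w'"
  shows "w = w'" "\<exists>g. set g \<subseteq> sides w \<and> u \<simeq> u' @ g"
proof -
  have d: "w \<in> disc" "w' \<in> disc" using assms tile_subset_disc by auto
  have m: "move (rev u' @ u) w = w'" using move_append[OF d(1)] assms(3) move_rev(1)[OF d(2)] by simp
  have "w' = w \<and> (\<exists>g. rev u' @ u \<simeq> g \<and> set g \<subseteq> sides w)"
    using tile_strict[OF assms(1), of "rev u' @ u"] assms(2) m by simp
  then obtain g where g: "w = w'" "rev u' @ u \<simeq> g" "set g \<subseteq> sides w" by blast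
  show "w = w'" by (rule g(1))
  have "u \<simeq> (u' @ rev u') @ u" using weq_append[OF weq_rev_right weq.refl, of u' u] weq.sym by simp
  also have "(u' @ rev u') @ u \<simeq> u' @ g" using weq_append[OF weq.refl g(2), of u'] by simp
  finally show "\<exists>g. set g \<subseteq> sides w \<and> u \<simeq> u' @ g" using g(3) by blast
qed

lemma short_word:
  assumes "set g \<subseteq> sides w"
  obtains g' where "g \<simeq> g'" "set g' \<subseteq> sides w" "length g' \<le> 3"
proof (cases rule: side_cases[of w])
  case 1
  then show thesis using that[of "[]"] assms by simp
next
  case (2 i)
  have "\<exists>g'. g \<simeq> g' \<and> g' \<in> {[], [i]}"
    using assms[unfolded 2]
  proof (induction g)
    case (Cons k g)
    then obtain g' where g': "g \<simeq> g'" "g' \<in> {[], [i]}" by auto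
    have kg: "k # g \<simeq> i # g'" using Cons.prems weq_Cons[OF g'(1), of i] by simp
    show ?case
    proof (cases "g' = []")
      case True
      then show ?thesis using kg by (intro exI[of _ "[i]"]) simp
    next
      case False
      then have "g' = [i]" using g'(2) by simp
      then have "k # g \<simeq> []" using kg weq_cancel_Cons[of i "[]"] weq.trans by simp
      then show ?thesis by (intro exI[of _ "[]"]) simp
    qed
  qed (auto intro: exI[of _ "[]"])
  then obtain g' where g': "g \<simeq> g'" "g' \<in> {[], [i]}" by blast
  then have "set g' \<subseteq> sides w" "length g' \<le> 3" using 2 by (cases "g' = []"; simp)+
  then show thesis by (rule that[OF g'(1)])
next
  case (3 i j)
  have "set g \<subseteq> {i, j}" using assms 3(2) by simp
  from dihedral_word_cases[OF 3(1) this]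
  obtain g' where g': "g' \<in> {[], [i], [j], [i, j], [j, i], [i, j, i]}" "g \<simeq> g'" unfolding Bex_def by (elim exE conjE)
  have "set g' \<subseteq> {i, j}" "length g' \<le> 3" using g'(1) by (elim insertE emptyE; simp)+
  then have "set g' \<subseteq> sides w" "length g' \<le> 3" using 3(2) by simp_all
  then show thesis by (rule that[OF g'(2)])
qed

lemma open_move_image:
  assumes "open M" "M \<subseteq> disc"
  shows "open (move u ` M)" "move u ` M \<subseteq> disc"
proof -
  have "move u ` M = disc \<inter> move (rev u) -` M"
  proof (intro Set.equalityI subsetI)
    fix p assume "p \<in> move u ` M"
    then obtain z where "z \<in> M" "p = move u z" by blast
    moreover from \<open>z \<in> M\<close> have "z \<in> disc" using assms(2) by blast
    ultimately show "p \<in> disc \<inter> move (rev u) -` M" using move_disc[of z u] move_rev(1)[of z u] by simp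
  next
    fix p assume "p \<in> disc \<inter> move (rev u) -` M"
    then show "p \<in> move u ` M" using move_rev(2)[of p u] by (intro image_eqI[of _ _ "move (rev u) p"]) auto
  qed
  then show "open (move u ` M)"
    using continuous_open_preimage[OF continuous_move open_disc assms(1)] by simp
  show "move u ` M \<subseteq> disc" using assms(2) move_disc by blast
qed

text \<open>An open neighbourhood of \<open>w\<close> that is invariant under the stabilizer of
  \<open>w\<close>, unlike a Euclidean ball. Its translates are therefore equal or disjoint and
  serve as sheets.\<close>

definition star :: "real \<times> real \<Rightarrow> (real \<times> real) set" where
  "star w = {move g z | g z. set g \<subseteq> sides w \<and> z \<in> tile \<and> sides z \<subseteq> sides w}"

lemma starI: "set g \<subseteq> sides w \<Longrightarrow> z \<in> tile \<Longrightarrow> sides z \<subseteq> sides w \<Longrightarrow> move g z \<in> star w"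
  unfolding star_def by blast

lemma starE:
  assumes "p \<in> star w" obtains g z where "set g \<subseteq> sides w" "z \<in> tile" "sides z \<subseteq> sides w" "p = move g z"
  using assms unfolding star_def by blast

lemma star_subset: "star w \<subseteq> disc"
  unfolding star_def using move_disc tile_subset_disc by blast

lemma move_star:
  assumes "set m \<subseteq> sides w" shows "move m ` star w = star w"
proof -
  have *: "move m p \<in> star w" if "p \<in> star w" "set m \<subseteq> sides w" for p m
  proof -
    obtain g z where g: "set g \<subseteq> sides w" "z \<in> tile" "sides z \<subseteq> sides w" "p = move g z"
      using starE[OF \<open>p \<in> star w\<close>] .
    have "z \<in> disc" using g(2) tile_subset_disc by blast
    then have "move m p = move (m @ g) z" using g(4) move_append by simp
    then show ?thesis using starI[of "m @ g" w z] g that(2) by simp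
  qed
  show ?thesis
  proof (intro Set.equalityI subsetI)
    show "p \<in> star w" if "p \<in> move m ` star w" for p using * that assms by blast
    fix p assume p: "p \<in> star w"
    have "set (rev m) \<subseteq> sides w" using assms by simp
    then have "move (rev m) p \<in> star w" using * p by blast
    moreover have "p \<in> disc" using p star_subset[of w] by blast
    then have "p = move m (move (rev m) p)" using move_rev(2)[of p m] by simp
    ultimately show "p \<in> move m ` star w" by blast
  qed
qed

lemma open_star: "open (star w)"
proof (subst open_subopen, intro ballI)
  fix p assume "p \<in> star w"
  then obtain g z where g: "set g \<subseteq> sides w" "z \<in> tile" "sides z \<subseteq> sides w" "p = move g z" by (rule starE)
  obtain \<epsilon> where \<epsilon>: "\<epsilon> > 0" "ball z \<epsilon> \<subseteq> disc"
    "\<And>y. y \<in> ball z \<epsilon> \<Longrightarrow> \<exists>g v. set g \<subseteq> sides z \<and> length g \<le> 3 \<and> v \<in> tile \<and> sides v \<subseteq> sides z \<and> y = move g v"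
    using star_neighbourhood[OF g(2)] by blast
  have "move g ` ball z \<epsilon> \<subseteq> star w"
  proof
    fix q assume "q \<in> move g ` ball z \<epsilon>"
    then obtain y where y: "y \<in> ball z \<epsilon>" "q = move g y" by blast
    obtain g' v where v: "set g' \<subseteq> sides z" "v \<in> tile" "sides v \<subseteq> sides z" "y = move g' v" using \<epsilon>(3)[OF y(1)] by blast
    have "v \<in> disc" using v(2) tile_subset_disc by blast
    then have "q = move (g @ g') v" using y v move_append by simp
    then show "q \<in> star w" using starI[of "g @ g'" w v] g v by auto
  qed
  moreover have "p \<in> move g ` ball z \<epsilon>" using g(4) \<epsilon>(1) by simp
  ultimately show "\<exists>T. open T \<and> p \<in> T \<and> T \<subseteq> star w" using open_move_image(1)[OF open_ball \<epsilon>(2)] by blast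
qed

context square_orbifold
begin

text \<open>The developing map. Appending a letter to \<open>u\<close> passes to the adjacent tile
  across that side, so the right action on lifts matches the left action on the disc: the tile moved
  by \<open>u\<close> carries the lift reached from \<open>x0\<close> along \<open>u\<close>. The
  choice of the pair is immaterial by \<open>dev_move\<close>.\<close>

definition dev :: "bool \<times> (real \<times> real \<Rightarrow> 'c) \<Rightarrow> real \<times> real \<Rightarrow> 'c" where
  "dev x0 h = (let p = SOME p. snd p \<in> tile \<and> h = move (fst p) (snd p) in snd (fold nb (fst p) x0) (snd p))"

context
  fixes x0 assumes x0: "x0 \<in> lifts"
begin

lemma dev_move: assumes "w \<in> tile" shows "dev x0 (move u w) = snd (fold nb u x0) w"
proof -
  define p where "p = (SOME p. snd p \<in> tile \<and> move u w = move (fst p) (snd p))"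
  have "\<exists>p. snd p \<in> tile \<and> move u w = move (fst p) (snd p)" using assms by (intro exI[of _ "(u, w)"]) simp
  then have p: "snd p \<in> tile" "move u w = move (fst p) (snd p)"
    unfolding p_def using someI_ex[of "\<lambda>p. snd p \<in> tile \<and> move u w = move (fst p) (snd p)"] by blast+
  have w: "w = snd p" by (rule same_tile(1)[OF assms p])
  obtain g where g: "set g \<subseteq> sides w" "u \<simeq> fst p @ g" using same_tile(2)[OF assms p] by blast
  have "fold nb u x0 = fold nb g (fold nb (fst p) x0)" using fold_nb_weq[OF g(2) x0] by simp
  then have "snd (fold nb u x0) w = snd (fold nb (fst p) x0) w"
    using fold_nb_value[OF fold_nb_lifts[OF x0] assms g(1)] by simp
  moreover have "dev x0 (move u w) = snd (fold nb (fst p) x0) (snd p)"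
    unfolding dev_def p_def[symmetric] by simp
  ultimately show ?thesis using w by simp
qed

lemma dev_continuous: "continuous_on disc (dev x0)"
proof (rule continuous_at_imp_continuous_on, rule ballI)
  fix h assume h: "h \<in> disc"
  obtain u w where w: "w \<in> tile" "h = move u w" using disc_covered[OF h] by blast
  have wd: "w \<in> disc" using w(1) tile_subset_disc by blast
  obtain \<epsilon> where \<epsilon>: "\<epsilon> > 0" "ball w \<epsilon> \<subseteq> disc"
    "\<And>y. y \<in> ball w \<epsilon> \<Longrightarrow> \<exists>g v. set g \<subseteq> sides w \<and> length g \<le> 3 \<and> v \<in> tile \<and> sides v \<subseteq> sides w \<and> y = move g v"
    using star_neighbourhood[OF w(1)] by blast
  let ?B = "cball w (\<epsilon> / 2)"
  have Bd: "?B \<subseteq> ball w \<epsilon>" using \<epsilon>(1) by auto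
  have Bdisc: "?B \<subseteq> disc" using Bd \<epsilon>(2) by blast
  let ?G = "{g. set g \<subseteq> sides w \<and> length g \<le> 3}"
  \<comment> \<open>Near \<open>w\<close> the disc is a union of finitely many closed pieces of
    tiles, on each of which the developing map is a lift composed with a motion.\<close>
  define C where "C g = ?B \<inter> move (rev g) -` tile" for g
  have clC: "closed (C g)" for g unfolding C_def
    by (intro continuous_closed_preimage continuous_on_subset[OF continuous_move Bdisc] closed_cball
        compact_imp_closed[OF compact_tile])
  have "continuous_on (\<Union>g\<in>?G. C g) (\<lambda>z. dev x0 (move u z))"
  proof (rule continuous_on_closed_Union)
    show "finite ?G" by (rule finite_lists_length_le) simp
    show "closed (C g)" for g by (rule clC)
    fix g
    have e: "dev x0 (move u z) = snd (fold nb (u @ g) x0) (move (rev g) z)" if "z \<in> C g" for z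
    proof -
      have z: "z \<in> disc" "move (rev g) z \<in> tile" using that Bdisc unfolding C_def by auto
      have "move u z = move (u @ g) (move (rev g) z)"
        using move_append[OF move_disc[OF z(1)]] move_rev(2)[OF z(1)] by simp
      then show ?thesis using dev_move[OF z(2)] by simp
    qed
    have "continuous_on (C g) (\<lambda>z. snd (fold nb (u @ g) x0) (move (rev g) z))"
    proof (rule continuous_on_compose2[OF liftsD(2)[OF fold_nb_lifts[OF x0]]])
      show "continuous_on (C g) (move (rev g))"
        by (rule continuous_on_subset[OF continuous_move]) (use Bdisc C_def in blast)
    qed (auto simp: C_def)
    then show "continuous_on (C g) (\<lambda>z. dev x0 (move u z))"
      by (rule continuous_on_cong[THEN iffD1, rotated 2]) (simp_all add: e)
  qed
  moreover have "?B \<subseteq> (\<Union>g\<in>?G. C g)"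
  proof
    fix z assume z: "z \<in> ?B"
    then obtain g v where g: "set g \<subseteq> sides w" "length g \<le> 3" "v \<in> tile" "z = move g v" using \<epsilon>(3) Bd by blast
    have "v \<in> disc" using g(3) tile_subset_disc by blast
    then have "move (rev g) z \<in> tile" using g move_rev(1) by simp
    then show "z \<in> (\<Union>g\<in>?G. C g)" using z g unfolding C_def by blast
  qed
  ultimately have cB: "continuous_on ?B (\<lambda>z. dev x0 (move u z))" by (rule continuous_on_subset)
  let ?N = "disc \<inter> move (rev u) -` ball w (\<epsilon> / 2)"
  have oN: "open ?N" by (rule continuous_open_preimage[OF continuous_move open_disc open_ball])
  have hN: "h \<in> ?N" using h w(2) move_rev(1)[OF wd] \<epsilon>(1) by simp
  have "continuous_on ?N (\<lambda>z. dev x0 (move u (move (rev u) z)))"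
    by (rule continuous_on_compose2[OF cB continuous_on_subset[OF continuous_move]]) auto
  then have "continuous_on ?N (dev x0)"
    by (rule continuous_on_cong[THEN iffD1, rotated 2]) (simp_all add: move_rev)
  then show "isCont (dev x0) h" using continuous_on_eq_continuous_at[OF oN] hN by blast
qed

lemma dev_S: "h \<in> disc \<Longrightarrow> dev x0 h \<in> S"
  using disc_covered[of h] dev_move liftsD(3)[OF fold_nb_lifts[OF x0]] by auto

text \<open>All lifts through a point are reached by crossing sides at that point, so every sector
  around it in \<open>S\<close> is the image of one in the disc. Two closed sets are cut away:
  points over parts of the faces far from \<open>w\<close>, and points near \<open>w\<close> on
  lifts that miss \<open>s\<close>.\<close>

lemma dev_open:
  assumes "open M" "M \<subseteq> disc" shows "openin (top_of_set S) (dev x0 ` M)"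
proof (subst openin_subopen, intro ballI)
  fix s assume "s \<in> dev x0 ` M"
  then obtain h where h: "h \<in> M" "s = dev x0 h" by blast
  then obtain u w where w: "w \<in> tile" "h = move u w" using disc_covered assms(2) by blast
  have wd: "w \<in> disc" using w(1) tile_subset_disc by blast
  define y where "y = fold nb u x0"
  have y: "y \<in> lifts" unfolding y_def by (rule fold_nb_lifts[OF x0])
  have sy: "s = snd y w" using h(2) w dev_move y_def by simp
  let ?G = "{g. set g \<subseteq> sides w \<and> length g \<le> 3}"
  have finG: "finite ?G" by (rule finite_lists_length_le) simp
  define M1 where "M1 = (\<Inter>g\<in>?G. disc \<inter> move (u @ g) -` M) \<inter> disc"
  have "open M1" unfolding M1_def
    by (intro open_Int open_INT finG ballI open_disc continuous_open_preimage[OF continuous_move open_disc assms(1)])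
  moreover have "w \<in> M1" unfolding M1_def using wd w(2) h(1) move_append[OF wd] move_fixed by auto
  ultimately obtain \<epsilon> where \<epsilon>: "\<epsilon> > 0" "ball w \<epsilon> \<subseteq> M1" unfolding open_contains_ball by blast
  have inM: "snd x z \<in> dev x0 ` M" if x: "x \<in> lifts" "snd x w = s" and z: "z \<in> tile" "z \<in> ball w \<epsilon>" for x z
  proof -
    have "snd y w = snd x w" using x(2) sy by simp
    from lifts_transitive[OF y x(1) w(1) this] obtain g where g: "set g \<subseteq> sides w" "fold nb g y = x" by blast
    obtain g' where g': "g \<simeq> g'" "set g' \<subseteq> sides w" "length g' \<le> 3" using short_word[OF g(1)] by blast
    have "fold nb (u @ g') x0 = x" using fold_nb_weq[OF g'(1) y] g(2) by (simp add: y_def)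
    then have "dev x0 (move (u @ g') z) = snd x z" using dev_move[OF z(1)] by metis
    moreover have "move (u @ g') z \<in> M" using \<epsilon>(2) z(2) g'(2,3) unfolding M1_def by blast
    ultimately show ?thesis by (intro image_eqI[of _ _ "move (u @ g') z"]) simp_all
  qed
  define K where "K = \<iota> True ` (tile - ball w \<epsilon>) \<union> \<iota> False ` (tile - ball w \<epsilon>)"
  have cK: "compact (\<iota> e ` (tile - ball w \<epsilon>))" for e
    by (intro compact_continuous_image compact_diff compact_tile open_ball continuous_on_subset[OF iota_cont]) auto
  then have oK: "open (- K)" unfolding K_def by (intro open_Compl closed_Un compact_imp_closed)
  define B where "B = (\<Union>x\<in>{x \<in> lifts. snd x w \<noteq> s}. snd x ` (tile \<inter> cball w \<epsilon>))"
  have clB: "closed B" unfolding B_def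
  proof (intro closed_UN ballI)
    show "finite {x \<in> lifts. snd x w \<noteq> s}" using finite_lifts by simp
    fix x assume "x \<in> {x \<in> lifts. snd x w \<noteq> s}"
    then have x: "x \<in> lifts" by simp
    show "closed (snd x ` (tile \<inter> cball w \<epsilon>))"
      by (intro compact_imp_closed compact_continuous_image compact_Int_closed compact_tile closed_cball
          continuous_on_subset[OF liftsD(2)[OF x]]) auto
  qed
  let ?N = "(S \<inter> f -` (- K)) \<inter> (- B)"
  have "openin (top_of_set S) ?N"
    by (intro openin_Int_open continuous_openin_preimage_gen[OF f_cont oK] open_Compl clB)
  moreover have "s \<in> ?N"
  proof -
    have sS: "s \<in> S" "f s = \<iota> (fst y) w" using liftsD(3,4)[OF y w(1)] sy by simp_all
    have "f s \<notin> K"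
    proof
      assume "f s \<in> K"
      then obtain e w' where w': "w' \<in> tile - ball w \<epsilon>" "\<iota> (fst y) w = \<iota> e w'" unfolding K_def sS(2) by blast
      then have "w = w'" using iota_eq[OF w(1), of w' "fst y" e] by simp
      then show False using w'(1) \<epsilon>(1) by simp
    qed
    moreover have "s \<notin> B"
    proof
      assume "s \<in> B"
      then obtain x w' where x: "x \<in> lifts" "snd x w \<noteq> s" "w' \<in> tile" "s = snd x w'" unfolding B_def by blast
      then have "\<iota> (fst y) w = \<iota> (fst x) w'" using liftsD(4)[OF x(1,3)] sS(2) by simp
      then have "w = w'" using iota_eq[OF w(1) x(3), of "fst y" "fst x"] by simp
      then show False using x by simp
    qed
    ultimately show ?thesis using sS(1) by simp
  qed
  moreover have "?N \<subseteq> dev x0 ` M"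
  proof
    fix p assume p: "p \<in> ?N"
    then obtain x w' where x: "x \<in> lifts" "w' \<in> tile" "snd x w' = p" using lift_through by blast
    have "f p = \<iota> (fst x) w'" using liftsD(4)[OF x(1,2)] x(3) by simp
    then have wb: "w' \<in> ball w \<epsilon>" using p x(2) unfolding K_def by (cases "fst x") auto
    have "snd x w = s"
    proof (rule ccontr)
      assume "snd x w \<noteq> s"
      then have "p \<in> B" unfolding B_def using x wb by (intro UN_I[of x] image_eqI[of _ _ w']) auto
      then show False using p by blast
    qed
    then show "p \<in> dev x0 ` M" using inM[OF x(1) _ x(2) wb] x(3) by simp
  qed
  ultimately show "\<exists>T. openin (top_of_set S) T \<and> s \<in> T \<and> T \<subseteq> dev x0 ` M" by blast
qed

text \<open>The image is open, and closed as a finite union of compact lifts; connectedness of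
  \<open>S\<close> makes it everything.\<close>

lemma dev_surj: "dev x0 ` disc = S"
proof -
  have "dev x0 ` disc = (\<Union>x\<in>{fold nb u x0 | u. True}. snd x ` tile)"
  proof (intro Set.equalityI subsetI)
    fix s assume "s \<in> dev x0 ` disc"
    then obtain u w where "w \<in> tile" "s = dev x0 (move u w)" using disc_covered by blast
    then show "s \<in> (\<Union>x\<in>{fold nb u x0 | u. True}. snd x ` tile)" using dev_move by blast
  next
    fix s assume "s \<in> (\<Union>x\<in>{fold nb u x0 | u. True}. snd x ` tile)"
    then obtain u w where w: "w \<in> tile" "s = snd (fold nb u x0) w" by blast
    then have "move u w \<in> disc" using tile_subset_disc move_disc by blast
    then show "s \<in> dev x0 ` disc" using dev_move[OF w(1)] w(2) by (metis image_eqI)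
  qed
  moreover have "closed (\<Union>x\<in>{fold nb u x0 | u. True}. snd x ` tile)"
  proof (intro closed_UN ballI)
    show "finite {fold nb u x0 | u. True}"
      by (rule finite_subset[OF _ finite_lifts]) (use fold_nb_lifts[OF x0] in blast)
    fix x assume "x \<in> {fold nb u x0 | u. True}"
    then have "x \<in> lifts" using fold_nb_lifts[OF x0] by blast
    then show "closed (snd x ` tile)"
      by (intro compact_imp_closed compact_continuous_image liftsD(2) compact_tile)
  qed
  ultimately have "closed (dev x0 ` disc)" by simp
  moreover have sub: "dev x0 ` disc \<subseteq> S" using dev_S by blast
  ultimately have "closedin (top_of_set S) (dev x0 ` disc)" by (simp add: closed_subset)
  moreover have "openin (top_of_set S) (dev x0 ` disc)" by (rule dev_open[OF open_disc order_refl])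
  moreover have "dev x0 ` disc \<noteq> {}" using open_disc by (auto simp: disc_def)
  ultimately show ?thesis using connected_S unfolding connected_clopen by blast
qed

lemma dev_eq_imp:
  assumes w: "w \<in> tile" "w' \<in> tile" and e: "dev x0 (move u w) = dev x0 (move u' w')"
  obtains k where "w = w'" "set k \<subseteq> sides w" "fold nb (u @ k) x0 = fold nb u' x0"
proof -
  let ?x = "fold nb u x0" and ?x' = "fold nb u' x0"
  have l: "?x \<in> lifts" "?x' \<in> lifts" using fold_nb_lifts[OF x0] by blast+
  have v: "snd ?x w = snd ?x' w'" using e dev_move w by simp
  then have "\<iota> (fst ?x) w = \<iota> (fst ?x') w'" using liftsD(4)[OF l(1) w(1)] liftsD(4)[OF l(2) w(2)] by simp
  then have ww: "w = w'" using iota_eq[OF w, of "fst ?x" "fst ?x'"] by simp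
  obtain k where "set k \<subseteq> sides w" "fold nb k ?x = ?x'" using lifts_transitive[OF l w(1)] v ww by blast
  then show thesis using that[OF ww] by simp
qed

text \<open>The sheets over the image of a star are the translates of this star by the words whose
  lift sends \<open>w\<close> to \<open>s\<close>. Disjointness comes from the tiling, injectivity
  on a sheet from freeness of the stabilizers.\<close>

lemma dev_covering: "covering_space disc (dev x0) S"
  unfolding covering_space_def
proof (intro conjI ballI)
  show "continuous_on disc (dev x0)" by (rule dev_continuous)
  show "dev x0 ` disc = S" by (rule dev_surj)
  fix s assume "s \<in> S"
  then obtain h where h: "h \<in> disc" "s = dev x0 h" using dev_surj by blast
  obtain u0 w where w: "w \<in> tile" "h = move u0 w" using disc_covered[OF h(1)] by blast
  let ?St = "star w"
  \<comment> \<open>The condition that the centre of the translated star lies over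
    \<open>s\<close>.\<close>
  define good where "good u \<longleftrightarrow> snd (fold nb u x0) w = s" for u
  have g0: "good u0" unfolding good_def using h(2) w dev_move by simp
  define T where "T = dev x0 ` move u0 ` ?St"
  have mSt: "open (move u ` ?St)" "move u ` ?St \<subseteq> disc" for u
    using open_move_image[OF open_star star_subset] by blast+
  have img: "dev x0 ` move u ` ?St \<subseteq> dev x0 ` move u' ` ?St" if "good u" "good u'" for u u'
  proof
    fix p assume "p \<in> dev x0 ` move u ` ?St"
    then obtain q where q: "q \<in> ?St" "p = dev x0 (move u q)" by blast
    obtain g z where g: "set g \<subseteq> sides w" "z \<in> tile" "sides z \<subseteq> sides w" "q = move g z" using starE[OF q(1)] .
    have zd: "z \<in> disc" using g(2) tile_subset_disc by blast
    have "snd (fold nb u' x0) w = snd (fold nb u x0) w" using that good_def by simp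
    from lifts_transitive[OF fold_nb_lifts[OF x0] fold_nb_lifts[OF x0] w(1) this]
    obtain k where k: "set k \<subseteq> sides w" "fold nb k (fold nb u' x0) = fold nb u x0" by blast
    have "p = snd (fold nb (u @ g) x0) z" using q(2) g(4) move_append[OF zd] dev_move[OF g(2)] by metis
    also have "fold nb (u @ g) x0 = fold nb (u' @ k @ g) x0" using k(2) by simp
    also have "snd \<dots> z = dev x0 (move (u' @ k @ g) z)" using dev_move[OF g(2)] by simp
    also have "move (u' @ k @ g) z = move u' (move (k @ g) z)" using move_append[OF zd] by blast
    finally have "p = dev x0 (move u' (move (k @ g) z))" .
    moreover have "move (k @ g) z \<in> ?St" by (rule starI) (use g k in auto)
    ultimately show "p \<in> dev x0 ` move u' ` ?St" by blast
  qed
  show "\<exists>T. s \<in> T \<and> openin (top_of_set S) T \<and>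
     (\<exists>v. \<Union>v = disc \<inter> dev x0 -` T \<and> (\<forall>u\<in>v. openin (top_of_set disc) u) \<and> pairwise disjnt v \<and>
       (\<forall>u\<in>v. \<exists>q. homeomorphism u T (dev x0) q))"
  proof (intro exI[of _ T] conjI exI[of _ "{move u ` ?St | u. good u}"] ballI)
    have "move [] w \<in> ?St" by (rule starI) (use w in auto)
    then show "s \<in> T" unfolding T_def using h(2) w(2) by simp
    show "openin (top_of_set S) T" unfolding T_def by (rule dev_open[OF mSt])
    show "\<Union>{move u ` ?St | u. good u} = disc \<inter> dev x0 -` T"
    proof (intro Set.equalityI subsetI)
      fix p assume "p \<in> \<Union>{move u ` ?St | u. good u}"
      then obtain u where u: "good u" "p \<in> move u ` ?St" by blast
      have "dev x0 p \<in> T" using img[OF u(1) g0] u(2) unfolding T_def by blast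
      then show "p \<in> disc \<inter> dev x0 -` T" using u(2) mSt(2) by blast
    next
      fix p assume p: "p \<in> disc \<inter> dev x0 -` T"
      then obtain q where q: "q \<in> ?St" "dev x0 p = dev x0 (move u0 q)" unfolding T_def by blast
      obtain g z where g: "set g \<subseteq> sides w" "z \<in> tile" "sides z \<subseteq> sides w" "q = move g z" using starE[OF q(1)] .
      have zd: "z \<in> disc" using g(2) tile_subset_disc by blast
      obtain u' z' where z': "z' \<in> tile" "p = move u' z'" using disc_covered p by blast
      have "dev x0 (move u' z') = dev x0 (move (u0 @ g) z)" using q(2) z'(2) g(4) move_append[OF zd] by simp
      from dev_eq_imp[OF z'(1) g(2) this] obtain k where
        k: "z' = z" "set k \<subseteq> sides z'" "fold nb (u' @ k) x0 = fold nb (u0 @ g) x0" .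
      have "good (u' @ k)"
        unfolding good_def k(3) using g0[unfolded good_def] fold_nb_value[OF fold_nb_lifts[OF x0] w(1) g(1)] by simp
      moreover have "p = move (u' @ k) z"
        using z'(2) k(1,2) move_append[OF zd] move_fixed by simp
      moreover have "move [] z \<in> ?St" by (rule starI) (use g in auto)
      ultimately show "p \<in> \<Union>{move u ` ?St | u. good u}" by auto
    qed
    show "pairwise disjnt {move u ` ?St | u. good u}"
    proof (rule pairwiseI)
      fix A B assume A: "A \<in> {move u ` ?St | u. good u}" and B: "B \<in> {move u ` ?St | u. good u}" and AB: "A \<noteq> B"
      obtain u u' where u: "A = move u ` ?St" "B = move u' ` ?St" using A B by blast
      show "disjnt A B"
      proof (rule ccontr)
        assume "\<not> disjnt A B"
        then obtain p q q' where p: "q \<in> ?St" "q' \<in> ?St" "p = move u q" "p = move u' q'"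
          unfolding disjnt_def u by blast
        obtain g z where g: "set g \<subseteq> sides w" "z \<in> tile" "sides z \<subseteq> sides w" "q = move g z" using starE[OF p(1)] .
        obtain g' z' where g': "set g' \<subseteq> sides w" "z' \<in> tile" "sides z' \<subseteq> sides w" "q' = move g' z'" using starE[OF p(2)] .
        have zd: "z \<in> disc" "z' \<in> disc" using g(2) g'(2) tile_subset_disc by auto
        have "move (u @ g) z = move (u' @ g') z'" using p(3,4) g(4) g'(4) move_append zd by simp
        from same_tile(2)[OF g(2) g'(2) this] obtain k where k: "set k \<subseteq> sides z" "u @ g \<simeq> (u' @ g') @ k" by blast
        define m where "m = g' @ k @ rev g"
        have m: "set m \<subseteq> sides w" using g g' k unfolding m_def by auto
        have "u \<simeq> u @ (g @ rev g)" using weq_append[OF weq.refl weq_rev_right, of u g] weq.sym by simp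
        also have "u @ (g @ rev g) \<simeq> u' @ m" using weq_append[OF k(2) weq.refl, of "rev g"] by (simp add: m_def)
        finally have um: "move u = move (u' @ m)" by (rule weq_move)
        have "move u ` ?St = move u' ` move m ` ?St"
        proof -
          have "move u p = move u' (move m p)" if "p \<in> ?St" for p
          proof -
            have "p \<in> disc" using that star_subset[of w] by blast
            then show ?thesis unfolding um by (rule move_append)
          qed
          then show ?thesis unfolding image_image by (rule image_cong[OF HOL.refl])
        qed
        then show False using move_star[OF m] AB u by simp
      qed
    qed
    fix A assume "A \<in> {move u ` ?St | u. good u}"
    then obtain u where u: "good u" "A = move u ` ?St" by blast
    show "openin (top_of_set disc) A" unfolding u(2)
      by (rule open_openin_trans[OF open_disc mSt])
    have inj: "inj_on (dev x0) A"
    proof (rule inj_onI)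
      fix p p' assume pp: "p \<in> A" "p' \<in> A" "dev x0 p = dev x0 p'"
      obtain q q' where q: "q \<in> ?St" "q' \<in> ?St" "p = move u q" "p' = move u q'" using pp u(2) by blast
      obtain g z where g: "set g \<subseteq> sides w" "z \<in> tile" "sides z \<subseteq> sides w" "q = move g z" using starE[OF q(1)] .
      obtain g' z' where g': "set g' \<subseteq> sides w" "z' \<in> tile" "sides z' \<subseteq> sides w" "q' = move g' z'" using starE[OF q(2)] .
      have zd: "z \<in> disc" "z' \<in> disc" using g(2) g'(2) tile_subset_disc by auto
      have "dev x0 (move (u @ g) z) = dev x0 (move (u @ g') z')" using pp(3) q(3,4) g(4) g'(4) move_append zd by simp
      from dev_eq_imp[OF g(2) g'(2) this] obtain k where
        k: "z = z'" "set k \<subseteq> sides z" "fold nb ((u @ g) @ k) x0 = fold nb (u @ g') x0" .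
      let ?y = "fold nb u x0"
      have y: "?y \<in> lifts" by (rule fold_nb_lifts[OF x0])
      have "fold nb (g @ k @ rev g') ?y = fold nb (g' @ rev g') ?y" using k(3) by simp
      also have "\<dots> = ?y" using fold_nb_weq[OF weq_rev_right y, of g'] by simp
      \<comment> \<open>Two points of one sheet with the same image differ by a word in the sides at
        \<open>w\<close> that fixes the lift, which is trivial.\<close>
      finally have "g @ k @ rev g' \<simeq> []"
        by (intro stabilizer_free[OF y w(1)]) (use g g' k in auto)
      then have a: "(g @ k @ rev g') @ g' \<simeq> [] @ g'" by (rule weq_append) simp
      have "g @ k \<simeq> (g @ k) @ (rev g' @ g')" using weq_append[OF weq.refl weq_rev_left, of "g @ k" g'] weq.sym by simp
      from weq.trans[OF this, of g'] a have "g @ k \<simeq> g'" by simp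
      then have "move g' z = move (g @ k) z" using weq_move by metis
      also have "\<dots> = move g z" using move_append[OF zd(1)] move_fixed[OF k(2)] by simp
      finally show "p = p'" using q g(4) g'(4) k(1) by simp
    qed
    have "dev x0 ` A = T" using img[OF u(1) g0] img[OF g0 u(1)] unfolding T_def u(2) by blast
    then show "\<exists>q. homeomorphism A T (dev x0) q"
    proof (rule homeomorphism_injective_open_map[rotated])
      show "continuous_on A (dev x0)" unfolding u(2) by (rule continuous_on_subset[OF dev_continuous mSt(2)])
      show "inj_on (dev x0) A" by (rule inj)
      fix U assume U: "openin (top_of_set A) U"
      then have oU: "open U" by (rule openin_open_trans) (simp add: u(2) mSt(1))
      have UA: "U \<subseteq> A" by (rule openin_imp_subset[OF U])
      have "U \<subseteq> disc" using UA mSt(2)[of u] u(2) by blast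
      then have "openin (top_of_set S) (dev x0 ` U)" by (rule dev_open[OF oU])
      moreover have "dev x0 ` U \<subseteq> T" using UA \<open>dev x0 ` A = T\<close> by blast
      moreover have "T \<subseteq> S"
      proof -
        have "T \<subseteq> dev x0 ` disc" unfolding T_def by (rule image_mono[OF mSt(2)])
        then show ?thesis by (simp only: dev_surj)
      qed
      ultimately show "openin (top_of_set T) (dev x0 ` U)" by (rule openin_subset_trans)
    qed blast
  qed
qed

lemma deck_move: assumes "fold nb u x0 = x0" "h \<in> disc" shows "dev x0 (move u h) = dev x0 h"
proof -
  obtain v w where w: "w \<in> tile" "h = move v w" using disc_covered[OF assms(2)] by blast
  have "w \<in> disc" using w(1) tile_subset_disc by blast
  then have "move u h = move (u @ v) w" using w(2) move_append by simp
  then show ?thesis using dev_move[OF w(1)] w(2) assms(1) by simp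
qed

lemma deck_transitive:
  assumes w0: "w0 \<in> tile" and h: "h \<in> disc" "dev x0 h = snd x0 w0"
  obtains u where "fold nb u x0 = x0" "move u w0 = h"
proof -
  obtain v w where w: "w \<in> tile" "h = move v w" using disc_covered[OF h(1)] by blast
  have "dev x0 (move v w) = dev x0 (move [] w0)" using h(2) w(2) dev_move[OF w0, of "[]"] by simp
  from dev_eq_imp[OF w(1) w0 this] obtain k where
    k: "w = w0" "set k \<subseteq> sides w" "fold nb (v @ k) x0 = fold nb [] x0" .
  have "w \<in> disc" using w(1) tile_subset_disc by blast
  then have "move (v @ k) w0 = h" using move_append[of w v k] move_fixed[OF k(2)] k(1) w(2) by simp
  then show thesis using that[of "v @ k"] k(3) by simp
qed

lemma deck_even: "fold nb u x0 = x0 \<Longrightarrow> even (length u)"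
  using fold_nb_sign[OF x0, of u] by auto

text \<open>Equal displacements of \<open>w0\<close> leave only a word in the sides at
  \<open>w0\<close> undetermined, and that word fixes the lift \<open>x0\<close>.\<close>

lemma deck_faithful:
  assumes w0: "w0 \<in> tile" and u: "fold nb u x0 = x0" "fold nb u' x0 = x0" and m: "move u w0 = move u' w0"
  shows "u \<simeq> u'"
proof -
  obtain g where g: "set g \<subseteq> sides w0" "u \<simeq> u' @ g" using same_tile(2)[OF w0 w0 m] by blast
  have "fold nb g x0 = x0" using fold_nb_weq[OF g(2) x0] u by simp
  then have "g \<simeq> []" by (rule stabilizer_free[OF x0 w0 g(1)])
  then have "u' @ g \<simeq> u' @ []" by (intro weq_append weq.refl)
  then show ?thesis using g(2) weq.trans by simp
qed

text \<open>By the pigeonhole principle, since the powers of \<open>v\<close> move \<open>x0\<close>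
  through a finite set. In the sequel this replaces finiteness of the index.\<close>

lemma deck_power: "\<exists>k>0. fold nb (concat (replicate k v)) x0 = x0"
proof -
  define p where "p k = fold nb (concat (replicate k v)) x0" for k
  have "\<not> inj p"
  proof
    assume "inj p"
    then have "infinite (range p)" by (rule range_inj_infinite)
    moreover have "range p \<subseteq> lifts" unfolding p_def using fold_nb_lifts[OF x0] by blast
    ultimately show False using finite_lifts finite_subset by blast
  qed
  then obtain a b where ab: "a < b" "p a = p b" unfolding inj_def by (metis nat_neq_iff)
  let ?u = "concat (replicate a v)"
  have "concat (replicate b v) = concat (replicate (b - a) v) @ ?u"
    using ab(1) by (metis concat_append le_add_diff_inverse2 less_imp_le replicate_add)
  then have e: "fold nb ?u (fold nb (concat (replicate (b - a) v)) x0) = fold nb ?u x0" using ab(2) by (simp add: p_def)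
  have r: "fold nb (rev ?u) (fold nb ?u y) = y" if "y \<in> lifts" for y
    using fold_nb_weq[OF weq_rev_right that, of ?u] by simp
  have "fold nb (concat (replicate (b - a) v)) x0 = x0"
    using r[OF fold_nb_lifts[OF x0], of "concat (replicate (b - a) v)"] r[OF x0] unfolding e by simp
  then show ?thesis using ab(1) by (intro exI[of _ "b - a"]) simp
qed

end

end

subsection \<open>The fundamental group as a group of words\<close>

definition is_loop :: "'a::topological_space set \<Rightarrow> 'a \<Rightarrow> (real \<Rightarrow> 'a) \<Rightarrow> bool" where
  "is_loop S b p \<longleftrightarrow> path p \<and> path_image p \<subseteq> S \<and> pathstart p = b \<and> pathfinish p = b"

lemma loop_class_eqI: "homotopic_paths S p q \<Longrightarrow> loop_class S p = loop_class S q"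
  unfolding loop_class_def using homotopic_paths_sym homotopic_paths_trans by blast

lemma loop_class_self: "is_loop S b p \<Longrightarrow> p \<in> loop_class S p"
  by (simp add: loop_class_def is_loop_def)

lemma fundamental_group_carrierE:
  assumes "P \<in> carrier (fundamental_group S b)"
  obtains p where "is_loop S b p" "P = loop_class S p"
  using assms unfolding fundamental_group_def is_loop_def by auto

lemma fundamental_group_carrierI: "is_loop S b p \<Longrightarrow> loop_class S p \<in> carrier (fundamental_group S b)"
  unfolding fundamental_group_def is_loop_def by auto

lemma is_loop_join: "is_loop S b p \<Longrightarrow> is_loop S b q \<Longrightarrow> is_loop S b (p +++ q)"
  unfolding is_loop_def by (simp add: path_image_join)

text \<open>The product is a union over representatives; homotopy invariance of concatenation makes
  all its members the same class.\<close>

lemma fundamental_group_mult: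
  assumes "is_loop S b p" "is_loop S b q"
  shows "loop_class S p \<otimes>\<^bsub>fundamental_group S b\<^esub> loop_class S q = loop_class S (p +++ q)"
proof -
  have "loop_class S (p' +++ q') = loop_class S (p +++ q)"
    if "p' \<in> loop_class S p" "q' \<in> loop_class S q" for p' q'
  proof (rule loop_class_eqI, rule homotopic_paths_sym, rule homotopic_paths_join)
    show "homotopic_paths S p p'" "homotopic_paths S q q'" using that by (simp_all add: loop_class_def)
    show "pathfinish p = pathstart q" using assms by (simp add: is_loop_def)
  qed
  then have "(\<Union>p'\<in>loop_class S p. \<Union>q'\<in>loop_class S q. loop_class S (p' +++ q')) = loop_class S (p +++ q)"
    using loop_class_self[OF assms(1)] loop_class_self[OF assms(2)] by blast
  then show ?thesis by (simp add: fundamental_group_def)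
qed

lemma fundamental_group_mult_closed:
  assumes "P \<in> carrier (fundamental_group S b)" "Q \<in> carrier (fundamental_group S b)"
  shows "P \<otimes>\<^bsub>fundamental_group S b\<^esub> Q \<in> carrier (fundamental_group S b)"
proof -
  obtain p where p: "is_loop S b p" "P = loop_class S p" using fundamental_group_carrierE[OF assms(1)] .
  obtain q where q: "is_loop S b q" "Q = loop_class S q" using fundamental_group_carrierE[OF assms(2)] .
  show ?thesis unfolding p(2) q(2) fundamental_group_mult[OF p(1) q(1)]
    by (rule fundamental_group_carrierI[OF is_loop_join[OF p(1) q(1)]])
qed

context square_orbifold
begin

text \<open>The disc is simply connected, so loops correspond to deck transformations, and these are
  the words that fix the lift \<open>x0\<close>. Words are unique only up to \<open>weq\<close>,
  which is why one is chosen for every class and multiplicativity is an equivalence.\<close>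

lemma fundamental_group_words:
  fixes S1 :: "'a::t2_space set"
  assumes \<eta>: "homeomorphism S1 S \<eta> \<eta>'" and b: "b \<in> S1"
  defines "\<Gamma> \<equiv> fundamental_group S1 b"
  shows "\<exists>h. (\<forall>P\<in>carrier \<Gamma>. even (length (h P))) \<and>
     (\<forall>P\<in>carrier \<Gamma>. \<forall>Q\<in>carrier \<Gamma>. h (P \<otimes>\<^bsub>\<Gamma>\<^esub> Q) \<simeq> h P @ h Q) \<and>
     (\<forall>P\<in>carrier \<Gamma>. \<forall>Q\<in>carrier \<Gamma>. h P \<simeq> h Q \<longrightarrow> P = Q) \<and>
     (\<forall>v. \<exists>k>0. \<exists>P\<in>carrier \<Gamma>. h P \<simeq> concat (replicate k v))"
proof -
  have \<eta>S: "\<eta> z \<in> S" if "z \<in> S1" for z using homeomorphism_image1[OF \<eta>] that by blast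
  have \<eta>'S: "\<eta>' z \<in> S1" if "z \<in> S" for z using homeomorphism_image2[OF \<eta>] that by blast
  have c\<eta>: "continuous_on S1 \<eta>" and c\<eta>': "continuous_on S \<eta>'"
    using homeomorphism_cont1[OF \<eta>] homeomorphism_cont2[OF \<eta>] .
  obtain x0 w0 where x0: "x0 \<in> lifts" and w0: "w0 \<in> tile" "snd x0 w0 = \<eta> b"
    using lift_through[OF \<eta>S[OF b]] .
  let ?\<pi> = "dev x0"
  have w0d: "w0 \<in> disc" using w0 tile_subset_disc by blast
  have cov: "covering_space disc ?\<pi> S" by (rule dev_covering[OF x0])
  have \<pi>0: "?\<pi> w0 = \<eta> b" using dev_move[OF x0 w0(1), of "[]"] w0(2) by simp
  \<comment> \<open>The word \<open>u\<close> is a deck transformation and describes where the lift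
    of the loop \<open>p\<close> from \<open>w0\<close> ends.\<close>
  define R where "R p u \<longleftrightarrow> fold nb u x0 = x0 \<and> (\<exists>h. path h \<and> path_image h \<subseteq> disc \<and> pathstart h = w0 \<and>
      pathfinish h = move u w0 \<and> (\<forall>t\<in>{0..1}. ?\<pi> (h t) = \<eta> (p t)))" for p u
  have \<eta>path: "path (\<eta> \<circ> p)" "path_image (\<eta> \<circ> p) \<subseteq> S" if "is_loop S1 b p" for p
    using that \<eta>S unfolding is_loop_def
    by (auto intro!: path_continuous_image continuous_on_subset[OF c\<eta>] simp: path_image_compose)
  have R_ex: "\<exists>u. R p u" if p: "is_loop S1 b p" for p
  proof -
    have "pathstart (\<eta> \<circ> p) = ?\<pi> w0" using p \<pi>0 by (simp add: is_loop_def pathstart_compose)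
    from covering_space_lift_path_strong[OF cov w0d \<eta>path[OF p] this]
    obtain h where h: "path h" "path_image h \<subseteq> disc" "pathstart h = w0"
      "\<And>t. t \<in> {0..1} \<Longrightarrow> ?\<pi> (h t) = (\<eta> \<circ> p) t" by blast
    have "pathfinish h \<in> disc" using h(2) by (simp add: pathfinish_in_path_image subsetD)
    moreover have "?\<pi> (pathfinish h) = snd x0 w0"
      using h(4)[of 1] p w0(2) by (simp add: is_loop_def pathfinish_def)
    ultimately obtain u where "fold nb u x0 = x0" "move u w0 = pathfinish h"
      by (rule deck_transitive[OF x0 w0(1)])
    then have "R p u" unfolding R_def using h by (intro conjI exI[of _ h]) simp_all
    then show ?thesis by blast
  qed
  have R_hom: "u \<simeq> u'" if pp: "homotopic_paths S1 p p'" "is_loop S1 b p" "is_loop S1 b p'" and R: "R p u" "R p' u'" for p p' u u'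
  proof -
    obtain h where h: "path h" "path_image h \<subseteq> disc" "pathstart h = w0" "pathfinish h = move u w0"
      "\<And>t. t \<in> {0..1} \<Longrightarrow> ?\<pi> (h t) = (\<eta> \<circ> p) t" using R(1) unfolding R_def comp_def by blast
    obtain h' where h': "path h'" "path_image h' \<subseteq> disc" "pathstart h' = w0" "pathfinish h' = move u' w0"
      "\<And>t. t \<in> {0..1} \<Longrightarrow> ?\<pi> (h' t) = (\<eta> \<circ> p') t" using R(2) unfolding R_def comp_def by blast
    have "homotopic_paths S (\<eta> \<circ> p) (\<eta> \<circ> p')"
      by (rule homotopic_paths_continuous_image[OF pp(1) c\<eta>]) (use \<eta>S in blast)
    from covering_space_lift_homotopic_paths[OF cov \<eta>path[OF pp(2)] \<eta>path[OF pp(3)] this h(1,2,5) h'(1,2,5)]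
    have "homotopic_paths disc h h'" using h(3) h'(3) by simp
    then have "move u w0 = move u' w0" using homotopic_paths_imp_pathfinish h(4) h'(4) by metis
    then show ?thesis using deck_faithful[OF x0 w0(1)] R unfolding R_def by blast
  qed
  have R_join: "R (p +++ p') (u @ u')" if R: "R p u" "R p' u'" for p p' u u'
  proof -
    obtain h where h: "path h" "path_image h \<subseteq> disc" "pathstart h = w0" "pathfinish h = move u w0"
      "\<And>t. t \<in> {0..1} \<Longrightarrow> ?\<pi> (h t) = \<eta> (p t)" using R(1) unfolding R_def by blast
    obtain h' where h': "path h'" "path_image h' \<subseteq> disc" "pathstart h' = w0" "pathfinish h' = move u' w0"
      "\<And>t. t \<in> {0..1} \<Longrightarrow> ?\<pi> (h' t) = \<eta> (p' t)" using R(2) unfolding R_def by blast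
    have u: "fold nb u x0 = x0" "fold nb u' x0 = x0" using R unfolding R_def by blast+
    \<comment> \<open>The second lift is translated by the first deck transformation so that the two
      can be joined; this order makes concatenation of loops concatenation of words.\<close>
    let ?k = "move u \<circ> h'"
    have k: "path ?k" "path_image ?k \<subseteq> disc" "pathstart ?k = move u w0" "pathfinish ?k = move (u @ u') w0"
    proof -
      show "path ?k" by (rule path_continuous_image[OF h'(1) continuous_on_subset[OF continuous_move h'(2)]])
      show "path_image ?k \<subseteq> disc" using h'(2) move_disc unfolding path_image_compose by blast
      show "pathstart ?k = move u w0" by (simp add: pathstart_compose h'(3))
      show "pathfinish ?k = move (u @ u') w0" by (simp add: pathfinish_compose h'(4) move_append[OF w0d])
    qed
    have "?\<pi> ((h +++ ?k) t) = \<eta> ((p +++ p') t)" if t: "t \<in> {0..1}" for t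
    proof (cases "t \<le> 1/2")
      case True
      then show ?thesis using h(5)[of "2 * t"] t by (simp add: joinpaths_def)
    next
      case False
      then have r: "2 * t - 1 \<in> {0..1}" using t by simp
      then have "h' (2 * t - 1) \<in> disc" using h'(2) unfolding path_image_def by blast
      then show ?thesis using False h'(5)[OF r] deck_move[OF x0 u(1)] by (simp add: joinpaths_def)
    qed
    moreover have "path (h +++ ?k)" using h k by simp
    moreover have "path_image (h +++ ?k) \<subseteq> disc" using h k by (simp add: path_image_join)
    moreover have "fold nb (u @ u') x0 = x0" using u by simp
    ultimately show ?thesis unfolding R_def using h(3) k(4) by (intro conjI exI[of _ "h +++ ?k"]) simp_all
  qed
  have R_inj: "homotopic_paths S1 p p'" if pp: "is_loop S1 b p" "is_loop S1 b p'" and R: "R p u" "R p' u'" and uu: "u \<simeq> u'" for p p' u u'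
  proof -
    obtain h where h: "path h" "path_image h \<subseteq> disc" "pathstart h = w0" "pathfinish h = move u w0"
      "\<And>t. t \<in> {0..1} \<Longrightarrow> ?\<pi> (h t) = \<eta> (p t)" using R(1) unfolding R_def by blast
    obtain h' where h': "path h'" "path_image h' \<subseteq> disc" "pathstart h' = w0" "pathfinish h' = move u' w0"
      "\<And>t. t \<in> {0..1} \<Longrightarrow> ?\<pi> (h' t) = \<eta> (p' t)" using R(2) unfolding R_def by blast
    have "pathfinish h' = pathfinish h" using h(4) h'(4) weq_move[OF uu] by simp
    moreover have "simply_connected disc" by (rule convex_imp_simply_connected[OF convex_disc])
    ultimately have hh: "homotopic_paths disc h h'"
      using h(1-3) h'(1-3) unfolding simply_connected_eq_homotopic_paths by simp
    have cont: "continuous_on disc (\<eta>' \<circ> ?\<pi>)"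
      by (rule continuous_on_compose[OF dev_continuous[OF x0]]) (simp add: dev_surj[OF x0] c\<eta>')
    have "\<eta>' \<circ> ?\<pi> \<in> disc \<rightarrow> S1" using dev_S[OF x0] \<eta>'S by simp
    from homotopic_paths_continuous_image[OF hh cont this]
    have H: "homotopic_paths S1 (\<eta>' \<circ> ?\<pi> \<circ> h) (\<eta>' \<circ> ?\<pi> \<circ> h')" .
    have e: "homotopic_paths S1 q (\<eta>' \<circ> ?\<pi> \<circ> g)" if q: "is_loop S1 b q" and g: "\<And>t. t \<in> {0..1} \<Longrightarrow> ?\<pi> (g t) = \<eta> (q t)" for q g
    proof (rule homotopic_paths_eq)
      show "path q" "path_image q \<subseteq> S1" using q by (simp_all add: is_loop_def)
      fix t :: real assume t: "t \<in> {0..1}"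
      then have "q t \<in> S1" using q unfolding is_loop_def path_image_def by blast
      then show "q t = (\<eta>' \<circ> ?\<pi> \<circ> g) t" using g[OF t] homeomorphism_apply1[OF \<eta>] by simp
    qed
    show ?thesis using homotopic_paths_trans[OF homotopic_paths_trans[OF e[OF pp(1) h(5)] H] homotopic_paths_sym[OF e[OF pp(2) h'(5)]]]
      by simp
  qed
  have R_surj: "\<exists>p. is_loop S1 b p \<and> R p u" if u: "fold nb u x0 = x0" for u
  proof -
    \<comment> \<open>Every deck transformation is realised by projecting the straight segment from
      \<open>w0\<close> to its image.\<close>
    let ?h = "linepath w0 (move u w0)"
    have m: "move u w0 \<in> disc" by (rule move_disc[OF w0d])
    have im: "path_image ?h \<subseteq> disc" using convex_disc w0d m by (simp add: convex_contains_segment)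
    define p where "p = \<eta>' \<circ> ?\<pi> \<circ> ?h"
    have cont: "continuous_on disc (\<eta>' \<circ> ?\<pi>)"
      by (rule continuous_on_compose[OF dev_continuous[OF x0]]) (simp add: dev_surj[OF x0] c\<eta>')
    have b': "\<eta>' (\<eta> b) = b" by (rule homeomorphism_apply1[OF \<eta> b])
    have "path p" unfolding p_def
      by (rule path_continuous_image[OF path_linepath continuous_on_subset[OF cont im]])
    moreover have "path_image p \<subseteq> S1"
      unfolding p_def path_image_compose using im dev_S[OF x0] \<eta>'S by (auto simp: image_subset_iff subset_iff simp del: path_image_linepath)
    moreover have "pathstart p = b" "pathfinish p = b"
      using b' \<pi>0 deck_move[OF x0 u w0d] by (simp_all add: p_def pathstart_compose pathfinish_compose)
    ultimately have l: "is_loop S1 b p" by (simp add: is_loop_def)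
    have "?\<pi> (?h t) = \<eta> (p t)" if t: "t \<in> {0..1}" for t
    proof -
      have "?h t \<in> disc" using im t unfolding path_image_def by blast
      then show ?thesis using homeomorphism_apply2[OF \<eta> dev_S[OF x0]] by (simp add: p_def)
    qed
    then have "R p u" unfolding R_def using u im by (intro conjI exI[of _ ?h]) simp_all
    then show ?thesis using l by blast
  qed
  define h where "h P = (SOME u. \<exists>p. is_loop S1 b p \<and> P = loop_class S1 p \<and> R p u)" for P
  have h: "\<exists>p. is_loop S1 b p \<and> P = loop_class S1 p \<and> R p (h P)" if "P \<in> carrier \<Gamma>" for P
    unfolding h_def
  proof (rule someI_ex)
    have PC: "P \<in> carrier (fundamental_group S1 b)" using that by (simp add: \<Gamma>_def)
    obtain p where "is_loop S1 b p" "P = loop_class S1 p" using fundamental_group_carrierE[OF PC] .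
    moreover obtain u where "R p u" using R_ex[OF \<open>is_loop S1 b p\<close>] by blast
    ultimately show "\<exists>u p. is_loop S1 b p \<and> P = loop_class S1 p \<and> R p u" by blast
  qed
  have homot: "homotopic_paths S1 p p'" if "loop_class S1 p = loop_class S1 p'" "is_loop S1 b p'" for p p'
    using loop_class_self[OF that(2)] that(1) by (auto simp: loop_class_def)
  have uniq: "h P \<simeq> u" if P: "P \<in> carrier \<Gamma>" "is_loop S1 b p" "P = loop_class S1 p" "R p u" for P p u
  proof -
    obtain q where q: "is_loop S1 b q" "P = loop_class S1 q" "R q (h P)" using h[OF P(1)] by blast
    have "homotopic_paths S1 q p" using homot[of q p] q(2) P(2,3) by simp
    then show ?thesis by (rule R_hom[OF _ q(1) P(2) q(3) P(4)])
  qed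
  show ?thesis
  proof (intro exI[of _ h] conjI ballI allI impI)
    fix P assume P: "P \<in> carrier \<Gamma>"
    then show "even (length (h P))" using h deck_even[OF x0] unfolding R_def by blast
    fix Q assume Q: "Q \<in> carrier \<Gamma>"
    obtain p where p: "is_loop S1 b p" "P = loop_class S1 p" "R p (h P)" using h[OF P] by blast
    obtain q where q: "is_loop S1 b q" "Q = loop_class S1 q" "R q (h Q)" using h[OF Q] by blast
    have PQ: "P \<otimes>\<^bsub>\<Gamma>\<^esub> Q = loop_class S1 (p +++ q)"
      unfolding \<Gamma>_def p(2) q(2) by (rule fundamental_group_mult[OF p(1) q(1)])
    show "h (P \<otimes>\<^bsub>\<Gamma>\<^esub> Q) \<simeq> h P @ h Q"
    proof (rule uniq[OF _ is_loop_join[OF p(1) q(1)] PQ R_join[OF p(3) q(3)]])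
      show "P \<otimes>\<^bsub>\<Gamma>\<^esub> Q \<in> carrier \<Gamma>" using fundamental_group_mult_closed P Q unfolding \<Gamma>_def by blast
    qed
    assume "h P \<simeq> h Q"
    then have "homotopic_paths S1 p q" by (rule R_inj[OF p(1) q(1) p(3) q(3)])
    then show "P = Q" unfolding p(2) q(2) by (rule loop_class_eqI)
  next
    fix v
    obtain k where k: "k > 0" "fold nb (concat (replicate k v)) x0 = x0" using deck_power[OF x0] by blast
    obtain p where p: "is_loop S1 b p" "R p (concat (replicate k v))" using R_surj[OF k(2)] by blast
    have P: "loop_class S1 p \<in> carrier \<Gamma>" unfolding \<Gamma>_def by (rule fundamental_group_carrierI[OF p(1)])
    show "\<exists>k>0. \<exists>P\<in>carrier \<Gamma>. h P \<simeq> concat (replicate k v)"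
      using k(1) P uniq[OF P p(1) HOL.refl p(2)] by blast
  qed
qed

end

subsection \<open>Embedding closed surfaces, and the sphere with four cone points\<close>

text \<open>Zero outside the chart is a continuous extension because the support is the image of a
  compact disc, hence closed in the Hausdorff space.\<close>

lemma bump_continuous:
  fixes S :: "'a::t2_space set" and k :: "complex \<Rightarrow> real"
  assumes U: "openin (top_of_set S) U" and \<phi>: "homeomorphism U (ball 0 1) \<phi> \<phi>'"
    and k: "continuous_on UNIV k" "\<And>z. z \<notin> cball c r \<Longrightarrow> k z = 0" "cball c r \<subseteq> ball 0 1"
  shows "continuous_on S (\<lambda>z. if z \<in> U then k (\<phi> z) else 0)"
proof -
  define K where "K = \<phi>' ` cball c r"
  have "compact K" unfolding K_def
    by (intro compact_continuous_image continuous_on_subset[OF homeomorphism_cont2[OF \<phi>] k(3)] compact_cball)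
  then have clK: "closed K" by (rule compact_imp_closed)
  have US: "U \<subseteq> S" by (rule openin_imp_subset[OF U])
  have KU: "K \<subseteq> U" unfolding K_def using k(3) homeomorphism_image2[OF \<phi>] by blast
  have eq: "U \<union> (S - K) = S" using US KU by blast
  have "continuous_on (U \<union> (S - K)) (\<lambda>z. if z \<in> U then k (\<phi> z) else 0)"
  proof (rule continuous_on_cases_local_open)
    show "openin (top_of_set (U \<union> (S - K))) U" unfolding eq by (rule U)
    show "openin (top_of_set (U \<union> (S - K))) (S - K)" unfolding eq using clK
      by (metis Diff_eq openin_open_Int open_Compl)
    show "continuous_on U (\<lambda>z. k (\<phi> z))"
      by (rule continuous_on_compose2[OF k(1) homeomorphism_cont1[OF \<phi>]]) simp
    fix x assume "x \<in> U \<and> x \<notin> U \<or> x \<in> S - K \<and> x \<in> U"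
    then have x: "x \<in> U" "x \<notin> K" by auto
    have "\<phi> x \<notin> cball c r"
    proof
      assume "\<phi> x \<in> cball c r"
      then have "\<phi>' (\<phi> x) \<in> K" unfolding K_def by (rule imageI)
      then show False using homeomorphism_apply1[OF \<phi> x(1)] x(2) by simp
    qed
    then show "k (\<phi> x) = 0" by (rule k(2))
  qed simp
  then show ?thesis unfolding eq .
qed

text \<open>The covering space library is restricted to normed spaces, hence the need for an embedding.\<close>

lemma surface_embedding:
  fixes S :: "'a::t2_space set"
  assumes cS: "compact S"
    and loc: "\<And>x. x \<in> S \<Longrightarrow> \<exists>U. openin (top_of_set S) U \<and> x \<in> U \<and> U homeomorphic ball (0::complex) 1"
  obtains S' :: "(nat \<Rightarrow>\<^sub>C real) set" and \<eta> \<eta>' where "homeomorphism S S' \<eta> \<eta>'"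
proof -
  have "\<exists>U \<phi> \<phi>'. openin (top_of_set S) U \<and> x \<in> U \<and> homeomorphism U (ball (0::complex) 1) \<phi> \<phi>'" if "x \<in> S" for x
    using loc[OF that] unfolding homeomorphic_def by blast
  then obtain U \<phi> \<phi>' where U: "\<And>x. x \<in> S \<Longrightarrow> openin (top_of_set S) (U x)" "\<And>x. x \<in> S \<Longrightarrow> x \<in> U x"
    and \<phi>: "\<And>x. x \<in> S \<Longrightarrow> homeomorphism (U x) (ball (0::complex) 1) (\<phi> x) (\<phi>' x)" by metis
  define c where "c x = \<phi> x x" for x
  \<comment> \<open>Half the distance from the chart value of \<open>x\<close> to the unit circle,
    so that the closed disc of this radius stays inside the chart.\<close>
  define r where "r x = (1 - norm (c x)) / 2" for x
  define bump where "bump x w = max 0 (r x - dist w (c x))" for x and w :: complex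
  have c1: "norm (c x) < 1" if "x \<in> S" for x
    using homeomorphism_image1[OF \<phi>[OF that]] U(2)[OF that] unfolding c_def by auto
  have rpos: "r x > 0" if "x \<in> S" for x using c1[OF that] by (simp add: r_def)
  have cball: "cball (c x) (r x) \<subseteq> ball 0 1" if "x \<in> S" for x
  proof
    fix z assume "z \<in> cball (c x) (r x)"
    then have "norm z \<le> norm (c x) + r x"
      using norm_triangle_ineq2[of z "c x"] by (simp add: dist_norm norm_minus_commute)
    moreover have "norm (c x) + r x < 1" using c1[OF that] by (simp add: r_def field_simps)
    ultimately show "z \<in> ball 0 1" by simp
  qed
  \<comment> \<open>Each chart contributes its bump and the bump times both chart coordinates: where
    the bump is positive, these three functions recover the chart value.\<close>
  define fn where "fn n w = (if n = 0 then 1 else if n = 1 then Re w else Im w)" for n :: nat and w :: complex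
  define G where "G p z = (if z \<in> U (fst p) then bump (fst p) (\<phi> (fst p) z) * fn (snd p) (\<phi> (fst p) z) else 0)"
    for p :: "'a \<times> nat" and z
  have contG: "continuous_on S (G p)" if "fst p \<in> S" for p
    unfolding G_def
  proof (rule bump_continuous[OF U(1)[OF that] \<phi>[OF that]])
    show "continuous_on UNIV (\<lambda>w. bump (fst p) w * fn (snd p) w)"
      unfolding bump_def fn_def by (cases "snd p = 0"; cases "snd p = 1") (auto intro!: continuous_intros)
    show "bump (fst p) z * fn (snd p) z = 0" if "z \<notin> cball (c (fst p)) (r (fst p))" for z
      using that by (simp add: bump_def dist_commute)
    show "cball (c (fst p)) (r (fst p)) \<subseteq> ball 0 1" by (rule cball[OF that])
  qed
  define N where "N x = {z \<in> S. G (x, 0) z > 0}" for x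
  have oN: "openin (top_of_set S) (N x)" if "x \<in> S" for x
  proof -
    have "openin (top_of_set S) (S \<inter> G (x, 0) -` {0<..})"
      by (rule continuous_openin_preimage_gen[OF contG open_greaterThan]) (simp add: that)
    moreover have "S \<inter> G (x, 0) -` {0<..} = N x" unfolding N_def by auto
    ultimately show ?thesis by simp
  qed
  have xN: "x \<in> N x" if "x \<in> S" for x
    using U(2)[OF that] rpos[OF that] that unfolding N_def G_def by (simp add: fn_def bump_def c_def)
  have "(\<forall>c\<in>N ` S. openin (top_of_set S) c) \<and> S \<subseteq> \<Union>(N ` S)" using oN xN by blast
  from cS[unfolded compact_eq_openin_cover, rule_format, OF this]
  obtain D where D: "D \<subseteq> N ` S" "finite D" "S \<subseteq> \<Union>D" by blast
  obtain X where X: "X \<subseteq> S" "finite X" "D = N ` X" using finite_subset_image[OF D(2,1)] by blast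
  define I where "I = X \<times> {0, 1, 2 :: nat}"
  have "finite I" unfolding I_def using X(2) by simp
  from finite_imp_inj_to_nat_seg[OF this]
  obtain m :: "'a \<times> nat \<Rightarrow> nat" and n :: nat where m: "m ` I = {i. i < n}" "inj_on m I" by (elim exE conjE)
  \<comment> \<open>The number of charts depends on the surface, so the coordinates are placed at
    finitely many positions of one fixed sequence space.\<close>
  define E where "E j = Bcontfun (\<lambda>i::nat. if i = j then 1 else 0 :: real)" for j
  have E: "apply_bcontfun (E j) i = (if i = j then 1 else 0)" for i j
  proof -
    have "(\<lambda>i::nat. if i = j then 1 else 0 :: real) \<in> bcontfun"
    proof (rule bcontfun_normI)
      show "norm (if i = j then 1 else 0 :: real) \<le> 1" for i by simp
    qed simp
    then show ?thesis unfolding E_def by (simp add: Bcontfun_inverse)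
  qed
  define \<eta> where "\<eta> z = (\<Sum>p\<in>I. G p z *\<^sub>R E (m p))" for z
  have app: "apply_bcontfun (\<eta> z) i = (\<Sum>p\<in>I. G p z * (if i = m p then 1 else 0))" for z i
  proof -
    have "apply_bcontfun (\<Sum>p\<in>J. G p z *\<^sub>R E (m p)) i = (\<Sum>p\<in>J. G p z * (if i = m p then 1 else 0))"
      if "finite J" for J
      using that by (induction J) (simp_all add: E scaleR_bcontfun.rep_eq plus_bcontfun.rep_eq zero_bcontfun.rep_eq)
    then show ?thesis unfolding \<eta>_def using \<open>finite I\<close> by blast
  qed
  have coord: "apply_bcontfun (\<eta> z) (m q) = G q z" if "q \<in> I" for z q
  proof -
    have "(\<Sum>p\<in>I. G p z * (if m q = m p then 1 else 0)) = (\<Sum>p\<in>I. if p = q then G p z else 0)"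
      using m(2) that by (intro sum.cong) (auto simp: inj_on_def)
    also have "\<dots> = G q z" using that \<open>finite I\<close> by simp
    finally show ?thesis unfolding app .
  qed
  have contE: "continuous_on S \<eta>" unfolding \<eta>_def
  proof (intro continuous_on_sum continuous_on_scaleR continuous_on_const)
    fix p assume "p \<in> I"
    then have "fst p \<in> S" using X(1) unfolding I_def by auto
    then show "continuous_on S (\<lambda>z. G p z)" using contG by blast
  qed
  have "inj_on \<eta> S"
  proof (rule inj_onI)
    fix z z' assume z: "z \<in> S" "z' \<in> S" "\<eta> z = \<eta> z'"
    have eqG: "G q z = G q z'" if "q \<in> I" for q using coord[OF that] z(3) by metis
    obtain x where x: "x \<in> X" "z \<in> N x" using z(1) D(3) X(3) by blast
    have xS: "x \<in> S" using x(1) X(1) by blast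
    have xI: "(x, 0) \<in> I" "(x, 1) \<in> I" "(x, 2) \<in> I" using x(1) unfolding I_def by auto
    have pos: "G (x, 0) z > 0" "G (x, 0) z' > 0" using x(2) eqG[OF xI(1)] unfolding N_def by auto
    then have zU: "z \<in> U x" "z' \<in> U x" unfolding G_def by (auto split: if_splits)
    have b: "bump x (\<phi> x z) = bump x (\<phi> x z')" "bump x (\<phi> x z') > 0"
      using eqG[OF xI(1)] pos zU unfolding G_def fn_def by auto
    have "Re (\<phi> x z) = Re (\<phi> x z')" "Im (\<phi> x z) = Im (\<phi> x z')"
      using eqG[OF xI(2)] eqG[OF xI(3)] zU b unfolding G_def fn_def by auto
    then have "\<phi> x z = \<phi> x z'" by (rule complex_eqI)
    then show "z = z'" using homeomorphism_apply1[OF \<phi>[OF xS]] zU by metis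
  qed
  then obtain \<eta>' where "homeomorphism S (\<eta> ` S) \<eta> \<eta>'"
    using homeomorphism_compact[OF cS contE] by blast
  then show thesis by (rule that)
qed

section \<open>Transport of orbifold coverings along homeomorphisms\<close>

lemma cone_chart_transport:
  assumes h: "homeomorphism X X' h h'" and c: "cone_chart X c x U \<phi>"
  shows "cone_chart X' (c \<circ> h') (h x) (h ` U) (\<phi> \<circ> h')"
proof -
  have U: "openin (top_of_set X) U" "x \<in> U" "\<phi> x = 0" "c x \<ge> 1" "\<forall>z\<in>U - {x}. c z = 1"
    using c by (auto simp: cone_chart_def)
  obtain \<phi>' where \<phi>': "homeomorphism U (ball 0 1) \<phi> \<phi>'" using c by (auto simp: cone_chart_def)
  have UX: "U \<subseteq> X" by (rule openin_imp_subset[OF U(1)])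
  have hh: "h' (h z) = z" if "z \<in> U" for z using homeomorphism_apply1[OF h] UX that by blast
  have "homeomorphism (h ` U) U h' h"
    by (rule homeomorphism_symD, rule homeomorphism_of_subsets[OF h UX])
      (use homeomorphism_image1[OF h] UX in blast)+
  from homeomorphism_compose[OF this \<phi>'] have "homeomorphism (h ` U) (ball 0 1) (\<phi> \<circ> h') (h \<circ> \<phi>')" .
  moreover have "openin (top_of_set X') (h ` U)" by (rule homeomorphism_imp_open_map[OF h U(1)])
  ultimately show ?thesis unfolding cone_chart_def using U hh by auto
qed

lemma orbifold_covering_transport:
  assumes h: "homeomorphism X X' h h'" and k: "homeomorphism Y Y' k k'" and f: "orbifold_covering X c Y d f"
  shows "orbifold_covering X' (c \<circ> h') Y' (d \<circ> k') (k \<circ> f \<circ> h')"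
proof -
  have fc: "continuous_on X f" and fi: "f ` X = Y" using f by (auto simp: orbifold_covering_def)
  have h'X: "h' z \<in> X" if "z \<in> X'" for z using homeomorphism_image2[OF h] that by blast
  show ?thesis
    unfolding orbifold_covering_def
  proof (intro conjI ballI)
    have "continuous_on X' (f \<circ> h')"
      by (rule continuous_on_compose[OF homeomorphism_cont2[OF h]]) (simp add: homeomorphism_image2[OF h] fc)
    moreover have "(f \<circ> h') ` X' = Y" unfolding image_comp[symmetric] homeomorphism_image2[OF h] fi ..
    then have "continuous_on ((f \<circ> h') ` X') k" using homeomorphism_cont1[OF k] by simp
    ultimately show "continuous_on X' (k \<circ> f \<circ> h')"
      unfolding comp_assoc by (rule continuous_on_compose)
    show "(k \<circ> f \<circ> h') ` X' = Y'"
    proof -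
      have "(k \<circ> f \<circ> h') ` X' = k ` (f ` (h' ` X'))" by (simp add: image_image)
      then show ?thesis by (simp only: homeomorphism_image2[OF h] fi homeomorphism_image1[OF k])
    qed
    fix y' assume y': "y' \<in> Y'"
    have yY: "k' y' \<in> Y" using homeomorphism_image2[OF k] y' by blast
    have ky: "k (k' y') = y'" by (rule homeomorphism_apply2[OF k y'])
    obtain U \<psi> \<V> where U: "cone_chart Y d (k' y') U \<psi>" and V: "\<Union>\<V> = X \<inter> f -` U" "pairwise disjnt \<V>"
      and ch: "\<forall>V\<in>\<V>. \<exists>x \<phi>. cone_chart X c x V \<phi> \<and> c x dvd d (k' y') \<and>
              (\<forall>v\<in>V. \<psi> (f v) = \<phi> v ^ (d (k' y') div c x))"
      using f[unfolded orbifold_covering_def, THEN conjunct2, THEN conjunct2, THEN bspec, OF yY]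
      by (elim exE conjE)
    have UY: "U \<subseteq> Y" using U openin_imp_subset unfolding cone_chart_def by blast
    have VX: "V \<subseteq> X" if "V \<in> \<V>" for V using that V(1) by blast
    have c1: "cone_chart Y' (d \<circ> k') y' (k ` U) (\<psi> \<circ> k')"
      using cone_chart_transport[OF k U] ky by simp
    have un: "\<Union>((`) h ` \<V>) = X' \<inter> (k \<circ> f \<circ> h') -` (k ` U)"
    proof (intro Set.equalityI subsetI)
      fix z assume "z \<in> \<Union>((`) h ` \<V>)"
      then obtain V v where v: "V \<in> \<V>" "v \<in> V" "z = h v" by blast
      have vX: "v \<in> X" "f v \<in> U" using v V(1) by blast+
      then show "z \<in> X' \<inter> (k \<circ> f \<circ> h') -` (k ` U)"
        using v(3) homeomorphism_apply1[OF h vX(1)] homeomorphism_image1[OF h] by auto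
    next
      fix z assume z: "z \<in> X' \<inter> (k \<circ> f \<circ> h') -` (k ` U)"
      then obtain u where u: "u \<in> U" "k (f (h' z)) = k u" by auto
      have "f (h' z) \<in> Y" using fi h'X z by blast
      then have "f (h' z) = u" using u homeomorphism_apply1[OF k] UY by (metis subsetD)
      then have "h' z \<in> X \<inter> f -` U" using u(1) h'X z by simp
      then obtain V where "V \<in> \<V>" "h' z \<in> V" using V(1) by blast
      moreover have "h (h' z) = z" using homeomorphism_apply2[OF h] z by simp
      ultimately show "z \<in> \<Union>((`) h ` \<V>)" by (metis UN_iff imageI)
    qed
    have dj: "pairwise disjnt ((`) h ` \<V>)"
    proof (rule pairwiseI)
      fix A B assume "A \<in> (`) h ` \<V>" "B \<in> (`) h ` \<V>" "A \<noteq> B"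
      then obtain V W where VW: "V \<in> \<V>" "W \<in> \<V>" "A = h ` V" "B = h ` W" "V \<noteq> W" by blast
      have "inj_on h X" using homeomorphism_apply1[OF h] by (metis inj_onI)
      moreover have "disjnt V W" using V(2) VW unfolding pairwise_def by blast
      ultimately show "disjnt A B"
        using VX[OF VW(1)] VX[OF VW(2)] unfolding VW disjnt_def inj_on_def by blast
    qed
    have ch': "\<exists>x \<phi>. cone_chart X' (c \<circ> h') x A \<phi> \<and> (c \<circ> h') x dvd (d \<circ> k') y' \<and>
              (\<forall>v\<in>A. (\<psi> \<circ> k') ((k \<circ> f \<circ> h') v) = \<phi> v ^ ((d \<circ> k') y' div (c \<circ> h') x))" if A: "A \<in> (`) h ` \<V>" for A
    proof -
      obtain V where V: "V \<in> \<V>" "A = h ` V" using A by blast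
      obtain x \<phi> where x: "cone_chart X c x V \<phi>" "c x dvd d (k' y')"
        "\<And>v. v \<in> V \<Longrightarrow> \<psi> (f v) = \<phi> v ^ (d (k' y') div c x)" using ch V(1) by blast
      have xX: "x \<in> X" using x(1) VX[OF V(1)] unfolding cone_chart_def by blast
      have hx: "h' (h x) = x" by (rule homeomorphism_apply1[OF h xX])
      have "(\<psi> \<circ> k') ((k \<circ> f \<circ> h') v') = (\<phi> \<circ> h') v' ^ ((d \<circ> k') y' div (c \<circ> h') (h x))" if v': "v' \<in> A" for v'
      proof -
        obtain v where v: "v \<in> V" "v' = h v" using v' V(2) by blast
        have vX: "v \<in> X" using v(1) VX[OF V(1)] by blast
        have "f v \<in> Y" using fi vX by blast
        then show ?thesis
          using v(2) homeomorphism_apply1[OF h vX] homeomorphism_apply1[OF k] x(3)[OF v(1)] hx by simp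
      qed
      moreover have "cone_chart X' (c \<circ> h') (h x) A (\<phi> \<circ> h')" unfolding V(2) by (rule cone_chart_transport[OF h x(1)])
      moreover have "(c \<circ> h') (h x) dvd (d \<circ> k') y'" using x(2) hx by simp
      ultimately show ?thesis by blast
    qed
    show "\<exists>U \<psi>. cone_chart Y' (d \<circ> k') y' U \<psi> \<and>
        (\<exists>\<V>. \<Union>\<V> = X' \<inter> (k \<circ> f \<circ> h') -` U \<and> pairwise disjnt \<V> \<and>
           (\<forall>V\<in>\<V>. \<exists>x \<phi>. cone_chart X' (c \<circ> h') x V \<phi> \<and> (c \<circ> h') x dvd (d \<circ> k') y' \<and>
              (\<forall>v\<in>V. \<psi> ((k \<circ> f \<circ> h') v) = \<phi> v ^ ((d \<circ> k') y' div (c \<circ> h') x))))"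
      by (rule exI[of _ "k ` U"], rule exI[of _ "\<psi> \<circ> k'"], intro conjI c1,
          rule exI[of _ "(`) h ` \<V>"], intro conjI un dj ballI ch')
  qed
qed

text \<open>A graph over the square, above or below it, whose height vanishes exactly on the
  boundary, so that the two faces are glued there.\<close>

definition face :: "bool \<Rightarrow> real \<times> real \<Rightarrow> (real \<times> real) \<times> real" where
  "face e w = (w, sg e * (1 - max \<bar>fst w\<bar> \<bar>snd w\<bar>))"

definition pillow :: "((real \<times> real) \<times> real) set" where
  "pillow = face True ` tile \<union> face False ` tile"

text \<open>The solid double pyramid over the square. The union of the two faces is its boundary,
  and boundaries of bounded convex bodies are spheres.\<close>

definition bulk :: "((real \<times> real) \<times> real) set" where
  "bulk = {p. \<bar>fst (fst p)\<bar> + \<bar>snd p\<bar> \<le> 1 \<and> \<bar>snd (fst p)\<bar> + \<bar>snd p\<bar> \<le> 1}"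

lemma pillow_eq: "pillow = {p. max \<bar>fst (fst p)\<bar> \<bar>snd (fst p)\<bar> + \<bar>snd p\<bar> = 1}"
proof (intro Set.equalityI subsetI)
  fix p assume "p \<in> pillow"
  then obtain e w where w: "w \<in> tile" "p = face e w" unfolding pillow_def by blast
  have "0 \<le> 1 - max \<bar>fst w\<bar> \<bar>snd w\<bar>" using w(1) by (simp add: tile_abs)
  then show "p \<in> {p. max \<bar>fst (fst p)\<bar> \<bar>snd (fst p)\<bar> + \<bar>snd p\<bar> = 1}"
    unfolding w(2) face_def by (simp add: abs_mult)
next
  fix p :: "(real \<times> real) \<times> real"
  assume p: "p \<in> {p. max \<bar>fst (fst p)\<bar> \<bar>snd (fst p)\<bar> + \<bar>snd p\<bar> = 1}"
  let ?w = "fst p"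
  have w: "?w \<in> tile" using p by (auto simp: tile_abs)
  have "p = face (snd p \<ge> 0) ?w" using p unfolding face_def by (simp add: prod_eq_iff sg_def) linarith
  then show "p \<in> pillow" unfolding pillow_def using w by (cases "snd p \<ge> 0") (metis UnI1 UnI2 imageI)+
qed

lemma convex_bulk: "convex bulk"
proof -
  have c: "convex {p. \<bar>\<alpha> p\<bar> + \<bar>snd p\<bar> \<le> (1::real)}" if "linear \<alpha>" for \<alpha> :: "(real \<times> real) \<times> real \<Rightarrow> real"
  proof (rule convexI)
    fix x y :: "(real \<times> real) \<times> real" and u v :: real
    assume h: "x \<in> {p. \<bar>\<alpha> p\<bar> + \<bar>snd p\<bar> \<le> 1}" "y \<in> {p. \<bar>\<alpha> p\<bar> + \<bar>snd p\<bar> \<le> 1}" "0 \<le> u" "0 \<le> v" "u + v = 1"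
    have "\<alpha> (u *\<^sub>R x + v *\<^sub>R y) = u * \<alpha> x + v * \<alpha> y" using that by (simp add: linear_add linear_cmul)
    then have "\<bar>\<alpha> (u *\<^sub>R x + v *\<^sub>R y)\<bar> \<le> u * \<bar>\<alpha> x\<bar> + v * \<bar>\<alpha> y\<bar>"
      using abs_triangle_ineq[of "u * \<alpha> x" "v * \<alpha> y"] h(3,4) by (simp add: abs_mult)
    moreover have "\<bar>snd (u *\<^sub>R x + v *\<^sub>R y)\<bar> \<le> u * \<bar>snd x\<bar> + v * \<bar>snd y\<bar>"
      using abs_triangle_ineq[of "u * snd x" "v * snd y"] h(3,4) by (simp add: abs_mult)
    moreover have "u * (\<bar>\<alpha> x\<bar> + \<bar>snd x\<bar>) \<le> u * 1" "v * (\<bar>\<alpha> y\<bar> + \<bar>snd y\<bar>) \<le> v * 1"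
      using mult_left_mono[OF _ h(3), of "\<bar>\<alpha> x\<bar> + \<bar>snd x\<bar>" 1] mult_left_mono[OF _ h(4), of "\<bar>\<alpha> y\<bar> + \<bar>snd y\<bar>" 1]
        h(1,2) by simp_all
    ultimately show "u *\<^sub>R x + v *\<^sub>R y \<in> {p. \<bar>\<alpha> p\<bar> + \<bar>snd p\<bar> \<le> 1}"
      using h(5) by (simp add: distrib_left)
  qed
  have "linear (\<lambda>p :: (real \<times> real) \<times> real. fst (fst p))" "linear (\<lambda>p :: (real \<times> real) \<times> real. snd (fst p))"
    by (auto intro!: linearI)
  then have "convex ({p :: (real \<times> real) \<times> real. \<bar>fst (fst p)\<bar> + \<bar>snd p\<bar> \<le> 1} \<inter> {p. \<bar>snd (fst p)\<bar> + \<bar>snd p\<bar> \<le> 1})"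
    by (intro convex_Int c)
  then show ?thesis unfolding bulk_def by (simp add: Collect_conj_eq)
qed

lemma bounded_bulk: "bounded bulk"
proof (rule boundedI)
  fix p assume "p \<in> bulk"
  then have "\<bar>fst (fst p)\<bar> \<le> 1" "\<bar>snd (fst p)\<bar> \<le> 1" "\<bar>snd p\<bar> \<le> 1" by (auto simp: bulk_def)
  moreover have "norm p \<le> norm (fst p) + norm (snd p)" by (metis norm_Pair_le prod.collapse)
  moreover have "norm (fst p) \<le> norm (fst (fst p)) + norm (snd (fst p))" by (metis norm_Pair_le prod.collapse)
  ultimately show "norm p \<le> 3" by simp
qed

lemma closed_bulk: "closed bulk"
  unfolding bulk_def by (intro closed_Collect_conj closed_Collect_le continuous_intros)

lemma interior_bulk: "interior bulk = {p. max \<bar>fst (fst p)\<bar> \<bar>snd (fst p)\<bar> + \<bar>snd p\<bar> < 1}"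
proof (intro Set.equalityI subsetI)
  fix p assume "p \<in> interior bulk"
  then obtain \<epsilon> where \<epsilon>: "\<epsilon> > 0" "ball p \<epsilon> \<subseteq> bulk" by (auto simp: mem_interior)
  \<comment> \<open>An interior point may be stretched by the factor 1 + \<open>\<delta>\<close>
    within the body, which makes the inequalities strict; the 1 in the denominator covers the
    origin.\<close>
  define \<delta> where "\<delta> = \<epsilon> / (norm p + 1) / 2"
  have \<delta>: "\<delta> > 0" using \<epsilon>(1) by (simp add: \<delta>_def add_nonneg_pos)
  have "norm (\<delta> *\<^sub>R p) < \<epsilon>"
  proof -
    have "norm p / (norm p + 1) < 1" by (simp add: add_nonneg_pos)
    then have lt: "\<epsilon> / 2 * (norm p / (norm p + 1)) < \<epsilon> / 2 * 1" using \<epsilon>(1) by (intro mult_strict_left_mono) auto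
    have eq: "norm (\<delta> *\<^sub>R p) = \<epsilon> / 2 * (norm p / (norm p + 1))" using \<delta> \<epsilon>(1) by (simp add: \<delta>_def algebra_simps)
    have "norm (\<delta> *\<^sub>R p) < \<epsilon> / 2 * 1" unfolding eq by (rule lt)
    then show ?thesis using \<epsilon>(1) by linarith
  qed
  then have "(1 + \<delta>) *\<^sub>R p \<in> ball p \<epsilon>" by (simp add: dist_norm algebra_simps)
  then have "(1 + \<delta>) *\<^sub>R p \<in> bulk" using \<epsilon>(2) by blast
  then have b: "(1 + \<delta>) * (\<bar>fst (fst p)\<bar> + \<bar>snd p\<bar>) \<le> 1" "(1 + \<delta>) * (\<bar>snd (fst p)\<bar> + \<bar>snd p\<bar>) \<le> 1"
    using \<delta> by (simp_all add: bulk_def abs_mult distrib_left)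
  have "x < 1" if "(1 + \<delta>) * x \<le> 1" for x
  proof (rule ccontr)
    assume "\<not> x < 1"
    then have "(1 + \<delta>) * 1 \<le> (1 + \<delta>) * x" using \<delta> by (intro mult_left_mono) auto
    from order_trans[OF this that] show False using \<delta> by simp
  qed
  from this[OF b(1)] this[OF b(2)] show "p \<in> {p. max \<bar>fst (fst p)\<bar> \<bar>snd (fst p)\<bar> + \<bar>snd p\<bar> < 1}" by simp
next
  have o: "open {p :: (real \<times> real) \<times> real. max \<bar>fst (fst p)\<bar> \<bar>snd (fst p)\<bar> + \<bar>snd p\<bar> < 1}"
    by (intro open_Collect_less continuous_intros)
  have "{p :: (real \<times> real) \<times> real. max \<bar>fst (fst p)\<bar> \<bar>snd (fst p)\<bar> + \<bar>snd p\<bar> < 1} \<subseteq> bulk"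
    by (auto simp: bulk_def)
  from interior_maximal[OF this o]
  show "p \<in> interior bulk" if "p \<in> {p. max \<bar>fst (fst p)\<bar> \<bar>snd (fst p)\<bar> + \<bar>snd p\<bar> < 1}" for p using that by blast
qed

lemma pillow_frontier: "pillow = rel_frontier bulk" and aff_dim_bulk: "aff_dim bulk = 3"
proof -
  have "0 \<in> interior bulk" unfolding interior_bulk by simp
  then have ne: "interior bulk \<noteq> {}" by blast
  have "rel_frontier bulk = bulk - interior bulk"
    using rel_frontier_nonempty_interior[OF ne] closed_bulk by (simp add: frontier_def)
  also have "\<dots> = pillow" unfolding interior_bulk pillow_eq
    by (intro Set.set_eqI) (simp add: bulk_def; linarith)
  finally show "pillow = rel_frontier bulk" by simp
  show "aff_dim bulk = 3" using aff_dim_nonempty_interior[OF ne] by simp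
qed

lemma pillow_homeomorphic_sphere: "pillow homeomorphic sphere (0 :: real ^ 3) 1"
proof -
  have "rel_frontier bulk homeomorphic rel_frontier (cball (0 :: real ^ 3) 1)"
    by (rule homeomorphic_rel_frontiers_convex_bounded_sets)
      (simp_all add: convex_bulk bounded_bulk aff_dim_bulk aff_dim_cball)
  then show ?thesis by (simp add: pillow_frontier)
qed

text \<open>Any four points of the sphere can be moved to any other four: remove a further point to
  work in the plane, where the points can be moved by a homeomorphism with bounded support.\<close>

lemma pillow_moving_points:
  assumes x: "\<And>i. i \<in> K \<Longrightarrow> x i \<in> pillow" "inj_on x K" and y: "\<And>i. i \<in> K \<Longrightarrow> y i \<in> pillow" "inj_on y K"
    and K: "finite K"
  obtains F G where "homeomorphism pillow pillow F G" "\<And>i. i \<in> K \<Longrightarrow> F (x i) = y i"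
proof -
  have "infinite pillow"
  proof -
    have "inj_on (face True) tile" by (rule inj_onI) (simp add: face_def)
    moreover have "infinite tile"
    proof -
      have "inj_on (\<lambda>t :: real. (t, 0 :: real)) {0..1}" by (rule inj_onI) simp
      moreover have "infinite {0..1::real}" by simp
      ultimately have "infinite ((\<lambda>t. (t, 0 :: real)) ` {0..1::real})" using finite_imageD by blast
      moreover have "(\<lambda>t. (t, 0 :: real)) ` {0..1::real} \<subseteq> tile" by (auto simp: tile_abs)
      ultimately show ?thesis using finite_subset by blast
    qed
    ultimately show ?thesis unfolding pillow_def using finite_imageD by blast
  qed
  then have "infinite (pillow - (x ` K \<union> y ` K))" using K by (intro Diff_infinite_finite) simp_all
  then obtain e where e: "e \<in> pillow" "e \<notin> x ` K" "e \<notin> y ` K" using infinite_imp_nonempty by blast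
  have "rel_frontier bulk - {e} homeomorphic (UNIV :: (real \<times> real) set)"
    by (rule homeomorphic_punctured_sphere_affine_gen)
      (use e(1) in \<open>simp_all add: convex_bulk bounded_bulk pillow_frontier aff_dim_bulk\<close>)
  then obtain \<sigma> \<sigma>' where \<sigma>: "homeomorphism (pillow - {e}) (UNIV :: (real \<times> real) set) \<sigma> \<sigma>'"
    unfolding homeomorphic_def pillow_frontier by blast
  have \<sigma>1: "\<sigma>' (\<sigma> p) = p" if "p \<in> pillow - {e}" for p by (rule homeomorphism_apply1[OF \<sigma> that])
  have \<sigma>2: "\<sigma> (\<sigma>' z) = z" for z by (rule homeomorphism_apply2[OF \<sigma>]) simp
  have \<sigma>'P: "\<sigma>' z \<in> pillow - {e}" for z using homeomorphism_image2[OF \<sigma>] by blast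
  have xe: "x i \<in> pillow - {e}" and ye: "y i \<in> pillow - {e}" if "i \<in> K" for i using x y e that by blast+
  obtain f g where fg: "homeomorphism UNIV UNIV f g" "\<And>i. i \<in> K \<Longrightarrow> f (\<sigma> (x i)) = \<sigma> (y i)"
    "bounded {z. \<not> (f z = z \<and> g z = z)}"
  proof (rule homeomorphism_moving_points_exists[of "UNIV :: (real \<times> real) set" UNIV K "\<lambda>i. \<sigma> (x i)" "\<lambda>i. \<sigma> (y i)"])
    show "pairwise (\<lambda>i j. \<sigma> (x i) \<noteq> \<sigma> (x j) \<and> \<sigma> (y i) \<noteq> \<sigma> (y j)) K"
    proof (rule pairwiseI)
      fix i j assume ij: "i \<in> K" "j \<in> K" "i \<noteq> j"
      have "x i \<noteq> x j" "y i \<noteq> y j" using x(2) y(2) ij by (auto simp: inj_on_def)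
      then show "\<sigma> (x i) \<noteq> \<sigma> (x j) \<and> \<sigma> (y i) \<noteq> \<sigma> (y j)"
        using \<sigma>1[OF xe[OF ij(1)]] \<sigma>1[OF xe[OF ij(2)]] \<sigma>1[OF ye[OF ij(1)]] \<sigma>1[OF ye[OF ij(2)]] by metis
    qed
  qed (use K in auto)
  have fgi: "f (g z) = z" "g (f z) = z" for z
    using homeomorphism_apply1[OF fg(1)] homeomorphism_apply2[OF fg(1)] by auto
  define B where "B = closure {z. \<not> (f z = z \<and> g z = z)}"
  have cB: "compact B" unfolding B_def using fg(3) by (simp add: compact_closure)
  have fixB: "f z = z" "g z = z" if "z \<notin> B" for z
  proof -
    have "{z. \<not> (f z = z \<and> g z = z)} \<subseteq> B" unfolding B_def by (rule closure_subset)
    then have "z \<notin> {z. \<not> (f z = z \<and> g z = z)}" using that by (rule contra_subsetD)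
    then show "f z = z" "g z = z" by simp_all
  qed
  \<comment> \<open>The support of the motion is compact and stays away from \<open>e\<close>.
    Extending by the identity thus needs no study of the behaviour at the removed point.\<close>
  define T where "T = \<sigma>' ` B"
  have cT: "compact T" unfolding T_def
    by (rule compact_continuous_image[OF continuous_on_subset[OF homeomorphism_cont2[OF \<sigma>]] cB]) simp
  have TP: "T \<subseteq> pillow - {e}" unfolding T_def using \<sigma>'P by blast
  define ext where "ext k p = (if p \<in> T then \<sigma>' (k (\<sigma> p)) else p)" for k p
  have ext_in: "ext k p = \<sigma>' (k (\<sigma> p))" if k: "\<And>z. z \<notin> B \<Longrightarrow> k z = z" and p: "p \<in> pillow - {e}" for k p
  proof (cases "p \<in> T")
    case False
    then have "\<sigma> p \<notin> B" using \<sigma>1[OF p] unfolding T_def by force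
    then show ?thesis using False k \<sigma>1[OF p] by (simp add: ext_def)
  qed (simp add: ext_def)
  have ext_e: "ext k e = e" for k using TP by (auto simp: ext_def)
  have ext_cont: "continuous_on pillow (ext k)" if k: "\<And>z. z \<notin> B \<Longrightarrow> k z = z" "continuous_on UNIV k" for k
  proof -
    have eq: "(pillow - {e}) \<union> (pillow - T) = pillow" using TP by blast
    have "continuous_on ((pillow - {e}) \<union> (pillow - T)) (\<lambda>p. if p \<in> T then \<sigma>' (k (\<sigma> p)) else p)"
    proof (rule continuous_on_cases_local_open)
      show "openin (top_of_set (pillow - {e} \<union> (pillow - T))) (pillow - {e})"
        unfolding eq by (simp add: openin_delete)
      show "openin (top_of_set (pillow - {e} \<union> (pillow - T))) (pillow - T)"
        unfolding eq using compact_imp_closed[OF cT] by (simp add: Diff_eq openin_open_Int open_Compl)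
      have "continuous_on (pillow - {e}) (\<lambda>p. k (\<sigma> p))"
        by (rule continuous_on_compose2[OF k(2) homeomorphism_cont1[OF \<sigma>]]) simp
      then show "continuous_on (pillow - {e}) (\<lambda>p. \<sigma>' (k (\<sigma> p)))"
        by (rule continuous_on_compose2[OF homeomorphism_cont2[OF \<sigma>]]) simp
      show "continuous_on (pillow - T) (\<lambda>p. p)" by (rule continuous_on_id)
      fix p assume p: "p \<in> pillow - {e} \<and> p \<notin> T \<or> p \<in> pillow - T \<and> p \<in> T"
      then have p': "p \<in> pillow - {e}" "p \<notin> T" by auto
      show "\<sigma>' (k (\<sigma> p)) = p" using ext_in[OF k(1) p'(1)] p'(2) by (simp add: ext_def)
    qed
    then show ?thesis unfolding eq ext_def .
  qed
  have cancel: "ext k (ext l p) = p" and ext_P: "ext l p \<in> pillow"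
    if k: "\<And>z. z \<notin> B \<Longrightarrow> k z = z" and l: "\<And>z. z \<notin> B \<Longrightarrow> l z = z" and kl: "\<And>z. k (l z) = z" and p: "p \<in> pillow" for k l p
  proof -
    show "ext l p \<in> pillow" using ext_in[OF l] ext_e p \<sigma>'P by (cases "p = e") auto
    show "ext k (ext l p) = p"
    proof (cases "p = e")
      case False
      then have pe: "p \<in> pillow - {e}" using p by simp
      have "ext k (ext l p) = \<sigma>' (k (\<sigma> (\<sigma>' (l (\<sigma> p)))))" using ext_in[OF l pe] ext_in[OF k \<sigma>'P] by simp
      then show ?thesis using \<sigma>2 kl \<sigma>1[OF pe] by simp
    qed (simp add: ext_e)
  qed
  have "homeomorphism pillow pillow (ext f) (ext g)"
  proof (rule homeomorphismI)
    show "continuous_on pillow (ext f)" "continuous_on pillow (ext g)"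
      using homeomorphism_cont1[OF fg(1)] homeomorphism_cont2[OF fg(1)] fixB by (auto intro!: ext_cont)
    show "ext f ` pillow \<subseteq> pillow" using ext_P[of g f] fixB fgi by blast
    show "ext g ` pillow \<subseteq> pillow" using ext_P[of f g] fixB fgi by blast
    show "ext g (ext f p) = p" if "p \<in> pillow" for p using cancel[of g f] fixB fgi that by blast
    show "ext f (ext g p) = p" if "p \<in> pillow" for p using cancel[of f g] fixB fgi that by blast
  qed
  moreover have "ext f (x i) = y i" if "i \<in> K" for i
    using ext_in[OF fixB(1) xe[OF that]] fg(2)[OF that] \<sigma>1[OF ye[OF that]] by simp
  ultimately show thesis by (rule that)
qed

lemma face_eq:
  assumes "w \<in> tile" "w' \<in> tile"
  shows "face e w = face e' w' \<longleftrightarrow> w = w' \<and> (e = e' \<or> sides w \<noteq> {})"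
proof -
  have "sides w \<noteq> {} \<longleftrightarrow> max \<bar>fst w\<bar> \<bar>snd w\<bar> = 1"
  proof
    assume "sides w \<noteq> {}"
    then obtain i where "i \<in> sides w" by blast
    then have "\<bar>if fst i then snd w else fst w\<bar> = 1" by (simp add: sides_iff)
    then show "max \<bar>fst w\<bar> \<bar>snd w\<bar> = 1" using assms(1) by (auto simp: tile_abs split: if_splits)
  next
    assume "max \<bar>fst w\<bar> \<bar>snd w\<bar> = 1"
    then have "\<bar>fst w\<bar> = 1 \<or> \<bar>snd w\<bar> = 1" by linarith
    then have "(False, fst w = - 1) \<in> sides w \<or> (True, snd w = - 1) \<in> sides w"
      by (auto simp: sides_iff sg_def)
    then show "sides w \<noteq> {}" by blast
  qed
  then show ?thesis by (cases e; cases e') (auto simp: face_def)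
qed

text \<open>The cone points are moved to the corners of the double pyramid and the surface is
  embedded in a normed space, which brings the covering into the form of
  \<open>square_orbifold\<close>.\<close>

theorem surface_group_words:
  fixes S :: "'a::t2_space set" and Y :: "'b::t2_space set"
  assumes Y: "is_orbifold_3333 Y d" and S: "surface_finitely_covers S f Y d" and b: "b \<in> S"
  defines "\<Gamma> \<equiv> fundamental_group S b"
  shows "\<exists>h. (\<forall>P\<in>carrier \<Gamma>. even (length (h P))) \<and>
     (\<forall>P\<in>carrier \<Gamma>. \<forall>Q\<in>carrier \<Gamma>. h (P \<otimes>\<^bsub>\<Gamma>\<^esub> Q) \<simeq> h P @ h Q) \<and>
     (\<forall>P\<in>carrier \<Gamma>. \<forall>Q\<in>carrier \<Gamma>. h P \<simeq> h Q \<longrightarrow> P = Q) \<and>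
     (\<forall>v. \<exists>k>0. \<exists>P\<in>carrier \<Gamma>. h P \<simeq> concat (replicate k v))"
proof -
  have S1: "S \<noteq> {}" "compact S" "connected S"
    "\<And>x. x \<in> S \<Longrightarrow> \<exists>U. openin (top_of_set S) U \<and> x \<in> U \<and> U homeomorphic ball (0::complex) 1"
    and cov: "orbifold_covering S (\<lambda>_. 1) Y d f" and fin: "\<And>y. y \<in> Y \<Longrightarrow> finite {x \<in> S. f x = y}"
    using S unfolding surface_finitely_covers_def closed_surface_def by auto
  obtain C where C: "C \<subseteq> Y" "card C = 4" "\<And>y. y \<in> C \<Longrightarrow> d y = 3" "\<And>y. y \<in> Y - C \<Longrightarrow> d y = 1"
    and Ys: "Y homeomorphic sphere (0 :: real ^ 3) 1" using Y unfolding is_orbifold_3333_def by blast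
  have "Y homeomorphic pillow"
    using homeomorphic_trans[OF Ys] pillow_homeomorphic_sphere homeomorphic_sym by blast
  then obtain k k' where k: "homeomorphism Y pillow k k'" unfolding homeomorphic_def by blast
  have card4: "card corners = 4" by (simp add: corners_def card_insert_if)
  have "finite C" using C(2) card.infinite by fastforce
  then obtain \<beta> where \<beta>: "bij_betw \<beta> C corners"
    using finite_same_card_bij[OF _ finite_corners] C(2) card4 by metis
  obtain F G where FG: "homeomorphism pillow pillow F G" "\<And>y. y \<in> C \<Longrightarrow> F (k y) = face True (\<beta> y)"
  proof (rule pillow_moving_points[of C k "\<lambda>y. face True (\<beta> y)"])
    show "k y \<in> pillow" if "y \<in> C" for y using homeomorphism_image1[OF k] C(1) that by blast
    show "inj_on k C" using homeomorphism_apply1[OF k] C(1) by (intro inj_onI) (metis subsetD)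
    show "face True (\<beta> y) \<in> pillow" if "y \<in> C" for y
      using bij_betwE[OF \<beta>] corners_subset_tile that unfolding pillow_def by blast
    show "inj_on (\<lambda>y. face True (\<beta> y)) C"
      using bij_betw_imp_inj_on[OF \<beta>] unfolding inj_on_def face_def by blast
  qed (use \<open>finite C\<close> in blast)+
  define \<kappa> where "\<kappa> = F \<circ> k"
  define \<kappa>' where "\<kappa>' = k' \<circ> G"
  have \<kappa>: "homeomorphism Y pillow \<kappa> \<kappa>'" unfolding \<kappa>_def \<kappa>'_def by (rule homeomorphism_compose[OF k FG(1)])
  obtain S' :: "(nat \<Rightarrow>\<^sub>C real) set" and \<eta> \<eta>' where \<eta>: "homeomorphism S S' \<eta> \<eta>'"
    using surface_embedding[OF S1(2,4)] .
  have S'S: "\<eta> ` S = S'" by (rule homeomorphism_image1[OF \<eta>])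
  have c\<eta>: "continuous_on S \<eta>" by (rule homeomorphism_cont1[OF \<eta>])
  have \<eta>'S: "\<eta>' x \<in> S" if "x \<in> S'" for x using homeomorphism_image2[OF \<eta>] that by blast
  have \<kappa>'Y: "\<kappa>' y \<in> Y" if "y \<in> pillow" for y using homeomorphism_image2[OF \<kappa>] that by blast
  have fY: "f x \<in> Y" if "x \<in> S" for x using cov that unfolding orbifold_covering_def by blast
  have orb: "square_orbifold S' pillow (d \<circ> \<kappa>') (\<kappa> \<circ> f \<circ> \<eta>') face"
  proof
    show "compact S'" using compact_continuous_image[OF c\<eta> S1(2)] S'S by simp
    show "connected S'" using connected_continuous_image[OF c\<eta> S1(3)] S'S by simp
    show "S' \<noteq> {}" using S1(1) S'S by blast
    show "orbifold_covering S' (\<lambda>_. 1) pillow (d \<circ> \<kappa>') (\<kappa> \<circ> f \<circ> \<eta>')"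
      using orbifold_covering_transport[OF \<eta> \<kappa> cov] by (simp add: comp_def)
    show "finite {x \<in> S'. (\<kappa> \<circ> f \<circ> \<eta>') x = y}" if y: "y \<in> pillow" for y
    proof (rule finite_subset)
      show "{x \<in> S'. (\<kappa> \<circ> f \<circ> \<eta>') x = y} \<subseteq> \<eta> ` {x \<in> S. f x = \<kappa>' y}"
      proof
        fix x assume x: "x \<in> {x \<in> S'. (\<kappa> \<circ> f \<circ> \<eta>') x = y}"
        then have "f (\<eta>' x) = \<kappa>' y" using homeomorphism_apply1[OF \<kappa> fY[OF \<eta>'S]] by auto
        moreover have "x = \<eta> (\<eta>' x)" using homeomorphism_apply2[OF \<eta>] x by simp
        ultimately show "x \<in> \<eta> ` {x \<in> S. f x = \<kappa>' y}" using \<eta>'S x by (intro image_eqI[of _ _ "\<eta>' x"]) auto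
      qed
      show "finite (\<eta> ` {x \<in> S. f x = \<kappa>' y})" using fin[OF \<kappa>'Y[OF y]] by simp
    qed
    show "continuous_on tile (face e)" for e unfolding face_def by (intro continuous_intros)
    show "face True ` tile \<union> face False ` tile = pillow" by (simp add: pillow_def)
    show "face e w = face e' w' \<longleftrightarrow> w = w' \<and> (e = e' \<or> sides w \<noteq> {})" if "w \<in> tile" "w' \<in> tile" for e e' w w'
      by (rule face_eq[OF that])
    show "(d \<circ> \<kappa>') (face e w) = (if w \<in> corners then 3 else 1)" if w: "w \<in> tile" for e w
    proof -
      have fp: "face e w \<in> pillow" using w unfolding pillow_def by (cases e; simp)
      have \<kappa>C: "\<kappa> y = face True (\<beta> y)" if "y \<in> C" for y using FG(2)[OF that] by (simp add: \<kappa>_def)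
      show ?thesis
      proof (cases "w \<in> corners")
        case True
        then obtain y where y: "y \<in> C" "w = \<beta> y" using \<beta> unfolding bij_betw_def by blast
        have "face e w = \<kappa> y" using \<kappa>C[OF y(1)] y(2) face_eq[OF w w, of e True] corner_iff_sides[OF w] True by auto
        then have "\<kappa>' (face e w) = y" using homeomorphism_apply1[OF \<kappa>] y(1) C(1) by auto
        then show ?thesis using C(3)[OF y(1)] True by simp
      next
        case False
        have "\<kappa>' (face e w) \<notin> C"
        proof
          assume c: "\<kappa>' (face e w) \<in> C"
          have "face e w = face True (\<beta> (\<kappa>' (face e w)))"
            using \<kappa>C[OF c] homeomorphism_apply2[OF \<kappa> fp] by simp
          then have "w = \<beta> (\<kappa>' (face e w))" by (simp add: face_def)
          then show False using bij_betwE[OF \<beta>] c False by metis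
        qed
        then show ?thesis using C(4) \<kappa>'Y[OF fp] False by simp
      qed
    qed
  qed
  show ?thesis unfolding \<Gamma>_def by (rule square_orbifold.fundamental_group_words[OF orb \<eta> b])
qed

section \<open>Binary forms\<close>

definition idx :: "'n::finite \<Rightarrow> nat" where "idx = to_nat_on UNIV"

lemma idx_bij: "bij_betw idx (UNIV :: 'n::finite set) {..<CARD('n)}"
  unfolding idx_def by (rule to_nat_on_finite) simp

lemma idx_less [simp]: "idx (i :: 'n::finite) < CARD('n)"
  using bij_betwE[OF idx_bij] by blast

lemma idx_eq_iff [simp]: "idx i = idx j \<longleftrightarrow> i = j"
  using bij_betw_imp_inj_on[OF idx_bij] by (auto simp: inj_on_def)

lemma idx_surj: "k < CARD('n) \<Longrightarrow> \<exists>i :: 'n::finite. idx i = k"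
proof -
  assume k: "k < CARD('n)"
  have "idx ` (UNIV :: 'n set) = {..<CARD('n)}" using idx_bij[where 'n='n] by (rule bij_betw_imp_surj_on)
  then have "k \<in> idx ` (UNIV :: 'n set)" using k by simp
  then show ?thesis by (auto intro: exI)
qed

lemma idx_sum: "(\<Sum>i\<in>UNIV. f (idx (i :: 'n::finite))) = (\<Sum>k<CARD('n). f k)"
  by (rule sum.reindex_bij_betw[OF idx_bij])

definition mon :: "nat \<Rightarrow> nat \<Rightarrow> real ^ 2 \<Rightarrow> real" where
  "mon d k v = v $ 1 ^ (d - k) * v $ 2 ^ k"

lemma basis_monomial_mon: "basis_monomial (j :: 'n::finite) = mon (CARD('n) - 1) (idx j)"
  by (simp add: basis_monomial_def mon_def idx_def fun_eq_iff)

text \<open>On the line with first coordinate 1 the monomials become the powers of one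
  variable.\<close>

lemma mon_independent:
  assumes "\<And>v. (\<Sum>i\<in>UNIV. c i * basis_monomial (i :: 'n::finite) v) = 0"
  shows "c i = 0"
proof -
  define c' where "c' k = c (the_inv idx k)" for k
  have c': "c' (idx i) = c i" for i :: 'n
    unfolding c'_def by (subst the_inv_f_f) (auto simp: inj_def)
  have "(\<Sum>k\<le>CARD('n) - 1. c' k * x ^ k) = 0" for x :: real
  proof -
    have "(\<Sum>k\<le>CARD('n) - 1. c' k * x ^ k) = (\<Sum>k<CARD('n). c' k * x ^ k)"
    proof (rule sum.cong)
      have "Suc (CARD('n) - 1) = CARD('n)" using idx_less[of i] by linarith
      then show "{..CARD('n) - 1} = {..<CARD('n)}" by (metis lessThan_Suc_atMost)
    qed simp
    also have "\<dots> = (\<Sum>i\<in>(UNIV :: 'n set). c' (idx i) * x ^ idx i)"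
      by (rule idx_sum[symmetric])
    also have "\<dots> = (\<Sum>i\<in>UNIV. c i * basis_monomial i (vector [1, x]))"
      by (simp add: c' basis_monomial_mon mon_def)
    finally show ?thesis using assms by simp
  qed
  then have "\<forall>k\<le>CARD('n) - 1. c' k = 0" using polyfun_eq_0[of c' "CARD('n) - 1"] by blast
  moreover have "idx i \<le> CARD('n) - 1" using idx_less[of i] by linarith
  ultimately show ?thesis using c' by metis
qed

lemma mon_independent2:
  assumes "\<And>v. (\<Sum>i\<in>UNIV. c i * basis_monomial (i :: 'n::finite) v) = (\<Sum>i\<in>UNIV. c' i * basis_monomial i v)"
  shows "c i = c' i"
proof -
  have "c i - c' i = 0"
    by (rule mon_independent[of "\<lambda>i. c i - c' i"]) (simp add: left_diff_distrib sum_subtractf assms)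
  then show ?thesis by simp
qed

text \<open>Linear combinations of \<open>b 0, \<dots>, b (p - 1)\<close> whose coefficients are functions from \<open>R\<close> of a
  parameter \<open>h\<close>. Integer, real and polynomial coefficients are all needed.\<close>

definition comb :: "('p \<Rightarrow> real) set \<Rightarrow> nat \<Rightarrow> (nat \<Rightarrow> 'v \<Rightarrow> real) \<Rightarrow> ('p \<Rightarrow> 'v \<Rightarrow> real) set" where
  "comb R p b = {f. \<exists>c. (\<forall>k. c k \<in> R) \<and> f = (\<lambda>h v. \<Sum>k<p. c k h * b k v)}"

definition coeff_ring :: "('p \<Rightarrow> real) set \<Rightarrow> bool" where
  "coeff_ring R \<longleftrightarrow> (\<lambda>_. 0) \<in> R \<and> (\<lambda>_. 1) \<in> R \<and>
     (\<forall>c\<in>R. \<forall>d\<in>R. (\<lambda>h. c h + d h) \<in> R \<and> (\<lambda>h. c h * d h) \<in> R)"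

lemma comb_add:
  assumes R: "coeff_ring R" and f: "f \<in> comb R p b" and g: "g \<in> comb R p b"
  shows "(\<lambda>h v. f h v + g h v) \<in> comb R p b"
proof -
  obtain c where c: "\<And>k. c k \<in> R" "f = (\<lambda>h v. \<Sum>k<p. c k h * b k v)" using f by (auto simp: comb_def)
  obtain d where d: "\<And>k. d k \<in> R" "g = (\<lambda>h v. \<Sum>k<p. d k h * b k v)" using g by (auto simp: comb_def)
  show ?thesis unfolding comb_def mem_Collect_eq
    by (rule exI[of _ "\<lambda>k h. c k h + d k h"])
      (use R c d in \<open>simp add: coeff_ring_def sum.distrib distrib_right\<close>)
qed

lemma comb_scale:
  assumes R: "coeff_ring R" and f: "f \<in> comb R p b" and a: "a \<in> R"
  shows "(\<lambda>h v. a h * f h v) \<in> comb R p b"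
proof -
  obtain c where c: "\<And>k. c k \<in> R" "f = (\<lambda>h v. \<Sum>k<p. c k h * b k v)" using f by (auto simp: comb_def)
  show ?thesis unfolding comb_def mem_Collect_eq
    by (rule exI[of _ "\<lambda>k h. a h * c k h"])
      (use R c a in \<open>simp add: coeff_ring_def sum_distrib_left mult.assoc\<close>)
qed

lemma comb_basis:
  assumes R: "coeff_ring R" and k: "k < p"
  shows "(\<lambda>h. b k) \<in> comb R p b"
proof -
  have "(\<lambda>h. b k) = (\<lambda>h v. \<Sum>l<p. (if l = k then 1 else 0) * b l v)"
  proof (intro ext)
    fix v
    have "(\<Sum>l<p. (if l = k then 1 else 0) * b l v) = (\<Sum>l<p. if l = k then b l v else 0)"
      by (rule sum.cong) auto
    then show "b k v = (\<Sum>l<p. (if l = k then 1 else 0) * b l v)" using k by simp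
  qed
  moreover have "(\<lambda>h. if l = k then 1 else 0) \<in> R" for l using R by (cases "l = k") (simp_all add: coeff_ring_def)
  ultimately show ?thesis unfolding comb_def by (intro CollectI exI[of _ "\<lambda>l h. if l = k then 1 else 0"]) simp
qed

lemma comb_zero: "coeff_ring R \<Longrightarrow> (\<lambda>h v. 0) \<in> comb R p b"
  unfolding comb_def by (intro CollectI exI[of _ "\<lambda>_ _. 0"]) (simp add: coeff_ring_def)

text \<open>Multiplication by a fixed form is controlled by its effect on the basis; iterating it
  expands products of powers of forms.\<close>

lemma comb_mult:
  assumes R: "coeff_ring R" and f: "f \<in> comb R p b"
    and g: "\<And>k. k < p \<Longrightarrow> (\<lambda>h v. g h v * b k v) \<in> comb R q b'"
  shows "(\<lambda>h v. g h v * f h v) \<in> comb R q b'"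
proof -
  obtain c where c: "\<And>k. c k \<in> R" "f = (\<lambda>h v. \<Sum>k<p. c k h * b k v)" using f by (auto simp: comb_def)
  have "(\<lambda>h v. \<Sum>k\<in>K. c k h * (g h v * b k v)) \<in> comb R q b'" if "finite K" "K \<subseteq> {..<p}" for K
    using that
  proof (induction K)
    case (insert k K)
    have "(\<lambda>h v. c k h * (g h v * b k v)) \<in> comb R q b'"
      by (rule comb_scale[OF R g c(1)]) (use insert in auto)
    from comb_add[OF R this insert.IH] show ?case using insert by simp
  qed (simp add: comb_zero[OF R])
  from this[of "{..<p}"] show ?thesis by (simp add: c(2) sum_distrib_left mult.left_commute)
qed

lemma comb_mon_power:
  assumes R: "coeff_ring R" and c: "c1 \<in> R" "c2 \<in> R" and f: "f \<in> comb R (Suc d) (mon d)"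
  shows "(\<lambda>h v. (c1 h * v $ 1 + c2 h * v $ 2) ^ i * f h v) \<in> comb R (Suc (d + i)) (mon (d + i))"
proof (induction i)
  case (Suc i)
  let ?e = "d + i"
  have "(\<lambda>h v. (c1 h * v $ 1 + c2 h * v $ 2) * ((c1 h * v $ 1 + c2 h * v $ 2) ^ i * f h v)) \<in> comb R (Suc (Suc ?e)) (mon (Suc ?e))"
  proof (rule comb_mult[OF R Suc])
    fix k assume k: "k < Suc ?e"
    have "(\<lambda>h v. c1 h * mon (Suc ?e) k v + c2 h * mon (Suc ?e) (Suc k) v) \<in> comb R (Suc (Suc ?e)) (mon (Suc ?e))"
      by (intro comb_add[OF R] comb_scale[OF R comb_basis[OF R]] c) (use k in simp_all)
    moreover have "(c1 h * v $ 1 + c2 h * v $ 2) * mon ?e k v = c1 h * mon (Suc ?e) k v + c2 h * mon (Suc ?e) (Suc k) v" for h v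
    proof -
      have "Suc ?e - k = Suc (?e - k)" using k by simp
      then show ?thesis unfolding mon_def by (simp add: algebra_simps)
    qed
    ultimately show "(\<lambda>h v. (c1 h * v $ 1 + c2 h * v $ 2) * mon ?e k v) \<in> comb R (Suc (Suc ?e)) (mon (Suc ?e))"
      by simp
  qed
  then show ?case by (simp add: mult.assoc)
qed (use f in simp)

lemma comb_mon_one: assumes R: "coeff_ring R" shows "(\<lambda>h v. 1) \<in> comb R (Suc 0) (mon 0)"
proof -
  have "mon 0 0 = (\<lambda>v. 1)" by (simp add: mon_def fun_eq_iff)
  then show ?thesis using comb_basis[OF R, of 0 "Suc 0" "mon 0"] by simp
qed

lemma coeff_ring_poly: "coeff_ring {c. real_polynomial_function c}"
  by (auto simp: coeff_ring_def)

lemma coeff_ring_UNIV: "coeff_ring UNIV"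
  by (simp add: coeff_ring_def)

lemma coeff_ring_Ints: "coeff_ring {c :: unit \<Rightarrow> real. c () \<in> \<int>}"
  by (simp add: coeff_ring_def)

lemma mult_vec2: "(h *v v) $ 1 = h $ 1 $ 1 * v $ 1 + h $ 1 $ 2 * v $ 2"
  "(h *v v) $ 2 = h $ 2 $ 1 * v $ 1 + h $ 2 $ 2 * v $ 2" for h :: "real ^ 2 ^ 2"
  by (simp_all add: matrix_vector_mult_def sum_2)

lemma comb_CARD:
  assumes "f \<in> comb R (CARD('n::finite)) b"
  shows "\<exists>c. \<forall>i. c i \<in> R \<and> (\<forall>h v. f h v = (\<Sum>i\<in>(UNIV :: 'n set). c i h * b (idx i) v))"
proof -
  obtain c where c: "\<And>k. c k \<in> R" "f = (\<lambda>h v. \<Sum>k<CARD('n). c k h * b k v)" using assms by (auto simp: comb_def)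
  have "f h v = (\<Sum>i\<in>(UNIV :: 'n set). c (idx i) h * b (idx i) v)" for h v
    unfolding c(2) by (rule idx_sum[symmetric])
  then show ?thesis using c(1) by (intro exI[of _ "\<lambda>i. c (idx i)"]) simp
qed

text \<open>The matrix of the substitution \<open>P \<mapsto> P \<circ> h\<close>, also for singular \<open>h\<close>.\<close>

definition subst_matrix :: "real ^ 2 ^ 2 \<Rightarrow> real ^ 'n ^ 'n" where
  "subst_matrix h = (THE M. \<forall>j v. basis_monomial j (h *v v) = (\<Sum>i\<in>UNIV. M $ i $ j * basis_monomial i v))"

lemma subst_matrix_eqI:
  assumes "\<And>j v. basis_monomial j (h *v v) = (\<Sum>i\<in>UNIV. M $ i $ j * basis_monomial (i :: 'n::finite) v)"
  shows "subst_matrix h = M"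
  unfolding subst_matrix_def
proof (rule the_equality)
  show "\<forall>j v. basis_monomial j (h *v v) = (\<Sum>i\<in>UNIV. M $ i $ j * basis_monomial i v)" using assms by blast
  fix M' :: "real ^ 'n ^ 'n"
  assume M': "\<forall>j v. basis_monomial j (h *v v) = (\<Sum>i\<in>UNIV. M' $ i $ j * basis_monomial i v)"
  have "M' $ i $ j = M $ i $ j" for i j
    by (rule mon_independent2[of "\<lambda>i. M' $ i $ j"]) (metis M' assms)
  then show "M' = M" by (simp add: vec_eq_iff)
qed

text \<open>A substituted monomial is a product of powers of two linear forms whose coefficients are
  entries of \<open>h\<close>.\<close>

lemma subst_matrix_poly:
  obtains C :: "'n::finite \<Rightarrow> 'n \<Rightarrow> real ^ 2 ^ 2 \<Rightarrow> real" where "\<And>i j. real_polynomial_function (C i j)"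
    "\<And>h j v. basis_monomial j (h *v v) = (\<Sum>i\<in>UNIV. C i j h * basis_monomial i v)"
proof -
  let ?R = "{c :: real ^ 2 ^ 2 \<Rightarrow> real. real_polynomial_function c}"
  have bl: "(\<lambda>h. h $ a $ b) \<in> ?R" for a b :: 2
    by (intro CollectI real_polynomial_function.intros(1) bounded_linear_compose[OF bounded_linear_vec_nth bounded_linear_vec_nth])
  have *: "\<forall>j :: 'n. \<exists>c. (\<forall>i. real_polynomial_function (c i)) \<and>
      (\<forall>h v. basis_monomial j (h *v v) = (\<Sum>i\<in>UNIV. c i h * basis_monomial (i :: 'n) v))"
  proof (rule allI)
    fix j :: 'n
    let ?p = "CARD('n) - 1 - idx j" and ?q = "idx j"
    have e: "0 + ?q + ?p = CARD('n) - 1" "Suc (CARD('n) - 1) = CARD('n)" using idx_less[of j] by linarith+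
    have "(\<lambda>h v. (h $ 1 $ 1 * v $ 1 + h $ 1 $ 2 * v $ 2) ^ ?p * ((h $ 2 $ 1 * v $ 1 + h $ 2 $ 2 * v $ 2) ^ ?q * 1))
        \<in> comb ?R (Suc (0 + ?q + ?p)) (mon (0 + ?q + ?p))"
      by (intro comb_mon_power comb_mon_one coeff_ring_poly bl)
    then have "(\<lambda>h v. mon (CARD('n) - 1) (idx j) (h *v v)) \<in> comb ?R (CARD('n)) (mon (CARD('n) - 1))"
      unfolding e by (simp add: mon_def mult_vec2)
    from comb_CARD[OF this] obtain c where c: "\<forall>i. c i \<in> ?R \<and>
      (\<forall>h v. mon (CARD('n) - 1) (idx j) (h *v v) = (\<Sum>i\<in>(UNIV :: 'n set). c i h * mon (CARD('n) - 1) (idx i) v))"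
      by (elim exE)
    show "\<exists>c. (\<forall>i. real_polynomial_function (c i)) \<and>
      (\<forall>h v. basis_monomial j (h *v v) = (\<Sum>i\<in>UNIV. c i h * basis_monomial (i :: 'n) v))"
      unfolding basis_monomial_mon by (rule exI[of _ c]) (use c in simp)
  qed
  from choice[OF *] obtain c where
    c: "\<forall>j :: 'n. (\<forall>i. real_polynomial_function (c j i)) \<and>
      (\<forall>h v. basis_monomial j (h *v v) = (\<Sum>i\<in>UNIV. c j i h * basis_monomial (i :: 'n) v))"
    by (elim exE)
  show thesis by (rule that[of "\<lambda>i j. c j i"]) (use c in simp_all)
qed

lemma subst_matrix:
  "basis_monomial (j :: 'n::finite) (h *v v) = (\<Sum>i\<in>UNIV. subst_matrix h $ i $ j * basis_monomial i v)"
proof -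
  obtain C :: "'n::finite \<Rightarrow> 'n \<Rightarrow> real ^ 2 ^ 2 \<Rightarrow> real" where C: "\<And>i j. real_polynomial_function (C i j)"
    "\<And>h j v. basis_monomial j (h *v v) = (\<Sum>i\<in>UNIV. C i j h * basis_monomial i v)" using subst_matrix_poly by blast
  have S: "subst_matrix h = (\<chi> i j. C i j h)" for h by (rule subst_matrix_eqI) (simp add: C(2))
  show "basis_monomial j (h *v v) = (\<Sum>i\<in>UNIV. subst_matrix h $ i $ j * basis_monomial i v)"
    unfolding S by (simp add: C(2))
qed

lemma sym_matrix_eq: "sym_matrix g = subst_matrix (matrix_inv g)"
  by (simp add: sym_matrix_def subst_matrix_def)

lemma sum_sum_matrix:
  "(\<Sum>i\<in>UNIV. M $ i $ j * (\<Sum>l\<in>UNIV. N $ l $ i * f l)) = (\<Sum>l\<in>UNIV. (N ** M) $ l $ j * f l)"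
  for M N :: "real ^ 'n ^ 'n" and f :: "'n::finite \<Rightarrow> real"
proof -
  have "(\<Sum>i\<in>UNIV. M $ i $ j * (\<Sum>l\<in>UNIV. N $ l $ i * f l)) = (\<Sum>i\<in>UNIV. \<Sum>l\<in>UNIV. N $ l $ i * M $ i $ j * f l)"
    by (simp add: sum_distrib_left mult_ac)
  also have "\<dots> = (\<Sum>l\<in>UNIV. \<Sum>i\<in>UNIV. N $ l $ i * M $ i $ j * f l)" by (rule sum.swap)
  finally show ?thesis by (simp add: matrix_matrix_mult_def sum_distrib_right)
qed

text \<open>Substitution acts from the right, hence the reversed order. The inverse in
  \<open>sym_matrix\<close> restores it.\<close>

lemma subst_matrix_mult: "subst_matrix (g ** h) = subst_matrix h ** (subst_matrix g :: real ^ 'n ^ 'n)"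
proof (rule subst_matrix_eqI)
  fix j :: 'n and v
  have "basis_monomial j (g ** h *v v) = basis_monomial j (g *v (h *v v))" by (simp add: matrix_vector_mul_assoc)
  also have "\<dots> = (\<Sum>i\<in>UNIV. subst_matrix g $ i $ j * (\<Sum>l\<in>UNIV. subst_matrix h $ l $ i * basis_monomial l v))"
    by (simp add: subst_matrix)
  finally show "basis_monomial j (g ** h *v v) = (\<Sum>i\<in>UNIV. (subst_matrix h ** subst_matrix g) $ i $ j * basis_monomial i v)"
    unfolding sum_sum_matrix .
qed

lemma sum_mat_1: "(\<Sum>i\<in>UNIV. (mat 1 :: real ^ 'n ^ 'n) $ i $ j * f i) = f (j :: 'n::finite)"
proof -
  have "(\<Sum>i\<in>UNIV. (mat 1 :: real ^ 'n ^ 'n) $ i $ j * f i) = (\<Sum>i\<in>UNIV. if i = j then f i else 0)"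
    by (rule sum.cong) (auto simp: mat_def)
  then show ?thesis by simp
qed

lemma subst_matrix_one: "subst_matrix (mat 1) = (mat 1 :: real ^ 'n ^ 'n)"
  by (rule subst_matrix_eqI) (simp add: sum_mat_1)

text \<open>The forms have even degree.\<close>

lemma subst_matrix_minus: assumes "odd CARD('n::finite)"
  shows "subst_matrix (- h) = (subst_matrix h :: real ^ 'n ^ 'n)"
proof (rule subst_matrix_eqI)
  fix j :: 'n and v
  let ?p = "CARD('n) - 1 - idx j"
  have "Suc (?p + idx j) = CARD('n)" using idx_less[of j] by linarith
  then have "even (?p + idx j)" using assms by (metis even_Suc)
  then have s: "(- 1 :: real) ^ ?p * (- 1) ^ idx j = 1" by (simp add: power_add[symmetric])
  have c: "(- h *v v) $ a = - ((h *v v) $ a)" for a by (simp add: matrix_vector_mult_def sum_negf)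
  have "basis_monomial j (- h *v v) = ((- 1) ^ ?p * (- 1) ^ idx j) * basis_monomial j (h *v v)"
    unfolding basis_monomial_mon mon_def c power_minus[of "(h *v v) $ 1"] power_minus[of "(h *v v) $ 2"]
    by (simp only: mult_ac)
  then show "basis_monomial j (- h *v v) = (\<Sum>i\<in>UNIV. subst_matrix h $ i $ j * basis_monomial i v)"
    unfolding s mult_1_left subst_matrix[of j h v] .
qed

text \<open>The derivative of \<open>subst_matrix\<close> at the identity.\<close>

definition deriv_matrix :: "real ^ 2 ^ 2 \<Rightarrow> real ^ 'n::finite ^ 'n" where
  "deriv_matrix Z = (\<chi> i j. (if idx i = idx j then of_nat (CARD('n) - 1 - idx j) * Z $ 1 $ 1 + of_nat (idx j) * Z $ 2 $ 2 else 0)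
     + (if idx i = Suc (idx j) then of_nat (CARD('n) - 1 - idx j) * Z $ 1 $ 2 else 0)
     + (if Suc (idx i) = idx j then of_nat (idx j) * Z $ 2 $ 1 else 0))"

lemma deriv_matrix:
  "((\<lambda>t. basis_monomial j (v + t *\<^sub>R (Z *v v))) has_real_derivative
     (\<Sum>i\<in>UNIV. deriv_matrix Z $ i $ (j :: 'n::finite) * basis_monomial i v)) (at 0)"
proof -
  let ?n = "CARD('n)" and ?k = "idx j"
  let ?p = "?n - 1 - ?k"
  define x where "x = v $ 1"
  define y where "y = v $ 2"
  define a where "a = (Z *v v) $ 1"
  define b where "b = (Z *v v) $ 2"
  have k: "?k < ?n" by simp
  have "((\<lambda>t. (x + t * a) ^ ?p * (y + t * b) ^ ?k) has_real_derivative
     of_nat ?p * x ^ (?p - 1) * a * y ^ ?k + x ^ ?p * (of_nat ?k * y ^ (?k - 1) * b)) (at 0)"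
    by (auto intro!: derivative_eq_intros)
  moreover have "(\<lambda>t. basis_monomial j (v + t *\<^sub>R (Z *v v))) = (\<lambda>t. (x + t * a) ^ ?p * (y + t * b) ^ ?k)"
    by (simp add: basis_monomial_mon mon_def x_def y_def a_def b_def)
  moreover have "(\<Sum>i\<in>UNIV. deriv_matrix Z $ i $ j * basis_monomial i v) =
     of_nat ?p * x ^ (?p - 1) * a * y ^ ?k + x ^ ?p * (of_nat ?k * y ^ (?k - 1) * b)"
  proof -
    let ?A = "of_nat ?p * Z $ 1 $ 1 + of_nat ?k * Z $ 2 $ 2 :: real"
    let ?B = "of_nat ?p * Z $ 1 $ 2 :: real"
    let ?C = "of_nat ?k * Z $ 2 $ 1 :: real"
    have "(\<Sum>i\<in>UNIV. deriv_matrix Z $ i $ j * basis_monomial i v) =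
       (\<Sum>i\<in>(UNIV :: 'n set). (\<lambda>l. (if l = ?k then ?A * mon (?n - 1) l v else 0) + (if l = Suc ?k then ?B * mon (?n - 1) l v else 0)
         + (if Suc l = ?k then ?C * mon (?n - 1) l v else 0)) (idx i))"
      by (rule sum.cong) (auto simp: deriv_matrix_def basis_monomial_mon algebra_simps)
    also have "\<dots> = (\<Sum>l<?n. (if l = ?k then ?A * mon (?n - 1) l v else 0) + (if l = Suc ?k then ?B * mon (?n - 1) l v else 0)
         + (if Suc l = ?k then ?C * mon (?n - 1) l v else 0))" by (rule idx_sum)
    also have "\<dots> = ?A * mon (?n - 1) ?k v + (if Suc ?k < ?n then ?B * mon (?n - 1) (Suc ?k) v else 0)
         + (if ?k > 0 then ?C * mon (?n - 1) (?k - 1) v else 0)"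
    proof -
      have "(\<Sum>l<?n. if Suc l = ?k then ?C * mon (?n - 1) l v else 0) = (if ?k > 0 then ?C * mon (?n - 1) (?k - 1) v else 0)"
      proof (cases "?k")
        case (Suc q)
        have "(\<Sum>l<?n. if Suc l = ?k then ?C * mon (?n - 1) l v else 0) = (\<Sum>l<?n. if l = q then ?C * mon (?n - 1) l v else 0)"
          by (rule sum.cong) (auto simp: Suc)
        then show ?thesis using Suc k by simp
      qed simp
      then show ?thesis using k by (simp add: sum.distrib)
    qed
    also have "\<dots> = of_nat ?p * x ^ (?p - 1) * a * y ^ ?k + x ^ ?p * (of_nat ?k * y ^ (?k - 1) * b)"
    proof -
      have 1: "of_nat ?p * x ^ (?p - 1) * x = of_nat ?p * x ^ ?p" by (cases ?p) simp_all
      have 2: "of_nat ?k * y ^ (?k - 1) * y = of_nat ?k * y ^ ?k" by (cases ?k) simp_all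
      have 3: "(if Suc ?k < ?n then ?B * mon (?n - 1) (Suc ?k) v else 0) = of_nat ?p * Z $ 1 $ 2 * (x ^ (?p - 1) * y ^ Suc ?k)"
      proof (cases "Suc ?k < ?n")
        case True
        then have "?n - 1 - Suc ?k = ?p - 1" by simp
        then show ?thesis using True by (simp add: mon_def x_def y_def)
      next
        case False
        then have "?p = 0" using k by simp
        then show ?thesis using False by simp
      qed
      have 4: "(if ?k > 0 then ?C * mon (?n - 1) (?k - 1) v else 0) = of_nat ?k * Z $ 2 $ 1 * (x ^ Suc ?p * y ^ (?k - 1))"
      proof (cases "?k > 0")
        case True
        then have "?n - 1 - (?k - 1) = Suc ?p" using k by linarith
        then show ?thesis using True by (simp add: mon_def x_def y_def)
      qed simp
      have ab: "a = Z $ 1 $ 1 * x + Z $ 1 $ 2 * y" "b = Z $ 2 $ 1 * x + Z $ 2 $ 2 * y"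
        unfolding a_def b_def x_def y_def mult_vec2 by simp_all
      have "of_nat ?p * x ^ (?p - 1) * a * y ^ ?k = Z $ 1 $ 1 * (of_nat ?p * x ^ (?p - 1) * x) * y ^ ?k + of_nat ?p * Z $ 1 $ 2 * (x ^ (?p - 1) * y ^ Suc ?k)"
        unfolding ab by (simp add: algebra_simps)
      moreover have "x ^ ?p * (of_nat ?k * y ^ (?k - 1) * b) = Z $ 2 $ 2 * x ^ ?p * (of_nat ?k * y ^ (?k - 1) * y) + of_nat ?k * Z $ 2 $ 1 * (x ^ Suc ?p * y ^ (?k - 1))"
        unfolding ab by (simp add: algebra_simps)
      ultimately show ?thesis unfolding 1 2 3 4 by (simp add: mon_def x_def[symmetric] y_def[symmetric] algebra_simps)
    qed
    finally show ?thesis .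
  qed
  ultimately show ?thesis by simp
qed

text \<open>Both sides differentiate the same curve, a monomial along
  \<open>M *v (v + t *\<^sub>R (Z *v v))\<close>: first substituting \<open>M\<close> and then
  moving along \<open>Z\<close>, or moving along the conjugated direction at the point
  \<open>M *v v\<close>.\<close>

lemma deriv_matrix_conj:
  assumes "M' ** M = mat 1"
  shows "deriv_matrix Z ** (subst_matrix M :: real ^ 'n::finite ^ 'n) = subst_matrix M ** deriv_matrix (M ** Z ** M')"
proof -
  have "(deriv_matrix Z ** (subst_matrix M :: real ^ 'n ^ 'n)) $ i $ j = (subst_matrix M ** deriv_matrix (M ** Z ** M')) $ i $ j" for i j
  proof (rule mon_independent2[of "\<lambda>i. (deriv_matrix Z ** (subst_matrix M :: real ^ 'n ^ 'n)) $ i $ j"])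
    fix v
    let ?f = "\<lambda>t. basis_monomial j (M *v (v + t *\<^sub>R (Z *v v)))"
    have "(?f has_real_derivative (\<Sum>i\<in>UNIV. subst_matrix M $ i $ j * (\<Sum>l\<in>UNIV. deriv_matrix Z $ l $ i * basis_monomial l v))) (at 0)"
      unfolding subst_matrix by (intro DERIV_sum DERIV_cmult deriv_matrix)
    moreover have "(?f has_real_derivative (\<Sum>i\<in>UNIV. deriv_matrix (M ** Z ** M') $ i $ j * basis_monomial i (M *v v))) (at 0)"
    proof -
      have "M' *v (M *v v) = v" using assms by (simp add: matrix_vector_mul_assoc)
      then have "M *v (v + t *\<^sub>R (Z *v v)) = M *v v + t *\<^sub>R ((M ** Z ** M') *v (M *v v))" for t
        by (simp add: matrix_vector_mul_assoc[symmetric] matrix_vector_right_distrib matrix_vector_mult_scaleR del: matrix_vector_mul_assoc)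
      then show ?thesis using deriv_matrix[of j "M *v v" "M ** Z ** M'"] by simp
    qed
    ultimately have "(\<Sum>i\<in>UNIV. subst_matrix M $ i $ j * (\<Sum>l\<in>UNIV. deriv_matrix Z $ l $ i * basis_monomial l v))
       = (\<Sum>i\<in>UNIV. deriv_matrix (M ** Z ** M') $ i $ j * basis_monomial i (M *v v))" by (rule DERIV_unique)
    then show "(\<Sum>i\<in>UNIV. (deriv_matrix Z ** subst_matrix M) $ i $ j * basis_monomial i v) =
       (\<Sum>i\<in>UNIV. (subst_matrix M ** deriv_matrix (M ** Z ** M')) $ i $ j * basis_monomial i v)"
      unfolding sum_sum_matrix subst_matrix[of _ M] .
  qed
  then show ?thesis by (simp add: vec_eq_iff)
qed

section \<open>The quadrilateral group in \<open>GL(2)\<close>\<close>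

definition mat2 :: "real \<Rightarrow> real \<Rightarrow> real \<Rightarrow> real \<Rightarrow> real ^ 2 ^ 2" where
  "mat2 a b c d = vector [vector [a, b], vector [c, d]]"

lemma mat2_nth [simp]: "mat2 a b c d $ 1 $ 1 = a" "mat2 a b c d $ 1 $ 2 = b"
  "mat2 a b c d $ 2 $ 1 = c" "mat2 a b c d $ 2 $ 2 = d"
  by (simp_all add: mat2_def)

lemma mat2_eqI: "M $ 1 $ 1 = N $ 1 $ 1 \<Longrightarrow> M $ 1 $ 2 = N $ 1 $ 2 \<Longrightarrow> M $ 2 $ 1 = N $ 2 $ 1 \<Longrightarrow> M $ 2 $ 2 = N $ 2 $ 2 \<Longrightarrow> M = N"
  for M N :: "real ^ 2 ^ 2"
  by (simp add: vec_eq_iff forall_2)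

lemma mat2_mult: "mat2 a b c d ** mat2 a' b' c' d' = mat2 (a * a' + b * c') (a * b' + b * d') (c * a' + d * c') (c * b' + d * d')"
  by (rule mat2_eqI) (simp_all add: matrix_matrix_mult_def sum_2)

lemma mat2_one: "mat 1 = mat2 1 0 0 1"
  by (rule mat2_eqI) (simp_all add: mat_def)

lemma mat2_minus: "- mat2 a b c d = mat2 (- a) (- b) (- c) (- d)"
  by (rule mat2_eqI) simp_all

lemma mat2_cong: "a = a' \<Longrightarrow> b = b' \<Longrightarrow> c = c' \<Longrightarrow> d = d' \<Longrightarrow> mat2 a b c d = mat2 a' b' c' d'" by simp

text \<open>The two constants satisfy \<open>rt6\<close>^2 - \<open>rt2\<close>^2 = 1, which makes
  the mirror matrices involutions, and 2 \<open>rt2\<close> \<open>rt6\<close> = sqrt 3, the radius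
  of the Klein disc.\<close>

definition rt2 :: real where "rt2 = sqrt (1 / 2)"
definition rt6 :: real where "rt6 = sqrt (3 / 2)"

lemma rt_squares: "rt2 * rt2 = 1 / 2" "rt6 * rt6 = 3 / 2" "rt2 * (rt2 * x) = x / 2" "rt6 * (rt6 * x) = 3 / 2 * x"
  by (simp_all add: rt2_def rt6_def mult.assoc[symmetric] del: real_sqrt_divide)

lemma rt_pos: "rt2 > 0" "rt6 > 0" by (simp_all add: rt2_def rt6_def del: real_sqrt_divide)

text \<open>Two-dimensional lifts of the reflections, of determinant -1 and determined up to sign.
  In this basis the mirrors on the first axis are antidiagonal, so the product of these two is
  diagonal.\<close>

definition mirror_matrix :: "mirror \<Rightarrow> real ^ 2 ^ 2" where
  "mirror_matrix i = (if fst i then mat2 rt6 (sg (snd i) * rt2) (- sg (snd i) * rt2) (- rt6)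
     else mat2 0 (rt6 - sg (snd i) * rt2) (rt6 + sg (snd i) * rt2) 0)"

lemma mirror_matrix_square: "mirror_matrix i ** mirror_matrix i = mat 1"
  by (cases "snd i") (simp_all add: mirror_matrix_def mat2_mult mat2_one algebra_simps rt_squares)

text \<open>Only the group modulo sign acts on the disc. No uniform sign can be expected: the
  relation holds exactly if the two mirrors carry different signs, and with a minus
  otherwise.\<close>

lemma mirror_matrix_braid:
  assumes "fst i \<noteq> fst j"
  shows "mirror_matrix i ** mirror_matrix j ** mirror_matrix i = mirror_matrix j ** mirror_matrix i ** mirror_matrix j \<or>
    mirror_matrix i ** mirror_matrix j ** mirror_matrix i = - (mirror_matrix j ** mirror_matrix i ** mirror_matrix j)"
proof -
  obtain k e k' e' where ij: "i = (k, e)" "j = (k', e')" by (metis surj_pair)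
  then have k: "k \<noteq> k'" using assms by simp
  show ?thesis
  proof (cases "e = e'")
    case True
    then show ?thesis using k unfolding ij
      by (intro disjI2; cases k; cases k'; cases e; simp add: mirror_matrix_def mat2_mult mat2_minus sg_def algebra_simps rt_squares;
        (intro mat2_cong; simp add: field_simps)?)
  next
    case False
    then show ?thesis using k unfolding ij
      by (intro disjI1; cases k; cases k'; cases e; cases e'; simp add: mirror_matrix_def mat2_mult mat2_minus sg_def algebra_simps rt_squares;
        (intro mat2_cong; simp add: field_simps)?)
  qed
qed

text \<open>An equivariant parametrization of the light cone.\<close>

definition light :: "real ^ 2 \<Rightarrow> real \<times> real \<times> real" where
  "light v = ((v $ 1)\<^sup>2 + (v $ 2)\<^sup>2, 2 * rt2 * rt6 * ((v $ 1)\<^sup>2 - (v $ 2)\<^sup>2), 4 * rt2 * rt6 * (v $ 1 * v $ 2))"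

lemma reflect_light: "reflect i (light v) = light (mirror_matrix i *v v)"
proof -
  obtain k e where i: "i = (k, e)" by force
  show ?thesis unfolding i
    by (cases k; cases e) (simp_all add: light_def mirror_matrix_def mult_vec2 power2_eq_square algebra_simps rt_squares)
qed

section \<open>An invariant lattice\<close>

definition form_s :: "real ^ 2 \<Rightarrow> real" where "form_s v = (v $ 1)\<^sup>2 + (v $ 2)\<^sup>2"
definition form_a :: "real ^ 2 \<Rightarrow> real" where "form_a v = 2 * rt2 * rt6 * ((v $ 1)\<^sup>2 - (v $ 2)\<^sup>2)"
definition form_b :: "real ^ 2 \<Rightarrow> real" where "form_b v = 4 * rt2 * rt6 * (v $ 1 * v $ 2)"

lemma light_forms: "light v = (form_s v, form_a v, form_b v)"
  by (simp add: light_def form_s_def form_a_def form_b_def)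

lemma rt26: "(rt2 * rt6) * (rt2 * rt6) = 3 / 4"
proof -
  have "(rt2 * rt6) * (rt2 * rt6) = (rt2 * rt2) * (rt6 * rt6)" by (simp only: mult_ac)
  then show ?thesis by (simp add: rt_squares)
qed

lemma forms_relation: "form_b v * form_b v = 3 * (form_s v * form_s v) - form_a v * form_a v"
proof -
  have "form_b v * form_b v = 16 * ((rt2 * rt6) * (rt2 * rt6)) * (v $ 1 * v $ 2)\<^sup>2"
    by (simp add: form_b_def power2_eq_square)
  moreover have "form_a v * form_a v = 4 * ((rt2 * rt6) * (rt2 * rt6)) * ((v $ 1)\<^sup>2 - (v $ 2)\<^sup>2)\<^sup>2"
    by (simp add: form_a_def power2_eq_square)
  ultimately show ?thesis unfolding rt26 form_s_def by (simp add: power2_eq_square algebra_simps)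
qed

text \<open>The monomials in the three quadratic forms that contain \<open>form_b\<close> at most once. Because of
  \<open>forms_relation\<close>, their integral span is stable under the integral substitutions \<open>reflect\<close>.\<close>

definition lat :: "nat \<Rightarrow> nat \<Rightarrow> real ^ 2 \<Rightarrow> real" where
  "lat m k v = (if k \<le> m then form_s v ^ (m - k) * form_a v ^ k
     else form_b v * (form_s v ^ (2 * m - k) * form_a v ^ (k - Suc m)))"

lemma lat_s:
  assumes "k < Suc (2 * m)"
  shows "form_s v * lat m k v = lat (Suc m) (if k \<le> m then k else Suc k) v"
proof (cases "k \<le> m")
  case True
  then have "Suc m - k = Suc (m - k)" by simp
  then show ?thesis using True by (simp add: lat_def)
next
  case False
  then have "2 * Suc m - Suc k = Suc (2 * m - k)" "Suc k - Suc (Suc m) = k - Suc m" using assms by simp_all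
  then show ?thesis using False by (simp add: lat_def)
qed

lemma lat_a:
  assumes "k < Suc (2 * m)"
  shows "form_a v * lat m k v = lat (Suc m) (if k \<le> m then Suc k else Suc (Suc k)) v"
proof (cases "k \<le> m")
  case True
  then show ?thesis by (simp add: lat_def)
next
  case False
  then have "2 * Suc m - Suc (Suc k) = 2 * m - k" "Suc (Suc k) - Suc (Suc m) = Suc (k - Suc m)" using assms by simp_all
  then show ?thesis using False by (simp add: lat_def)
qed

lemma lat_b:
  assumes "k < Suc (2 * m)"
  shows "k \<le> m \<Longrightarrow> form_b v * lat m k v = lat (Suc m) (m + 2 + k) v"
    and "\<not> k \<le> m \<Longrightarrow> form_b v * lat m k v = 3 * lat (Suc m) (k - Suc m) v + - 1 * lat (Suc m) (Suc (Suc (k - Suc m))) v"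
proof -
  assume "k \<le> m"
  then have "2 * Suc m - (m + 2 + k) = m - k" "m + 2 + k - Suc (Suc m) = k" "\<not> m + 2 + k \<le> Suc m" by simp_all
  then show "form_b v * lat m k v = lat (Suc m) (m + 2 + k) v" using \<open>k \<le> m\<close> by (simp add: lat_def)
next
  assume k: "\<not> k \<le> m"
  define l where "l = k - Suc m"
  define e where "e = 2 * m - k"
  have le: "Suc m - l = Suc (Suc e)" "Suc m - Suc (Suc l) = e" "l \<le> Suc m" "Suc (Suc l) \<le> Suc m"
    using assms k by (auto simp: l_def e_def)
  have "form_b v * lat m k v = (form_b v * form_b v) * (form_s v ^ e * form_a v ^ l)"
    using k by (simp add: lat_def l_def e_def)
  also have "\<dots> = 3 * (form_s v ^ Suc (Suc e) * form_a v ^ l) - form_s v ^ e * form_a v ^ Suc (Suc l)"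
    unfolding forms_relation by (simp add: algebra_simps)
  finally show "form_b v * lat m k v = 3 * lat (Suc m) (k - Suc m) v + - 1 * lat (Suc m) (Suc (Suc (k - Suc m))) v"
    unfolding l_def[symmetric] using le by (simp add: lat_def)
qed

text \<open>Multiplication by an integral combination of the three forms maps the lattice of one
  degree to that of the next; a square of \<open>form_b\<close> is removed by
  \<open>forms_relation\<close>.\<close>

lemma comb_lat_power:
  assumes R: "coeff_ring R" and Z: "\<And>z. (\<lambda>_. of_int z) \<in> R" and c: "(\<lambda>_. p) \<in> R" "(\<lambda>_. q) \<in> R" "(\<lambda>_. r) \<in> R"
    and f: "f \<in> comb R (Suc (2 * d)) (lat d)"
  shows "(\<lambda>h v. (p * form_s v + q * form_a v + r * form_b v) ^ i * f h v) \<in> comb R (Suc (2 * (d + i))) (lat (d + i))"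
proof (induction i)
  case (Suc i)
  let ?e = "d + i"
  let ?K = "comb R (Suc (2 * Suc ?e)) (lat (Suc ?e))"
  let ?l = "\<lambda>v. p * form_s v + q * form_a v + r * form_b v"
  have "(\<lambda>h v. ?l v * (?l v ^ i * f h v)) \<in> ?K"
  proof (rule comb_mult[OF R Suc])
    fix k assume k: "k < Suc (2 * ?e)"
    have s: "(\<lambda>h v. form_s v * lat ?e k v) \<in> ?K"
      unfolding lat_s[OF k] by (rule comb_basis[OF R]) (use k in auto)
    have a: "(\<lambda>h v. form_a v * lat ?e k v) \<in> ?K"
      unfolding lat_a[OF k] by (rule comb_basis[OF R]) (use k in auto)
    have b: "(\<lambda>h v. form_b v * lat ?e k v) \<in> ?K"
    proof (cases "k \<le> ?e")
      case True
      show ?thesis unfolding lat_b(1)[OF k True] by (rule comb_basis[OF R]) (use True in auto)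
    next
      case False
      have 3: "(\<lambda>_. 3) \<in> R" "(\<lambda>_. - 1) \<in> R" using Z[of 3] Z[of "- 1"] by simp_all
      show ?thesis unfolding lat_b(2)[OF k False]
        by (intro comb_add[OF R] comb_scale[OF R comb_basis[OF R], of _ _ "\<lambda>_. 3"] comb_scale[OF R comb_basis[OF R], of _ _ "\<lambda>_. - 1"] 3)
          (use k in auto)
    qed
    have "(\<lambda>h v. p * (form_s v * lat ?e k v) + q * (form_a v * lat ?e k v) + r * (form_b v * lat ?e k v)) \<in> ?K"
      by (intro comb_add[OF R] comb_scale[OF R s c(1)] comb_scale[OF R a c(2)] comb_scale[OF R b c(3)])
    then show "(\<lambda>h v. ?l v * lat ?e k v) \<in> ?K" by (simp add: algebra_simps)
  qed
  then show ?case by (simp add: mult.assoc)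
qed (use f in simp)

lemma comb_lat_one: assumes R: "coeff_ring R" shows "(\<lambda>h v. 1) \<in> comb R (Suc (2 * 0)) (lat 0)"
proof -
  have "lat 0 0 = (\<lambda>v. 1)" by (simp add: lat_def fun_eq_iff)
  then show ?thesis using comb_basis[OF R, of 0 "Suc (2 * 0)" "lat 0"] by simp
qed

lemma comb_lat_substitution:
  assumes R: "coeff_ring R" and Z: "\<And>z. (\<lambda>_. of_int z) \<in> R"
    and c: "\<And>a. (\<lambda>_. p a) \<in> R" "\<And>a. (\<lambda>_. q a) \<in> R" "\<And>a. (\<lambda>_. r a) \<in> R"
    and ijl: "i + j + l = m"
  shows "(\<lambda>h v. (p 0 * form_s v + q 0 * form_a v + r 0 * form_b v) ^ i * ((p 1 * form_s v + q 1 * form_a v + r 1 * form_b v) ^ j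
     * ((p 2 * form_s v + q 2 * form_a v + r (2 :: nat) * form_b v) ^ l * 1))) \<in> comb R (Suc (2 * m)) (lat m)"
proof -
  have e: "0 + l + j + i = m" using ijl by simp
  show ?thesis unfolding e[symmetric] by (intro comb_lat_power[OF R Z] c comb_lat_one[OF R])
qed

lemma lat_reflect:
  assumes k: "k < Suc (2 * m)"
  shows "(\<lambda>h v. lat m k (mirror_matrix i *v v)) \<in> comb {c :: unit \<Rightarrow> real. c () \<in> \<int>} (Suc (2 * m)) (lat m)"
proof -
  obtain x e where i: "i = (x, e)" by force
  \<comment> \<open>The integral matrix of the reflection on the three quadratic forms, one triple
    for each row.\<close>
  define p :: "nat \<Rightarrow> real" where "p a = (if a = 0 then 2 else if a = 1 then (if x then 0 else - 3 * sg e) else (if x then - 3 * sg e else 0))" for a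
  define q :: "nat \<Rightarrow> real" where "q a = (if a = 0 then (if x then 0 else sg e) else if a = 1 then (if x then 1 else - 2) else 0)" for a
  define r :: "nat \<Rightarrow> real" where "r a = (if a = 0 then (if x then sg e else 0) else if a = 1 then 0 else (if x then - 2 else 1))" for a
  have sgZ: "sg e \<in> \<int>" by (cases e) simp_all
  have Z: "p a \<in> \<int>" "q a \<in> \<int>" "r a \<in> \<int>" for a using sgZ by (auto simp: p_def q_def r_def)
  have L: "light (mirror_matrix i *v v) = (p 0 * form_s v + q 0 * form_a v + r 0 * form_b v,
      p 1 * form_s v + q 1 * form_a v + r 1 * form_b v, p 2 * form_s v + q 2 * form_a v + r 2 * form_b v)" for v
    unfolding reflect_light[symmetric] unfolding light_forms i by (cases x) (simp_all add: p_def q_def r_def)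
  have fs: "form_s (mirror_matrix i *v v) = p 0 * form_s v + q 0 * form_a v + r 0 * form_b v"
    "form_a (mirror_matrix i *v v) = p 1 * form_s v + q 1 * form_a v + r 1 * form_b v"
    "form_b (mirror_matrix i *v v) = p 2 * form_s v + q 2 * form_a v + r 2 * form_b v" for v
    using L[of v] unfolding light_forms by simp_all
  show ?thesis
  proof (cases "k \<le> m")
    case True
    have "m - k + k + 0 = m" using True by simp
    from comb_lat_substitution[OF coeff_ring_Ints, of p q r "m - k" k 0 m, OF _ _ _ _ this]
    show ?thesis using True Z by (simp add: lat_def fs)
  next
    case False
    have "2 * m - k + (k - Suc m) + 1 = m" using False k by simp
    from comb_lat_substitution[OF coeff_ring_Ints, of p q r "2 * m - k" "k - Suc m" 1 m, OF _ _ _ _ this]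
    show ?thesis using False Z by (simp add: lat_def fs mult_ac)
  qed
qed

lemma lat_mon:
  assumes k: "k < Suc (2 * m)"
  shows "(\<lambda>h v. mon (2 * m) k v) \<in> comb (UNIV :: (unit \<Rightarrow> real) set) (Suc (2 * m)) (lat m)"
proof -
  \<comment> \<open>The factor that inverts the three forms: the squares of the coordinates are
    \<open>form_s\<close> / 2 plus or minus \<open>w\<close> times \<open>form_a\<close>, and their
    product is \<open>w\<close> times \<open>form_b\<close>.\<close>
  define w where "w = 1 / (4 * rt2 * rt6)"
  have w: "4 * rt2 * rt6 * w = 1" using rt_pos by (simp add: w_def)
  define p :: "nat \<Rightarrow> real" where "p a = (if a \<le> 1 then 1 / 2 else 0)" for a
  define q :: "nat \<Rightarrow> real" where "q a = (if a = 0 then w else if a = 1 then - w else 0)" for a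
  define r :: "nat \<Rightarrow> real" where "r a = (if a \<le> 1 then 0 else w)" for a
  have wa: "w * form_a v = ((v $ 1)\<^sup>2 - (v $ 2)\<^sup>2) / 2" for v
  proof -
    have "w * form_a v = (4 * rt2 * rt6 * w) * ((v $ 1)\<^sup>2 - (v $ 2)\<^sup>2) / 2" by (simp add: form_a_def)
    then show ?thesis unfolding w by simp
  qed
  have wb: "w * form_b v = v $ 1 * v $ 2" for v
  proof -
    have "w * form_b v = (4 * rt2 * rt6 * w) * (v $ 1 * v $ 2)" by (simp add: form_b_def)
    then show ?thesis unfolding w by simp
  qed
  have fs: "p 0 * form_s v + q 0 * form_a v + r 0 * form_b v = (v $ 1)\<^sup>2"
    "p 1 * form_s v + q 1 * form_a v + r 1 * form_b v = (v $ 2)\<^sup>2"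
    "p 2 * form_s v + q 2 * form_a v + r 2 * form_b v = v $ 1 * v $ 2" for v
    using wa[of v] wb[of v] by (simp_all add: p_def q_def r_def form_s_def field_simps)
  \<comment> \<open>A monomial of even degree is a product of squares of the coordinates and at most
    one mixed product.\<close>
  define l where "l = k mod 2"
  define j where "j = k div 2"
  define i where "i = m - j - l"
  have jl: "k = 2 * j + l" "l \<le> 1" by (simp_all add: j_def l_def)
  have ijl: "i + j + l = m" using k jl by (auto simp: i_def)
  have "mon (2 * m) k v = ((v $ 1)\<^sup>2) ^ i * (((v $ 2)\<^sup>2) ^ j * ((v $ 1 * v $ 2) ^ l * 1))" for v
  proof -
    have "2 * m - k = 2 * i + l" using ijl jl by simp
    then show ?thesis unfolding mon_def jl(1)
      by (simp add: power_add power_mult power_mult_distrib)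
  qed
  moreover have "(\<lambda>(h :: unit) v. ((v $ 1)\<^sup>2) ^ i * (((v $ 2)\<^sup>2) ^ j * ((v $ 1 * v $ 2) ^ l * 1))) \<in> comb UNIV (Suc (2 * m)) (lat m)"
    using comb_lat_substitution[OF coeff_ring_UNIV, of p q r i j l m, OF _ _ _ _ ijl] unfolding fs by simp
  ultimately show ?thesis by simp
qed

lemma comb_mon_form:
  fixes p q r :: real
  assumes R: "coeff_ring R" and c: "(\<lambda>_. p) \<in> R" "(\<lambda>_. q) \<in> R" "(\<lambda>_. r) \<in> R"
    and f: "f \<in> comb R (Suc d) (mon d)"
  shows "(\<lambda>h v. (p * (v $ 1)\<^sup>2 + q * (v $ 1 * v $ 2) + r * (v $ 2)\<^sup>2) ^ i * f h v) \<in> comb R (Suc (d + 2 * i)) (mon (d + 2 * i))"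
proof (induction i)
  case (Suc i)
  let ?e = "d + 2 * i"
  let ?K = "comb R (Suc (Suc (Suc ?e))) (mon (Suc (Suc ?e)))"
  let ?l = "\<lambda>v :: real ^ 2. p * (v $ 1)\<^sup>2 + q * (v $ 1 * v $ 2) + r * (v $ 2)\<^sup>2"
  have "(\<lambda>h v. ?l v * (?l v ^ i * f h v)) \<in> ?K"
  proof (rule comb_mult[OF R Suc])
    fix k assume k: "k < Suc ?e"
    have "(\<lambda>h v. p * mon (Suc (Suc ?e)) k v + q * mon (Suc (Suc ?e)) (Suc k) v + r * mon (Suc (Suc ?e)) (Suc (Suc k)) v) \<in> ?K"
      by (intro comb_add[OF R] comb_scale[OF R comb_basis[OF R] c(1)] comb_scale[OF R comb_basis[OF R] c(2)]
          comb_scale[OF R comb_basis[OF R] c(3)]) (use k in simp_all)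
    moreover have "?l v * mon ?e k v = p * mon (Suc (Suc ?e)) k v + q * mon (Suc (Suc ?e)) (Suc k) v + r * mon (Suc (Suc ?e)) (Suc (Suc k)) v" for v
    proof -
      have "Suc (Suc ?e) - k = Suc (Suc (?e - k))" "Suc ?e - k = Suc (?e - k)" using k by simp_all
      then show ?thesis unfolding mon_def by (simp add: algebra_simps power2_eq_square)
    qed
    ultimately show "(\<lambda>h v. ?l v * mon ?e k v) \<in> ?K" by simp
  qed
  then show ?case by (simp add: mult.assoc)
qed (use f in simp)

lemma mon_lat:
  assumes k: "k < Suc (2 * m)"
  shows "(\<lambda>h v. lat m k v) \<in> comb (UNIV :: (unit \<Rightarrow> real) set) (Suc (2 * m)) (mon (2 * m))"
proof -
  let ?c = "rt2 * rt6"
  have *: "(\<lambda>h v. (1 * (v $ 1)\<^sup>2 + 0 * (v $ 1 * v $ 2) + 1 * (v $ 2)\<^sup>2) ^ i * ((2 * ?c * (v $ 1)\<^sup>2 + 0 * (v $ 1 * v $ 2) + (- (2 * ?c)) * (v $ 2)\<^sup>2) ^ j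
      * ((0 * (v $ 1)\<^sup>2 + 4 * ?c * (v $ 1 * v $ 2) + 0 * (v $ 2)\<^sup>2) ^ l * 1))) \<in> comb (UNIV :: (unit \<Rightarrow> real) set) (Suc (2 * m)) (mon (2 * m))"
    if "i + j + l = m" for i j l
  proof -
    have e: "0 + 2 * l + 2 * j + 2 * i = 2 * m" using that by simp
    show ?thesis
      unfolding e[symmetric] by (intro comb_mon_form[OF coeff_ring_UNIV] comb_mon_one coeff_ring_UNIV UNIV_I)
  qed
  have fs: "1 * (v $ 1)\<^sup>2 + 0 * (v $ 1 * v $ 2) + 1 * (v $ 2)\<^sup>2 = form_s v"
    "2 * ?c * (v $ 1)\<^sup>2 + 0 * (v $ 1 * v $ 2) + (- (2 * ?c)) * (v $ 2)\<^sup>2 = form_a v"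
    "0 * (v $ 1)\<^sup>2 + 4 * ?c * (v $ 1 * v $ 2) + 0 * (v $ 2)\<^sup>2 = form_b v" for v :: "real ^ 2"
    by (simp_all add: form_s_def form_a_def form_b_def algebra_simps)
  note * = *[unfolded fs]
  show ?thesis
  proof (cases "k \<le> m")
    case True
    then show ?thesis using *[of "m - k" k 0] by (simp add: lat_def)
  next
    case False
    then have "2 * m - k + (k - Suc m) + 1 = m" using k by simp
    from *[OF this] show ?thesis using False by (simp add: lat_def mult_ac)
  qed
qed

definition entries_in :: "real set \<Rightarrow> real ^ 'n ^ 'n \<Rightarrow> bool" where
  "entries_in R M \<longleftrightarrow> (\<forall>i j. M $ i $ j \<in> R)"

lemma comb_matrix:
  assumes "CARD('n::finite) = p" and "\<And>k. k < p \<Longrightarrow> (\<lambda>h v. f k v) \<in> comb R p b"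
  shows "\<exists>M :: real ^ 'n ^ 'n. (\<forall>i j. (\<lambda>_ :: unit. M $ i $ j) \<in> R) \<and> (\<forall>j v. f (idx j) v = (\<Sum>i\<in>UNIV. M $ i $ j * b (idx i) v))"
proof -
  have *: "\<forall>j :: 'n. \<exists>c. \<forall>i. c i \<in> R \<and> (\<forall>(h :: unit) v. f (idx j) v = (\<Sum>i\<in>(UNIV :: 'n set). c i h * b (idx i) v))"
    by (rule allI, rule comb_CARD) (unfold assms(1), rule assms(2), metis idx_less assms(1))
  from choice[OF *] obtain c where
    c: "\<forall>j :: 'n. \<forall>i. c j i \<in> R \<and> (\<forall>(h :: unit) v. f (idx j) v = (\<Sum>i\<in>(UNIV :: 'n set). c j i h * b (idx i) v))" by (elim exE)
  have u: "(\<lambda>_. c j i ()) = c j i" for j i by (rule ext) simp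
  show ?thesis
    by (rule exI[of _ "\<chi> i j. c j i ()"]) (use c in \<open>simp add: u\<close>)
qed

lemma mon_matrix_eqI:
  assumes "\<And>j v. (\<Sum>i\<in>UNIV. M $ i $ j * basis_monomial (i :: 'n::finite) v) = (\<Sum>i\<in>UNIV. N $ i $ j * basis_monomial i v)"
  shows "M = (N :: real ^ 'n ^ 'n)"
proof -
  have "M $ i $ j = N $ i $ j" for i j by (rule mon_independent2[of "\<lambda>i. M $ i $ j"]) (rule assms)
  then show ?thesis by (simp add: vec_eq_iff)
qed

text \<open>\<open>C\<close> and \<open>D\<close> change between the monomials and the lattice
  basis. Determinant one is arranged so that conjugation by \<open>D\<close> stays within a
  conjugacy class of the special linear group.\<close>

lemma invariant_lattice:
  assumes odd: "odd CARD('n::finite)"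
  obtains C D :: "real ^ 'n ^ 'n" where "C ** D = mat 1" "D ** C = mat 1" "det C = 1"
    "\<And>i. entries_in \<int> (D ** subst_matrix (mirror_matrix i) ** C)"
proof -
  obtain m where m: "CARD('n) = Suc (2 * m)" using odd by (auto elim!: oddE)
  have bm: "basis_monomial (i :: 'n) = mon (2 * m) (idx i)" for i unfolding basis_monomial_mon m by simp
  obtain C :: "real ^ 'n ^ 'n" where C: "\<And>j v. lat m (idx j) v = (\<Sum>i\<in>UNIV. C $ i $ j * basis_monomial i v)"
    using comb_matrix[where f = "lat m", OF m mon_lat] unfolding bm[symmetric] by blast
  obtain D :: "real ^ 'n ^ 'n" where D: "\<And>j v. basis_monomial j v = (\<Sum>i\<in>UNIV. D $ i $ j * lat m (idx i) v)"
    using comb_matrix[where f = "mon (2 * m)", OF m lat_mon] unfolding bm[symmetric] by blast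
  have CD: "C ** D = mat 1"
  proof (rule mon_matrix_eqI)
    fix j :: 'n and v
    have "basis_monomial j v = (\<Sum>i\<in>UNIV. D $ i $ j * (\<Sum>l\<in>UNIV. C $ l $ i * basis_monomial l v))"
      unfolding C[symmetric] by (rule D)
    then show "(\<Sum>i\<in>UNIV. (C ** D) $ i $ j * basis_monomial i v) = (\<Sum>i\<in>UNIV. (mat 1 :: real ^ 'n ^ 'n) $ i $ j * basis_monomial i v)"
      unfolding sum_sum_matrix sum_mat_1 by simp
  qed
  then have DC: "D ** C = mat 1" using matrix_left_right_inverse by blast
  have int: "entries_in \<int> (D ** subst_matrix (mirror_matrix i) ** C)" for i
  proof -
    obtain Z :: "real ^ 'n ^ 'n" where Z: "\<And>a b. Z $ a $ b \<in> \<int>"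
      "\<And>j v. lat m (idx j) (mirror_matrix i *v v) = (\<Sum>l\<in>UNIV. Z $ l $ j * lat m (idx l) v)"
      using comb_matrix[where f = "\<lambda>k v. lat m k (mirror_matrix i *v v)", OF m lat_reflect] by (auto 4 0)
    have "subst_matrix (mirror_matrix i) ** C = C ** Z"
    proof (rule mon_matrix_eqI)
      fix j :: 'n and v
      have "(\<Sum>l\<in>UNIV. C $ l $ j * (\<Sum>i'\<in>UNIV. subst_matrix (mirror_matrix i) $ i' $ l * basis_monomial i' v)) =
        lat m (idx j) (mirror_matrix i *v v)" unfolding C subst_matrix ..
      also have "\<dots> = (\<Sum>l\<in>UNIV. Z $ l $ j * (\<Sum>i\<in>UNIV. C $ i $ l * basis_monomial i v))" unfolding C[symmetric] by (rule Z(2))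
      finally show "(\<Sum>i'\<in>UNIV. (subst_matrix (mirror_matrix i) ** C) $ i' $ j * basis_monomial i' v) =
        (\<Sum>i\<in>UNIV. (C ** Z) $ i $ j * basis_monomial i v)" unfolding sum_sum_matrix .
    qed
    then have "D ** (subst_matrix (mirror_matrix i) ** C) = Z" by (simp add: matrix_mul_assoc DC)
    then show ?thesis using Z(1) by (simp add: matrix_mul_assoc entries_in_def)
  qed
  have d0: "det C \<noteq> 0"
  proof
    assume "det C = 0"
    then have "det (C ** D) = 0" by (simp add: det_mul)
    then show False unfolding CD by simp
  qed
  \<comment> \<open>For odd \<open>n\<close> a real root exists whatever the sign of the
    determinant, and scaling does not affect the conjugation.\<close>
  define r where "r = root CARD('n) (det C)"
  have r: "r ^ CARD('n) = det C" unfolding r_def by (rule odd_real_root_pow[OF odd])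
  have r0: "r \<noteq> 0" using r d0 by (auto simp: power_0_left)
  have sc: "(a *\<^sub>R X) ** (b *\<^sub>R Y) = (a * b) *\<^sub>R (X ** Y)" for a b and X Y :: "real ^ 'n ^ 'n"
    by (simp add: vec_eq_iff matrix_matrix_mult_def sum_distrib_left mult_ac)
  show thesis
  proof (rule that[of "(1 / r) *\<^sub>R C" "r *\<^sub>R D"])
    show "((1 / r) *\<^sub>R C) ** (r *\<^sub>R D) = mat 1" "(r *\<^sub>R D) ** ((1 / r) *\<^sub>R C) = mat 1"
      using r0 by (simp_all add: sc CD DC)
    have "(1 / r) *\<^sub>R C = ((1 / r) *\<^sub>R mat 1) ** C" using sc[of "1 / r" "mat 1" 1 C] by simp
    moreover have "det ((1 / r) *\<^sub>R mat 1 :: real ^ 'n ^ 'n) = (1 / r) ^ CARD('n)"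
      by (subst det_diagonal) (simp_all add: mat_def)
    ultimately have "det ((1 / r) *\<^sub>R C) = (1 / r) ^ CARD('n) * det C" by (simp add: det_mul)
    then show "det ((1 / r) *\<^sub>R C) = 1" using r d0 by (simp add: power_divide)
    fix i
    have "(r *\<^sub>R D) ** subst_matrix (mirror_matrix i) ** ((1 / r) *\<^sub>R C) = D ** subst_matrix (mirror_matrix i) ** C"
      using sc[of r D 1 "subst_matrix (mirror_matrix i)"] sc[of r "D ** subst_matrix (mirror_matrix i)" "1 / r" C] r0 by simp
    then show "entries_in \<int> ((r *\<^sub>R D) ** subst_matrix (mirror_matrix i) ** ((1 / r) *\<^sub>R C))" using int by simp
  qed
qed

section \<open>The bent representations\<close>

abbreviation mirror_rep :: "mirror \<Rightarrow> real ^ 'n::finite ^ 'n" where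
  "mirror_rep i \<equiv> subst_matrix (mirror_matrix i)"

definition diag_mat :: "(nat \<Rightarrow> real) \<Rightarrow> real ^ 'n::finite ^ 'n" where
  "diag_mat f = (\<chi> i j. if i = j then f (idx i) else 0)"

lemma diag_mat_left: "(diag_mat f ** M) $ i $ j = f (idx i) * M $ i $ j"
proof -
  have "(diag_mat f ** M) $ i $ j = (\<Sum>k\<in>UNIV. (if i = k then f (idx i) else 0) * M $ k $ j)"
    by (simp add: matrix_matrix_mult_def diag_mat_def)
  also have "\<dots> = (\<Sum>k\<in>UNIV. if k = i then f (idx i) * M $ i $ j else 0)" by (rule sum.cong) auto
  finally have "(diag_mat f ** M) $ i $ j = (\<Sum>k\<in>UNIV. if k = i then f (idx i) * M $ i $ j else 0)" .
  then show ?thesis by simp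
qed

lemma diag_mat_right: "(M ** diag_mat f) $ i $ j = M $ i $ j * f (idx j)"
proof -
  have "(M ** diag_mat f) $ i $ j = (\<Sum>k\<in>UNIV. M $ i $ k * (if k = j then f (idx k) else 0))"
    by (simp add: matrix_matrix_mult_def diag_mat_def)
  also have "\<dots> = (\<Sum>k\<in>UNIV. if k = j then M $ i $ j * f (idx j) else 0)" by (rule sum.cong) auto
  finally have "(M ** diag_mat f) $ i $ j = (\<Sum>k\<in>UNIV. if k = j then M $ i $ j * f (idx j) else 0)" .
  then show ?thesis by simp
qed

lemma diag_mat_mult: "diag_mat f ** diag_mat g = diag_mat (\<lambda>k. f k * g k)"
  by (simp add: vec_eq_iff diag_mat_left) (simp add: diag_mat_def)

lemma diag_mat_one: "diag_mat (\<lambda>_. 1) = mat 1" by (simp add: diag_mat_def mat_def)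

lemma mirror_rep_square: "mirror_rep i ** mirror_rep i = mat 1"
  unfolding subst_matrix_mult[symmetric] mirror_matrix_square by (rule subst_matrix_one)

lemma mirror_rep_braid:
  assumes "odd CARD('n::finite)" and "fst i \<noteq> fst j"
  shows "mirror_rep i ** mirror_rep j ** mirror_rep i = mirror_rep j ** mirror_rep i ** (mirror_rep j :: real ^ 'n ^ 'n)"
proof -
  have "subst_matrix (mirror_matrix i ** mirror_matrix j ** mirror_matrix i) =
      (subst_matrix (mirror_matrix j ** mirror_matrix i ** mirror_matrix j) :: real ^ 'n ^ 'n)"
    using mirror_matrix_braid[OF assms(2)] subst_matrix_minus[OF assms(1)] by (elim disjE) simp_all
  then show ?thesis unfolding subst_matrix_mult by (simp add: matrix_mul_assoc)
qed

lemma subst_matrix_antidiag: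
  "subst_matrix (mat2 0 p q 0) $ i $ j = (if idx i + idx j = CARD('n) - 1 then p ^ (CARD('n) - 1 - idx j) * q ^ idx j else 0)"
  for i j :: "'n::finite"
proof -
  have "subst_matrix (mat2 0 p q 0) = (\<chi> i j. if idx i + idx j = CARD('n) - 1 then p ^ (CARD('n) - 1 - idx j) * q ^ idx j else 0 :: real ^ 'n ^ 'n)"
  proof (rule subst_matrix_eqI)
    fix j :: 'n and v :: "real ^ 2"
    let ?d = "CARD('n) - 1"
    have le: "idx j \<le> ?d" using idx_less[of j] by linarith
    have "?d - idx j < CARD('n)" using idx_less[of j] by linarith
    from idx_surj[OF this] obtain l :: 'n where l: "idx l = ?d - idx j" by (elim exE)
    have lj: "idx i + idx j = ?d \<longleftrightarrow> i = l" for i :: 'n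
    proof -
      have "idx i + idx j = ?d \<longleftrightarrow> idx i = idx l" using l le by linarith
      then show ?thesis by simp
    qed
    have "(\<Sum>i\<in>UNIV. (\<chi> i j. if idx i + idx j = ?d then p ^ (?d - idx j) * q ^ idx j else 0 :: real ^ 'n ^ 'n) $ i $ j * basis_monomial i v)
      = (\<Sum>i\<in>UNIV. if i = l then p ^ (?d - idx j) * q ^ idx j * basis_monomial i v else 0)"
      by (intro sum.cong HOL.refl) (unfold vec_lambda_beta lj, simp)
    also have "\<dots> = p ^ (?d - idx j) * q ^ idx j * basis_monomial l v" by simp
    also have "\<dots> = basis_monomial j (mat2 0 p q 0 *v v)"
      unfolding basis_monomial_mon mon_def l mult_vec2 diff_diff_cancel[OF le] by (simp add: power_mult_distrib)
    finally show "basis_monomial j (mat2 0 p q 0 *v v) =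
      (\<Sum>i\<in>UNIV. (\<chi> i j. if idx i + idx j = ?d then p ^ (?d - idx j) * q ^ idx j else 0 :: real ^ 'n ^ 'n) $ i $ j * basis_monomial i v)" ..
  qed
  then show ?thesis by simp
qed

text \<open>These mirrors act by antidiagonal matrices, which reverse the order of the diagonal
  entries.\<close>

lemma mirror_False_symmetric:
  fixes f :: "nat \<Rightarrow> real"
  assumes "\<And>k. k < CARD('n) \<Longrightarrow> f (CARD('n) - 1 - k) = f k"
  shows "diag_mat f ** mirror_rep (False, e) = mirror_rep (False, e) ** (diag_mat f :: real ^ 'n::finite ^ 'n)"
proof -
  have "f (idx i) * subst_matrix (mat2 0 p q 0) $ i $ j = subst_matrix (mat2 0 p q 0) $ i $ j * f (idx j)" for p q and i j :: 'n
  proof (cases "idx i + idx j = CARD('n) - 1")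
    case True
    then have "CARD('n) - 1 - idx j = idx i" by linarith
    then show ?thesis using assms[of "idx j"] by simp
  qed (simp add: subst_matrix_antidiag)
  then show ?thesis by (simp add: vec_eq_iff diag_mat_left diag_mat_right mirror_matrix_def)
qed

text \<open>Symmetric under reversal of the indices, as commutation with the antidiagonal mirrors
  demands. Its determinant is irrelevant since \<open>bend t\<close> acts by conjugation
  only.\<close>

definition bend_fun :: "nat \<Rightarrow> real \<Rightarrow> nat \<Rightarrow> real" where
  "bend_fun n x k = (if k = 0 \<or> k = n - 1 then x else 1)"

definition bend :: "real \<Rightarrow> real ^ 'n::finite ^ 'n" where
  "bend t = diag_mat (bend_fun CARD('n) (1 + t))"

definition unbend :: "real \<Rightarrow> real ^ 'n::finite ^ 'n" where
  "unbend t = diag_mat (bend_fun CARD('n) (1 / (1 + t)))"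

definition bent_rep :: "real \<Rightarrow> mirror \<Rightarrow> real ^ 'n::finite ^ 'n" where
  "bent_rep t i = (if i = (True, False) then bend t ** mirror_rep i ** unbend t else mirror_rep i)"

lemma bend_unbend: assumes "t \<ge> 0" shows "bend t ** unbend t = mat 1" "unbend t ** bend t = mat 1"
proof -
  have "bend_fun n (1 + t) k * bend_fun n (1 / (1 + t)) k = 1" "bend_fun n (1 / (1 + t)) k * bend_fun n (1 + t) k = 1" for n k
    using assms by (simp_all add: bend_fun_def)
  then show "bend t ** unbend t = mat 1" "unbend t ** bend t = mat 1"
    by (simp_all add: bend_def unbend_def diag_mat_mult diag_mat_one)
qed

lemma bend_mirror_False: "bend t ** mirror_rep (False, e) = mirror_rep (False, e) ** bend t"
  "unbend t ** mirror_rep (False, e) = mirror_rep (False, e) ** unbend t"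
  unfolding bend_def unbend_def by (rule mirror_False_symmetric; auto simp: bend_fun_def)+

lemma conj_mult:
  fixes p q M N :: "real ^ 'n::finite ^ 'n"
  assumes "q ** p = mat 1"
  shows "(p ** M ** q) ** (p ** N ** q) = p ** (M ** N) ** q"
proof -
  have "(p ** M ** q) ** (p ** N ** q) = p ** M ** (q ** p) ** N ** q" by (simp add: matrix_mul_assoc)
  then show ?thesis using assms by (simp add: matrix_mul_assoc)
qed

lemma bent_rep_square: assumes "t \<ge> 0" shows "bent_rep t i ** bent_rep t i = mat 1"
  using assms by (simp add: bent_rep_def conj_mult bend_unbend mirror_rep_square)

lemma bent_rep_conj_False: assumes "t \<ge> 0" shows "bend t ** mirror_rep (False, e) ** unbend t = mirror_rep (False, e)"
  by (simp add: bend_mirror_False matrix_mul_assoc[symmetric] bend_unbend[OF assms])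

text \<open>A relation that involves the bent mirror involves otherwise a mirror commuting with
  \<open>bend t\<close>, so the whole relation is conjugated.\<close>

lemma bent_rep_braid:
  assumes odd: "odd CARD('n::finite)" and t: "t \<ge> 0" and ij: "fst i \<noteq> fst j"
  shows "bent_rep t i ** bent_rep t j ** bent_rep t i = bent_rep t j ** bent_rep t i ** (bent_rep t j :: real ^ 'n ^ 'n)"
proof (cases "i = (True, False) \<or> j = (True, False)")
  case True
  have "bent_rep t k = bend t ** mirror_rep k ** (unbend t :: real ^ 'n ^ 'n)" if "k = i \<or> k = j" for k
  proof (cases "k = (True, False)")
    case False
    then have "fst k = False" using True ij that by auto
    then obtain e where "k = (False, e)" by (metis prod.collapse)
    then show ?thesis by (simp add: bent_rep_def bent_rep_conj_False[OF t])
  qed (simp add: bent_rep_def)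
  then show ?thesis using mirror_rep_braid[OF odd ij] by (simp add: conj_mult bend_unbend[OF t])
next
  case False
  then show ?thesis using mirror_rep_braid[OF odd ij] by (simp add: bent_rep_def)
qed

definition word_mat :: "(mirror \<Rightarrow> real ^ 'm::finite ^ 'm) \<Rightarrow> mirror list \<Rightarrow> real ^ 'm ^ 'm" where
  "word_mat X u = foldr (\<lambda>i M. X i ** M) u (mat 1)"

lemma word_mat_simps [simp]: "word_mat X [] = mat 1" "word_mat X (i # u) = X i ** word_mat X u"
  by (simp_all add: word_mat_def)

lemma word_mat_append: "word_mat X (u @ v) = word_mat X u ** word_mat X v"
  by (induction u) (simp_all add: matrix_mul_assoc)

definition is_rep :: "(mirror \<Rightarrow> real ^ 'm::finite ^ 'm) \<Rightarrow> bool" where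
  "is_rep X \<longleftrightarrow> (\<forall>i. X i ** X i = mat 1) \<and> (\<forall>i j. fst i \<noteq> fst j \<longrightarrow> X i ** X j ** X i = X j ** X i ** X j)"

lemma is_rep_square: "is_rep X \<Longrightarrow> X i ** X i = mat 1"
  unfolding is_rep_def by (elim conjE allE)

lemma is_rep_braid: "is_rep X \<Longrightarrow> fst i \<noteq> fst j \<Longrightarrow> X i ** X j ** X i = X j ** X i ** X j"
  unfolding is_rep_def by (elim conjE allE impE) assumption+

lemma word_mat_weq:
  fixes X :: "mirror \<Rightarrow> real ^ 'm::finite ^ 'm"
  assumes X: "is_rep X" and uv: "u \<simeq> v"
  shows "word_mat X u = word_mat X v"
  using uv
proof (induction rule: weq.induct)
  case (cancel u i v)
  have "X i ** (X i ** M) = M" for M :: "real ^ 'm ^ 'm" by (simp add: is_rep_square[OF X] matrix_mul_assoc)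
  then show ?case by (simp add: word_mat_append)
next
  case (braid i j u v)
  have "X i ** X j ** X i = X j ** X i ** X j" by (rule is_rep_braid[OF X braid])
  then have "X i ** (X j ** (X i ** M)) = X j ** (X i ** (X j ** M))" for M :: "real ^ 'm ^ 'm" by (simp add: matrix_mul_assoc)
  then show ?case by (simp add: word_mat_append)
qed simp_all

lemma is_rep_bent: "odd CARD('n::finite) \<Longrightarrow> t \<ge> 0 \<Longrightarrow> is_rep (bent_rep t :: mirror \<Rightarrow> real ^ 'n ^ 'n)"
  unfolding is_rep_def using bent_rep_square bent_rep_braid by blast

lemma word_mat_rev: assumes "is_rep X" shows "word_mat X (rev u) ** word_mat X u = mat 1"
proof -
  have "rev u @ u \<simeq> []" by (rule weq_rev_left)
  from word_mat_weq[OF assms this] show ?thesis by (simp add: word_mat_append)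
qed

text \<open>The braid relations force all generators to have the same determinant, a sign, which
  cancels in even words.\<close>

lemma word_mat_det:
  assumes X: "is_rep X" and u: "even (length u)"
  shows "det (word_mat X u) = 1"
proof -
  define e where "e = det (X (False, False))"
  have sq: "det (X i) * det (X i) = 1" for i
  proof -
    from is_rep_square[OF X] have "det (X i ** X i) = 1" by simp
    then show ?thesis by (simp add: det_mul)
  qed
  have br: "det (X i) = det (X j)" if "fst i \<noteq> fst j" for i j
  proof -
    have "X i ** X j ** X i = X j ** X i ** X j" by (rule is_rep_braid[OF X that])
    then have "det (X i ** X j ** X i) = det (X j ** X i ** X j)" by simp
    then have "(det (X i) * det (X i)) * det (X j) = (det (X j) * det (X j)) * det (X i)" by (simp add: det_mul mult_ac)
    then show ?thesis unfolding sq by simp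
  qed
  have e: "det (X i) = e" for i
  proof (cases "fst i")
    case True then show ?thesis unfolding e_def by (intro br) simp
  next
    case False
    have "det (X i) = det (X (True, False))" using False by (intro br) simp
    also have "\<dots> = e" unfolding e_def by (intro br) simp
    finally show ?thesis .
  qed
  have "det (word_mat X v) = e ^ length v" for v by (induction v) (simp_all add: det_mul e)
  moreover have "e ^ length u = 1" using u sq[of "(False, False)"] unfolding e_def[symmetric]
    by (elim evenE) (simp add: power_mult power2_eq_square)
  ultimately show ?thesis by simp
qed

section \<open>Rationality\<close>

definition subring_real :: "real set \<Rightarrow> bool" where
  "subring_real R \<longleftrightarrow> 0 \<in> R \<and> 1 \<in> R \<and> (\<forall>x\<in>R. \<forall>y\<in>R. x + y \<in> R \<and> x - y \<in> R \<and> x * y \<in> R)"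

lemma subring_Ints: "subring_real \<int>" and subring_Rats: "subring_real \<rat>"
  by (simp_all add: subring_real_def)

lemma entries_in_mult:
  assumes R: "subring_real R" and "entries_in R M" "entries_in R N"
  shows "entries_in R (M ** N)"
proof -
  have s: "sum f K \<in> R" if "finite K" "\<And>k. f k \<in> R" for f :: "'n \<Rightarrow> real" and K
    using that R by (induction K) (auto simp: subring_real_def)
  have "M $ i $ k * N $ k $ j \<in> R" for i j k using assms by (auto simp: subring_real_def entries_in_def)
  then show ?thesis unfolding entries_in_def matrix_matrix_mult_def by (simp add: s)
qed

lemma entries_in_add: "subring_real R \<Longrightarrow> entries_in R M \<Longrightarrow> entries_in R N \<Longrightarrow> entries_in R (M + N)"
  by (simp add: entries_in_def subring_real_def)

lemma entries_in_diff: "subring_real R \<Longrightarrow> entries_in R M \<Longrightarrow> entries_in R N \<Longrightarrow> entries_in R (M - N)"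
  by (simp add: entries_in_def subring_real_def)

lemma entries_in_scale: "subring_real R \<Longrightarrow> a \<in> R \<Longrightarrow> entries_in R M \<Longrightarrow> entries_in R (a *\<^sub>R M)"
  by (simp add: entries_in_def subring_real_def)

lemma entries_in_one: "subring_real R \<Longrightarrow> entries_in R (mat 1)"
  by (simp add: entries_in_def subring_real_def mat_def)

lemma entries_in_word_mat:
  assumes "subring_real R" "\<And>i. entries_in R (X i)"
  shows "entries_in R (word_mat X u)"
  by (induction u) (simp_all add: entries_in_one entries_in_mult assms)

text \<open>The power sums of the two roots of X^2 - 14 X + 1. These roots are the fourth powers of
  \<open>rt6 - rt2\<close> and \<open>rt6 + rt2\<close>, which are mutually inverse with squares
  adding up to 4.\<close>

fun trace_seq :: "nat \<Rightarrow> real" where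
  "trace_seq 0 = 2"
| "trace_seq (Suc 0) = 14"
| "trace_seq (Suc (Suc k)) = 14 * trace_seq (Suc k) - trace_seq k"

lemma trace_seq_Ints: "trace_seq k \<in> \<int>"
  by (induction k rule: trace_seq.induct) simp_all

lemma trace_seq_mono: "k < l \<Longrightarrow> trace_seq k < trace_seq l"
proof -
  have *: "2 \<le> trace_seq k \<and> trace_seq k < trace_seq (Suc k)" for k
  proof (induction k)
    case (Suc k)
    have "trace_seq (Suc (Suc k)) = 14 * trace_seq (Suc k) - trace_seq k" by simp
    then show ?case using Suc by linarith
  qed simp
  show "k < l \<Longrightarrow> trace_seq k < trace_seq l" by (rule lift_Suc_mono_less) (use * in auto)
qed

lemma trace_seq_powers:
  assumes "x * y = 1" "x + y = 14"
  shows "x ^ k + y ^ k = trace_seq k"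
proof (induction k rule: trace_seq.induct)
  case (3 k)
  have "x ^ Suc (Suc k) + y ^ Suc (Suc k) = (x + y) * (x ^ Suc k + y ^ Suc k) - (x * y) * (x ^ k + y ^ k)"
    by (simp add: algebra_simps)
  also have "\<dots> = 14 * (x ^ Suc k + y ^ Suc k) - (x ^ k + y ^ k)" unfolding assms by simp
  also have "\<dots> = trace_seq (Suc (Suc k))" unfolding 3 by simp
  finally show ?case .
qed (use assms in simp_all)

lemma subst_matrix_diag:
  assumes n: "CARD('n::finite) = Suc (2 * m)"
  shows "subst_matrix (mat2 a 0 0 b) = (diag_mat (\<lambda>k. a ^ (2 * m - k) * b ^ k) :: real ^ 'n ^ 'n)"
proof (rule subst_matrix_eqI)
  fix j :: 'n and v :: "real ^ 2"
  have "(\<Sum>i\<in>UNIV. diag_mat (\<lambda>k. a ^ (2 * m - k) * b ^ k) $ i $ j * basis_monomial i v)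
    = (\<Sum>i\<in>UNIV. if i = j then a ^ (2 * m - idx j) * b ^ idx j * basis_monomial i v else 0)"
    by (rule sum.cong) (auto simp: diag_mat_def)
  also have "\<dots> = basis_monomial j (mat2 a 0 0 b *v v)"
    by (simp add: basis_monomial_mon mon_def n mult_vec2 power_mult_distrib)
  finally show "basis_monomial j (mat2 a 0 0 b *v v) = (\<Sum>i\<in>UNIV. diag_mat (\<lambda>k. a ^ (2 * m - k) * b ^ k) $ i $ j * basis_monomial i v)" ..
qed

lemma mirror_product:
  assumes n: "CARD('n::finite) = Suc (2 * m)"
  obtains y :: real where "y > 1"
    "mirror_rep (False, True) ** mirror_rep (False, False) = (diag_mat (\<lambda>k. y ^ (2 * m - k) * (1 / y) ^ k) :: real ^ 'n ^ 'n)"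
proof -
  define y where "y = (rt6 + rt2) * (rt6 + rt2)"
  have "y = 2 + 2 * (rt6 * rt2)" by (simp add: y_def algebra_simps rt_squares)
  then have y: "y > 1" using mult_pos_pos[OF rt_pos(2,1)] by linarith
  have "(rt6 - rt2) * (rt6 - rt2) * y = 1" 
  proof -
    have "(rt6 - rt2) * (rt6 + rt2) = 1" by (simp add: algebra_simps rt_squares)
    moreover have "(rt6 - rt2) * (rt6 - rt2) * y = ((rt6 - rt2) * (rt6 + rt2)) * ((rt6 - rt2) * (rt6 + rt2))"
      unfolding y_def by (simp only: mult_ac)
    ultimately show ?thesis by simp
  qed
  then have p: "(rt6 - rt2) * (rt6 - rt2) = 1 / y" using y by (simp add: field_simps)
  have "mirror_rep (False, True) ** mirror_rep (False, False) = (subst_matrix (mat2 y 0 0 (1 / y)) :: real ^ 'n ^ 'n)"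
    unfolding subst_matrix_mult[symmetric] p[symmetric] by (simp add: mirror_matrix_def mat2_mult y_def)
  then show thesis using that[OF y] subst_matrix_diag[OF n] by simp
qed

text \<open>Adding the inverse turns the irrational eigenvalues of the hyperbolic element into
  integers. They depend only on the distance of the index from the middle, so the largest belongs to
  the first and last coordinates.\<close>

lemma mirror_product_diag:
  assumes n: "CARD('n::finite) = Suc (2 * m)"
  shows "mirror_rep (False, True) ** mirror_rep (False, False) + mirror_rep (False, False) ** mirror_rep (False, True) =
    (diag_mat (\<lambda>k. trace_seq (if k \<le> m then m - k else k - m)) :: real ^ 'n ^ 'n)"
proof -
  define p where "p = rt6 - rt2"
  define q where "q = rt6 + rt2"
  define x where "x = p ^ 4"
  define y where "y = q ^ 4"
  have pq: "p * q = 1" by (simp add: p_def q_def algebra_simps rt_squares)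
  have "x * y = (p * q) ^ 4" by (simp add: x_def y_def power_mult_distrib)
  then have xy: "x * y = 1" by (simp add: pq)
  have "p * p + q * q = 4" by (simp add: p_def q_def algebra_simps rt_squares)
  then have "(p * p + q * q) * (p * p + q * q) = 16" by simp
  moreover have "(p * p + q * q) * (p * p + q * q) = x + y + 2 * (p * q) * (p * q)"
    by (simp add: x_def y_def power4_eq_xxxx algebra_simps)
  ultimately have x_y: "x + y = 14" unfolding pq by simp
  define S where "S a b = (subst_matrix (mat2 a 0 0 b) :: real ^ 'n ^ 'n)" for a b
  have S: "S a b = diag_mat (\<lambda>k. a ^ (2 * m - k) * b ^ k)" for a b
    unfolding S_def by (rule subst_matrix_diag[OF n])
  have 1: "mirror_rep (False, True) ** mirror_rep (False, False) = S (q * q) (p * p)"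
    "mirror_rep (False, False) ** mirror_rep (False, True) = S (p * p) (q * q)"
    unfolding S_def subst_matrix_mult[symmetric] by (simp_all add: mirror_matrix_def mat2_mult p_def q_def)
  have "(q * q) ^ (2 * m - k) * (p * p) ^ k + (p * p) ^ (2 * m - k) * (q * q) ^ k = trace_seq (if k \<le> m then m - k else k - m)"
    if k: "k < Suc (2 * m)" for k
  proof (cases "k \<le> m")
    case True
    define l where "l = m - k"
    have l: "2 * m - k = 2 * l + k" using True by (simp add: l_def)
    have "a ^ (2 * l + k) * b ^ k = (a * a) ^ l" if "a * b = 1" for a b :: real
    proof -
      have "a ^ (2 * l + k) * b ^ k = (a * a) ^ l * (a * b) ^ k"
        by (simp add: power_add power_mult power2_eq_square power_mult_distrib mult_ac)
      then show ?thesis using that by simp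
    qed
    from this[of "q * q" "p * p"] this[of "p * p" "q * q"]
    have "(q * q) ^ (2 * l + k) * (p * p) ^ k + (p * p) ^ (2 * l + k) * (q * q) ^ k = y ^ l + x ^ l"
      using pq by (simp add: x_def y_def power4_eq_xxxx mult_ac)
    then show ?thesis using trace_seq_powers[OF xy x_y, of l] True unfolding l by (simp add: l_def)
  next
    case False
    define l where "l = k - m"
    define r where "r = 2 * m - k"
    have l: "k = 2 * l + r" using False k by (simp add: l_def r_def)
    have "a ^ r * b ^ (2 * l + r) = (b * b) ^ l" if "a * b = 1" for a b :: real
    proof -
      have "a ^ r * b ^ (2 * l + r) = (b * b) ^ l * (a * b) ^ r"
        by (simp add: power_add power_mult power2_eq_square power_mult_distrib mult_ac)
      then show ?thesis using that by simp
    qed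
    from this[of "q * q" "p * p"] this[of "p * p" "q * q"]
    have "(q * q) ^ r * (p * p) ^ (2 * l + r) + (p * p) ^ r * (q * q) ^ (2 * l + r) = x ^ l + y ^ l"
      using pq by (simp add: x_def y_def power4_eq_xxxx mult_ac)
    then have "(q * q) ^ r * (p * p) ^ k + (p * p) ^ r * (q * q) ^ k = trace_seq l"
      unfolding l[symmetric] trace_seq_powers[OF xy x_y] .
    then show ?thesis using False by (simp add: l_def r_def)
  qed
  then have "S (q * q) (p * p) + S (p * p) (q * q) = diag_mat (\<lambda>k. trace_seq (if k \<le> m then m - k else k - m))"
    unfolding S using n idx_less[where 'n = 'n] by (simp add: vec_eq_iff diag_mat_def)
  then show ?thesis unfolding 1 .
qed

lemma diag_mat_scale: "a *\<^sub>R diag_mat f = diag_mat (\<lambda>k. a * f k)"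
  and diag_mat_add: "diag_mat f + diag_mat g = diag_mat (\<lambda>k. f k + g k)"
  and diag_mat_diff: "diag_mat f - diag_mat g = diag_mat (\<lambda>k. f k - g k)"
  by (simp_all add: diag_mat_def vec_eq_iff)

lemma matrix_add_conj:
  "D ** (M + N) ** C = D ** M ** C + D ** N ** C" "D ** (M - N) ** C = D ** M ** C - D ** N ** C"
  "D ** (a *\<^sub>R M) ** C = a *\<^sub>R (D ** M ** C)" for C D M N :: "real ^ 'n::finite ^ 'n"
  by (simp_all add: vec_eq_iff matrix_matrix_mult_def sum_distrib_left sum_distrib_right algebra_simps
      sum.distrib sum_subtractf)

text \<open>The projection to the first and last coordinate is a rational polynomial in the sum of
  \<open>mirror_rep (False, True) ** mirror_rep (False, False)\<close> and its inverse.\<close>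

lemma ends_rational:
  fixes C D :: "real ^ 'n::finite ^ 'n"
  assumes odd: "odd CARD('n)" and CD: "C ** D = mat 1" "D ** C = mat 1"
    and int: "\<And>i. entries_in \<int> (D ** mirror_rep i ** C)"
  shows "entries_in \<rat> (D ** diag_mat (bend_fun CARD('n) 1) ** C)"
    and "entries_in \<rat> (D ** (diag_mat (\<lambda>k. if k = 0 \<or> k = CARD('n) - 1 then 1 else 0)) ** C)"
proof -
  obtain m where m: "CARD('n) = Suc (2 * m)" using odd by (auto elim!: oddE)
  have rat: "entries_in \<rat> M" if "entries_in \<int> M" for M :: "real ^ 'n ^ 'n"
    using that Ints_subset_Rats by (auto simp: entries_in_def)
  define e where "e k = trace_seq (if k \<le> m then m - k else k - m)" for k
  have one: "entries_in \<rat> (D ** mat 1 ** C)" using CD by (simp add: entries_in_one[OF subring_Rats])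
  then show "entries_in \<rat> (D ** diag_mat (bend_fun CARD('n) 1) ** C)" unfolding bend_fun_def
    by (simp add: diag_mat_one cong: if_cong)
  have E: "entries_in \<rat> (D ** diag_mat e ** C)"
  proof -
    have "D ** diag_mat e ** C = (D ** mirror_rep (False, True) ** C) ** (D ** mirror_rep (False, False) ** C)
       + (D ** mirror_rep (False, False) ** C) ** (D ** mirror_rep (False, True) ** C)"
      unfolding conj_mult[OF CD(1)] e_def[abs_def] mirror_product_diag[OF m, symmetric] by (rule matrix_add_conj)
    then show ?thesis by (simp add: entries_in_add[OF subring_Rats] entries_in_mult[OF subring_Rats] rat int)
  qed
  have P: "entries_in \<rat> (D ** diag_mat (\<lambda>k. \<Prod>j<r. e k - trace_seq j) ** C)" for r
  proof (induction r)
    case 0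
    then show ?case using one by (simp add: diag_mat_one)
  next
    case (Suc r)
    have "diag_mat (\<lambda>k. \<Prod>j<Suc r. e k - trace_seq j) =
       diag_mat (\<lambda>k. \<Prod>j<r. e k - trace_seq j) ** (diag_mat e - trace_seq r *\<^sub>R (mat 1 :: real ^ 'n ^ 'n))"
      by (simp add: diag_mat_one[symmetric] diag_mat_scale diag_mat_diff diag_mat_mult)
    then have "D ** diag_mat (\<lambda>k. \<Prod>j<Suc r. e k - trace_seq j) ** C =
      (D ** diag_mat (\<lambda>k. \<Prod>j<r. e k - trace_seq j) ** C) ** (D ** diag_mat e ** C - trace_seq r *\<^sub>R (D ** mat 1 ** C))"
      unfolding matrix_add_conj[symmetric] conj_mult[OF CD(1)] by simp
    moreover have "trace_seq r \<in> \<rat>" using trace_seq_Ints Ints_subset_Rats by blast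
    ultimately show ?case
      using Suc E one by (simp add: entries_in_mult[OF subring_Rats] entries_in_diff[OF subring_Rats] entries_in_scale[OF subring_Rats])
  qed
  \<comment> \<open>The normalization of the Lagrange polynomial that is 1 at the largest eigenvalue
    and 0 at all the others.\<close>
  define q where "q = (\<Prod>j<m. trace_seq m - trace_seq j)"
  have q0: "q \<noteq> 0" 
  proof -
    have "trace_seq m - trace_seq j \<noteq> 0" if "j < m" for j using trace_seq_mono[OF that] by simp
    then show ?thesis unfolding q_def by simp
  qed
  have "trace_seq j \<in> \<rat>" for j using trace_seq_Ints Ints_subset_Rats by blast
  then have qR: "q \<in> \<rat>" unfolding q_def by (intro Rats_prod) (simp add: Rats_diff)
  have pr: "(\<Prod>j<m. e k - trace_seq j) = q * (if k = 0 \<or> k = CARD('n) - 1 then 1 else 0)" if "k < CARD('n)" for k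
  proof (cases "k = 0 \<or> k = 2 * m")
    case True
    then have "e k = trace_seq m" by (auto simp: e_def)
    then show ?thesis using True m by (auto simp: q_def)
  next
    case False
    define j where "j = (if k \<le> m then m - k else k - m)"
    have "j < m" using False that m by (auto simp: j_def)
    moreover have "e k - trace_seq j = 0" by (simp add: e_def j_def)
    ultimately have "(\<Prod>j<m. e k - trace_seq j) = 0" by (intro prod_zero) auto
    then show ?thesis using False m by simp
  qed
  have "diag_mat (\<lambda>k. if k = 0 \<or> k = CARD('n) - 1 then 1 else 0) =
    (1 / q) *\<^sub>R (diag_mat (\<lambda>k. \<Prod>j<m. e k - trace_seq j) :: real ^ 'n ^ 'n)"
    using q0 pr by (simp add: vec_eq_iff diag_mat_def)
  then show "entries_in \<rat> (D ** (diag_mat (\<lambda>k. if k = 0 \<or> k = CARD('n) - 1 then 1 else 0)) ** C)"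
    using P[of m] qR by (simp add: matrix_add_conj entries_in_scale[OF subring_Rats])
qed

lemma bent_rep_rational:
  fixes C D :: "real ^ 'n::finite ^ 'n"
  assumes odd: "odd CARD('n)" and CD: "C ** D = mat 1" "D ** C = mat 1"
    and int: "\<And>i. entries_in \<int> (D ** mirror_rep i ** C)" and t: "t \<in> \<rat>" "t \<ge> 0"
  shows "entries_in \<rat> (D ** bent_rep t i ** C)"
proof -
  have rat: "entries_in \<rat> (D ** mirror_rep i ** C)" for i
    using int[of i] Ints_subset_Rats by (auto simp: entries_in_def)
  have b: "entries_in \<rat> (D ** diag_mat (bend_fun CARD('n) x) ** C)" if "x \<in> \<rat>" for x
  proof -
    \<comment> \<open>The diagonal matrix is the identity plus a rational multiple of the rational
      projection; this covers \<open>bend t\<close> and its inverse alike.\<close>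
    have "diag_mat (bend_fun CARD('n) x) = diag_mat (bend_fun CARD('n) 1) +
      (x - 1) *\<^sub>R (diag_mat (\<lambda>k. if k = 0 \<or> k = CARD('n) - 1 then 1 else 0) :: real ^ 'n ^ 'n)"
      by (auto simp: diag_mat_scale diag_mat_add bend_fun_def fun_eq_iff intro: arg_cong[of _ _ diag_mat])
    then show ?thesis
      using ends_rational[OF odd CD int] that
      by (simp add: matrix_add_conj entries_in_add[OF subring_Rats] entries_in_scale[OF subring_Rats])
  qed
  have "D ** (bend t ** mirror_rep i ** unbend t) ** C = (D ** bend t ** C) ** (D ** mirror_rep i ** C) ** (D ** unbend t ** C)"
    by (simp add: conj_mult[OF CD(1)])
  moreover have "entries_in \<rat> (D ** bend t ** C)" "entries_in \<rat> (D ** unbend t ** C)"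
    unfolding bend_def unbend_def by (rule b, use t in simp)+
  ultimately have "entries_in \<rat> (D ** (bend t ** mirror_rep i ** unbend t) ** C)"
    using rat[of i] by (simp add: entries_in_mult[OF subring_Rats])
  then show ?thesis using rat[of i] unfolding bent_rep_def by (cases "i = (True, False)") simp_all
qed

lemma word_mat_conj:
  fixes C D :: "real ^ 'n::finite ^ 'n"
  assumes "C ** D = mat 1" "D ** C = mat 1"
  shows "word_mat (\<lambda>i. D ** X i ** C) u = D ** word_mat X u ** C"
proof (induction u)
  case (Cons i u)
  then show ?case by (simp add: conj_mult[OF assms(1)])
qed (simp add: assms)

section \<open>Comparison with the Fuchsian group\<close>

lemma word_mirror_matrix: "word_mat mirror_matrix (rev u) ** word_mat mirror_matrix u = mat 1"
proof (induction u)
  case (Cons i u)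
  have "word_mat mirror_matrix (rev (i # u)) ** word_mat mirror_matrix (i # u) =
    word_mat mirror_matrix (rev u) ** (mirror_matrix i ** mirror_matrix i) ** word_mat mirror_matrix u"
    by (simp add: word_mat_append matrix_mul_assoc)
  then show ?case using Cons by (simp add: mirror_matrix_square)
qed simp

lemma matrix_inv_eqI: "A ** B = mat 1 \<Longrightarrow> matrix_inv A = (B :: real ^ 'm::finite ^ 'm)"
proof -
  assume AB: "A ** B = mat 1"
  then have BA: "B ** A = mat 1" using matrix_left_right_inverse by blast
  have "\<exists>A'. A ** A' = mat 1 \<and> A' ** A = mat 1" using AB BA by (intro exI conjI)
  from someI_ex[OF this] have "matrix_inv A ** A = mat 1" unfolding matrix_inv_def by (rule conjunct2)
  then have "matrix_inv A ** A ** B = B" by simp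
  then show ?thesis by (simp add: AB matrix_mul_assoc[symmetric])
qed

lemma subst_word: "subst_matrix (word_mat mirror_matrix u) = word_mat mirror_rep (rev u)"
  by (induction u) (simp_all add: subst_matrix_one subst_matrix_mult word_mat_append)

text \<open>The inverse in the definition of the action and the contravariance of substitution both
  reverse the word, so it survives unchanged.\<close>

lemma sym_matrix_word: "sym_matrix (word_mat mirror_matrix u) = word_mat mirror_rep u"
proof -
  have "matrix_inv (word_mat mirror_matrix u) = word_mat mirror_matrix (rev u)"
    by (rule matrix_inv_eqI) (use word_mirror_matrix[of "rev u"] in simp)
  then show ?thesis by (simp add: sym_matrix_eq subst_word)
qed

lemma det2: "det (mat2 a b c d) = a * d - b * c" by (simp add: det_2)

lemma det_word_mirror: "even (length u) \<Longrightarrow> det (word_mat mirror_matrix u) = 1"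
proof -
  have "det (mirror_matrix i) = - 1" for i
    by (cases "fst i"; cases "snd i") (simp_all add: mirror_matrix_def det2 algebra_simps rt_squares)
  then have "det (word_mat mirror_matrix u) = (- 1) ^ length u" by (induction u) (simp_all add: det_mul)
  then show "even (length u) \<Longrightarrow> det (word_mat mirror_matrix u) = 1" by simp
qed

lemma act_light: "act u (light v) = light (word_mat mirror_matrix u *v v)"
  by (induction u) (simp_all add: reflect_light matrix_vector_mul_assoc)

lemma light_minus: "light (- v) = light v"
  by (simp add: light_def)

text \<open>A matrix acts on the light cone in the same way as its negative, and the centre (1, 0,
  0) is the mean of two vectors of the light cone. So the quotient of the words fixes the
  centre.\<close>

lemma word_mirror_injective:
  assumes "word_mat mirror_matrix u = word_mat mirror_matrix v \<or> word_mat mirror_matrix u = - word_mat mirror_matrix v"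
  shows "u \<simeq> v"
proof -
  define w where "w = rev v @ u"
  have vv: "word_mat mirror_matrix (rev v) ** word_mat mirror_matrix v = mat 1" by (rule word_mirror_matrix)
  have neg: "A ** (- B) = - (A ** B)" for A B :: "real ^ 2 ^ 2" by (simp add: vec_eq_iff matrix_matrix_mult_def sum_negf)
  have "word_mat mirror_matrix w = mat 1 \<or> word_mat mirror_matrix w = - mat 1"
    unfolding w_def word_mat_append using assms by (elim disjE) (simp_all add: vv neg)
  moreover have "(- mat 1 :: real ^ 2 ^ 2) *v x = - x" for x by (simp add: vec_eq_iff matrix_vector_mult_def mat_def sum_2 forall_2)
  ultimately have L: "act w (light x) = light x" for x unfolding act_light by (auto simp: light_minus)
  have "(1, 0, 0) = (1 / 2) *\<^sub>R (light (vector [1, 0]) + light (vector [0, 1]))" by (simp add: light_def)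
  then have "act w (1, 0, 0) = (1, 0, 0)" by (simp only: act_linear L)
  then have "w \<simeq> []" by (rule act_center_imp_weq)
  then have "v @ w \<simeq> v @ []" by (intro weq_append weq.refl)
  moreover have "v @ w \<simeq> u" using weq_append[OF weq_rev_right[of v] weq.refl[of u]] by (simp add: w_def)
  ultimately have "u \<simeq> v @ []" using weq.sym weq.trans by blast
  then show ?thesis by simp
qed

section \<open>Zariski closures and invariant derivations\<close>

lemma matrix_mult_add:
  "(A + B) ** M = A ** M + B ** M" "M ** (A + B) = M ** A + M ** B"
  "(A - B) ** M = A ** M - B ** M" "M ** (A - B) = M ** A - M ** B"
  "(r *\<^sub>R A) ** M = r *\<^sub>R (A ** M)" "M ** (r *\<^sub>R A) = r *\<^sub>R (M ** A)"
  for A B M :: "real ^ 'n::finite ^ 'n"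
  by (simp_all add: vec_eq_iff matrix_matrix_mult_def algebra_simps sum.distrib sum_subtractf sum_distrib_left)

lemma linear_mult_left: "linear (\<lambda>g :: real ^ 'n ^ 'n. Z ** g)" for Z :: "real ^ 'n::finite ^ 'n"
  by (rule linearI) (simp_all add: matrix_mult_add)

lemma linear_mult_right: "linear (\<lambda>g :: real ^ 'n ^ 'n. g ** Z)" for Z :: "real ^ 'n::finite ^ 'n"
  by (rule linearI) (simp_all add: matrix_mult_add)

lemma polynomial_comp_linear:
  fixes T :: "real ^ 'n::finite ^ 'n \<Rightarrow> real ^ 'n ^ 'n"
  assumes "linear T" and "real_polynomial_function P"
  shows "real_polynomial_function (\<lambda>g. P (T g))"
  using assms(2)
proof (induction rule: real_polynomial_function.induct)
  case (linear L)
  have "bounded_linear T" using assms(1) by (simp add: linear_conv_bounded_linear)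
  then show ?case using linear by (intro real_polynomial_function.intros(1)) (rule bounded_linear_compose)
qed (auto intro: real_polynomial_function.intros)

lemma linear_entries:
  fixes L :: "real ^ 'n::finite ^ 'n \<Rightarrow> real"
  assumes "bounded_linear L"
  shows "\<exists>w. \<forall>M. L M = (\<Sum>i\<in>UNIV. \<Sum>j\<in>UNIV. w i j * M $ i $ j)"
proof -
  interpret bounded_linear L by fact
  define e :: "'n \<Rightarrow> 'n \<Rightarrow> real ^ 'n ^ 'n" where "e a b = (\<chi> i j. if i = a \<and> j = b then 1 else 0)" for a b
  have M: "M = (\<Sum>a\<in>UNIV. \<Sum>b\<in>UNIV. M $ a $ b *\<^sub>R e a b)" for M :: "real ^ 'n ^ 'n"
  proof -
    have "(\<Sum>a\<in>UNIV. \<Sum>b\<in>UNIV. M $ a $ b *\<^sub>R e a b) $ i $ j = M $ i $ j" for i j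
    proof -
      have "(\<Sum>a\<in>UNIV. \<Sum>b\<in>UNIV. M $ a $ b *\<^sub>R e a b) $ i $ j = (\<Sum>a\<in>UNIV. \<Sum>b\<in>UNIV. M $ a $ b * (if i = a \<and> j = b then 1 else 0))"
        by (simp add: e_def)
      also have "\<dots> = (\<Sum>a\<in>UNIV. \<Sum>b\<in>UNIV. if b = j then (if a = i then M $ i $ j else 0) else 0)"
        by (intro sum.cong HOL.refl) auto
      finally show ?thesis by simp
    qed
    then show ?thesis by (simp add: vec_eq_iff del: sum_component)
  qed
  have LM: "L M = L (\<Sum>a\<in>UNIV. \<Sum>b\<in>UNIV. M $ a $ b *\<^sub>R e a b)" for M by (rule arg_cong[of _ _ L]) (rule M)
  have LE: "L (\<Sum>a\<in>UNIV. \<Sum>b\<in>UNIV. M $ a $ b *\<^sub>R e a b) = (\<Sum>a\<in>UNIV. \<Sum>b\<in>UNIV. L (e a b) * M $ a $ b)" for M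
    by (simp add: sum scale mult.commute)
  show ?thesis by (intro exI[of _ "\<lambda>a b. L (e a b)"] allI) (rule HOL.trans[OF LM LE])
qed

text \<open>The closure is taken in the space of all matrices; determinant one follows later, since
  the determinant is itself a polynomial.\<close>

definition zar :: "(real ^ 'n::finite ^ 'n) set \<Rightarrow> (real ^ 'n ^ 'n) set" where
  "zar X = {g. \<forall>P. real_polynomial_function P \<longrightarrow> (\<forall>x\<in>X. P x = 0) \<longrightarrow> P g = 0}"

lemma zarD: "g \<in> zar X \<Longrightarrow> real_polynomial_function P \<Longrightarrow> (\<And>x. x \<in> X \<Longrightarrow> P x = 0) \<Longrightarrow> P g = 0"
  by (simp add: zar_def)

text \<open>The classical two steps: for fixed \<open>x\<close> in the set, right translation by
  \<open>x\<close> preserves the closure; then, for fixed \<open>g\<close> in the closure, so does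
  left translation by \<open>g\<close>.\<close>

lemma zar_mult:
  assumes X: "\<And>x y. x \<in> X \<Longrightarrow> y \<in> X \<Longrightarrow> x ** y \<in> X" and g: "g \<in> zar X" and h: "h \<in> zar X"
  shows "g ** h \<in> zar X"
proof -
  have 1: "g ** x \<in> zar X" if x: "x \<in> X" for x unfolding zar_def mem_Collect_eq
  proof (intro allI impI)
    fix P assume P: "real_polynomial_function P" "\<forall>x\<in>X. P x = 0"
    show "P (g ** x) = 0"
      by (rule zarD[OF g polynomial_comp_linear[OF linear_mult_right P(1)]]) (use P(2) X x in simp)
  qed
  show ?thesis unfolding zar_def mem_Collect_eq
  proof (intro allI impI)
    fix P assume P: "real_polynomial_function P" "\<forall>x\<in>X. P x = 0"
    show "P (g ** h) = 0"
    proof (rule zarD[OF h polynomial_comp_linear[OF linear_mult_left P(1)]])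
      fix x assume "x \<in> X"
      show "P (g ** x) = 0" by (rule zarD[OF 1[OF \<open>x \<in> X\<close>] P(1)]) (use P(2) in simp)
    qed
  qed
qed

section \<open>Right invariant derivations on polynomial functions\<close>

definition curve_at_one :: "(real \<Rightarrow> real ^ 'n::finite ^ 'n) \<Rightarrow> real ^ 'n ^ 'n \<Rightarrow> bool" where
  "curve_at_one c Z \<longleftrightarrow> c 0 = mat 1 \<and> (\<forall>i j. ((\<lambda>s. c s $ i $ j) has_real_derivative Z $ i $ j) (at 0))"

definition dir :: "real ^ 'n::finite ^ 'n \<Rightarrow> (real ^ 'n ^ 'n \<Rightarrow> real) \<Rightarrow> real ^ 'n ^ 'n \<Rightarrow> real" where
  "dir Z P g = deriv (\<lambda>s. P ((mat 1 + s *\<^sub>R Z) ** g)) 0"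

lemma curve_line: "curve_at_one (\<lambda>s. mat 1 + s *\<^sub>R Z) Z"
  unfolding curve_at_one_def by (auto intro!: derivative_eq_intros)

text \<open>The derivative depends on the curve only through its velocity and is again a polynomial
  in \<open>g\<close>, so derivations can be iterated and curves other than lines may be
  used.\<close>

lemma dir_exists:
  fixes Z :: "real ^ 'n::finite ^ 'n" and P :: "real ^ 'n ^ 'n \<Rightarrow> real"
  assumes "real_polynomial_function P"
  shows "\<exists>Q. real_polynomial_function Q \<and>
    (\<forall>c g. curve_at_one c Z \<longrightarrow> ((\<lambda>s. P (c s ** g)) has_real_derivative Q g) (at 0))"
  using assms
proof (induction rule: real_polynomial_function.induct)
  case (linear L)
  from linear_entries[OF linear] obtain w where "\<forall>M. L M = (\<Sum>i\<in>UNIV. \<Sum>j\<in>UNIV. w i j * M $ i $ j)" by (elim exE)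
  note w = this[rule_format]
  show ?case
  proof (intro exI[of _ "\<lambda>g. L (Z ** g)"] conjI allI impI)
    show "real_polynomial_function (\<lambda>g. L (Z ** g))"
      by (rule polynomial_comp_linear[OF linear_mult_left]) (rule real_polynomial_function.intros(1)[OF linear])
    fix c g assume c: "curve_at_one c Z"
    show "((\<lambda>s. L (c s ** g)) has_real_derivative L (Z ** g)) (at 0)"
      unfolding w matrix_matrix_mult_def vec_lambda_beta
      by (intro DERIV_sum DERIV_cmult DERIV_cmult_right) (use c in \<open>simp add: curve_at_one_def\<close>)
  qed
next
  case (const c)
  show ?case by (rule exI[of _ "\<lambda>_. 0"]) (simp add: real_polynomial_function.intros)
next
  case (add P1 P2)
  from add.IH obtain Q1 Q2 where "real_polynomial_function Q1" "real_polynomial_function Q2"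
    "\<forall>c g. curve_at_one c Z \<longrightarrow> ((\<lambda>s. P1 (c s ** g)) has_real_derivative Q1 g) (at 0)"
    "\<forall>c g. curve_at_one c Z \<longrightarrow> ((\<lambda>s. P2 (c s ** g)) has_real_derivative Q2 g) (at 0)" by (elim exE conjE)
  then show ?case
    by (intro exI[of _ "\<lambda>g. Q1 g + Q2 g"] conjI allI impI real_polynomial_function.intros(3) DERIV_add) simp_all
next
  case (mult P1 P2)
  from mult.IH obtain Q1 Q2 where Q: "real_polynomial_function Q1" "real_polynomial_function Q2"
    "\<forall>c g. curve_at_one c Z \<longrightarrow> ((\<lambda>s. P1 (c s ** g)) has_real_derivative Q1 g) (at 0)"
    "\<forall>c g. curve_at_one c Z \<longrightarrow> ((\<lambda>s. P2 (c s ** g)) has_real_derivative Q2 g) (at 0)" by (elim exE conjE)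
  show ?case
  proof (intro exI[of _ "\<lambda>g. Q1 g * P2 g + Q2 g * P1 g"] conjI allI impI)
    show "real_polynomial_function (\<lambda>g. Q1 g * P2 g + Q2 g * P1 g)"
      using Q(1,2) mult.hyps by (intro real_polynomial_function.intros(3,4))
    fix c g assume c: "curve_at_one c Z"
    then have "c 0 = mat 1" by (simp add: curve_at_one_def)
    then show "((\<lambda>s. P1 (c s ** g) * P2 (c s ** g)) has_real_derivative Q1 g * P2 g + Q2 g * P1 g) (at 0)"
      using DERIV_mult[OF Q(3)[rule_format, OF c, of g] Q(4)[rule_format, OF c, of g]] by simp
  qed
qed

lemma dir:
  assumes "real_polynomial_function P"
  shows dir_curve: "curve_at_one c Z \<Longrightarrow> ((\<lambda>s. P (c s ** g)) has_real_derivative dir Z P g) (at 0)"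
    and dir_polynomial: "real_polynomial_function (dir Z P)"
proof -
  obtain Q where Q: "real_polynomial_function Q"
    "\<forall>c g. curve_at_one c Z \<longrightarrow> ((\<lambda>s. P (c s ** g)) has_real_derivative Q g) (at 0)"
    using dir_exists[OF assms, of Z] by (elim exE conjE)
  have D: "dir Z P = Q" unfolding dir_def
    by (rule ext, rule DERIV_imp_deriv) (rule Q(2)[rule_format, OF curve_line])
  show "curve_at_one c Z \<Longrightarrow> ((\<lambda>s. P (c s ** g)) has_real_derivative dir Z P g) (at 0)"
    unfolding D by (rule Q(2)[rule_format])
  show "real_polynomial_function (dir Z P)" unfolding D by (rule Q(1))
qed

lemma dir_linear: assumes "bounded_linear L" shows "dir Z L g = L (Z ** g)"
proof -
  interpret bounded_linear L by fact
  have "((\<lambda>s. L g + s * L (Z ** g)) has_real_derivative L (Z ** g)) (at 0)"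
    by (auto intro!: derivative_eq_intros)
  then show ?thesis unfolding dir_def by (intro DERIV_imp_deriv) (simp add: matrix_mult_add add scale)
qed

lemma dir_const: "dir Z (\<lambda>_. c) g = 0"
  by (simp add: dir_def)

lemma dir_add:
  assumes P: "real_polynomial_function P" and Q: "real_polynomial_function Q"
  shows "dir Z (\<lambda>x. P x + Q x) g = dir Z P g + dir Z Q g"
  unfolding dir_def[of Z "\<lambda>x. P x + Q x"]
  by (rule DERIV_imp_deriv) (rule DERIV_add[OF dir_curve[OF P curve_line] dir_curve[OF Q curve_line]])

lemma dir_mult:
  assumes P: "real_polynomial_function P" and Q: "real_polynomial_function Q"
  shows "dir Z (\<lambda>x. P x * Q x) g = dir Z P g * Q g + P g * dir Z Q g"
proof -
  have "((\<lambda>s. P ((mat 1 + s *\<^sub>R Z) ** g) * Q ((mat 1 + s *\<^sub>R Z) ** g)) has_real_derivative dir Z P g * Q g + P g * dir Z Q g) (at 0)"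
    using DERIV_mult[OF dir_curve[OF P curve_line, of Z g] dir_curve[OF Q curve_line, of Z g]]
    by (simp add: mult.commute)
  then show ?thesis unfolding dir_def[of Z "\<lambda>x. P x * Q x"] by (rule DERIV_imp_deriv)
qed

lemma dir_plus_scale:
  assumes "real_polynomial_function P"
  shows "dir (a *\<^sub>R Y + b *\<^sub>R Z) P g = a * dir Y P g + b * dir Z P g"
  using assms
proof (induction arbitrary: g rule: real_polynomial_function.induct)
  case (linear L)
  note L = linear
  interpret bounded_linear L by fact
  show ?case by (simp add: dir_linear[OF L] matrix_mult_add add scale)
qed (simp_all add: dir_const dir_add dir_mult algebra_simps)

text \<open>Right invariant vector fields reverse the order of composition, hence the sign. By the
  Leibniz rule it suffices to compare both sides on linear functions.\<close>

lemma dir_bracket: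
  assumes "real_polynomial_function P"
  shows "dir (Y ** Z - Z ** Y) P g = dir Z (dir Y P) g - dir Y (dir Z P) g"
  using assms
proof (induction arbitrary: g rule: real_polynomial_function.induct)
  case (linear L)
  note L = linear
  interpret bounded_linear L by fact
  have "dir Y L = (\<lambda>g. L (Y ** g))" "bounded_linear (\<lambda>g. L (Y ** g))" for Y
    using bounded_linear_compose[OF L linear_mult_left[of Y, unfolded linear_conv_bounded_linear]]
    by (simp_all add: dir_linear[OF L] fun_eq_iff)
  then show ?case by (simp add: dir_linear[OF L] dir_linear matrix_mult_add diff matrix_mul_assoc)
next
  case (const c)
  have "dir Y (\<lambda>_. c) = (\<lambda>_. 0)" for Y :: "real ^ 'a ^ 'a" by (rule ext) (rule dir_const)
  then show ?case by (simp add: dir_const)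
next
  case (add P Q)
  have "dir Y (\<lambda>x. P x + Q x) = (\<lambda>x. dir Y P x + dir Y Q x)" for Y by (rule ext) (rule dir_add[OF add.hyps])
  then show ?case by (simp add: dir_add add dir_polynomial)
next
  case (mult P Q)
  have "dir Y (\<lambda>x. P x * Q x) = (\<lambda>x. dir Y P x * Q x + P x * dir Y Q x)" for Y by (rule ext) (rule dir_mult[OF mult.hyps])
  then show ?case
    by (simp add: mult.IH mult.hyps dir_add dir_mult dir_polynomial real_polynomial_function.intros algebra_simps)
qed

text \<open>Instead of tangent vectors, the Lie algebra of the closure is described by the right invariant
  derivations that preserve the vanishing ideal; brackets and one-parameter unipotent groups are then
  a matter of algebra.\<close>

definition lie :: "(real ^ 'n::finite ^ 'n) set \<Rightarrow> (real ^ 'n ^ 'n) set" where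
  "lie X = {Z. \<forall>P. real_polynomial_function P \<longrightarrow> (\<forall>g\<in>zar X. P g = 0) \<longrightarrow> (\<forall>g\<in>zar X. dir Z P g = 0)}"

lemma lie_combine: "Y \<in> lie X \<Longrightarrow> Z \<in> lie X \<Longrightarrow> a *\<^sub>R Y + b *\<^sub>R Z \<in> lie X"
  by (simp add: lie_def dir_plus_scale)

lemma lie_scale: "Y \<in> lie X \<Longrightarrow> a *\<^sub>R Y \<in> lie X"
  using lie_combine[of Y X Y a 0] by simp

lemma lie_add: "Y \<in> lie X \<Longrightarrow> Z \<in> lie X \<Longrightarrow> Y + Z \<in> lie X"
  using lie_combine[of Y X Z 1 1] by simp

lemma lie_diff: "Y \<in> lie X \<Longrightarrow> Z \<in> lie X \<Longrightarrow> Y - Z \<in> lie X"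
  using lie_combine[of Y X Z 1 "- 1"] by simp

lemma lie_unscale: "a *\<^sub>R Y \<in> lie X \<Longrightarrow> a \<noteq> 0 \<Longrightarrow> Y \<in> lie X"
  using lie_scale[of "a *\<^sub>R Y" X "1 / a"] by simp

lemma lie_bracket: "Y \<in> lie X \<Longrightarrow> Z \<in> lie X \<Longrightarrow> Y ** Z - Z ** Y \<in> lie X"
  by (simp add: lie_def dir_bracket dir_polynomial)

lemma lie_curve:
  assumes X: "\<And>x y. x \<in> X \<Longrightarrow> y \<in> X \<Longrightarrow> x ** y \<in> X" and c: "curve_at_one c Z" "\<And>s. c s \<in> zar X"
  shows "Z \<in> lie X"
  unfolding lie_def mem_Collect_eq
proof (intro allI impI ballI)
  fix P g assume P: "real_polynomial_function P" "\<forall>g\<in>zar X. P g = 0" and g: "g \<in> zar X"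
  have "(\<lambda>s. P (c s ** g)) = (\<lambda>_. 0)" using P(2) zar_mult[OF X c(2) g] by simp
  then have "((\<lambda>s. P (c s ** g)) has_real_derivative 0) (at 0)" by simp
  with dir_curve[OF P(1) c(1)] show "dir Z P g = 0" by (rule DERIV_unique)
qed

text \<open>A polynomial all of whose derivatives vanish at 0 is zero; the family \<open>I\<close>
  only has to be closed under differentiation.\<close>

lemma polynomial_vanishes:
  assumes I: "\<And>f. f \<in> I \<Longrightarrow> f 0 = (0 :: real)" "\<And>f. f \<in> I \<Longrightarrow> \<exists>h\<in>I. \<forall>x. (f has_real_derivative h x) (at x)"
  shows "f \<in> I \<Longrightarrow> (\<And>x. f x = (\<Sum>k\<le>d. a k * x ^ k)) \<Longrightarrow> f x = 0"
proof (induction d arbitrary: f a x)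
  case 0
  have "f x = f 0" unfolding 0(2)[of x] 0(2)[of 0] by simp
  then show ?case using I(1)[OF 0(1)] by (rule HOL.trans)
next
  case (Suc d)
  from I(2)[OF Suc.prems(1)] obtain h where h: "h \<in> I" and h': "\<forall>x. (f has_real_derivative h x) (at x)" by (elim bexE)
  have f: "f = (\<lambda>x. \<Sum>k\<le>Suc d. a k * x ^ k)" using Suc.prems(2) by (rule ext)
  have "h x = (\<Sum>k\<le>d. (a (Suc k) * (1 + of_nat k)) * x ^ k)" for x
  proof -
    have "(f has_real_derivative (\<Sum>k\<le>Suc d. a k * (of_nat k * x ^ (k - 1)))) (at x)"
      unfolding f by (intro DERIV_sum DERIV_cmult) (auto intro!: derivative_eq_intros)
    then have "h x = (\<Sum>k\<le>Suc d. a k * (of_nat k * x ^ (k - 1)))" using h'[rule_format] by (rule DERIV_unique[rotated])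
    also have "\<dots> = (\<Sum>k\<le>d. a (Suc k) * (of_nat (Suc k) * x ^ k))" by (subst sum.atMost_Suc_shift) simp
    finally show ?thesis by (simp add: mult_ac)
  qed
  from Suc.IH[OF h(1) this] have "h x = 0" for x .
  then have "\<And>x. (f has_real_derivative 0) (at x)" using h' by simp
  then have "f x = f 0" by (intro DERIV_isconst_all) simp
  then show ?case using I(1)[OF Suc.prems(1)] by simp
qed

text \<open>Since \<open>Z\<close> squares to zero, the line is a one-parameter group.
  Differentiating a polynomial along it applies \<open>dir Z\<close>, which preserves the vanishing
  ideal, so all derivatives vanish at the identity.\<close>

lemma lie_unipotent:
  assumes Z: "Z \<in> lie X" "Z ** Z = 0" and one: "mat 1 \<in> zar X"
  shows "mat 1 + x *\<^sub>R Z \<in> zar X"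
proof -
  define I where "I = {\<lambda>x. P (mat 1 + x *\<^sub>R Z) | P. real_polynomial_function P \<and> (\<forall>g\<in>zar X. P g = 0)}"
  have "P (mat 1 + x *\<^sub>R Z) = 0" if P: "real_polynomial_function P" "\<forall>x\<in>X. P x = 0" for P
  proof -
    have PX: "\<forall>g\<in>zar X. P g = 0" using P by (auto intro: zarD)
    have "bounded_linear (\<lambda>x. x *\<^sub>R Z)" by (rule bounded_linear_scaleR_left)
    then have "real_polynomial_function (P \<circ> (\<lambda>x. mat 1 + x *\<^sub>R Z))"
      using P(1) by (intro real_polynomial_function_compose polynomial_function_add polynomial_function_const polynomial_function_bounded_linear)
    then obtain a d where a: "(P \<circ> (\<lambda>x. mat 1 + x *\<^sub>R Z)) = (\<lambda>x. \<Sum>k\<le>d. a k * x ^ k)"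
      unfolding real_polynomial_function_iff_sum by (elim exE)
    show ?thesis
    proof (rule polynomial_vanishes[of I "\<lambda>x. P (mat 1 + x *\<^sub>R Z)"])
      fix f assume "f \<in> I"
      then obtain Q where Q: "f = (\<lambda>x. Q (mat 1 + x *\<^sub>R Z))" "real_polynomial_function Q" "\<forall>g\<in>zar X. Q g = 0"
        unfolding I_def by auto
      show "f 0 = 0" using Q(3) one by (simp add: Q(1))
      show "\<exists>h\<in>I. \<forall>x. (f has_real_derivative h x) (at x)"
      proof (intro bexI allI)
        show "(\<lambda>x. dir Z Q (mat 1 + x *\<^sub>R Z)) \<in> I" unfolding I_def
          using Z(1) Q(2,3) dir_polynomial[OF Q(2), of Z] by (auto simp: lie_def)
        fix x
        have "(mat 1 + s *\<^sub>R Z) ** (mat 1 + x *\<^sub>R Z) = mat 1 + (s + x) *\<^sub>R Z" for s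
          by (simp add: matrix_mult_add Z(2) scaleR_add_left)
        then have "((\<lambda>s. f (s + x)) has_real_derivative dir Z Q (mat 1 + x *\<^sub>R Z)) (at 0)"
          using dir_curve[OF Q(2) curve_line, of Z "mat 1 + x *\<^sub>R Z"] unfolding Q(1) by simp
        then show "(f has_real_derivative dir Z Q (mat 1 + x *\<^sub>R Z)) (at x)"
          using DERIV_shift[of f _ 0 x] by simp
      qed
    next
      show "(\<lambda>x. P (mat 1 + x *\<^sub>R Z)) \<in> I" unfolding I_def using P(1) PX by blast
      fix x show "P (mat 1 + x *\<^sub>R Z) = (\<Sum>k\<le>d. a k * x ^ k)" using fun_cong[OF a, of x] by simp
    qed
  qed
  then show ?thesis unfolding zar_def by blast
qed

section \<open>Laurent polynomials\<close>

text \<open>Behaviour at 0 is left open on purpose: entries of a torus involve powers of 1 /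
  x.\<close>

definition laurent :: "(real \<Rightarrow> real) \<Rightarrow> bool" where
  "laurent f \<longleftrightarrow> (\<exists>D p. real_polynomial_function p \<and> (\<forall>x. x \<noteq> 0 \<longrightarrow> x ^ D * f x = p x))"

lemma polynomial_power_id: "real_polynomial_function (\<lambda>x :: real. x ^ k)"
  by (intro real_polynomial_function_power real_polynomial_function.intros(1) bounded_linear_ident)

lemma laurentI: "real_polynomial_function p \<Longrightarrow> (\<And>x. x \<noteq> 0 \<Longrightarrow> x ^ D * f x = p x) \<Longrightarrow> laurent f"
  unfolding laurent_def by blast

lemma laurent_const: "laurent (\<lambda>_. c)"
  by (rule laurentI[of "\<lambda>_. c" 0]) (simp_all add: real_polynomial_function.intros)

lemma laurent_power: "laurent (\<lambda>x. x ^ k)" "laurent (\<lambda>x. (1 / x) ^ k)"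
  by (rule laurentI[of "\<lambda>x. x ^ k" 0], simp_all add: polynomial_power_id)
    (rule laurentI[of "\<lambda>x. 1" k], simp_all add: real_polynomial_function.intros power_divide)

lemma laurent_add:
  assumes "laurent f" "laurent g" shows "laurent (\<lambda>x. f x + g x)" and "laurent (\<lambda>x. f x * g x)"
proof -
  obtain D p where f: "real_polynomial_function p" "\<forall>x. x \<noteq> 0 \<longrightarrow> x ^ D * f x = p x" using assms(1) unfolding laurent_def by (elim exE conjE)
  obtain E q where g: "real_polynomial_function q" "\<forall>x. x \<noteq> 0 \<longrightarrow> x ^ E * g x = q x" using assms(2) unfolding laurent_def by (elim exE conjE)
  show "laurent (\<lambda>x. f x + g x)"
  proof (rule laurentI[of "\<lambda>x. x ^ E * p x + x ^ D * q x" "D + E"])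
    show "real_polynomial_function (\<lambda>x. x ^ E * p x + x ^ D * q x)"
      by (intro real_polynomial_function.intros(3,4) polynomial_power_id f g)
    fix x :: real assume "x \<noteq> 0"
    then have "x ^ D * f x = p x" "x ^ E * g x = q x" using f g by simp_all
    moreover have "x ^ (D + E) * (f x + g x) = x ^ E * (x ^ D * f x) + x ^ D * (x ^ E * g x)"
      by (simp add: power_add algebra_simps)
    ultimately show "x ^ (D + E) * (f x + g x) = x ^ E * p x + x ^ D * q x" by simp
  qed
  show "laurent (\<lambda>x. f x * g x)"
  proof (rule laurentI[of "\<lambda>x. p x * q x" "D + E"])
    show "real_polynomial_function (\<lambda>x. p x * q x)" by (intro real_polynomial_function.intros(4) f g)
    fix x :: real assume "x \<noteq> 0"
    then have "x ^ D * f x = p x" "x ^ E * g x = q x" using f g by simp_all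
    moreover have "x ^ (D + E) * (f x * g x) = (x ^ D * f x) * (x ^ E * g x)"
      by (simp add: power_add algebra_simps)
    ultimately show "x ^ (D + E) * (f x * g x) = p x * q x" by simp
  qed
qed

lemma laurent_sum: "finite K \<Longrightarrow> (\<And>k. k \<in> K \<Longrightarrow> laurent (f k)) \<Longrightarrow> laurent (\<lambda>x. \<Sum>k\<in>K. f k x)"
  by (induction K rule: finite_induct) (simp_all add: laurent_const laurent_add(1))

lemma laurent_polynomial:
  fixes c :: "real \<Rightarrow> real ^ 'n::finite ^ 'n"
  assumes "real_polynomial_function P" and c: "\<And>i j. laurent (\<lambda>x. c x $ i $ j)"
  shows "laurent (\<lambda>x. P (c x))"
  using assms(1)
proof (induction rule: real_polynomial_function.induct)
  case (linear L)
  from linear_entries[OF linear] obtain w where "\<forall>M. L M = (\<Sum>i\<in>UNIV. \<Sum>j\<in>UNIV. w i j * M $ i $ j)" by (elim exE)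
  note w = this[rule_format]
  show ?case unfolding w by (intro laurent_sum laurent_add(2) laurent_const c) simp_all
qed (simp_all add: laurent_const laurent_add)

lemma laurent_zero:
  assumes "laurent f" and inf: "infinite {x. x \<noteq> 0 \<and> f x = 0}" and x: "x \<noteq> 0"
  shows "f x = 0"
proof -
  obtain D p where f: "real_polynomial_function p" "\<forall>x. x \<noteq> 0 \<longrightarrow> x ^ D * f x = p x" using assms(1) unfolding laurent_def by (elim exE conjE)
  obtain a d where a: "p = (\<lambda>x. \<Sum>k\<le>d. a k * x ^ k)"
    using f(1) unfolding real_polynomial_function_iff_sum by (elim exE)
  have "{x. x \<noteq> 0 \<and> f x = 0} \<subseteq> {x. (\<Sum>k\<le>d. a k * x ^ k) = 0}" using f(2) by (auto simp: a)
  then have "infinite {x. (\<Sum>k\<le>d. a k * x ^ k) = 0}" using inf by (rule infinite_super)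
  have "a k = 0" if k: "k \<le> d" for k
  proof (rule ccontr)
    assume "a k \<noteq> 0"
    then have "finite {x. (\<Sum>k\<le>d. a k * x ^ k) = 0}" using k
      by (rule polyfun_rootbound_finite | rule polyfun_rootbound_finite[rotated] | (intro polyfun_rootbound_finite exI conjI; simp; fail) | metis polyfun_rootbound_finite)
    then show False using \<open>infinite {x. (\<Sum>k\<le>d. a k * x ^ k) = 0}\<close> by simp
  qed
  then have "p x = 0" by (simp add: a)
  then show ?thesis using f(2) x by auto
qed

text \<open>A polynomial that vanishes on \<open>X\<close> becomes a Laurent polynomial on the torus
  with infinitely many zeros, namely the powers of \<open>z\<close>.\<close>

lemma torus_in_zar:
  fixes c :: "real \<Rightarrow> real ^ 'n::finite ^ 'n"
  assumes X: "\<And>x y. x \<in> X \<Longrightarrow> y \<in> X \<Longrightarrow> x ** y \<in> X"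
    and c: "\<And>i j. laurent (\<lambda>x. c x $ i $ j)" "\<And>x y. c x ** c y = c (x * y)"
    and z: "z > 1" "c z \<in> X" and x: "x \<noteq> 0"
  shows "c x \<in> zar X"
  unfolding zar_def mem_Collect_eq
proof (intro allI impI)
  fix P assume P: "real_polynomial_function P" "\<forall>x\<in>X. P x = 0"
  have p: "c (z ^ Suc j) \<in> X" for j
  proof (induction j)
    case (Suc j)
    have "c z ** c (z ^ Suc j) \<in> X" using z(2) Suc by (rule X)
    then show ?case unfolding c(2) by simp
  qed (use z in simp)
  have "inj (\<lambda>j. z ^ Suc j)" using z(1) by (intro injI) (simp add: power_inject_exp del: power_Suc)
  then have "infinite (range (\<lambda>j. z ^ Suc j))" by (rule range_inj_infinite)
  moreover have "range (\<lambda>j. z ^ Suc j) \<subseteq> {x. x \<noteq> 0 \<and> P (c x) = 0}" using p P(2) z(1) by auto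
  ultimately have "infinite {x. x \<noteq> 0 \<and> P (c x) = 0}" using infinite_super by blast
  from laurent_zero[OF laurent_polynomial[OF P(1) c(1)] this x] show "P (c x) = 0" .
qed

section \<open>Generation of the special linear group by transvections\<close>

definition unit_mat :: "'n \<Rightarrow> 'n \<Rightarrow> real ^ 'n::finite ^ 'n" where
  "unit_mat a b = (\<chi> i j. if i = a \<and> j = b then 1 else 0)"

lemma unit_mat_left: "(unit_mat a b ** M) $ i $ j = (if i = a then M $ b $ j else 0)"
proof -
  have "(unit_mat a b ** M) $ i $ j = (\<Sum>k\<in>UNIV. (if i = a \<and> k = b then 1 else 0) * M $ k $ j)"
    by (simp add: matrix_matrix_mult_def unit_mat_def)
  also have "\<dots> = (\<Sum>k\<in>UNIV. if k = b then (if i = a then M $ b $ j else 0) else 0)" by (rule sum.cong) auto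
  finally show ?thesis by simp
qed

lemma unit_mat_right: "(M ** unit_mat a b) $ i $ j = (if j = b then M $ i $ a else 0)"
proof -
  have "(M ** unit_mat a b) $ i $ j = (\<Sum>k\<in>UNIV. M $ i $ k * (if k = a \<and> j = b then 1 else 0))"
    by (simp add: matrix_matrix_mult_def unit_mat_def)
  also have "\<dots> = (\<Sum>k\<in>UNIV. if k = a then (if j = b then M $ i $ a else 0) else 0)" by (rule sum.cong) auto
  finally show ?thesis by simp
qed

lemma unit_mat_mult: "unit_mat a b ** unit_mat c d = (if b = c then unit_mat a d else 0)"
  by (auto simp: vec_eq_iff unit_mat_left) (auto simp: unit_mat_def)

definition transvection :: "'n \<Rightarrow> 'n \<Rightarrow> real \<Rightarrow> real ^ 'n::finite ^ 'n" where
  "transvection a b x = mat 1 + x *\<^sub>R unit_mat a b"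

lemma transvection_left: "(transvection a b x ** M) $ i $ j = M $ i $ j + (if i = a then x * M $ b $ j else 0)"
  for M :: "real ^ 'n::finite ^ 'n"
  by (simp add: transvection_def matrix_mult_add unit_mat_left)

text \<open>Gaussian elimination writes the matrix as a product from \<open>G\<close> and a diagonal
  matrix, and diagonal matrices of determinant one are products of transvections. Closure under
  multiplication is enough, as the inverse of a transvection is a transvection.\<close>

lemma transvections_SL:
  fixes G :: "(real ^ 'n::finite ^ 'n) set"
  assumes G: "\<And>x y. x \<in> G \<Longrightarrow> y \<in> G \<Longrightarrow> x ** y \<in> G" "mat 1 \<in> G" "\<And>x. x \<in> G \<Longrightarrow> det x = 1"
    and tv: "\<And>a b x. a \<noteq> b \<Longrightarrow> transvection a b x \<in> G" and A: "det A = 1"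
  shows "A \<in> G"
proof -
  define dg :: "('n \<Rightarrow> real) \<Rightarrow> real ^ 'n ^ 'n" where "dg d = (\<chi> i j. if i = j then d i else 0)" for d
  have "det A \<noteq> 0 \<longrightarrow> (\<exists>U\<in>G. \<exists>d. A = U ** dg d)"
  proof (induction A rule: induct_matrix_row_operations)
    case (1 A i)
    then show ?case by (simp add: det_zero_row)
  next
    case (2 A)
    then have "A = mat 1 ** dg (\<lambda>i. A $ i $ i)" by (auto simp: vec_eq_iff dg_def)
    then show ?case using G(2) by blast
  next
    case (3 A m n)
    let ?t = "Transposition.transpose m n"
    define B :: "real ^ 'n ^ 'n" where "B = (\<chi> i j. A $ i $ ?t j)"
    define S :: "real ^ 'n ^ 'n" where "S = (\<chi> i j. if i = ?t j then 1 else 0)"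
    have MS: "M ** S = (\<chi> i j. M $ i $ ?t j)" for M
      by (simp add: vec_eq_iff matrix_matrix_mult_def S_def if_distrib cong: if_cong)
    have BS: "B = A ** S" by (simp add: MS B_def)
    show ?case unfolding B_def[symmetric]
    proof
      assume "det B \<noteq> 0"
      then have "det A \<noteq> 0" by (auto simp: BS det_mul)
      then obtain U d where U: "U \<in> G" "A = U ** dg d" using 3 by blast
      \<comment> \<open>Three transvections swap two coordinates up to a sign; the sign is absorbed
        by \<open>d'\<close>.\<close>
      define w where "w = transvection m n 1 ** (transvection n m (- 1) ** transvection m n 1)"
      define d' where "d' = d(m := - d n, n := d m)"
      have "dg d ** S = w ** dg d'" using 3(2)
        unfolding MS w_def matrix_mul_assoc[symmetric]
        by (auto simp: vec_eq_iff transvection_left dg_def d'_def Transposition.transpose_def)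
      then have "B = (U ** w) ** dg d'" by (simp add: BS U(2) matrix_mul_assoc[symmetric])
      moreover have "U ** w \<in> G" unfolding w_def using 3(2) by (intro G(1) U(1) tv) simp_all
      ultimately show "\<exists>U\<in>G. \<exists>d. B = U ** dg d" by blast
    qed
  next
    case (4 A m n k)
    define B :: "real ^ 'n ^ 'n" where "B = (\<chi> i. if i = m then row m A + k *\<^sub>R row n A else row i A)"
    have B: "B = transvection m n k ** A" by (simp add: B_def vec_eq_iff transvection_left row_def)
    show ?case unfolding B_def[symmetric]
    proof
      assume "det B \<noteq> 0"
      then have "det A \<noteq> 0" by (auto simp: B det_mul)
      then obtain U d where U: "U \<in> G" "A = U ** dg d" using 4 by blast
      then have "B = (transvection m n k ** U) ** dg d" by (simp add: B matrix_mul_assoc)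
      moreover have "transvection m n k ** U \<in> G" using 4(2) by (intro G(1) U(1) tv) simp
      ultimately show "\<exists>U\<in>G. \<exists>d. B = U ** dg d" by blast
    qed
  qed
  then obtain U d where U: "U \<in> G" "A = U ** dg d" using A by auto
  have "det (dg d) = (\<Prod>i\<in>UNIV. d i)" by (subst det_diagonal) (simp_all add: dg_def)
  then have d: "(\<Prod>i\<in>UNIV. d i) = 1" using A U G(3)[OF U(1)] by (simp add: det_mul)
  have "dg d \<in> G"
  proof -
    obtain a :: 'n where True by blast
    have "finite K \<Longrightarrow> a \<notin> K \<Longrightarrow> (\<And>i. i \<notin> insert a K \<Longrightarrow> e i = 1) \<Longrightarrow> (\<Prod>i\<in>insert a K. e i) = 1 \<Longrightarrow> dg e \<in> G" for K e
    proof (induction K arbitrary: e rule: finite_induct)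
      case empty
      then have "e i = 1" for i by (cases "i = a") simp_all
      then have "dg e = mat 1" by (simp add: dg_def mat_def vec_eq_iff)
      then show ?case using G(2) by simp
    next
      case (insert b K)
      have ab: "a \<noteq> b" using insert.prems(1) by auto
      define u where "u = e b"
      \<comment> \<open>The factor at \<open>b\<close> is collected at \<open>a\<close>, so the set
        of indices with an entry other than 1 shrinks.\<close>
      define e' where "e' = e(b := 1, a := e a * e b)"
      have pr: "e a * (e b * (\<Prod>i\<in>K. e i)) = 1" using insert by (simp add: ab)
      have u0: "u \<noteq> 0" using pr by (auto simp: u_def)
      have "(\<Prod>i\<in>K. e' i) = (\<Prod>i\<in>K. e i)" by (rule prod.cong) (use insert in \<open>auto simp: e'_def\<close>)
      then have "(\<Prod>i\<in>insert a K. e' i) = 1" using insert pr by (simp add: e'_def ab mult_ac)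
      moreover have "e' i = 1" if "i \<notin> insert a K" for i using that insert.prems(2)[of i] by (auto simp: e'_def)
      ultimately have "dg e' \<in> G" using insert.IH[of e'] insert.prems(1) by simp
      \<comment> \<open>The six transvections multiply to the diagonal matrix with \<open>u\<close>
        at \<open>b\<close> and 1 / \<open>u\<close> at \<open>a\<close>: a signed swap scaled by
        \<open>u\<close>, followed by the inverse of the unscaled one.\<close>
      then have "transvection b a u ** (transvection a b (- 1 / u) ** (transvection b a u **
        (transvection b a (- 1) ** (transvection a b 1 ** (transvection b a (- 1) ** dg e'))))) \<in> G"
        using ab by (intro G(1) tv) auto
      moreover have "transvection b a u ** (transvection a b (- 1 / u) ** (transvection b a u **
        (transvection b a (- 1) ** (transvection a b 1 ** (transvection b a (- 1) ** dg e'))))) = dg e"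
        using ab u0 by (auto simp: vec_eq_iff transvection_left dg_def e'_def u_def field_simps)
      ultimately show ?case by simp
    qed
    from this[of "UNIV - {a}" d] show ?thesis using d by (simp add: insert_absorb insert_UNIV)
  qed
  with U(1) show ?thesis unfolding U(2) by (rule G(1))
qed

section \<open>The Zariski closure of a bent representation\<close>

definition lower_e :: "real ^ 'n::finite ^ 'n" where "lower_e = deriv_matrix (mat2 0 1 0 0)"
definition upper_e :: "real ^ 'n::finite ^ 'n" where "upper_e = deriv_matrix (mat2 0 0 1 0)"
definition cartan :: "real ^ 'n::finite ^ 'n" where "cartan = deriv_matrix (mat2 (1 / 2) 0 0 (- 1 / 2))"

lemma lower_e_nth: "(lower_e :: real ^ 'n::finite ^ 'n) $ i $ j = (if idx i = Suc (idx j) then of_nat (CARD('n) - 1 - idx j) else 0)"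
  and upper_e_nth: "(upper_e :: real ^ 'n ^ 'n) $ i $ j = (if Suc (idx i) = idx j then of_nat (idx j) else 0)"
  by (simp_all add: lower_e_def upper_e_def deriv_matrix_def)

definition weight :: "nat \<Rightarrow> nat \<Rightarrow> real" where "weight n k = (of_nat (n - 1) - 2 * of_nat k) / 2"

lemma cartan_diag: "(cartan :: real ^ 'n::finite ^ 'n) = diag_mat (weight CARD('n))"
proof -
  have "idx j \<le> CARD('n) - 1" for j :: 'n using idx_less[of j] by linarith
  then have "of_nat (CARD('n) - 1 - idx j) = (of_nat (CARD('n) - 1) - of_nat (idx j) :: real)" for j :: 'n
    by (rule of_nat_diff)
  then show ?thesis
    by (simp add: vec_eq_iff cartan_def deriv_matrix_def diag_mat_def weight_def) (simp add: field_simps)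
qed

lemma diag_bracket: "(diag_mat f ** M - M ** diag_mat f) $ i $ j = (f (idx i) - f (idx j)) * M $ i $ j"
  for M :: "real ^ 'n::finite ^ 'n"
  by (simp add: diag_mat_left diag_mat_right algebra_simps)

lemma cartan_brackets:
  "cartan ** lower_e - lower_e ** cartan = - (lower_e :: real ^ 'n::finite ^ 'n)"
  "cartan ** upper_e - upper_e ** cartan = (upper_e :: real ^ 'n ^ 'n)"
proof -
  have "(cartan ** lower_e - lower_e ** cartan) $ i $ j = (- lower_e) $ i $ j" for i j :: 'n
    unfolding cartan_diag diag_bracket by (simp add: lower_e_nth weight_def field_simps)
  then show "cartan ** lower_e - lower_e ** cartan = - (lower_e :: real ^ 'n::finite ^ 'n)" by (simp add: vec_eq_iff)
  have "(cartan ** upper_e - upper_e ** cartan) $ i $ j = upper_e $ i $ j" for i j :: 'n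
  proof (cases "Suc (idx i) = idx j")
    case True
    have "weight CARD('n) (idx i) - weight CARD('n) (idx j) = 1" unfolding True[symmetric] by (simp add: weight_def field_simps)
    then show ?thesis unfolding cartan_diag diag_bracket by simp
  next
    case False
    then show ?thesis unfolding cartan_diag diag_bracket by (simp add: upper_e_nth)
  qed
  then show "cartan ** upper_e - upper_e ** cartan = (upper_e :: real ^ 'n ^ 'n)" by (simp add: vec_eq_iff)
qed

text \<open>The other two mirrors do not preserve the diagonal torus; conjugating its generator
  therefore produces off-diagonal elements. The identity is the two-dimensional one transported by
  \<open>deriv_matrix_conj\<close>.\<close>

lemma mirror_rep_cartan:
  "mirror_rep (True, e) ** cartan ** mirror_rep (True, e) =
    2 *\<^sub>R cartan + (sg e * (rt2 * rt6)) *\<^sub>R (lower_e - upper_e :: real ^ 'n::finite ^ 'n)"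
proof -
  let ?M = "mirror_matrix (True, e)" and ?h = "mat2 (1 / 2) 0 0 (- 1 / 2)"
  have "?M ** (?M ** ?h ** ?M) ** ?M = (?M ** ?M) ** ?h ** (?M ** ?M)" by (simp only: matrix_mul_assoc)
  then have c: "?M ** (?M ** ?h ** ?M) ** ?M = ?h" by (simp add: mirror_matrix_square)
  have "mirror_rep (True, e) ** cartan ** mirror_rep (True, e) =
    (deriv_matrix (?M ** ?h ** ?M) ** mirror_rep (True, e) ** mirror_rep (True, e) :: real ^ 'n ^ 'n)"
    unfolding deriv_matrix_conj[OF mirror_matrix_square] c cartan_def ..
  also have "\<dots> = deriv_matrix (?M ** ?h ** ?M)" by (simp add: matrix_mul_assoc[symmetric] mirror_rep_square)
  also have "?M ** ?h ** ?M = mat2 1 (sg e * (rt2 * rt6)) (- (sg e * (rt2 * rt6))) (- 1)"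
    by (cases e) (simp_all add: mirror_matrix_def mat2_mult, (intro mat2_cong; simp add: algebra_simps rt_squares)+)
  also have "(deriv_matrix \<dots> :: real ^ 'n ^ 'n) = 2 *\<^sub>R cartan + (sg e * (rt2 * rt6)) *\<^sub>R (lower_e - upper_e)"
    by (simp add: vec_eq_iff deriv_matrix_def cartan_def lower_e_def upper_e_def algebra_simps)
  finally show ?thesis .
qed

text \<open>What density needs to know of the image of the surface group: it may miss a word, but
  not all positive powers of it.\<close>

definition power_closed :: "(mirror \<Rightarrow> real ^ 'n::finite ^ 'n) \<Rightarrow> (real ^ 'n ^ 'n) set \<Rightarrow> bool" where
  "power_closed R X \<longleftrightarrow> (\<forall>x\<in>X. \<forall>y\<in>X. x ** y \<in> X) \<and> (\<forall>v. \<exists>k>0. word_mat R (concat (replicate k v)) \<in> X)"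

lemma power_closed_mult: "power_closed R X \<Longrightarrow> x \<in> X \<Longrightarrow> y \<in> X \<Longrightarrow> x ** y \<in> X"
  by (simp add: power_closed_def)

text \<open>The words \<open>v\<close> itself need not belong to the group. However, a power of the
  conjugate by \<open>v\<close> of the hyperbolic word does, and the torus through that power is the
  full conjugated torus.\<close>

lemma conj_cartan_in_lie:
  fixes X :: "(real ^ 'n::finite ^ 'n) set"
  assumes odd: "odd CARD('n)" and t: "t \<ge> 0" and X: "power_closed (bent_rep t) X"
  shows "word_mat (bent_rep t) v ** cartan ** word_mat (bent_rep t) (rev v) \<in> lie X" and "mat 1 \<in> zar X"
proof -
  let ?R = "bent_rep t :: mirror \<Rightarrow> real ^ 'n ^ 'n"
  obtain m where m: "CARD('n) = Suc (2 * m)" using odd by (auto elim!: oddE)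
  obtain y :: real where y: "y > 1"
    "mirror_rep (False, True) ** mirror_rep (False, False) = (diag_mat (\<lambda>k. y ^ (2 * m - k) * (1 / y) ^ k) :: real ^ 'n ^ 'n)"
    by (rule mirror_product[OF m])
  define dg :: "real \<Rightarrow> real ^ 'n ^ 'n" where "dg x = diag_mat (\<lambda>k. x ^ (2 * m - k) * (1 / x) ^ k)" for x
  have dg: "dg x ** dg x' = dg (x * x')" for x x'
    unfolding dg_def diag_mat_mult by (simp add: power_mult_distrib power_divide mult_ac)
  have main: "word_mat ?R v ** dg x ** word_mat ?R (rev v) \<in> zar X" if x: "x \<noteq> 0" for x v
  proof -
    define V where "V = word_mat ?R v"
    define V' where "V' = word_mat ?R (rev v)"
    have VV: "V' ** V = mat 1" unfolding V_def V'_def by (rule word_mat_rev[OF is_rep_bent[OF odd t]])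
    define c where "c x = V ** dg x ** V'" for x
    have c_mult: "c x ** c x' = c (x * x')" for x x'
      unfolding c_def conj_mult[OF VV] dg ..
    have c_nth: "c x $ i $ j = (\<Sum>l\<in>UNIV. V $ i $ l * (x ^ (2 * m - idx l) * (1 / x) ^ idx l) * V' $ l $ j)" for x i j
      unfolding c_def matrix_matrix_mult_def[of "V ** dg x"] by (simp add: dg_def diag_mat_right)
    have c_laurent: "laurent (\<lambda>x. c x $ i $ j)" for i j
      unfolding c_nth by (intro laurent_sum laurent_add(2) laurent_const laurent_power) simp
    \<comment> \<open>The two inner letters are mirrors that are never bent, so their product is the
      same diagonal matrix for every \<open>t\<close>.\<close>
    define w where "w = v @ [(False, True), (False, False)] @ rev v"
    have w: "word_mat ?R w = c y"
      unfolding w_def word_mat_append c_def V_def V'_def dg_def y(2)[symmetric] by (simp add: bent_rep_def matrix_mul_assoc)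
    obtain k where k: "k > 0" "word_mat ?R (concat (replicate k w)) \<in> X"
      using X unfolding power_closed_def by blast
    have "word_mat ?R (concat (replicate (Suc j) w)) = c (y ^ Suc j)" for j
    proof (induction j)
      case (Suc j)
      have "word_mat ?R (concat (replicate (Suc (Suc j)) w)) = word_mat ?R w ** word_mat ?R (concat (replicate (Suc j) w))"
        by (simp add: word_mat_append)
      then show ?case unfolding Suc w c_mult by simp
    qed (simp add: w)
    from this[of "k - 1"] have "c (y ^ k) \<in> X" using k by simp
    moreover have "y ^ k > 1" using y(1) k(1) by simp
    ultimately have "c x \<in> zar X"
      using torus_in_zar[OF power_closed_mult[OF X] c_laurent c_mult, of "y ^ k" x] x by simp
    then show ?thesis unfolding c_def V_def V'_def .
  qed
  have "dg 1 = mat 1" by (simp add: dg_def diag_mat_one)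
  then show "mat 1 \<in> zar X" using main[of 1 "[]"] by simp
  let ?V = "word_mat ?R v" and ?V' = "word_mat ?R (rev v)"
  have VV: "?V ** ?V' = mat 1" using word_mat_rev[OF is_rep_bent[OF odd t], of "rev v"] by simp
  define c where "c s = ?V ** dg (exp s) ** ?V'" for s
  \<comment> \<open>The factor 2 arises because \<open>cartan\<close> has half the exponents of
    \<open>dg\<close> as eigenvalues.\<close>
  have crv: "curve_at_one c (2 *\<^sub>R (?V ** cartan ** ?V'))" unfolding curve_at_one_def
  proof (intro conjI allI)
    show "c 0 = mat 1" using VV by (simp add: c_def \<open>dg 1 = mat 1\<close>)
    fix i j
    have 1: "c s $ i $ j = (\<Sum>l\<in>UNIV. ?V $ i $ l * (exp s ^ (2 * m - idx l) * exp (- s) ^ idx l) * ?V' $ l $ j)" for s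
      unfolding c_def matrix_matrix_mult_def[of "?V ** dg (exp s)"]
      by (simp add: dg_def diag_mat_right exp_minus inverse_eq_divide)
    have 2: "(2 *\<^sub>R (?V ** cartan ** ?V')) $ i $ j = (\<Sum>l\<in>UNIV. ?V $ i $ l * (of_nat (2 * m - idx l) - of_nat (idx l)) * ?V' $ l $ j)"
    proof -
      have "2 * weight CARD('n) (idx l) = of_nat (2 * m - idx l) - of_nat (idx l)" for l :: 'n
        using idx_less[of l] unfolding m weight_def by (simp add: of_nat_diff)
      then have W: "2 * (?V $ i $ l * weight CARD('n) (idx l) * ?V' $ l $ j) = ?V $ i $ l * (of_nat (2 * m - idx l) - of_nat (idx l)) * ?V' $ l $ j" for l
        unfolding \<open>\<And>l :: 'n. 2 * weight CARD('n) (idx l) = of_nat (2 * m - idx l) - of_nat (idx l)\<close>[symmetric]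
        by (simp only: mult_ac)
      show ?thesis
        unfolding vector_scaleR_component matrix_matrix_mult_def[of "?V ** cartan"] vec_lambda_beta real_scaleR_def sum_distrib_left
        unfolding cartan_diag diag_mat_right by (rule sum.cong[OF HOL.refl]) (rule W)
    qed
    have 3: "((\<lambda>s. exp s ^ a * exp (- s) ^ b) has_real_derivative of_nat a - of_nat b) (at 0)" for a b
      by (auto intro!: derivative_eq_intros)
    show "((\<lambda>s. c s $ i $ j) has_real_derivative (2 *\<^sub>R (?V ** cartan ** ?V')) $ i $ j) (at 0)"
      unfolding 1 2 by (intro DERIV_sum DERIV_cmult_right DERIV_cmult 3)
  qed
  have "2 *\<^sub>R (?V ** cartan ** ?V') \<in> lie X"
  proof (rule lie_curve[OF _ crv])
    show "x ** y \<in> X" if "x \<in> X" "y \<in> X" for x y by (rule power_closed_mult[OF X that])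
    show "c s \<in> zar X" for s by (simp add: c_def main)
  qed
  then show "?V ** cartan ** ?V' \<in> lie X" by (rule lie_unscale) simp
qed

text \<open>The conjugate of \<open>cartan\<close> by an unbent mirror contains the difference of
  \<open>lower_e\<close> and \<open>upper_e\<close>, and bracketing with \<open>cartan\<close> gives
  their sum. For the bent mirror the same computation is conjugated by \<open>bend t\<close>, which
  commutes with \<open>cartan\<close>.\<close>

lemma sl2_in_lie:
  fixes X :: "(real ^ 'n::finite ^ 'n) set"
  assumes odd: "odd CARD('n)" and t: "t \<ge> 0" and X: "power_closed (bent_rep t) X"
  shows "cartan \<in> lie X" "lower_e \<in> lie X" "upper_e \<in> lie X"
    and "bend t ** lower_e ** unbend t \<in> lie X" "bend t ** upper_e ** unbend t \<in> lie X"
proof -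
  note L = conj_cartan_in_lie(1)[OF odd t X]
  show H: "cartan \<in> lie X" using L[of "[]"] by simp
  \<comment> \<open>Carried out for a pair \<open>p\<close>, \<open>q\<close> so that it serves for
    the identity and for \<open>bend t\<close>.\<close>
  have split: "p ** lower_e ** q \<in> lie X \<and> p ** upper_e ** q \<in> lie X"
    if pq: "p ** cartan ** q = cartan" "q ** p = mat 1" and c: "c \<noteq> 0"
      and D: "2 *\<^sub>R cartan + c *\<^sub>R (p ** (lower_e - upper_e) ** q) \<in> lie X" for p q :: "real ^ 'n ^ 'n" and c
  proof -
    let ?D = "p ** (lower_e - upper_e) ** q"
    have "c *\<^sub>R ?D \<in> lie X" using lie_diff[OF D lie_scale[OF H, of 2]] by simp
    then have D: "?D \<in> lie X" using c by (rule lie_unscale)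
    have "cartan ** ?D - ?D ** cartan = p ** (cartan ** (lower_e - upper_e) - (lower_e - upper_e) ** cartan) ** q"
      using conj_mult[OF pq(2), of cartan "lower_e - upper_e"] conj_mult[OF pq(2), of "lower_e - upper_e" cartan]
      unfolding pq(1) by (simp add: matrix_mult_add)
    also have "cartan ** (lower_e - upper_e) - (lower_e - upper_e) ** cartan =
      (cartan ** lower_e - lower_e ** cartan) - (cartan ** upper_e - upper_e ** (cartan :: real ^ 'n ^ 'n))"
      by (simp add: matrix_mult_add)
    also have "\<dots> = (- 1) *\<^sub>R (lower_e + upper_e)" unfolding cartan_brackets by simp
    finally have "cartan ** ?D - ?D ** cartan = (- 1) *\<^sub>R (p ** (lower_e + upper_e) ** q)"
      unfolding matrix_mult_add(5,6) .
    then have S: "(- 1) *\<^sub>R (p ** (lower_e + upper_e) ** q) \<in> lie X"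
      using lie_bracket[OF H D] by (simp only:)
    then have S: "p ** (lower_e + upper_e) ** q \<in> lie X" by (rule lie_unscale) simp
    have "2 *\<^sub>R (p ** lower_e ** q) = p ** (lower_e + upper_e) ** q + ?D"
      "2 *\<^sub>R (p ** upper_e ** q) = p ** (lower_e + upper_e) ** q - ?D"
      by (simp_all add: matrix_mult_add scaleR_2)
    then have "2 *\<^sub>R (p ** lower_e ** q) \<in> lie X" "2 *\<^sub>R (p ** upper_e ** q) \<in> lie X"
      using lie_add[OF S D] lie_diff[OF S D] by simp_all
    then show ?thesis using lie_unscale[of 2 _ X] by simp
  qed
  have c: "sg e * (rt2 * rt6) \<noteq> 0" for e using rt_pos by (cases e) simp_all
  have "2 *\<^sub>R cartan + (sg True * (rt2 * rt6)) *\<^sub>R (mat 1 ** (lower_e - upper_e) ** mat 1) \<in> lie X"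
    using L[of "[(True, True)]"] mirror_rep_cartan[of True, where 'n = 'n] by (simp add: bent_rep_def)
  from split[OF _ _ c this] show "lower_e \<in> lie X" "upper_e \<in> lie X" by simp_all
  have bc: "bend t ** cartan ** unbend t = (cartan :: real ^ 'n ^ 'n)" "unbend t ** cartan ** bend t = (cartan :: real ^ 'n ^ 'n)"
  proof -
    have "bend t ** cartan = cartan ** (bend t :: real ^ 'n ^ 'n)" "unbend t ** cartan = cartan ** (unbend t :: real ^ 'n ^ 'n)"
      unfolding cartan_diag bend_def unbend_def diag_mat_mult by (simp_all add: mult.commute)
    then show "bend t ** cartan ** unbend t = (cartan :: real ^ 'n ^ 'n)" "unbend t ** cartan ** bend t = (cartan :: real ^ 'n ^ 'n)"
      by (simp_all add: matrix_mul_assoc[symmetric] bend_unbend[OF t])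
  qed
  let ?A = "mirror_rep (True, False) :: real ^ 'n ^ 'n"
  have "(bend t ** ?A ** unbend t) ** cartan ** (bend t ** ?A ** unbend t) = bend t ** (?A ** (unbend t ** cartan ** bend t) ** ?A) ** unbend t"
    by (simp add: matrix_mul_assoc)
  also have "\<dots> = 2 *\<^sub>R cartan + (sg False * (rt2 * rt6)) *\<^sub>R (bend t ** (lower_e - upper_e) ** unbend t)"
    unfolding bc mirror_rep_cartan by (simp only: matrix_mult_add(1,2,5,6) bc)
  finally have "2 *\<^sub>R cartan + (sg False * (rt2 * rt6)) *\<^sub>R (bend t ** (lower_e - upper_e) ** unbend t) \<in> lie X"
    using L[of "[(True, False)]"] by (simp add: bent_rep_def)
  from split[OF bc(1) bend_unbend(2)[OF t] c this]
  show "bend t ** lower_e ** unbend t \<in> lie X" "bend t ** upper_e ** unbend t \<in> lie X" by simp_all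
qed

text \<open>The bent and the unbent copies of \<open>lower_e\<close> and \<open>upper_e\<close>
  differ only next to the ends of the basis. From these differences one elementary matrix is
  isolated at the first end and then spread to all places by brackets.\<close>

lemma unit_mats_in_lie:
  fixes X :: "(real ^ 'n::finite ^ 'n) set"
  assumes odd: "odd CARD('n)" and n1: "CARD('n) > 1" and t: "t > 0" and X: "power_closed (bent_rep t) X" and ab: "a \<noteq> b"
  shows "unit_mat a b \<in> lie X"
proof -
  let ?n = "CARD('n)"
  have t0: "t \<ge> 0" using t by simp
  have n3: "?n \<ge> 3" using odd n1 by presburger
  note sl2 = sl2_in_lie[OF odd t0 X]
  obtain z0 z1 y0 y1 :: 'n where z: "idx z0 = 0" "idx z1 = 1" "idx y0 = ?n - 1" "idx y1 = ?n - 2"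
    using idx_surj[where 'n = 'n, of 0] idx_surj[where 'n = 'n, of 1] idx_surj[where 'n = 'n, of "?n - 1"] idx_surj[where 'n = 'n, of "?n - 2"] n3
    by auto
  have eq: "i = z0 \<longleftrightarrow> idx i = 0" "i = z1 \<longleftrightarrow> idx i = 1" "i = y0 \<longleftrightarrow> idx i = ?n - 1" "i = y1 \<longleftrightarrow> idx i = ?n - 2" for i
    using z idx_eq_iff by metis+
  have ne: "z0 \<noteq> z1" "z0 \<noteq> y0" "z0 \<noteq> y1" "z1 \<noteq> y0" "y0 \<noteq> y1" "z1 \<noteq> z0" "y0 \<noteq> z0" "y1 \<noteq> z0" "y0 \<noteq> z1" "y1 \<noteq> y0"
    using z n3 by auto
  \<comment> \<open>The change of the entry n - 1 of \<open>lower_e\<close> in the first column,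
    which bending divides by 1 + t. Its entry 1 in the last row is multiplied by 1 + t and changes
    by \<open>t\<close>; for \<open>upper_e\<close> the two ends are exchanged.\<close>
  define x where "x = (of_nat ?n - 1) * (1 / (1 + t) - 1)"
  have x: "x < 0" using t n3 by (simp add: x_def field_simps)
  define XE where "XE = x *\<^sub>R unit_mat z1 z0 + t *\<^sub>R (unit_mat y0 y1 :: real ^ 'n ^ 'n)"
  define XF where "XF = t *\<^sub>R unit_mat z0 z1 + x *\<^sub>R (unit_mat y1 y0 :: real ^ 'n ^ 'n)"
  have conj_nth: "(bend t ** M ** unbend t) $ i $ j = bend_fun ?n (1 + t) (idx i) * M $ i $ j * bend_fun ?n (1 / (1 + t)) (idx j)" for M :: "real ^ 'n ^ 'n" and i j
    unfolding bend_def unbend_def diag_mat_right diag_mat_left ..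
  have tt: "(1 + t) * (c * (1 / (1 + t))) = c" for c using t by simp
  have bf: "bend_fun ?n p 0 = p" "bend_fun ?n p (?n - 1) = p" "k \<noteq> 0 \<Longrightarrow> k \<noteq> ?n - 1 \<Longrightarrow> bend_fun ?n p k = 1" for p k
    by (simp_all add: bend_fun_def)
  have "bend t ** lower_e ** unbend t - lower_e = XE"
  proof -
    have "(bend t ** lower_e ** unbend t - lower_e) $ i $ j = XE $ i $ j" for i j
    proof (cases "idx i = Suc (idx j)")
      case True
      then have L: "lower_e $ i $ j = (of_nat (?n - 1 - idx j) :: real)" by (simp add: lower_e_nth)
      consider "idx j = 0" | "idx j = ?n - 2" | "idx j \<noteq> 0" "idx j \<noteq> ?n - 2" by blast
      then show ?thesis
      proof cases
        case 1
        have "bend_fun ?n (1 + t) (idx i) = 1" using 1 True n3 by (intro bf(3)) auto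
        then show ?thesis using 1 True n3 by (simp add: conj_nth L bf XE_def unit_mat_def eq x_def of_nat_diff algebra_simps)
      next
        case 2
        have i: "idx i = ?n - 1" using 2 True n3 by linarith
        have "bend_fun ?n (1 / (1 + t)) (idx j) = 1" using 2 n3 by (intro bf(3)) auto
        moreover have "bend_fun ?n (1 + t) (idx i) = 1 + t" unfolding i by (rule bf)
        moreover have "of_nat (?n - 1 - idx j) = (1 :: real)" using 2 n3 by simp
        ultimately show ?thesis using 2 i n3 by (simp add: conj_nth L XE_def unit_mat_def eq)
      next
        case 3
        have "idx j \<noteq> ?n - 1" using True idx_less[of i] by linarith
        moreover have "idx i \<noteq> ?n - 1" using True 3 by linarith
        ultimately show ?thesis using 3 True by (simp add: conj_nth L bf(3) XE_def unit_mat_def eq)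
      qed
    next
      case False
      then show ?thesis using n3 by (auto simp: conj_nth lower_e_nth XE_def unit_mat_def eq)
    qed
    then show ?thesis by (simp add: vec_eq_iff)
  qed
  then have XE: "XE \<in> lie X" using lie_diff[OF sl2(4) sl2(2)] by simp
  have "bend t ** upper_e ** unbend t - upper_e = XF"
  proof -
    have "(bend t ** upper_e ** unbend t - upper_e) $ i $ j = XF $ i $ j" for i j
    proof (cases "Suc (idx i) = idx j")
      case True
      then have L: "upper_e $ i $ j = (of_nat (Suc (idx i)) :: real)" by (simp add: upper_e_nth)
      consider "idx i = 0" | "idx i = ?n - 2" | "idx i \<noteq> 0" "idx i \<noteq> ?n - 2" by blast
      then show ?thesis
      proof cases
        case 1
        have "bend_fun ?n (1 / (1 + t)) (idx j) = 1" using 1 True n3 by (intro bf(3)) auto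
        moreover have "idx j = 1" using 1 True by simp
        ultimately show ?thesis using 1 n3 by (simp add: conj_nth L bf XF_def unit_mat_def eq)
      next
        case 2
        have j: "idx j = ?n - 1" using 2 True n3 by linarith
        have "bend_fun ?n (1 + t) (idx i) = 1" using 2 n3 by (intro bf(3)) auto
        moreover have "bend_fun ?n (1 / (1 + t)) (idx j) = 1 / (1 + t)" unfolding j by (rule bf)
        moreover have "of_nat (Suc (idx i)) = (of_nat ?n - 1 :: real)" using 2 n3 by (simp add: of_nat_diff)
        ultimately show ?thesis using 2 j n3 unfolding vector_minus_component conj_nth L
          by (simp add: XF_def unit_mat_def eq x_def algebra_simps)
      next
        case 3
        have "idx i \<noteq> ?n - 1" using True idx_less[of j] by linarith
        moreover have "idx j \<noteq> ?n - 1" using True 3 by linarith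
        ultimately show ?thesis using 3 True by (simp add: conj_nth L bf(3) XF_def unit_mat_def eq)
      qed
    next
      case False
      then show ?thesis using n3 by (auto simp: conj_nth upper_e_nth XF_def unit_mat_def eq)
    qed
    then show ?thesis by (simp add: vec_eq_iff)
  qed
  then have XF: "XF \<in> lie X" using lie_diff[OF sl2(5) sl2(3)] by simp
  define D where "D = unit_mat z1 z1 - (unit_mat z0 z0 :: real ^ 'n ^ 'n)"
  have EX: "lower_e ** unit_mat z0 z1 = (of_nat ?n - 1) *\<^sub>R unit_mat z1 z1" "unit_mat z0 z1 ** lower_e = (of_nat ?n - 1) *\<^sub>R unit_mat z0 z0"
    "lower_e ** unit_mat y1 y0 = unit_mat y0 y0" "unit_mat y1 y0 ** lower_e = (unit_mat y1 y1 :: real ^ 'n ^ 'n)"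
  proof -
    have "(lower_e ** unit_mat z0 z1) $ i $ j = ((of_nat ?n - 1) *\<^sub>R unit_mat z1 z1) $ i $ j"
      "(unit_mat z0 z1 ** lower_e) $ i $ j = ((of_nat ?n - 1) *\<^sub>R unit_mat z0 z0) $ i $ j"
      "(lower_e ** unit_mat y1 y0) $ i $ j = unit_mat y0 y0 $ i $ j"
      "(unit_mat y1 y0 ** lower_e) $ i $ j = unit_mat y1 y1 $ i $ j" for i j :: 'n
      unfolding unit_mat_left unit_mat_right lower_e_nth using z n3
      by (auto simp: unit_mat_def eq of_nat_diff)
    then show "lower_e ** unit_mat z0 z1 = (of_nat ?n - 1) *\<^sub>R unit_mat z1 z1" "unit_mat z0 z1 ** lower_e = (of_nat ?n - 1) *\<^sub>R unit_mat z0 z0"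
      "lower_e ** unit_mat y1 y0 = unit_mat y0 y0" "unit_mat y1 y0 ** lower_e = (unit_mat y1 y1 :: real ^ 'n ^ 'n)"
      by (simp_all add: vec_eq_iff)
  qed
  \<comment> \<open>The factor \<open>t\<close> makes the contributions of the far end cancel. Those
    of the near end do not, because \<open>x\<close> and \<open>t\<close> have opposite
    signs.\<close>
  have "t *\<^sub>R (lower_e ** XF - XF ** lower_e) - (XE ** XF - XF ** XE) = (t * ((of_nat ?n - 1) * t - x)) *\<^sub>R D"
    unfolding XE_def XF_def matrix_mult_add EX unit_mat_mult D_def using ne by (simp add: algebra_simps)
  then have "(t * ((of_nat ?n - 1) * t - x)) *\<^sub>R D \<in> lie X"
    using lie_diff[OF lie_scale[OF lie_bracket[OF sl2(2) XF], of t] lie_bracket[OF XE XF]] by simp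
  moreover have "t * ((of_nat ?n - 1) * t - x) \<noteq> 0"
  proof -
    have "(of_nat ?n - 1) * t > 0" using t n3 by simp
    then have "(of_nat ?n - 1) * t - x > 0" using x by linarith
    then show ?thesis using t by simp
  qed
  ultimately have D: "D \<in> lie X" by (rule lie_unscale)
  \<comment> \<open>For \<open>n\<close> = 3 the indices 1 and n - 2 coincide, and \<open>D\<close>
    no longer commutes with the far ends of \<open>XE\<close> and \<open>XF\<close>; the correction
    by \<open>h\<close> removes them.\<close>
  define h where "h = (if y1 = z1 then 1 else 0 :: real)"
  have "(D ** XE - XE ** D) + h *\<^sub>R XE = ((2 + h) * x) *\<^sub>R unit_mat z1 z0"
    "(D ** XF - XF ** D) - h *\<^sub>R XF = (- (2 + h) * t) *\<^sub>R unit_mat z0 z1"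
    unfolding XE_def XF_def D_def matrix_mult_add unit_mat_mult h_def using ne
    by (cases "y1 = z1"; simp add: vec_eq_iff; simp add: algebra_simps)+
  then have "((2 + h) * x) *\<^sub>R unit_mat z1 z0 \<in> lie X" "(- (2 + h) * t) *\<^sub>R unit_mat z0 z1 \<in> lie X"
    using lie_add[OF lie_bracket[OF D XE] lie_scale[OF XE, of h]] lie_diff[OF lie_bracket[OF D XF] lie_scale[OF XF, of h]] by simp_all
  moreover have "(2 + h) * x \<noteq> 0" "- (2 + h) * t \<noteq> 0" using x t by (auto simp: h_def)
  ultimately have e1: "unit_mat z1 z0 \<in> lie X" "unit_mat z0 z1 \<in> lie X" using lie_unscale by blast+
  \<comment> \<open>Bracketing with \<open>lower_e\<close> moves down the first column, with
    \<open>upper_e\<close> along the first row, each time with a nonzero factor.\<close>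
  have low: "unit_mat j z0 \<in> lie X" "unit_mat z0 j \<in> lie X" if "idx j = Suc k" for j k
  proof -
    have "\<forall>j. idx j = Suc k \<longrightarrow> unit_mat j z0 \<in> lie X \<and> unit_mat z0 j \<in> lie X" for k
    proof (induction k)
      case 0
      have "j = z1" if "idx j = Suc 0" for j using that by (simp add: eq)
      then show ?case using e1 by blast
    next
      case (Suc k)
      show ?case
      proof (intro allI impI)
        fix j :: 'n assume j: "idx j = Suc (Suc k)"
        have "Suc k < ?n" using idx_less[of j] j by linarith
        from idx_surj[OF this] obtain l :: 'n where l: "idx l = Suc k" by (elim exE)
        have jl: "i = j \<longleftrightarrow> idx i = Suc (Suc k)" "i = l \<longleftrightarrow> idx i = Suc k" for i using j l idx_eq_iff by metis+
        have "lower_e ** unit_mat l z0 - unit_mat l z0 ** lower_e = of_nat (?n - 1 - Suc k) *\<^sub>R (unit_mat j z0 :: real ^ 'n ^ 'n)"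
          by (auto simp: vec_eq_iff unit_mat_left unit_mat_right lower_e_nth z) (auto simp: unit_mat_def jl l j eq z)
        then have "of_nat (?n - 1 - Suc k) *\<^sub>R (unit_mat j z0 :: real ^ 'n ^ 'n) \<in> lie X"
          using lie_bracket[OF sl2(2), of "unit_mat l z0"] Suc l by simp
        moreover have "of_nat (?n - 1 - Suc k) \<noteq> (0 :: real)" using idx_less[of j] j by simp
        ultimately have 1: "unit_mat j z0 \<in> lie X" by (rule lie_unscale)
        have "unit_mat z0 l ** upper_e - upper_e ** unit_mat z0 l = of_nat (Suc (Suc k)) *\<^sub>R (unit_mat z0 j :: real ^ 'n ^ 'n)"
          by (auto simp: vec_eq_iff unit_mat_left unit_mat_right upper_e_nth z) (auto simp: unit_mat_def jl l j eq z)
        then have "of_nat (Suc (Suc k)) *\<^sub>R (unit_mat z0 j :: real ^ 'n ^ 'n) \<in> lie X"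
          using lie_bracket[OF _ sl2(3), of "unit_mat z0 l"] Suc l by simp
        then have "unit_mat z0 j \<in> lie X" by (rule lie_unscale) simp
        with 1 show "unit_mat j z0 \<in> lie X \<and> unit_mat z0 j \<in> lie X" ..
      qed
    qed
    then show "unit_mat j z0 \<in> lie X" "unit_mat z0 j \<in> lie X" using that by blast+
  qed
  have low: "unit_mat j z0 \<in> lie X" "unit_mat z0 j \<in> lie X" if j: "j \<noteq> z0" for j
  proof -
    obtain k where "idx j = Suc k" using j by (cases "idx j") (auto simp: eq)
    then show "unit_mat j z0 \<in> lie X" "unit_mat z0 j \<in> lie X" by (rule low)+
  qed
  show ?thesis
  proof (cases "a = z0 \<or> b = z0")
    case True
    then show ?thesis using low ab by auto
  next
    case False
    \<comment> \<open>Every other off-diagonal place is the bracket of one from the first column and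
      one from the first row.\<close>
    have "unit_mat a z0 ** unit_mat z0 b - unit_mat z0 b ** unit_mat a z0 = (unit_mat a b :: real ^ 'n ^ 'n)"
      using ab by (simp add: unit_mat_mult)
    then show ?thesis using lie_bracket[OF low(1) low(2), of a b] False by simp
  qed
qed

lemma polynomial_det: "real_polynomial_function (det :: real ^ 'n::finite ^ 'n \<Rightarrow> real)"
proof -
  have e: "real_polynomial_function (\<lambda>M :: real ^ 'n ^ 'n. M $ i $ j)" for i j
    by (intro real_polynomial_function.intros(1) bounded_linear_compose[OF bounded_linear_vec_nth bounded_linear_vec_nth])
  show ?thesis unfolding det_def[abs_def]
    by (intro real_polynomial_function_sum real_polynomial_function.intros(2,4) real_polynomial_function_prod e) (simp_all add: finite_permutations)
qed

text \<open>The elementary matrices in the Lie algebra square to zero, so their one-parameter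
  groups, the transvections, lie in the closure.\<close>

lemma zar_bent:
  fixes X :: "(real ^ 'n::finite ^ 'n) set"
  assumes odd: "odd CARD('n)" and n1: "CARD('n) > 1" and t: "t > 0" and X: "power_closed (bent_rep t) X"
    and det: "\<And>x. x \<in> X \<Longrightarrow> det x = 1"
  shows "zar X = {M. det M = 1}"
proof -
  have zdet: "det g = 1" if g: "g \<in> zar X" for g
  proof -
    have "real_polynomial_function (\<lambda>M :: real ^ 'n ^ 'n. det M + - 1)"
      by (intro real_polynomial_function.intros(2,3) polynomial_det)
    from zarD[OF g this] have "det g + - 1 = 0" using det by simp
    then show ?thesis by simp
  qed
  have one: "mat 1 \<in> zar X" by (rule conj_cartan_in_lie(2)[OF odd _ X]) (use t in simp)
  have "M \<in> zar X" if "det M = 1" for M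
  proof (rule transvections_SL[OF _ one zdet _ that])
    show "x ** y \<in> zar X" if "x \<in> zar X" "y \<in> zar X" for x y
      by (rule zar_mult[OF power_closed_mult[OF X] that])
    fix a b :: 'n and x assume ab: "a \<noteq> b"
    show "transvection a b x \<in> zar X" unfolding transvection_def
      by (rule lie_unipotent[OF unit_mats_in_lie[OF odd n1 t X ab] _ one]) (use ab in \<open>simp add: unit_mat_mult\<close>)
  qed
  then show ?thesis using zdet by blast
qed

text \<open>Invariance under the group passes to its closure and then to the derivations. The
  principal three-dimensional algebra alone is irreducible, so this holds at t = 0 as well.\<close>

lemma bent_irreducible:
  fixes X :: "(real ^ 'n::finite ^ 'n) set"
  assumes odd: "odd CARD('n)" and t: "t \<ge> 0" and X: "power_closed (bent_rep t) X"
    and V: "subspace V" "\<And>x v. x \<in> X \<Longrightarrow> v \<in> V \<Longrightarrow> x *v v \<in> V"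
  shows "V = {0} \<or> V = UNIV"
proof -
  \<comment> \<open>Membership in \<open>V\<close> is expressed by linear functionals vanishing on
    \<open>V\<close>, which turns invariance into a polynomial condition on the matrix.\<close>
  have perp: "x \<in> V" if x: "\<And>w. (\<forall>v\<in>V. w \<bullet> v = 0) \<Longrightarrow> w \<bullet> x = 0" for x
  proof -
    obtain y z where yz: "y \<in> span V" "\<And>w. w \<in> span V \<Longrightarrow> orthogonal z w" "x = y + z"
      by (rule orthogonal_subspace_decomp_exists[of V x]) blast
    have sp: "span V = V" using V(1) by (simp add: span_eq_iff)
    have "\<forall>v\<in>V. z \<bullet> v = 0" using yz(2) unfolding sp orthogonal_def by blast
    then have "z \<bullet> x = 0" "z \<bullet> y = 0" using x yz(1) sp by auto
    then have "z = 0" using yz(3) by (simp add: inner_add_right)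
    then show ?thesis using yz sp by simp
  qed
  have lin: "bounded_linear (\<lambda>g :: real ^ 'n ^ 'n. w \<bullet> (g *v v))" for w v
    unfolding linear_conv_bounded_linear[symmetric]
    by (rule linearI) (simp_all add: matrix_vector_mult_add_rdistrib inner_add_right scaleR_matrix_vector_assoc[symmetric])
  have zV: "g *v v \<in> V" if g: "g \<in> zar X" and v: "v \<in> V" for g v
  proof (rule perp)
    fix w assume w: "\<forall>v\<in>V. w \<bullet> v = 0"
    show "w \<bullet> (g *v v) = 0"
      by (rule zarD[OF g real_polynomial_function.intros(1)[OF lin]]) (use w V(2) v in simp)
  qed
  have lV: "Z *v v \<in> V" if Z: "Z \<in> lie X" and v: "v \<in> V" for Z v
  proof (rule perp)
    fix w assume w: "\<forall>v\<in>V. w \<bullet> v = 0"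
    have "\<forall>g\<in>zar X. w \<bullet> (g *v v) = 0" using w zV v by simp
    then have "dir Z (\<lambda>g. w \<bullet> (g *v v)) (mat 1) = 0"
      using Z conj_cartan_in_lie(2)[OF odd t X] real_polynomial_function.intros(1)[OF lin] unfolding lie_def by blast
    then show "w \<bullet> (Z *v v) = 0" unfolding dir_linear[OF lin] by simp
  qed
  note sl2 = sl2_in_lie[OF odd t X]
  have diag: "diag_mat f *v v = (\<chi> i. f (idx i) * v $ i)" for f and v :: "real ^ 'n"
    by (simp add: vec_eq_iff matrix_vector_mult_def diag_mat_def if_distrib[of "\<lambda>x. x * _"] cong: if_cong)
  show ?thesis
  proof (cases "V = {0}")
    case False
    let ?s = "\<lambda>v :: real ^ 'n. card {i. v $ i \<noteq> 0}"
    have "\<exists>v. v \<in> V \<and> v \<noteq> 0" using False subspace_0[OF V(1)] by blast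
    \<comment> \<open>A nonzero vector of smallest support is a multiple of a basis vector: the
      weights are distinct, so \<open>cartan\<close> minus one weight would otherwise shorten
      it.\<close>
    then obtain v where v: "v \<in> V" "v \<noteq> 0" "\<And>w. w \<in> V \<and> w \<noteq> 0 \<Longrightarrow> ?s v \<le> ?s w"
      using ex_has_least_nat[of "\<lambda>v. v \<in> V \<and> v \<noteq> 0" _ ?s] by blast
    obtain a where a: "v $ a \<noteq> 0" using v(2) by (auto simp: vec_eq_iff)
    have single: "v $ b = 0" if ab: "b \<noteq> a" for b
    proof (rule ccontr)
      assume b: "v $ b \<noteq> 0"
      define w where "w = cartan *v v - weight CARD('n) (idx a) *\<^sub>R v"
      have w: "w \<in> V" unfolding w_def by (intro subspace_diff[OF V(1)] subspace_scale[OF V(1)] lV sl2 v)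
      have wi: "w $ i = (weight CARD('n) (idx i) - weight CARD('n) (idx a)) * v $ i" for i
        unfolding w_def cartan_diag diag by (simp add: algebra_simps)
      have "idx b \<noteq> idx a" using ab by simp
      then have "w $ b \<noteq> 0" using b by (simp add: wi weight_def)
      then have "w \<noteq> 0" by auto
      then have "?s v \<le> ?s w" using v(3) w by blast
      moreover have "{i. w $ i \<noteq> 0} \<subset> {i. v $ i \<noteq> 0}" using a by (auto simp: wi)
      then have "?s w < ?s v" by (intro psubset_card_mono) simp_all
      ultimately show False by simp
    qed
    have "axis a 1 = (1 / v $ a) *\<^sub>R v" using single a by (auto simp: vec_eq_iff axis_def)
    then have A: "axis a 1 \<in> V" using subspace_scale[OF V(1) v(1)] by simp
    have col: "M *v axis i 1 = (\<chi> k. M $ k $ i)" for M :: "real ^ 'n ^ 'n" and i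
      by (simp add: vec_eq_iff matrix_vector_mult_def axis_def if_distrib cong: if_cong)
    have step: "axis j 1 \<in> V \<longleftrightarrow> axis i 1 \<in> V" if ij: "idx j = Suc (idx i)" for i j :: 'n
    proof
      have k: "k = j \<longleftrightarrow> idx k = Suc (idx i)" "k = i \<longleftrightarrow> Suc (idx k) = idx j" for k
        using ij idx_eq_iff[of k j] idx_eq_iff[of k i] by auto
      have "lower_e *v axis i 1 = of_nat (CARD('n) - 1 - idx i) *\<^sub>R (axis j 1 :: real ^ 'n)"
        unfolding col by (auto simp: vec_eq_iff lower_e_nth axis_def k)
      moreover have "of_nat (CARD('n) - 1 - idx i) \<noteq> (0 :: real)" using idx_less[of j] ij by simp
      ultimately have e: "axis j 1 = (1 / of_nat (CARD('n) - 1 - idx i)) *\<^sub>R (lower_e *v axis i 1 :: real ^ 'n)" by simp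
      show "axis j 1 \<in> V" if i: "axis i 1 \<in> V"
        unfolding e by (intro subspace_scale[OF V(1)] lV sl2 i)
      have "upper_e *v axis j 1 = of_nat (idx j) *\<^sub>R (axis i 1 :: real ^ 'n)"
        unfolding col by (auto simp: vec_eq_iff upper_e_nth axis_def k)
      then have e: "axis i 1 = (1 / of_nat (idx j)) *\<^sub>R (upper_e *v axis j 1 :: real ^ 'n)" using ij by simp
      show "axis i 1 \<in> V" if j: "axis j 1 \<in> V"
        unfolding e by (intro subspace_scale[OF V(1)] lV sl2 j)
    qed
    obtain z :: 'n where z: "idx z = 0" using idx_surj[of 0, where 'n = 'n] by auto
    have all: "axis i 1 \<in> V \<longleftrightarrow> axis z 1 \<in> V" if "idx i = k" for i k
      using that
    proof (induction k arbitrary: i)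
      case 0
      then have "i = z" using z idx_eq_iff[of i z] by simp
      then show ?case by simp
    next
      case (Suc k)
      have "k < CARD('n)" using idx_less[of i] Suc.prems by linarith
      from idx_surj[OF this] obtain l :: 'n where l: "idx l = k" by (elim exE)
      show ?case using step[of i l] Suc.IH[OF l] Suc.prems l by simp
    qed
    have ax: "axis i 1 \<in> V" for i using all[OF HOL.refl, of a] all[OF HOL.refl, of i] A by blast
    have "x \<in> V" for x
    proof -
      have "x = (\<Sum>i\<in>UNIV. x $ i *\<^sub>R axis i 1)" using basis_expansion[of x] by (simp add: scalar_mult_eq_scaleR)
      also have "\<dots> \<in> V" by (intro subspace_sum[OF V(1)] subspace_scale[OF V(1)] ax)
      finally show ?thesis .
    qed
    then show ?thesis by blast
  qed simp
qed

section \<open>Representations of surface groups\<close>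

text \<open>The two-dimensional matrices represent the words modulo sign only, that is, in the
  projective group.\<close>

lemma weq_mirror:
  assumes "u \<simeq> v"
  shows "word_mat mirror_matrix u = word_mat mirror_matrix v \<or> word_mat mirror_matrix u = - word_mat mirror_matrix v"
  using assms
proof (induction rule: weq.induct)
  case (cancel u i v)
  have "mirror_matrix i ** (mirror_matrix i ** M) = M" for M :: "real ^ 2 ^ 2" by (simp add: mirror_matrix_square matrix_mul_assoc)
  then show ?case by (simp add: word_mat_append)
next
  case (braid i j u v)
  have neg: "(- A) ** B = - (A ** B)" "A ** (- B) = - (A ** B)" for A B :: "real ^ 2 ^ 2"
    by (simp_all add: vec_eq_iff matrix_matrix_mult_def sum_negf)
  have "word_mat mirror_matrix (u @ [k, l, k] @ v) = word_mat mirror_matrix u ** (mirror_matrix k ** mirror_matrix l ** mirror_matrix k) ** word_mat mirror_matrix v" for k l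
    by (simp add: word_mat_append matrix_mul_assoc)
  then show ?case using mirror_matrix_braid[OF braid] by (elim disjE) (simp_all add: neg)
next
  case (trans u v w)
  then show ?case by auto
qed auto

lemma SL_inverse:
  fixes g :: "real ^ 'n::finite ^ 'n"
  assumes "det g = 1"
  obtains g' where "g ** g' = mat 1" "g' ** g = mat 1" "matrix_inv g = g'"
proof -
  have "invertible g" using assms by (simp add: invertible_det_nz)
  then obtain g' where g': "g ** g' = mat 1" "g' ** g = mat 1" unfolding invertible_def by (elim exE conjE)
  show thesis by (rule that[OF g' matrix_inv_eqI[OF g'(1)]])
qed

lemma conjugacy_class_conj_subset:
  fixes d d' :: "real ^ 'n::finite ^ 'n"
  assumes d: "d ** d' = mat 1" "det d = 1" and r: "\<And>\<gamma>. \<gamma> \<in> carrier \<Gamma> \<Longrightarrow> r2 \<gamma> = d ** r1 \<gamma> ** d'"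
  shows "conjugacy_class \<Gamma> r2 \<subseteq> conjugacy_class \<Gamma> r1"
proof
  fix x assume "x \<in> conjugacy_class \<Gamma> r2"
  then obtain g where g: "det g = 1" "x = (\<lambda>\<gamma>\<in>carrier \<Gamma>. g ** r2 \<gamma> ** matrix_inv g)"
    unfolding conjugacy_class_def by (auto simp: SL_def)
  obtain g' where g': "g ** g' = mat 1" "matrix_inv g = g'" using SL_inverse[OF g(1)] by metis
  have "(g ** d) ** (d' ** g') = g ** (d ** d') ** g'" by (simp only: matrix_mul_assoc)
  then have "(g ** d) ** (d' ** g') = mat 1" by (simp add: d g')
  then have gd: "matrix_inv (g ** d) = d' ** g'" by (rule matrix_inv_eqI)
  have "x = (\<lambda>\<gamma>\<in>carrier \<Gamma>. (g ** d) ** r1 \<gamma> ** matrix_inv (g ** d))"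
    unfolding g(2) gd g'(2) by (rule restrict_ext) (simp add: r matrix_mul_assoc)
  moreover have "g ** d \<in> carrier SL" using g(1) d(2) by (simp add: SL_def det_mul)
  ultimately show "x \<in> conjugacy_class \<Gamma> r1" unfolding conjugacy_class_def by blast
qed

lemma conjugacy_class_conj:
  fixes d d' :: "real ^ 'n::finite ^ 'n"
  assumes d: "d ** d' = mat 1" "d' ** d = mat 1" "det d = 1" and r: "\<And>\<gamma>. \<gamma> \<in> carrier \<Gamma> \<Longrightarrow> r2 \<gamma> = d ** r1 \<gamma> ** d'"
  shows "conjugacy_class \<Gamma> r2 = conjugacy_class \<Gamma> r1"
proof (rule subset_antisym)
  show "conjugacy_class \<Gamma> r2 \<subseteq> conjugacy_class \<Gamma> r1" using d(1,3) r by (rule conjugacy_class_conj_subset)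
  have "det (d ** d') = 1" unfolding d(1) by simp
  then have d1: "det d' = 1" using d(3) by (simp add: det_mul)
  have "r1 \<gamma> = d' ** r2 \<gamma> ** d" if "\<gamma> \<in> carrier \<Gamma>" for \<gamma>
  proof -
    have "d' ** (d ** r1 \<gamma> ** d') ** d = (d' ** d) ** r1 \<gamma> ** (d' ** d)" by (simp only: matrix_mul_assoc)
    then show ?thesis using that by (simp add: r d)
  qed
  then show "conjugacy_class \<Gamma> r1 \<subseteq> conjugacy_class \<Gamma> r2" by (rule conjugacy_class_conj_subset[OF d(2) d1])
qed

section \<open>Discreteness of the Fuchsian group and continuity of the path\<close>

lemma reflect_int:
  assumes "fst z \<in> \<int>" "fst (snd z) \<in> \<int>" "snd (snd z) \<in> \<int>"
  shows "fst (reflect i z) \<in> \<int>" "fst (snd (reflect i z)) \<in> \<int>" "snd (snd (reflect i z)) \<in> \<int>"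
proof -
  obtain s a b where z: "z = (s, a, b)" by (metis surj_pair)
  obtain k e where i: "i = (k, e)" by force
  show "fst (reflect i z) \<in> \<int>" "fst (snd (reflect i z)) \<in> \<int>" "snd (snd (reflect i z)) \<in> \<int>"
    using assms unfolding z i by (cases k; cases e; simp)+
qed

lemma act_center_int: "fst (act u (1, 0, 0)) \<in> \<int> \<and> fst (snd (act u (1, 0, 0))) \<in> \<int> \<and> snd (snd (act u (1, 0, 0))) \<in> \<int>"
  by (induction u) (simp_all add: reflect_int)

lemma int_vectors_close:
  fixes x y :: "real \<times> real \<times> real"
  assumes "fst x \<in> \<int>" "fst (snd x) \<in> \<int>" "snd (snd x) \<in> \<int>" "fst y \<in> \<int>" "fst (snd y) \<in> \<int>" "snd (snd y) \<in> \<int>"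
    and d: "dist x y < 1"
  shows "x = y"
proof -
  have *: "p = q" if "p \<in> \<int>" "q \<in> \<int>" "dist p q < 1" for p q :: real
  proof -
    have "\<bar>p - q\<bar> < 1" using that(3) by (simp add: dist_real_def)
    then have "p - q = 0" using Ints_nonzero_abs_less1[of "p - q"] that(1,2) by auto
    then show ?thesis by simp
  qed
  have "dist (fst x) (fst y) < 1" using dist_fst_le[of x y] d by linarith
  moreover have "dist (snd x) (snd y) < 1" using dist_snd_le[of x y] d by linarith
  then have "dist (fst (snd x)) (fst (snd y)) < 1" "dist (snd (snd x)) (snd (snd y)) < 1"
    using dist_fst_le[of "snd x" "snd y"] dist_snd_le[of "snd x" "snd y"] by linarith+
  ultimately show ?thesis using *[OF assms(1,4)] *[OF assms(2,5)] *[OF assms(3,6)] by (simp add: prod_eq_iff)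
qed

text \<open>The image of the centre (1, 0, 0), written as a continuous even function of an arbitrary
  matrix. On words it takes integral values, so it separates the group elements discretely.\<close>

definition light_sum :: "real ^ 2 ^ 2 \<Rightarrow> real \<times> real \<times> real" where
  "light_sum M = (1 / 2) *\<^sub>R (light (M *v vector [1, 0]) + light (M *v vector [0, 1]))"

lemma light_sum_word: "light_sum (word_mat mirror_matrix u) = act u (1, 0, 0)"
proof -
  have "(1, 0, 0) = (1 / 2) *\<^sub>R (light (vector [1, 0]) + light (vector [0, 1]))" by (simp add: light_def)
  then show ?thesis unfolding light_sum_def act_light[symmetric] by (simp only: act_linear)
qed

lemma light_sum_minus: "light_sum (- M) = light_sum M"
proof -
  have "(- M) *v x = - (M *v x)" for x by (simp add: matrix_vector_mult_def vec_eq_iff sum_negf)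
  then show ?thesis by (simp add: light_sum_def light_minus)
qed

lemma light_sum_continuous: "continuous_on S light_sum"
  unfolding light_sum_def[abs_def] light_def mult_vec2 by (intro continuous_intros)

lemma rcos_eq: "{mat 1, - mat 1} #>\<^bsub>SL\<^esub> M = {M, - M}" for M :: "real ^ 2 ^ 2"
proof -
  have "(- mat 1) ** M = - M" by (simp add: vec_eq_iff matrix_matrix_mult_def mat_def sum_2 forall_2)
  then show ?thesis by (auto simp: r_coset_def SL_def)
qed

lemma continuous_on_matrix_mult:
  fixes M N :: "real \<Rightarrow> real ^ 'n::finite ^ 'n"
  assumes "continuous_on S M" "continuous_on S N"
  shows "continuous_on S (\<lambda>t. M t ** N t)"
  unfolding matrix_matrix_mult_def
  by (intro continuous_on_vec_lambda continuous_on_sum continuous_on_mult continuous_on_component assms)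

lemma continuous_on_bent_rep: "continuous_on {0..} (\<lambda>t. bent_rep t i :: real ^ 'n::finite ^ 'n)"
proof -
  have b: "continuous_on {0..} (\<lambda>t. bend_fun n (f t) k)" if "continuous_on {0..} f" for n k and f :: "real \<Rightarrow> real"
    unfolding bend_fun_def using that by (cases "k = 0 \<or> k = n - 1") simp_all
  have d: "continuous_on {0..} (\<lambda>t. diag_mat (bend_fun n (f t)) :: real ^ 'n ^ 'n)" if f: "continuous_on {0..} f" for n and f :: "real \<Rightarrow> real"
  proof -
    have "continuous_on {0..} (\<lambda>t. if i = j then bend_fun n (f t) (idx i) else 0)" for i j :: 'n
      using b[OF f] by (cases "i = j") simp_all
    then show ?thesis unfolding diag_mat_def by (intro continuous_on_vec_lambda)
  qed
  have c: "continuous_on {0..} (\<lambda>t :: real. 1 / (1 + t))" "continuous_on {0..} (\<lambda>t :: real. 1 + t)"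
    by (intro continuous_intros; simp)+
  have "continuous_on {0..} (\<lambda>t. bend t :: real ^ 'n ^ 'n)" unfolding bend_def by (rule d[OF c(2)])
  moreover have "continuous_on {0..} (\<lambda>t. unbend t :: real ^ 'n ^ 'n)" unfolding unbend_def by (rule d[OF c(1)])
  ultimately show ?thesis unfolding bent_rep_def
    by (cases "i = (True, False)") (simp_all add: continuous_on_matrix_mult)
qed

lemma bent_rep_zero: "(bent_rep 0 :: mirror \<Rightarrow> real ^ 'n::finite ^ 'n) = mirror_rep"
proof -
  have "bend_fun n 1 = (\<lambda>_. 1)" for n by (rule ext) (simp add: bend_fun_def)
  then have "bend 0 = (mat 1 :: real ^ 'n ^ 'n)" "unbend 0 = (mat 1 :: real ^ 'n ^ 'n)"
    by (simp_all add: bend_def unbend_def diag_mat_one)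
  then show ?thesis by (intro ext) (simp add: bent_rep_def)
qed

lemma continuous_on_word_mat:
  fixes X :: "real \<Rightarrow> mirror \<Rightarrow> real ^ 'n::finite ^ 'n"
  assumes "\<And>i. continuous_on S (\<lambda>t. X t i)"
  shows "continuous_on S (\<lambda>t. word_mat (X t) u)"
  by (induction u) (simp_all add: continuous_on_matrix_mult assms)

lemma continuous_map_quotient: "continuous_map X (quotient_topology X q) q"
proof -
  have top: "topspace (quotient_topology X q) = q ` topspace X"
  proof (rule subset_antisym)
    show "topspace (quotient_topology X q) \<subseteq> q ` topspace X"
      using openin_topspace[of "quotient_topology X q"] unfolding openin_quotient_topology by (elim conjE)
    have "{x \<in> topspace X. q x \<in> q ` topspace X} = topspace X" by auto
    then have "openin (quotient_topology X q) (q ` topspace X)" by (simp add: openin_quotient_topology)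
    then show "q ` topspace X \<subseteq> topspace (quotient_topology X q)" by (rule openin_subset)
  qed
  show ?thesis unfolding continuous_map_def top by (auto simp: openin_quotient_topology)
qed

text \<open>The algebraic remainder of the topology: words faithful up to \<open>weq\<close>, and a
  positive power of every word in the image.\<close>

locale surface_words =
  fixes \<Gamma> :: "'g monoid" and h :: "'g \<Rightarrow> mirror list"
  assumes closed: "\<And>x y. x \<in> carrier \<Gamma> \<Longrightarrow> y \<in> carrier \<Gamma> \<Longrightarrow> x \<otimes>\<^bsub>\<Gamma>\<^esub> y \<in> carrier \<Gamma>"
    and even: "\<And>x. x \<in> carrier \<Gamma> \<Longrightarrow> even (length (h x))"
    and mult: "\<And>x y. x \<in> carrier \<Gamma> \<Longrightarrow> y \<in> carrier \<Gamma> \<Longrightarrow> h (x \<otimes>\<^bsub>\<Gamma>\<^esub> y) \<simeq> h x @ h y"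
    and eq_if_weq: "\<And>x y. x \<in> carrier \<Gamma> \<Longrightarrow> y \<in> carrier \<Gamma> \<Longrightarrow> h x \<simeq> h y \<Longrightarrow> x = y"
    and power: "\<And>v. \<exists>k>0. \<exists>x\<in>carrier \<Gamma>. h x \<simeq> concat (replicate k v)"
begin

definition rep :: "real ^ 'n::finite ^ 'n \<Rightarrow> real ^ 'n ^ 'n \<Rightarrow> real \<Rightarrow> 'g \<Rightarrow> real ^ 'n ^ 'n" where
  "rep D C t = (\<lambda>\<gamma>\<in>carrier \<Gamma>. D ** word_mat (bent_rep t) (h \<gamma>) ** C)"

lemma det_conj:
  fixes C D :: "real ^ 'n::finite ^ 'n"
  assumes "D ** C = mat 1" "is_rep X" "\<gamma> \<in> carrier \<Gamma>"
  shows "det (D ** word_mat X (h \<gamma>) ** C) = 1"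
proof -
  have "det (D ** C) = 1" unfolding assms(1) by simp
  then show ?thesis using word_mat_det[OF assms(2) even[OF assms(3)]] by (simp add: det_mul)
qed

lemma rep_hom:
  fixes C D :: "real ^ 'n::finite ^ 'n"
  assumes odd: "odd CARD('n)" and t: "t \<ge> 0" and CD: "C ** D = mat 1" "D ** C = mat 1"
  shows "rep D C t \<in> Hom_SL \<Gamma>"
proof -
  have R: "is_rep (bent_rep t :: mirror \<Rightarrow> real ^ 'n ^ 'n)" by (rule is_rep_bent[OF odd t])
  have "rep D C t \<gamma> \<in> carrier SL" if "\<gamma> \<in> carrier \<Gamma>" for \<gamma>
    using det_conj[OF CD(2) R that] that by (simp add: rep_def SL_def)
  moreover have "rep D C t (x \<otimes>\<^bsub>\<Gamma>\<^esub> y) = rep D C t x \<otimes>\<^bsub>SL\<^esub> rep D C t y" if xy: "x \<in> carrier \<Gamma>" "y \<in> carrier \<Gamma>" for x y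
    using xy closed[OF xy] word_mat_weq[OF R mult[OF xy]] by (simp add: rep_def SL_def conj_mult[OF CD(1)] word_mat_append)
  ultimately show ?thesis unfolding Hom_SL_def hom_def by (auto simp: rep_def)
qed

definition image_words :: "real \<Rightarrow> (real ^ 'n::finite ^ 'n) set" where
  "image_words t = (\<lambda>\<gamma>. word_mat (bent_rep t) (h \<gamma>)) ` carrier \<Gamma>"

lemma power_closed_words:
  assumes odd: "odd CARD('n::finite)" and t: "t \<ge> 0"
  shows "power_closed (bent_rep t) (image_words t :: (real ^ 'n ^ 'n) set)"
proof -
  have R: "is_rep (bent_rep t :: mirror \<Rightarrow> real ^ 'n ^ 'n)" by (rule is_rep_bent[OF odd t])
  have "word_mat (bent_rep t) (h x) ** word_mat (bent_rep t) (h y) \<in> (image_words t :: (real ^ 'n ^ 'n) set)"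
    if xy: "x \<in> carrier \<Gamma>" "y \<in> carrier \<Gamma>" for x y
    unfolding word_mat_append[symmetric] word_mat_weq[OF R mult[OF xy], symmetric] image_words_def using closed[OF xy] by (rule imageI)
  moreover have "\<exists>k>0. word_mat (bent_rep t) (concat (replicate k v)) \<in> (image_words t :: (real ^ 'n ^ 'n) set)" for v
  proof -
    obtain k x where k: "k > 0" "x \<in> carrier \<Gamma>" "h x \<simeq> concat (replicate k v)" using power[of v] by (elim exE conjE bexE)
    have "word_mat (bent_rep t) (concat (replicate k v)) \<in> (image_words t :: (real ^ 'n ^ 'n) set)"
      unfolding word_mat_weq[OF R k(3), symmetric] image_words_def using k(2) by (rule imageI)
    with k(1) show ?thesis by blast
  qed
  ultimately show ?thesis unfolding power_closed_def by (auto simp: image_words_def)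
qed

text \<open>The representation is irreducible, so the whole space is the only summand. Invariant
  subspaces are carried by \<open>C\<close> to the basis in which \<open>bent_irreducible\<close> is
  stated.\<close>

lemma rep_hom_plus:
  fixes C D :: "real ^ 'n::finite ^ 'n"
  assumes odd: "odd CARD('n)" and t: "t \<ge> 0" and CD: "C ** D = mat 1" "D ** C = mat 1"
  shows "rep D C t \<in> Hom_plus \<Gamma>"
proof -
  have irr: "W = {0} \<or> W = UNIV" if W: "invariant_subspace \<Gamma> (rep D C t) W" for W
  proof -
    have sub: "subspace W" and inv: "\<And>\<gamma> v. \<gamma> \<in> carrier \<Gamma> \<Longrightarrow> v \<in> W \<Longrightarrow> rep D C t \<gamma> *v v \<in> W"
      using W unfolding invariant_subspace_def by auto
    have CDv: "C *v (D *v v) = v" "D *v (C *v v) = v" for v using CD by (simp_all add: matrix_vector_mul_assoc)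
    define V where "V = {v. D *v v \<in> W}"
    have "subspace V" unfolding subspace_def V_def
      using sub by (auto simp: matrix_vector_right_distrib matrix_vector_mult_scaleR subspace_def)
    moreover have "x *v v \<in> V" if x: "x \<in> image_words t" and v: "v \<in> V" for x v
    proof -
      obtain \<gamma> where g: "\<gamma> \<in> carrier \<Gamma>" "x = word_mat (bent_rep t) (h \<gamma>)" using x unfolding image_words_def by blast
      have "rep D C t \<gamma> *v (D *v v) = D *v (x *v v)"
        using g by (simp add: rep_def matrix_vector_mul_assoc[symmetric] CDv del: matrix_vector_mul_assoc)
      then show ?thesis using inv[OF g(1), of "D *v v"] v by (simp add: V_def)
    qed
    ultimately have "V = {0} \<or> V = UNIV" by (rule bent_irreducible[OF odd t power_closed_words[OF odd t]])
    then show ?thesis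
    proof
      assume V: "V = {0}"
      have "w = 0" if "w \<in> W" for w
      proof -
        have "C *v w \<in> V" using that by (simp add: V_def CDv)
        then have "D *v (C *v w) = D *v 0" unfolding V by simp
        then show ?thesis unfolding CDv by simp
      qed
      then show ?thesis using subspace_0[OF sub] by blast
    next
      assume V: "V = UNIV"
      have "w \<in> W" for w using UNIV_I[of "C *v w"] unfolding V[symmetric] V_def by (simp add: CDv)
      then show ?thesis by blast
    qed
  qed
  have "(axis undefined 1 :: real ^ 'n) \<noteq> 0" by (simp add: axis_eq_0_iff)
  then have "(UNIV :: (real ^ 'n) set) \<noteq> {0}" by blast
  then have U: "irreducible_subrep \<Gamma> (rep D C t) UNIV" unfolding irreducible_subrep_def
    using irr by (auto simp: invariant_subspace_def)
  have "\<exists>!f. f \<in> (\<Pi>\<^sub>E V\<in>{UNIV}. V) \<and> x = (\<Sum>V\<in>{UNIV}. f V)" for x :: "real ^ 'n"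
  proof (rule ex1I[of _ "\<lambda>V\<in>{UNIV}. x"])
    fix f assume f: "f \<in> (\<Pi>\<^sub>E V\<in>{UNIV}. V) \<and> x = (\<Sum>V\<in>{UNIV}. f V)"
    show "f = (\<lambda>V\<in>{UNIV}. x)"
    proof (rule ext)
      fix V show "f V = (\<lambda>V\<in>{UNIV}. x) V" using f by (cases "V = UNIV") (auto simp: PiE_def extensional_def)
    qed
  qed simp
  then show ?thesis unfolding Hom_plus_def mem_Collect_eq
    by (intro conjI rep_hom[OF odd t CD] exI[of _ "{UNIV}"]) (use U in simp_all)
qed

lemma rep_zariski_dense:
  fixes C D :: "real ^ 'n::finite ^ 'n"
  assumes odd: "odd CARD('n)" and n1: "CARD('n) > 1" and t: "t > 0" and CD: "C ** D = mat 1" "D ** C = mat 1"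
  shows "zariski_dense \<Gamma> (rep D C t)"
proof -
  have t0: "t \<ge> 0" using t by simp
  have R: "is_rep (bent_rep t :: mirror \<Rightarrow> real ^ 'n ^ 'n)" by (rule is_rep_bent[OF odd t0])
  have z: "zar (image_words t) = {M :: real ^ 'n ^ 'n. det M = 1}"
    by (rule zar_bent[OF odd n1 t power_closed_words[OF odd t0]]) (auto simp: image_words_def word_mat_det[OF R even])
  have "P g = 0" if g: "det g = 1" and P: "real_polynomial_function P" "\<forall>x\<in>rep D C t ` carrier \<Gamma>. P x = 0" for g P
  proof -
    have "det (C ** D) = 1" unfolding CD by simp
    then have "det (C ** g ** D) = 1" using g by (simp add: det_mul)
    then have G: "C ** g ** D \<in> zar (image_words t)" unfolding z by simp
    have "D ** (C ** g ** D) ** C = (D ** C) ** g ** (D ** C)" by (simp only: matrix_mul_assoc)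
    then have e: "D ** (C ** g ** D) ** C = g" by (simp add: CD)
    \<comment> \<open>Conjugation is a linear change of variables on matrices, so density need only
      be known in the monomial basis.\<close>
    have p: "real_polynomial_function (\<lambda>M. P (D ** M ** C))"
      using polynomial_comp_linear[OF linear_mult_left polynomial_comp_linear[OF linear_mult_right P(1)]] .
    have "P (D ** (C ** g ** D) ** C) = 0"
      by (rule zarD[OF G p]) (use P(2) in \<open>auto simp: image_words_def rep_def\<close>)
    then show ?thesis unfolding e .
  qed
  then have "carrier SL \<subseteq> zariski_closure_SL (rep D C t ` carrier \<Gamma>)" unfolding zariski_closure_SL_def by (auto simp: SL_def)
  then show ?thesis unfolding zariski_dense_def by (auto simp: zariski_closure_SL_def)
qed

lemma rep_entries:
  fixes C D :: "real ^ 'n::finite ^ 'n"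
  assumes odd: "odd CARD('n)" and t: "t \<ge> 0" and CD: "C ** D = mat 1" "D ** C = mat 1"
    and R: "subring_real R" "\<And>i. entries_in R (D ** bent_rep t i ** C)"
  shows "rep D C t ` carrier \<Gamma> \<subseteq> SL_over R"
proof -
  have "entries_in R (D ** word_mat (bent_rep t) u ** C)" for u
    unfolding word_mat_conj[OF CD, symmetric] by (rule entries_in_word_mat[OF R])
  then show ?thesis
    using det_conj[OF CD(2) is_rep_bent[OF odd t]] by (auto simp: SL_over_def SL_def rep_def entries_in_def)
qed

lemma rep_continuous:
  fixes C D :: "real ^ 'n::finite ^ 'n"
  assumes odd: "odd CARD('n)" and CD: "C ** D = mat 1" "D ** C = mat 1" and A: "A \<subseteq> carrier \<Gamma>"
  shows "continuous_map (top_of_set {0..}) (Hom_topology A \<Gamma>) (rep D C)"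
  unfolding Hom_topology_def
proof (rule continuous_map_pullback')
  show "topspace (top_of_set {0..}) \<subseteq> rep D C -` Hom_SL \<Gamma>" using rep_hom[OF odd _ CD] by auto
  have "continuous_map (top_of_set {0..}) (top_of_set (carrier SL)) (\<lambda>t. restrict (rep D C t) A \<gamma>)" if \<gamma>: "\<gamma> \<in> A" for \<gamma>
  proof -
    have g: "\<gamma> \<in> carrier \<Gamma>" using \<gamma> A by blast
    have "continuous_on {0..} (\<lambda>t. D ** word_mat (bent_rep t) (h \<gamma>) ** C)"
      by (intro continuous_on_matrix_mult continuous_on_const continuous_on_word_mat continuous_on_bent_rep)
    moreover have "D ** word_mat (bent_rep t) (h \<gamma>) ** C \<in> carrier SL" if "t \<in> {0..}" for t
      using det_conj[OF CD(2) is_rep_bent[OF odd] g] that by (simp add: SL_def)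
    ultimately show ?thesis using \<gamma> g by (auto simp: rep_def continuous_map_in_subtopology)
  qed
  then show "continuous_map (top_of_set {0..}) (product_topology (\<lambda>_. top_of_set (carrier SL)) A) ((\<lambda>\<rho>. restrict \<rho> A) \<circ> rep D C)"
    unfolding continuous_map_componentwise by (auto simp: o_def)
qed

definition phi :: "'g \<Rightarrow> real ^ 'n::finite ^ 'n" where
  "phi = (\<lambda>\<gamma>\<in>carrier \<Gamma>. word_mat mirror_rep (h \<gamma>))"

text \<open>The mirror words modulo sign give the discrete faithful representation. The sign by
  which they fail to be multiplicative disappears in the projective group and, the degree being
  even, in \<open>omega\<close>.\<close>

lemma phi_fuchsian:
  assumes odd: "odd CARD('n::finite)"
  shows "fuchsian \<Gamma> (phi :: 'g \<Rightarrow> real ^ 'n ^ 'n)"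
proof -
  let ?M = "\<lambda>\<gamma>. word_mat mirror_matrix (h \<gamma>)"
  let ?q = "\<lambda>g :: real ^ 2 ^ 2. {mat 1, - mat 1} #>\<^bsub>SL\<^esub> g"
  define r where "r \<gamma> = ?q (?M \<gamma>)" for \<gamma>
  have r: "r \<gamma> = {?M \<gamma>, - ?M \<gamma>}" for \<gamma> unfolding r_def by (rule rcos_eq)
  have MSL: "?M \<gamma> \<in> carrier SL" if "\<gamma> \<in> carrier \<Gamma>" for \<gamma>
    using det_word_mirror[OF even[OF that]] by (simp add: SL_def)
  have hom: "r \<in> hom \<Gamma> PSL2"
  proof -
    have "r \<gamma> \<in> carrier PSL2" if "\<gamma> \<in> carrier \<Gamma>" for \<gamma>
      using MSL[OF that] unfolding PSL2_def FactGroup_def RCOSETS_def r_def by auto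
    moreover have "r (x \<otimes>\<^bsub>\<Gamma>\<^esub> y) = r x \<otimes>\<^bsub>PSL2\<^esub> r y" if xy: "x \<in> carrier \<Gamma>" "y \<in> carrier \<Gamma>" for x y
    proof -
      have neg: "(- A) ** B = - (A ** B)" "A ** (- B) = - (A ** B)" for A B :: "real ^ 2 ^ 2"
        by (simp_all add: vec_eq_iff matrix_matrix_mult_def sum_negf)
      have "r x \<otimes>\<^bsub>PSL2\<^esub> r y = {?M x ** ?M y, - (?M x ** ?M y)}"
        unfolding PSL2_def FactGroup_def r by (auto simp: set_mult_def SL_def neg)
      moreover have "r (x \<otimes>\<^bsub>\<Gamma>\<^esub> y) = {?M x ** ?M y, - (?M x ** ?M y)}"
        using weq_mirror[OF mult[OF xy]] unfolding r word_mat_append by (elim disjE) auto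
      ultimately show ?thesis by simp
    qed
    ultimately show ?thesis by (auto simp: hom_def)
  qed
  have inj: "inj_on r (carrier \<Gamma>)"
  proof (rule inj_onI)
    fix x y assume xy: "x \<in> carrier \<Gamma>" "y \<in> carrier \<Gamma>" "r x = r y"
    then have "?M x = ?M y \<or> ?M x = - ?M y" unfolding r by (auto simp: doubleton_eq_iff)
    then show "x = y" by (rule eq_if_weq[OF xy(1,2) word_mirror_injective])
  qed
  have disc: "subtopology PSL2_topology (r ` carrier \<Gamma>) = discrete_topology (r ` carrier \<Gamma>)"
  proof -
    have single: "\<exists>U. openin PSL2_topology U \<and> r \<gamma> \<in> U \<and> U \<inter> r ` carrier \<Gamma> \<subseteq> {r \<gamma>}" if g: "\<gamma> \<in> carrier \<Gamma>" for \<gamma>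
    proof -
      \<comment> \<open>The open ball of radius one contains only one integral vector of the orbit.
        Its preimage is stable under sign change, so it descends to an open set of the
        quotient.\<close>
      define B where "B = {g \<in> carrier SL. light_sum g \<in> ball (light_sum (?M \<gamma>)) 1}"
      have "openin (top_of_set (carrier SL)) (carrier SL \<inter> light_sum -` ball (light_sum (?M \<gamma>)) 1)"
        by (rule continuous_openin_preimage_gen[OF light_sum_continuous open_ball])
      moreover have "carrier SL \<inter> light_sum -` ball (light_sum (?M \<gamma>)) 1 = B" by (auto simp: B_def)
      ultimately have oB: "openin (top_of_set (carrier SL)) B" by simp
      have "x \<in> B" if x: "x \<in> carrier SL" "?q x \<in> ?q ` B" for x
      proof -
        obtain y where y: "y \<in> B" "?q x = ?q y" using x(2) by blast
        then have "x = y \<or> x = - y" unfolding rcos_eq by (auto simp: doubleton_eq_iff)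
        then have "light_sum x = light_sum y" using light_sum_minus by auto
        then show ?thesis using x(1) y(1) by (simp add: B_def)
      qed
      then have "{x \<in> carrier SL. ?q x \<in> ?q ` B} = B" by (auto simp: B_def)
      then have oU: "openin PSL2_topology (?q ` B)"
        unfolding PSL2_topology_def openin_quotient_topology using oB by (auto simp: B_def)
      have "?M \<gamma> \<in> B" using MSL[OF g] by (simp add: B_def)
      then have mem: "r \<gamma> \<in> ?q ` B" unfolding r_def by (rule imageI)
      have eq: "r \<delta> = r \<gamma>" if d: "\<delta> \<in> carrier \<Gamma>" "r \<delta> \<in> ?q ` B" for \<delta>
      proof -
        obtain y where y: "y \<in> B" "?q (?M \<delta>) = ?q y" using d(2) unfolding r_def by blast
        then have "?M \<delta> = y \<or> ?M \<delta> = - y" unfolding rcos_eq by (auto simp: doubleton_eq_iff)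
        then have "light_sum (?M \<delta>) = light_sum y" using light_sum_minus by auto
        then have "dist (act (h \<gamma>) (1, 0, 0)) (act (h \<delta>) (1, 0, 0)) < 1"
          using y(1) unfolding light_sum_word[symmetric] by (simp add: B_def)
        then have e: "act (h \<gamma>) (1, 0, 0) = act (h \<delta>) (1, 0, 0)"
          using act_center_int[of "h \<gamma>"] act_center_int[of "h \<delta>"] by (intro int_vectors_close) auto
        have app: "act (u @ v) z = act u (act v z)" for u v z by (induction u) simp_all
        have "act (rev (h \<delta>) @ h \<gamma>) (1, 0, 0) = act (rev (h \<delta>) @ h \<delta>) (1, 0, 0)" unfolding app e ..
        also have "\<dots> = (1, 0, 0)" using weq_act[OF weq_rev_left[of "h \<delta>"]] by simp
        finally have "rev (h \<delta>) @ h \<gamma> \<simeq> []" by (rule act_center_imp_weq)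
        then have "h \<delta> @ (rev (h \<delta>) @ h \<gamma>) \<simeq> h \<delta> @ []" by (intro weq_append weq.refl)
        moreover have "h \<delta> @ (rev (h \<delta>) @ h \<gamma>) \<simeq> h \<gamma>" using weq_append[OF weq_rev_right[of "h \<delta>"] weq.refl[of "h \<gamma>"]] by simp
        ultimately have "h \<gamma> \<simeq> h \<delta> @ []" using weq.sym weq.trans by blast
        then have "h \<gamma> \<simeq> h \<delta>" by simp
        then have "\<gamma> = \<delta>" by (rule eq_if_weq[OF g d(1)])
        then show ?thesis by simp
      qed
      have "?q ` B \<inter> r ` carrier \<Gamma> \<subseteq> {r \<gamma>}"
      proof
        fix c assume c: "c \<in> ?q ` B \<inter> r ` carrier \<Gamma>"
        from IntD2[OF c] obtain \<delta> where d: "c = r \<delta>" "\<delta> \<in> carrier \<Gamma>" by (rule imageE)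
        have m: "r \<delta> \<in> ?q ` B" using IntD1[OF c] unfolding d(1) .
        show "c \<in> {r \<gamma>}" unfolding d(1) eq[OF d(2) m] by (rule singletonI)
      qed
      then show ?thesis by (intro exI[of _ "?q ` B"] conjI oU mem)
    qed
    have sub: "r ` carrier \<Gamma> \<subseteq> topspace PSL2_topology"
    proof
      fix c assume "c \<in> r ` carrier \<Gamma>"
      then obtain \<gamma> where g: "c = r \<gamma>" "\<gamma> \<in> carrier \<Gamma>" by (rule imageE)
      from single[OF g(2)] obtain U where U: "openin PSL2_topology U" "r \<gamma> \<in> U" by (elim exE conjE)
      show "c \<in> topspace PSL2_topology" unfolding g(1) by (rule subsetD[OF openin_subset[OF U(1)] U(2)])
    qed
    show ?thesis
    proof (rule HOL.sym, subst discrete_topology_unique, intro conjI ballI)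
      show "topspace (subtopology PSL2_topology (r ` carrier \<Gamma>)) = r ` carrier \<Gamma>" using sub by auto
      fix c assume "c \<in> r ` carrier \<Gamma>"
      then obtain \<gamma> where g: "c = r \<gamma>" "\<gamma> \<in> carrier \<Gamma>" by (rule imageE)
      from single[OF g(2)] obtain U where U: "openin PSL2_topology U" "r \<gamma> \<in> U" "U \<inter> r ` carrier \<Gamma> \<subseteq> {r \<gamma>}" by (elim exE conjE)
      have "c \<in> U \<inter> r ` carrier \<Gamma>" unfolding g(1) using U(2) imageI[OF g(2), of r] by (rule IntI)
      then have "{c} = U \<inter> r ` carrier \<Gamma>" using U(3) unfolding g(1) by (intro subset_antisym) simp_all
      then show "openin (subtopology PSL2_topology (r ` carrier \<Gamma>)) {c}" unfolding openin_subtopology using U(1) by blast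
    qed
  qed
  have "omega (r \<gamma>) = (word_mat mirror_rep (h \<gamma>) :: real ^ 'n ^ 'n)" for \<gamma>
  proof -
    have inv: "?M \<gamma> ** word_mat mirror_matrix (rev (h \<gamma>)) = mat 1" using word_mirror_matrix[of "rev (h \<gamma>)"] by simp
    have "(- ?M \<gamma>) ** (- word_mat mirror_matrix (rev (h \<gamma>))) = ?M \<gamma> ** word_mat mirror_matrix (rev (h \<gamma>))"
      by (simp add: vec_eq_iff matrix_matrix_mult_def)
    then have "matrix_inv (- ?M \<gamma>) = - word_mat mirror_matrix (rev (h \<gamma>))" using inv by (intro matrix_inv_eqI) simp
    then have "sym_matrix (- ?M \<gamma>) = (sym_matrix (?M \<gamma>) :: real ^ 'n ^ 'n)"
      unfolding sym_matrix_eq matrix_inv_eqI[OF inv] by (simp add: subst_matrix_minus[OF odd])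
    then show ?thesis unfolding omega_def r by (simp add: sym_matrix_word)
  qed
  then have "phi = (\<lambda>\<gamma>\<in>carrier \<Gamma>. omega (r \<gamma>) :: real ^ 'n ^ 'n)" by (simp add: phi_def)
  then show ?thesis unfolding fuchsian_def using hom inj disc by blast
qed

text \<open>The half line of parameters is connected and maps into the space of completely reducible
  classes, so the whole path stays in the component of its start. At t = 0 the representation is
  conjugate to the Fuchsian \<open>phi\<close> by a matrix of determinant one.\<close>

lemma rep_hitchin:
  fixes C D :: "real ^ 'n::finite ^ 'n"
  assumes odd: "odd CARD('n)" and CD: "C ** D = mat 1" "D ** C = mat 1" and C1: "det C = 1" and A: "A \<subseteq> carrier \<Gamma>" and t: "t \<ge> 0"
  shows "surface_hitchin A \<Gamma> (rep D C t)"
proof -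
  let ?q = "conjugacy_class \<Gamma> :: ('g \<Rightarrow> real ^ 'n ^ 'n) \<Rightarrow> _"
  have plus: "rep D C s \<in> Hom_plus \<Gamma>" if "s \<ge> 0" for s by (rule rep_hom_plus[OF odd that CD])
  have "continuous_map (top_of_set {0..}) (subtopology (Hom_topology A \<Gamma>) (Hom_plus \<Gamma>)) (rep D C)"
    using rep_continuous[OF odd CD A] plus by (auto simp: continuous_map_in_subtopology)
  then have "continuous_map (top_of_set {0..}) (Rep_plus A \<Gamma>) (?q \<circ> rep D C)"
    unfolding Rep_plus_def by (rule continuous_map_compose) (rule continuous_map_quotient)
  moreover have "connectedin (top_of_set {0..}) {0 :: real..}"
    by (simp add: connectedin_subtopology)
  ultimately have con: "connectedin (Rep_plus A \<Gamma>) ((?q \<circ> rep D C) ` {0..})" by (rule connectedin_continuous_map_image)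
  define K where "K = connected_component_of_set (Rep_plus A \<Gamma>) (?q (rep D C 0))"
  have K: "?q (rep D C s) \<in> K" if "s \<ge> 0" for s
    unfolding K_def mem_Collect_eq connected_component_of_def using con that by (intro exI[of _ "(?q \<circ> rep D C) ` {0..}"]) auto
  have "?q (rep D C 0) \<in> topspace (Rep_plus A \<Gamma>)" using connectedin_subset_topspace[OF con] by auto
  then have KC: "K \<in> connected_components_of (Rep_plus A \<Gamma>)" unfolding K_def connected_components_of_def by (rule imageI)
  have "det (D ** C) = 1" unfolding CD by simp
  then have D1: "det D = 1" using C1 by (simp add: det_mul)
  have "?q (rep D C 0) = ?q phi"
    by (rule conjugacy_class_conj[OF CD(2,1) D1]) (simp add: rep_def phi_def bent_rep_zero)
  then have "?q phi \<in> K" using K[of 0] by simp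
  then show ?thesis unfolding surface_hitchin_def using plus[OF t] KC K[OF t] phi_fuchsian[OF odd] by blast
qed

end

theorem theorem24:
  fixes S :: "'a::t2_space set" and Y :: "'b::t2_space set" and d :: "'b \<Rightarrow> nat"
    and f :: "'a \<Rightarrow> 'b" and x0 :: 'a and A :: "(real \<Rightarrow> 'a) set set"
  defines "\<Gamma> \<equiv> fundamental_group S x0"
  assumes "is_orbifold_3333 Y d"
    and "surface_finitely_covers S f Y d"
    and "x0 \<in> S"
    and "finite A" and "A \<subseteq> carrier \<Gamma>" and "generate \<Gamma> A = carrier \<Gamma>"
    and "odd CARD('n::finite)" and "CARD('n) > 1"
  shows "\<exists>\<rho> :: real \<Rightarrow> (real \<Rightarrow> 'a) set \<Rightarrow> real ^ 'n ^ 'n.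
           continuous_map (top_of_set {0..}) (Hom_topology A \<Gamma>) \<rho> \<and>
           (\<forall>t\<ge>0. surface_hitchin A \<Gamma> (\<rho> t)) \<and>
           \<rho> 0 ` carrier \<Gamma> \<subseteq> SL_over \<int> \<and>
           (\<forall>t>0. zariski_dense \<Gamma> (\<rho> t)) \<and>
           (\<forall>t\<in>\<rat>. t \<ge> 0 \<longrightarrow> \<rho> t ` carrier \<Gamma> \<subseteq> SL_over \<rat>)"
proof -
  from surface_group_words[OF assms(2-4)] obtain h where h:
    "\<forall>P\<in>carrier \<Gamma>. even (length (h P))"
    "\<forall>P\<in>carrier \<Gamma>. \<forall>Q\<in>carrier \<Gamma>. h (P \<otimes>\<^bsub>\<Gamma>\<^esub> Q) \<simeq> h P @ h Q"
    "\<forall>P\<in>carrier \<Gamma>. \<forall>Q\<in>carrier \<Gamma>. h P \<simeq> h Q \<longrightarrow> P = Q"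
    "\<forall>v. \<exists>k>0. \<exists>P\<in>carrier \<Gamma>. h P \<simeq> concat (replicate k v)"
    unfolding \<Gamma>_def[symmetric] by (elim exE conjE)
  interpret surface_words \<Gamma> h
  proof
    show "x \<otimes>\<^bsub>\<Gamma>\<^esub> y \<in> carrier \<Gamma>" if "x \<in> carrier \<Gamma>" "y \<in> carrier \<Gamma>" for x y
      using that unfolding \<Gamma>_def by (rule fundamental_group_mult_closed)
  qed (use h in simp_all)
  note odd = \<open>odd CARD('n)\<close>
  obtain C D :: "real ^ 'n ^ 'n" where CD: "C ** D = mat 1" "D ** C = mat 1" and C1: "det C = 1"
    and int: "\<And>i. entries_in \<int> (D ** mirror_rep i ** C)"
    using invariant_lattice[OF odd] by metis
  show ?thesis
  proof (intro exI[of _ "rep D C"] conjI allI impI ballI)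
    show "continuous_map (top_of_set {0..}) (Hom_topology A \<Gamma>) (rep D C)"
      by (rule rep_continuous[OF odd CD \<open>A \<subseteq> carrier \<Gamma>\<close>])
    show "surface_hitchin A \<Gamma> (rep D C t)" if "t \<ge> 0" for t
      by (rule rep_hitchin[OF odd CD C1 \<open>A \<subseteq> carrier \<Gamma>\<close> that])
    show "rep D C 0 ` carrier \<Gamma> \<subseteq> SL_over \<int>"
      by (rule rep_entries[OF odd _ CD subring_Ints]) (simp_all add: bent_rep_zero int)
    show "zariski_dense \<Gamma> (rep D C t)" if "t > 0" for t
      by (rule rep_zariski_dense[OF odd \<open>CARD('n) > 1\<close> that CD])
    show "rep D C t ` carrier \<Gamma> \<subseteq> SL_over \<rat>" if "t \<in> \<rat>" "t \<ge> 0" for t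
      by (rule rep_entries[OF odd that(2) CD subring_Rats bent_rep_rational[OF odd CD int that]])
  qed
qed


end
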